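(* Let $\mathsf{U}^\mathsf{t}$ satisfy $\{\mathbf{F},\mathbf{G}\}\subseteq\mathsf{U}^\mathsf{t}\subseteq\{\mathbf{F},\mathbf{G},\neg\}$. Then for every $\mathsf{B}^\mathsf{l}\subseteq\mathrm{Bin}_{lg}$ and every $n\in\mathbb{N}$, the problem $\mathrm{ATL}^2_{\mathrm{Learn}}(\mathsf{U}^\mathsf{t},\emptyset,\mathsf{B}^\mathsf{l},n)$ is NP-complete.
   Context: $\mathrm{Bin}_{lg}$ is the set of binary logical operators $\vee,\wedge,\Rightarrow,\Leftarrow,\Leftrightarrow$ and their negations. A concurrent game structure (CGS) with agents $\mathrm{Ag}=\{1,\dots,k\}$: finite states $Q$, initial states $I\subseteq Q$, labelling $\pi:Q\to2^{\mathsf{Prop}}$, a number $d(q,a)\ge1$ of actions for each state and agent, and a transition function $\delta(q,\alpha_1,\dots,\alpha_k)\in Q$; size = number of tuples $(q,\alpha_1,\dots,\alpha_k)$ plus $|\mathsf{Prop}|$. A strategy of agent $a$ maps finite histories to legal actions; for coalition $A$ and profile $s$, $\mathrm{Out}(q,s)$ is the set of infinite paths from $q$ consistent with $s$. $\mathrm{ATL}^k(\mathsf{Prop},\mathsf{U}^\mathsf{t},\emptyset,\mathsf{B}^\mathsf{l})$: $\phi::=p\mid\neg\phi\mid\phi*\phi\ ( *\in\mathsf{B}^\mathsf{l})\mid\langle\!\langle A\rangle\!\rangle\circ\phi$ with $A\subseteq\mathrm{Ag}$, $\circ\in\mathsf{U}^\mathsf{t}\setminus\{\neg\}$, negation available only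 if $\neg\in\mathsf{U}^\mathsf{t}$; $q\models\langle\!\langle A\rangle\!\rangle\circ\phi$ iff some profile $s$ of $A$ makes every $\rho\in\mathrm{Out}(q,s)$ satisfy $\circ\phi$ ($\mathbf{F}\phi$: some $\rho[i]\models\phi$; $\mathbf{G}\phi$: all $\rho[i]\models\phi$). A CGS satisfies $\phi$ iff all initial states do. $|\phi|$ = number of distinct subformulas; $|\phi|_{\mathrm{Bin}}$ = number of distinct subformulas $\phi_1*\phi_2$. $\mathrm{ATL}^k_{\mathrm{Learn}}(\mathsf{U}^\mathsf{t},\emptyset,\mathsf{B}^\mathsf{l},n)$: input $(\mathsf{Prop},\mathcal{P},\mathcal{N},B)$ with finite sets of $k$-agent CGS and $B$ in unary; yes iff some $\phi$ in the fragment with $|\phi|\le B$ and $|\phi|_{\mathrm{Bin}}\le n$ holds on all of $\mathcal{P}$ and fails on all of $\mathcal{N}$. *)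

theory Defs
  imports Main "HOL-Computational_Algebra.Polynomial"
begin

section \<open>Deterministic multi-tape Turing machines\<close>

datatype move = MoveL | Stay | MoveR

text \<open>
  Symbols and states are initial segments of the naturals. Symbol 0 is the blank, symbols 1 and 2
  stand for the bits 0 and 1, and larger symbols are work symbols. The transition
  function maps a state and the list of scanned symbols (one per tape) to a new state and, for
  each tape, the symbol to write and the subsequent head move.
\<close>

record tm =
  tm_tapes :: nat
  tm_symbols :: nat
  tm_states :: nat
  tm_start :: nat
  tm_accept :: nat
  tm_reject :: nat
  tm_trans :: "nat \<Rightarrow> nat list \<Rightarrow> nat \<times> (nat \<times> move) list"

definition wf_tm :: "tm \<Rightarrow> bool" where
  "wf_tm M \<longleftrightarrow>
     2 \<le> tm_tapes M \<and> 3 \<le> tm_symbols M \<and>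
     tm_start M < tm_states M \<and> tm_accept M < tm_states M \<and> tm_reject M < tm_states M \<and>
     tm_accept M \<noteq> tm_reject M \<and>
     (\<forall>q < tm_states M. \<forall>ss. length ss = tm_tapes M \<and> set ss \<subseteq> {..<tm_symbols M} \<longrightarrow>
        fst (tm_trans M q ss) < tm_states M \<and>
        length (snd (tm_trans M q ss)) = tm_tapes M \<and>
        fst ` set (snd (tm_trans M q ss)) \<subseteq> {..<tm_symbols M})"

text \<open>A tape is a two-way infinite sequence of cells together with a head position.\<close>

type_synonym tape = "(int \<Rightarrow> nat) \<times> int"
type_synonym config = "nat \<times> tape list"

definition tape_read :: "tape \<Rightarrow> nat" where
  "tape_read T = fst T (snd T)"

fun move_offset :: "move \<Rightarrow> int" where
  "move_offset MoveL = - 1"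
| "move_offset Stay = 0"
| "move_offset MoveR = 1"

fun tape_act :: "nat \<times> move \<Rightarrow> tape \<Rightarrow> tape" where
  "tape_act (s, m) (c, h) = (c(h := s), h + move_offset m)"

definition halted :: "tm \<Rightarrow> config \<Rightarrow> bool" where
  "halted M c \<longleftrightarrow> fst c = tm_accept M \<or> fst c = tm_reject M"

definition tm_step :: "tm \<Rightarrow> config \<Rightarrow> config" where
  "tm_step M c =
     (if halted M c then c
      else let (q', as) = tm_trans M (fst c) (map tape_read (snd c))
           in (q', map2 tape_act as (snd c)))"

definition tm_run :: "tm \<Rightarrow> nat \<Rightarrow> config \<Rightarrow> config" where
  "tm_run M t c = (tm_step M ^^ t) c"

definition bit_symbol :: "bool \<Rightarrow> nat" where
  "bit_symbol b = (if b then 2 else 1)"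

definition word_cells :: "bool list \<Rightarrow> int \<Rightarrow> nat" where
  "word_cells x z = (if 0 \<le> z \<and> z < int (length x) then bit_symbol (x ! nat z) else 0)"

text \<open>The words \<open>xs\<close> are placed on the first tapes; all remaining tapes are blank.\<close>

definition init_config :: "tm \<Rightarrow> bool list list \<Rightarrow> config" where
  "init_config M xs =
     (tm_start M,
      map (\<lambda>i. (word_cells (if i < length xs then xs ! i else []), 0)) [0..<tm_tapes M])"

text \<open>The output is read off the second tape, from cell 0 up to the first blank.\<close>

definition has_output :: "config \<Rightarrow> bool list \<Rightarrow> bool" where
  "has_output c y \<longleftrightarrow> (\<forall>i \<le> length y. fst (snd c ! 1) (int i) = word_cells y (int i))"


section \<open>Polynomial time and NP-completeness\<close>

type_synonym language = "bool list set"

definition polytime_computable :: "(bool list \<Rightarrow> bool list) \<Rightarrow> bool" where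
  "polytime_computable f \<longleftrightarrow>
     (\<exists>M (p :: nat poly). wf_tm M \<and>
        (\<forall>x. \<exists>t \<le> poly p (length x).
           let c = tm_run M t (init_config M [x]) in halted M c \<and> has_output c (f x)))"

definition polytime_decidable2 :: "(bool list \<Rightarrow> bool list \<Rightarrow> bool) \<Rightarrow> bool" where
  "polytime_decidable2 R \<longleftrightarrow>
     (\<exists>M (p :: nat poly). wf_tm M \<and>
        (\<forall>x y. \<exists>t \<le> poly p (length x + length y).
           let c = tm_run M t (init_config M [x, y])
           in halted M c \<and> (fst c = tm_accept M \<longleftrightarrow> R x y)))"

definition in_NP :: "language \<Rightarrow> bool" where
  "in_NP L \<longleftrightarrow>
     (\<exists>R (p :: nat poly). polytime_decidable2 R \<and>
        (\<forall>x. x \<in> L \<longleftrightarrow> (\<exists>y. length y \<le> poly p (length x) \<and> R x y)))"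

definition polytime_reducible :: "language \<Rightarrow> language \<Rightarrow> bool" where
  "polytime_reducible L L' \<longleftrightarrow>
     (\<exists>f. polytime_computable f \<and> (\<forall>x. x \<in> L \<longleftrightarrow> f x \<in> L'))"

definition NP_hard :: "language \<Rightarrow> bool" where
  "NP_hard L \<longleftrightarrow> (\<forall>L'. in_NP L' \<longrightarrow> polytime_reducible L' L)"

definition NP_complete :: "language \<Rightarrow> bool" where
  "NP_complete L \<longleftrightarrow> in_NP L \<and> NP_hard L"


section \<open>Concurrent game structures\<close>

text \<open>
  States are \<open>{0..<cgs_states C}\<close>, the agents of a \<open>k\<close>-agent structure are \<open>{1..k}\<close>, the actions of
  agent \<open>a\<close> in state \<open>q\<close> are \<open>{1..cgs_actions C q a}\<close>, and an action tuple is a list of length \<open>k\<close>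
  whose entry at index \<open>a - 1\<close> is the action of agent \<open>a\<close>. Values of the fields outside these ranges
  are irrelevant.
\<close>

record cgs =
  cgs_states :: nat
  cgs_init :: "nat set"
  cgs_label :: "nat \<Rightarrow> nat set"
  cgs_actions :: "nat \<Rightarrow> nat \<Rightarrow> nat"
  cgs_delta :: "nat \<Rightarrow> nat list \<Rightarrow> nat"

definition legal_tuples :: "nat \<Rightarrow> cgs \<Rightarrow> nat \<Rightarrow> nat list set" where
  "legal_tuples k C q =
     {\<alpha>. length \<alpha> = k \<and> (\<forall>a\<in>{1..k}. \<alpha> ! (a - 1) \<in> {1..cgs_actions C q a})}"

definition wf_cgs :: "nat \<Rightarrow> nat set \<Rightarrow> cgs \<Rightarrow> bool" where
  "wf_cgs k Props C \<longleftrightarrow>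
     cgs_init C \<subseteq> {..<cgs_states C} \<and>
     (\<forall>q < cgs_states C.
        cgs_label C q \<subseteq> Props \<and>
        (\<forall>a\<in>{1..k}. 1 \<le> cgs_actions C q a) \<and>
        (\<forall>\<alpha>\<in>legal_tuples k C q. cgs_delta C q \<alpha> < cgs_states C))"

definition strategy :: "cgs \<Rightarrow> nat \<Rightarrow> (nat list \<Rightarrow> nat) \<Rightarrow> bool" where
  "strategy C a s \<longleftrightarrow>
     (\<forall>h. h \<noteq> [] \<and> set h \<subseteq> {..<cgs_states C} \<longrightarrow> s h \<in> {1..cgs_actions C (last h) a})"

definition outcomes ::
  "nat \<Rightarrow> cgs \<Rightarrow> nat set \<Rightarrow> nat \<Rightarrow> (nat \<Rightarrow> nat list \<Rightarrow> nat) \<Rightarrow> (nat \<Rightarrow> nat) set" where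
  "outcomes k C A q s =
     {\<rho>. \<rho> 0 = q \<and>
        (\<forall>i. \<exists>\<alpha>\<in>legal_tuples k C (\<rho> i).
           (\<forall>a\<in>A. \<alpha> ! (a - 1) = s a (map \<rho> [0..<Suc i])) \<and>
           \<rho> (Suc i) = cgs_delta C (\<rho> i) \<alpha>)}"


section \<open>ATL formulas\<close>

datatype binop = Or | And | Imp | RevImp | Iff | NOr | NAnd | NImp | NRevImp | NIff

fun binop_sem :: "binop \<Rightarrow> bool \<Rightarrow> bool \<Rightarrow> bool" where
  "binop_sem Or x y = (x \<or> y)"
| "binop_sem And x y = (x \<and> y)"
| "binop_sem Imp x y = (x \<longrightarrow> y)"
| "binop_sem RevImp x y = (y \<longrightarrow> x)"
| "binop_sem Iff x y = (x \<longleftrightarrow> y)"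
| "binop_sem NOr x y = (\<not> (x \<or> y))"
| "binop_sem NAnd x y = (\<not> (x \<and> y))"
| "binop_sem NImp x y = (\<not> (x \<longrightarrow> y))"
| "binop_sem NRevImp x y = (\<not> (y \<longrightarrow> x))"
| "binop_sem NIff x y = (\<not> (x \<longleftrightarrow> y))"

datatype tempop = Next | Future | Globally

datatype unop = UNeg | UTemp tempop

fun tempop_sem :: "tempop \<Rightarrow> (nat \<Rightarrow> bool) \<Rightarrow> bool" where
  "tempop_sem Next P = P 1"
| "tempop_sem Future P = (\<exists>i. P i)"
| "tempop_sem Globally P = (\<forall>i. P i)"

text \<open>\<open>Coop A t \<phi>\<close> is the formula with strategic quantifier for the coalition \<open>A\<close>.\<close>

datatype atl =
    Atom nat
  | Neg atl
  | Bin binop atl atl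
  | Coop "nat set" tempop atl

primrec sat :: "nat \<Rightarrow> cgs \<Rightarrow> nat \<Rightarrow> atl \<Rightarrow> bool" where
  "sat k C q (Atom p) \<longleftrightarrow> p \<in> cgs_label C q"
| "sat k C q (Neg \<phi>) \<longleftrightarrow> \<not> sat k C q \<phi>"
| "sat k C q (Bin b \<phi> \<psi>) \<longleftrightarrow> binop_sem b (sat k C q \<phi>) (sat k C q \<psi>)"
| "sat k C q (Coop A t \<phi>) \<longleftrightarrow>
     (\<exists>s. (\<forall>a\<in>A. strategy C a (s a)) \<and>
        (\<forall>\<rho>\<in>outcomes k C A q s. tempop_sem t (\<lambda>i. sat k C (\<rho> i) \<phi>)))"

definition cgs_sat :: "nat \<Rightarrow> cgs \<Rightarrow> atl \<Rightarrow> bool" where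
  "cgs_sat k C \<phi> \<longleftrightarrow> (\<forall>q\<in>cgs_init C. sat k C q \<phi>)"

primrec in_fragment :: "nat \<Rightarrow> nat set \<Rightarrow> unop set \<Rightarrow> binop set \<Rightarrow> atl \<Rightarrow> bool" where
  "in_fragment k Props U Bl (Atom p) \<longleftrightarrow> p \<in> Props"
| "in_fragment k Props U Bl (Neg \<phi>) \<longleftrightarrow> UNeg \<in> U \<and> in_fragment k Props U Bl \<phi>"
| "in_fragment k Props U Bl (Bin b \<phi> \<psi>) \<longleftrightarrow>
     b \<in> Bl \<and> in_fragment k Props U Bl \<phi> \<and> in_fragment k Props U Bl \<psi>"
| "in_fragment k Props U Bl (Coop A t \<phi>) \<longleftrightarrow>
     A \<subseteq> {1..k} \<and> UTemp t \<in> U \<and> in_fragment k Props U Bl \<phi>"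

primrec subformulas :: "atl \<Rightarrow> atl set" where
  "subformulas (Atom p) = {Atom p}"
| "subformulas (Neg \<phi>) = insert (Neg \<phi>) (subformulas \<phi>)"
| "subformulas (Bin b \<phi> \<psi>) = insert (Bin b \<phi> \<psi>) (subformulas \<phi> \<union> subformulas \<psi>)"
| "subformulas (Coop A t \<phi>) = insert (Coop A t \<phi>) (subformulas \<phi>)"

definition atl_size :: "atl \<Rightarrow> nat" where
  "atl_size \<phi> = card (subformulas \<phi>)"

definition atl_bin_size :: "atl \<Rightarrow> nat" where
  "atl_bin_size \<phi> = card {\<psi> \<in> subformulas \<phi>. \<exists>b \<psi>1 \<psi>2. \<psi> = Bin b \<psi>1 \<psi>2}"


section \<open>The learning problem\<close>

definition separable ::
  "nat \<Rightarrow> unop set \<Rightarrow> binop set \<Rightarrow> nat \<Rightarrow> nat set \<Rightarrow> cgs set \<Rightarrow> cgs set \<Rightarrow> nat \<Rightarrow> bool" where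
  "separable k U Bl n Props P N B \<longleftrightarrow>
     (\<exists>\<phi>. in_fragment k Props U Bl \<phi> \<and> atl_size \<phi> \<le> B \<and> atl_bin_size \<phi> \<le> n \<and>
        (\<forall>C\<in>P. cgs_sat k C \<phi>) \<and> (\<forall>C\<in>N. \<not> cgs_sat k C \<phi>))"

text \<open>
  Inputs are encoded as bit strings: numbers in unary, and structures by the tables of their
  components over the legal ranges. For fixed \<open>k\<close>, every number in the tables of a structure is
  bounded by its number of tuples (state, actions), of which there is at least one per state. So the
  encoding of a structure is polynomial in its size, that is, in the number of such tuples plus the
  number of propositions. Each component is self-delimiting given the preceding ones.
\<close>

definition enc_nat :: "nat \<Rightarrow> bool list" where
  "enc_nat n = replicate n True @ [False]"

definition enc_list :: "('a \<Rightarrow> bool list) \<Rightarrow> 'a list \<Rightarrow> bool list" where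
  "enc_list e xs = enc_nat (length xs) @ concat (map e xs)"

definition tuple_list :: "nat \<Rightarrow> cgs \<Rightarrow> nat \<Rightarrow> nat list list" where
  "tuple_list k C q = product_lists (map (\<lambda>a. [1..<Suc (cgs_actions C q a)]) [1..<Suc k])"

definition enc_state :: "nat \<Rightarrow> nat \<Rightarrow> cgs \<Rightarrow> nat \<Rightarrow> bool list" where
  "enc_state k m C q =
     [q \<in> cgs_init C] @
     map (\<lambda>p. p \<in> cgs_label C q) [0..<m] @
     concat (map (\<lambda>a. enc_nat (cgs_actions C q a)) [1..<Suc k]) @
     concat (map (\<lambda>\<alpha>. enc_nat (cgs_delta C q \<alpha>)) (tuple_list k C q))"

definition enc_cgs :: "nat \<Rightarrow> nat \<Rightarrow> cgs \<Rightarrow> bool list" where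
  "enc_cgs k m C = enc_list (enc_state k m C) [0..<cgs_states C]"

definition enc_input :: "nat \<Rightarrow> nat \<Rightarrow> cgs list \<Rightarrow> cgs list \<Rightarrow> nat \<Rightarrow> bool list" where
  "enc_input k m Ps Ns B =
     enc_nat m @ enc_list (enc_cgs k m) Ps @ enc_list (enc_cgs k m) Ns @ enc_nat B"

text \<open>
  The set of propositions is \<open>{..<m}\<close>; the finite sets of positive and negative structures are given
  by listing their elements. Strings that encode no input are not in the language.
\<close>

definition ATL_Learn :: "nat \<Rightarrow> unop set \<Rightarrow> binop set \<Rightarrow> nat \<Rightarrow> language" where
  "ATL_Learn k U Bl n =
     {enc_input k m Ps Ns B | m Ps Ns B.
        (\<forall>C \<in> set Ps \<union> set Ns. wf_cgs k {..<m} C) \<and>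
        separable k U Bl n {..<m} (set Ps) (set Ns) B}"

end

theory Submission
  imports Defs "HOL-Library.Countable"
begin

text \<open>Membership: a certificate lists the given structures, a directed acyclic graph for the formula and
  the truth values of its nodes in all states. The values of a strategic formula are a fixpoint of the
  one-step forcing operator; ranks certify that it is the least one for \<open>Future\<close> and the greatest
  one for \<open>Globally\<close>. All checks are bounded sums over the input words, and such functions are
  compiled to Turing machines whose heads serve as counters.

  Hardness: satisfiability of uniformly described clauses, obtained from computation tableaux, is
  reduced to learning. All structures of the reduction are levelled, and a positive and a negative one
  start in twin states that only differ below the lowest level. A formula can carry this difference one
  level per modality, so that with the tight size bound it has to be a chain of modalities, free of
  negations and binary operators, that is forced except for one choice between \<open>Future\<close> and
  \<open>Globally\<close> in every block of twelve levels. These choices form an assignment, and in the structure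
  of a clause the literals connect the twins exactly in the blocks of true literals.\<close>


section \<open>Structured programs for Turing machines\<close>

text \<open>The number 12 comes from side effects: a modality acts on all levels of its agent at
  once, also on those that the difference has not reached, so a choice would spoil the levels above.
  Levels 0 to 2 of a block make the choice. The rails of level 0 start with opposite values, so that
  a diamond carries the difference on rail 0 and a box on rail 1. Level 1 gives levels 0 and 2 the
  same owner; hence the choice also presets level 2, where the rails meet and the opposite kind of
  modality is forced. The nine further modalities restore all values, whatever the choice was.

  Inputs are never parsed: the certificate supplies the structures, and their encoding is compared
  with the input. The encoding omits values outside the legal ranges, so one string stands for
  several lists of structures, and the reduction needs that satisfaction does not depend on what is
  omitted.

  Hardness concerns all languages in NP, and the reduction has to be a bounded sum over the input.
  Therefore the tableau clauses are numbered by a family, a time and two cells, and their literals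
  are given by predicates of such numbers.\<close>

datatype com =
    Act nat "nat \<Rightarrow> nat" move
  | Seq com com (infixr ";;" 60)
  | Cond nat "nat \<Rightarrow> bool" com com
  | While nat "nat \<Rightarrow> bool" com
  | Reject

fun wf_com :: "nat \<Rightarrow> com \<Rightarrow> bool" where
  "wf_com k (Act j g m) \<longleftrightarrow> j < k \<and> (\<forall>s<3. g s < 3)"
| "wf_com k (a ;; b) \<longleftrightarrow> wf_com k a \<and> wf_com k b"
| "wf_com k (Cond j P a b) \<longleftrightarrow> j < k \<and> wf_com k a \<and> wf_com k b"
| "wf_com k (While j P a) \<longleftrightarrow> j < k \<and> wf_com k a"
| "wf_com k Reject \<longleftrightarrow> True"

lemma wf_com_mono: "wf_com k c \<Longrightarrow> k \<le> k' \<Longrightarrow> wf_com k' c"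
  by (induction c) auto

text \<open>The step counts are exact, with one step for unfolding a composite command, as in the
  machine. \<open>Reject\<close> has no rule: a rejecting machine just stands in the stack
  \<open>[Reject]\<close>.\<close>

inductive exec :: "com \<Rightarrow> (nat \<Rightarrow> tape) \<Rightarrow> nat \<Rightarrow> (nat \<Rightarrow> tape) \<Rightarrow> bool" where
  Act: "exec (Act j g m) \<sigma> 1 (\<sigma>(j := tape_act (g (tape_read (\<sigma> j)), m) (\<sigma> j)))"
| Seq: "exec a \<sigma> t \<sigma>' \<Longrightarrow> exec b \<sigma>' u \<sigma>'' \<Longrightarrow> exec (a ;; b) \<sigma> (Suc (t + u)) \<sigma>''"
| CondT: "P (tape_read (\<sigma> j)) \<Longrightarrow> exec a \<sigma> t \<sigma>' \<Longrightarrow> exec (Cond j P a b) \<sigma> (Suc t) \<sigma>'"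
| CondF: "\<not> P (tape_read (\<sigma> j)) \<Longrightarrow> exec b \<sigma> t \<sigma>' \<Longrightarrow> exec (Cond j P a b) \<sigma> (Suc t) \<sigma>'"
| WhileF: "\<not> P (tape_read (\<sigma> j)) \<Longrightarrow> exec (While j P a) \<sigma> 1 \<sigma>"
| WhileT: "P (tape_read (\<sigma> j)) \<Longrightarrow> exec a \<sigma> t \<sigma>' \<Longrightarrow> exec (While j P a) \<sigma>' u \<sigma>'' \<Longrightarrow>
    exec (While j P a) \<sigma> (Suc (t + u)) \<sigma>''"

text \<open>The control states of the Turing machine of a program are continuations: stacks of
  commands that remain to be executed. The empty stack accepts.\<close>

fun next_stack :: "(nat \<Rightarrow> nat) \<Rightarrow> com list \<Rightarrow> com list" where
  "next_stack rd [] = []"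
| "next_stack rd (Act j g m # K) = K"
| "next_stack rd ((a ;; b) # K) = a # b # K"
| "next_stack rd (Cond j P a b # K) = (if P (rd j) then a else b) # K"
| "next_stack rd (While j P a # K) = (if P (rd j) then a # While j P a # K else K)"
| "next_stack rd (Reject # K) = Reject # K"

fun stack_act :: "(nat \<Rightarrow> nat) \<Rightarrow> com list \<Rightarrow> nat \<Rightarrow> nat \<times> move" where
  "stack_act rd (Act j g m # K) i = (if i = j then (g (rd j), m) else (rd i, Stay))"
| "stack_act rd K i = (rd i, Stay)"

text \<open>Every occurrence of a subcommand has a single continuation, so there are only finitely
  many stacks, although loops may run arbitrarily long. This is what allows stacks to be control
  states.\<close>

fun stacks :: "com \<Rightarrow> com list \<Rightarrow> com list set" where
  "stacks (Act j g m) K = {Act j g m # K}"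
| "stacks (a ;; b) K = insert ((a ;; b) # K) (stacks a (b # K) \<union> stacks b K)"
| "stacks (Cond j P a b) K = insert (Cond j P a b # K) (stacks a K \<union> stacks b K)"
| "stacks (While j P a) K = insert (While j P a # K) (stacks a (While j P a # K))"
| "stacks Reject K = {Reject # K}"

section \<open>Finiteness and closure of the control stacks\<close>

lemma stacks_head: "c # K \<in> stacks c K"
  by (cases c) auto

lemma finite_stacks: "finite (stacks c K)"
  by (induction c arbitrary: K) auto

lemma stacks_closed: "L \<in> stacks c K \<Longrightarrow> next_stack rd L \<in> insert K (stacks c K)"
proof (induction c arbitrary: K)
  case (Seq a b)
  show ?case using Seq.prems stacks_head[of a "b # K"] stacks_head[of b K] Seq.IH(1)[of "b # K"] Seq.IH(2)[of K]
    by (auto split: if_splits)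
next
  case (Cond j P a b)
  show ?case using Cond.prems stacks_head[of a K] stacks_head[of b K] Cond.IH(1)[of K] Cond.IH(2)[of K]
    by (auto split: if_splits)
next
  case (While j P a)
  show ?case using While.prems stacks_head[of a "While j P a # K"] While.IH[of "While j P a # K"]
    by (auto split: if_splits)
qed auto

lemma stacks_wf:
  assumes "L \<in> stacks c K" "wf_com k c" "\<forall>d\<in>set K. wf_com k d"
  shows "\<forall>d\<in>set L. wf_com k d"
  using assms
proof (induction c arbitrary: K)
  case (Seq a b)
  show ?case using Seq.prems Seq.IH(1)[of "b # K"] Seq.IH(2)[of K] by auto
next
  case (Cond j P a b)
  show ?case using Cond.prems Cond.IH(1)[of K] Cond.IH(2)[of K] by auto
next
  case (While j P a)
  show ?case using While.prems While.IH[of "While j P a # K"] by auto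
qed auto

text \<open>Both halting stacks are added explicitly: \<open>stacks p []\<close> contains only
  nonempty stacks, and \<open>[Reject]\<close> has to be a state even if \<open>p\<close> never
  rejects.\<close>

definition program_stacks :: "com \<Rightarrow> com list set" where
  "program_stacks p = stacks p [] \<union> {[], [Reject]}"

definition stack_index :: "com \<Rightarrow> com list \<Rightarrow> nat" where
  "stack_index p = (SOME f. bij_betw f (program_stacks p) {0..<card (program_stacks p)})"

definition tm_of :: "nat \<Rightarrow> com \<Rightarrow> tm" where
  "tm_of k p =
     \<lparr>tm_tapes = k, tm_symbols = 3, tm_states = card (program_stacks p),
      tm_start = stack_index p [p], tm_accept = stack_index p [],
      tm_reject = stack_index p [Reject],
      tm_trans = (\<lambda>q ss.
        let K = inv_into (program_stacks p) (stack_index p) q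
        in (stack_index p (next_stack ((!) ss) K), map (stack_act ((!) ss) K) [0..<k]))\<rparr>"

lemma finite_program_stacks: "finite (program_stacks p)"
  by (simp add: program_stacks_def finite_stacks)

lemma stack_index_bij:
  "bij_betw (stack_index p) (program_stacks p) {0..<card (program_stacks p)}"
  unfolding stack_index_def
  by (rule someI_ex[OF ex_bij_betw_finite_nat[OF finite_program_stacks]])

lemma program_stacks_closed: "K \<in> program_stacks p \<Longrightarrow> next_stack rd K \<in> program_stacks p"
  using stacks_closed[of K p "[]" rd] by (auto simp: program_stacks_def)

lemma program_stacks_start: "[p] \<in> program_stacks p"
  by (simp add: program_stacks_def stacks_head)

lemma stack_index_less: "K \<in> program_stacks p \<Longrightarrow> stack_index p K < card (program_stacks p)"
  using stack_index_bij[of p] by (auto simp: bij_betw_def)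

lemma stack_index_eq:
  "K \<in> program_stacks p \<Longrightarrow> L \<in> program_stacks p \<Longrightarrow> stack_index p K = stack_index p L \<longleftrightarrow> K = L"
  using stack_index_bij[of p] by (auto simp: bij_betw_def inj_on_def)

lemma stack_index_inv:
  "K \<in> program_stacks p \<Longrightarrow> inv_into (program_stacks p) (stack_index p) (stack_index p K) = K"
  using stack_index_bij[of p] by (auto simp: bij_betw_def)

lemma wf_tm_of:
  assumes "wf_com k p" "2 \<le> k"
  shows "wf_tm (tm_of k p)"
proof -
  have "fst (stack_act ((!) ss) K i) < 3"
    if K: "K \<in> program_stacks p" and ss: "length ss = k" "set ss \<subseteq> {..<3}" and i: "i < k" for ss K i
  proof -
    have wf: "\<forall>d\<in>set K. wf_com k d"
      using K stacks_wf[of K p "[]" k] assms by (auto simp: program_stacks_def)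
    have rd: "ss ! j < 3" if "j < k" for j
      using that ss nth_mem[of j ss] by (metis lessThan_iff subset_iff)
    show ?thesis
      using wf rd i by (cases "(((!) ss), K, i)" rule: stack_act.cases) auto
  qed
  moreover have "inv_into (program_stacks p) (stack_index p) q \<in> program_stacks p"
    if "q < card (program_stacks p)" for q
    using that stack_index_bij[of p] by (intro inv_into_into) (auto simp: bij_betw_def)
  moreover have "[] \<in> program_stacks p" "[Reject] \<in> program_stacks p"
    by (auto simp: program_stacks_def)
  ultimately show ?thesis
    using assms stack_index_eq[of "[]" p "[Reject]"]
    by (auto simp: wf_tm_def tm_of_def Let_def intro!: stack_index_less program_stacks_closed
        program_stacks_start)
qed

section \<open>Simulation of programs by machines\<close>

lemma tm_step_of:
  assumes "K \<in> program_stacks p" "K \<noteq> []" "K \<noteq> [Reject]"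
  shows "tm_step (tm_of k p) (stack_index p K, map \<sigma> [0..<k]) =
    (stack_index p (next_stack ((!) (map (tape_read \<circ> \<sigma>) [0..<k])) K),
     map (\<lambda>i. tape_act (stack_act ((!) (map (tape_read \<circ> \<sigma>) [0..<k])) K i) (\<sigma> i)) [0..<k])"
proof -
  have "[] \<in> program_stacks p" "[Reject] \<in> program_stacks p"
    by (auto simp: program_stacks_def)
  then have "\<not> halted (tm_of k p) (stack_index p K, map \<sigma> [0..<k])"
    using assms by (auto simp: halted_def tm_of_def stack_index_eq)
  then show ?thesis
    using assms(1)
    by (simp add: tm_step_def) (simp add: tm_of_def stack_index_inv Let_def comp_def list_eq_iff_nth_eq)
qed

lemma tape_act_stay: "tape_act (tape_read T, Stay) T = T"
  by (cases T) (simp add: tape_read_def)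

lemma funpow_Suc_add:
  "f x = y \<Longrightarrow> (f ^^ t) y = z \<Longrightarrow> (f ^^ u) z = w \<Longrightarrow> (f ^^ Suc (t + u)) x = w"
  by (metis add.commute comp_apply funpow_Suc_right funpow_add)

lemma tm_step_silent:
  assumes "c # K \<in> program_stacks p" "c \<noteq> Reject"
    and "\<And>j g m. c \<noteq> Act j g m"
    and "next_stack ((!) (map (tape_read \<circ> \<sigma>) [0..<k])) (c # K) = L"
  shows "tm_step (tm_of k p) (stack_index p (c # K), map \<sigma> [0..<k]) = (stack_index p L, map \<sigma> [0..<k])"
proof -
  have "stack_act rd (c # K) i = (rd i, Stay)" for rd i
    using assms(3) by (cases c) auto
  then have "map (\<lambda>i. tape_act (stack_act ((!) (map (tape_read \<circ> \<sigma>) [0..<k])) (c # K) i) (\<sigma> i)) [0..<k]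
      = map \<sigma> [0..<k]"
    by (auto simp: tape_act_stay)
  then show ?thesis
    using tm_step_of[OF assms(1), of k \<sigma>] assms(2,4) by simp
qed

text \<open>The arbitrary continuation \<open>K\<close> below the command makes the induction
  compositional. That \<open>K\<close> is again a control state belongs to the claim because the
  next command starts from it.\<close>

lemma exec_tm:
  assumes "exec c \<sigma> t \<sigma>'" "wf_com k c" "c # K \<in> program_stacks p"
  shows "K \<in> program_stacks p \<and>
    (tm_step (tm_of k p) ^^ t) (stack_index p (c # K), map \<sigma> [0..<k]) =
    (stack_index p K, map \<sigma>' [0..<k])"
  using assms
proof (induction arbitrary: K rule: exec.induct)
  case (Act j g m \<sigma>)
  have "K \<in> program_stacks p"
    using program_stacks_closed[OF Act(2)] by simp
  moreover have "map (\<lambda>i. tape_act (stack_act ((!) (map (tape_read \<circ> \<sigma>) [0..<k])) (Act j g m # K) i) (\<sigma> i)) [0..<k]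
      = map (\<sigma>(j := tape_act (g (tape_read (\<sigma> j)), m) (\<sigma> j))) [0..<k]"
    using Act(1) by (auto simp: tape_act_stay)
  ultimately show ?case
    using tm_step_of[OF Act(2), of k \<sigma>] by simp
next
  case (Seq a \<sigma> t \<sigma>' b u \<sigma>'')
  have a: "a # b # K \<in> program_stacks p"
    using program_stacks_closed[OF Seq.prems(2)] by simp
  have wf: "wf_com k a" "wf_com k b"
    using Seq.prems(1) by auto
  note IH1 = Seq.IH(1)[OF wf(1) a]
  note IH2 = Seq.IH(2)[OF wf(2) conjunct1[OF IH1]]
  have "tm_step (tm_of k p) (stack_index p ((a ;; b) # K), map \<sigma> [0..<k])
      = (stack_index p (a # b # K), map \<sigma> [0..<k])"
    by (rule tm_step_silent[OF Seq.prems(2)]) auto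
  from conjunct1[OF IH2] funpow_Suc_add[OF this conjunct2[OF IH1] conjunct2[OF IH2]]
  show ?case by (rule conjI)
next
  case (CondT P \<sigma> j a t \<sigma>' b)
  have a: "a # K \<in> program_stacks p"
    using program_stacks_closed[OF CondT.prems(2), of "\<lambda>_. tape_read (\<sigma> j)"] CondT.hyps by simp
  have wf: "wf_com k a" "j < k"
    using CondT.prems(1) by auto
  note IH = CondT.IH[OF wf(1) a]
  have "tm_step (tm_of k p) (stack_index p (Cond j P a b # K), map \<sigma> [0..<k])
      = (stack_index p (a # K), map \<sigma> [0..<k])"
    by (rule tm_step_silent[OF CondT.prems(2)]) (use CondT.hyps wf in auto)
  from conjunct1[OF IH] funpow_Suc_add[where u = 0, OF this conjunct2[OF IH]]
  show ?case by simp
next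
  case (CondF P \<sigma> j b t \<sigma>' a)
  have b: "b # K \<in> program_stacks p"
    using program_stacks_closed[OF CondF.prems(2), of "\<lambda>_. tape_read (\<sigma> j)"] CondF.hyps by simp
  have wf: "wf_com k b" "j < k"
    using CondF.prems(1) by auto
  note IH = CondF.IH[OF wf(1) b]
  have "tm_step (tm_of k p) (stack_index p (Cond j P a b # K), map \<sigma> [0..<k])
      = (stack_index p (b # K), map \<sigma> [0..<k])"
    by (rule tm_step_silent[OF CondF.prems(2)]) (use CondF.hyps wf in auto)
  from conjunct1[OF IH] funpow_Suc_add[where u = 0, OF this conjunct2[OF IH]]
  show ?case by simp
next
  case (WhileF P \<sigma> j a)
  have K: "K \<in> program_stacks p"
    using program_stacks_closed[OF WhileF.prems(2), of "\<lambda>_. tape_read (\<sigma> j)"] WhileF.hyps by simp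
  have "tm_step (tm_of k p) (stack_index p (While j P a # K), map \<sigma> [0..<k])
      = (stack_index p K, map \<sigma> [0..<k])"
    by (rule tm_step_silent[OF WhileF.prems(2)]) (use WhileF.hyps WhileF.prems(1) in auto)
  with K show ?case by simp
next
  case (WhileT P \<sigma> j a t \<sigma>' u \<sigma>'')
  have a: "a # While j P a # K \<in> program_stacks p"
    using program_stacks_closed[OF WhileT.prems(2), of "\<lambda>_. tape_read (\<sigma> j)"] WhileT.hyps by simp
  have wf: "wf_com k a" "j < k"
    using WhileT.prems(1) by auto
  note IH1 = WhileT.IH(1)[OF wf(1) a]
  note IH2 = WhileT.IH(2)[OF WhileT.prems(1) conjunct1[OF IH1]]
  have "tm_step (tm_of k p) (stack_index p (While j P a # K), map \<sigma> [0..<k])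
      = (stack_index p (a # While j P a # K), map \<sigma> [0..<k])"
    by (rule tm_step_silent[OF WhileT.prems(2)]) (use WhileT.hyps wf in auto)
  from conjunct1[OF IH2] funpow_Suc_add[OF this conjunct2[OF IH1] conjunct2[OF IH2]]
  show ?case by (rule conjI)
qed

lemma exec_program:
  assumes "exec p \<sigma> t \<sigma>'" "wf_com k p"
  shows "tm_run (tm_of k p) t (stack_index p [p], map \<sigma> [0..<k]) = (stack_index p [], map \<sigma>' [0..<k])"
  using exec_tm[OF assms program_stacks_start] by (simp add: tm_run_def)

section \<open>Counters\<close>

text \<open>Every tape from the third on represents a number by its head position; cell 0 carries a
  marker, so that a counter can be tested for zero. The heads of the first two tapes serve as
  pointers into the words.\<close>

definition counter :: "nat \<Rightarrow> tape" where
  "counter v = ((\<lambda>z. if z = 0 then 1 else 0), int v)"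

text \<open>During an evaluation only heads move, while words and markers are never overwritten.
  Hence a vector of positions describes the whole memory.\<close>

definition store :: "bool list \<Rightarrow> bool list \<Rightarrow> (nat \<Rightarrow> nat) \<Rightarrow> nat \<Rightarrow> tape" where
  "store x y \<nu> j =
     (if j = 0 then (word_cells x, int (\<nu> 0)) else if j = 1 then (word_cells y, int (\<nu> 1))
      else counter (\<nu> j))"

definition runs :: "com \<Rightarrow> (nat \<Rightarrow> tape) \<Rightarrow> nat \<Rightarrow> (nat \<Rightarrow> tape) \<Rightarrow> bool" where
  "runs c \<sigma> b \<sigma>' \<longleftrightarrow> (\<exists>t\<le>b. exec c \<sigma> t \<sigma>')"

abbreviation inc :: "nat \<Rightarrow> com" where "inc j \<equiv> Act j id MoveR"
abbreviation dec :: "nat \<Rightarrow> com" where "dec j \<equiv> Act j id MoveL"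
abbreviation nop :: com where "nop \<equiv> Act 0 id Stay"
abbreviation nonzero :: "nat \<Rightarrow> bool" where "nonzero s \<equiv> s \<noteq> 1"
abbreviation nonblank :: "nat \<Rightarrow> bool" where "nonblank s \<equiv> s \<noteq> 0"

definition word :: "nat \<Rightarrow> bool list \<Rightarrow> bool list \<Rightarrow> bool list" where
  "word b x y = (if b = 0 then x else y)"

section \<open>Rules for bounded running times\<close>

lemma runs_mono: "runs c \<sigma> b \<sigma>' \<Longrightarrow> b \<le> b' \<Longrightarrow> runs c \<sigma> b' \<sigma>'"
  unfolding runs_def by (meson order_trans)

lemma read_counter: "2 \<le> j \<Longrightarrow> tape_read (store x y \<nu> j) = (if \<nu> j = 0 then 1 else 0)"
  by (simp add: store_def counter_def tape_read_def)

lemma read_word: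
  "j < 2 \<Longrightarrow> tape_read (store x y \<nu> j) =
     (if \<nu> j < length (word j x y) then bit_symbol (word j x y ! \<nu> j) else 0)"
  by (auto simp: store_def tape_read_def word_cells_def word_def less_2_cases_iff)

lemma tape_act_read: "tape_act (tape_read T, m) T = (fst T, snd T + move_offset m)"
  by (cases T) (simp add: tape_read_def)

lemma runs_act: "runs (Act j g m) \<sigma> 1 (\<sigma>(j := tape_act (g (tape_read (\<sigma> j)), m) (\<sigma> j)))"
  unfolding runs_def using exec.Act by blast

lemma runs_inc: "runs (inc j) (store x y \<nu>) 1 (store x y (\<nu>(j := Suc (\<nu> j))))"
  by (rule back_subst[of "runs _ _ _", OF runs_act])
    (auto simp: tape_act_read store_def counter_def fun_eq_iff)

lemma runs_dec: "0 < \<nu> j \<Longrightarrow> runs (dec j) (store x y \<nu>) 1 (store x y (\<nu>(j := \<nu> j - 1)))"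
  by (rule back_subst[of "runs _ _ _", OF runs_act])
    (auto simp: tape_act_read store_def counter_def fun_eq_iff of_nat_diff)

lemma runs_nop: "runs nop \<sigma> 1 \<sigma>"
  by (rule back_subst[of "runs _ _ _", OF runs_act]) (simp add: tape_act_stay)

lemma runs_seq:
  assumes "runs a \<sigma> b1 \<sigma>'" "runs b \<sigma>' b2 \<sigma>''"
  shows "runs (a ;; b) \<sigma> (Suc (b1 + b2)) \<sigma>''"
proof -
  obtain t u where "t \<le> b1" "exec a \<sigma> t \<sigma>'" "u \<le> b2" "exec b \<sigma>' u \<sigma>''"
    using assms by (auto simp: runs_def)
  then show ?thesis
    unfolding runs_def by (intro exI[of _ "Suc (t + u)"]) (auto intro: exec.Seq)
qed

lemma runs_cond:
  assumes "P (tape_read (\<sigma> j)) \<Longrightarrow> runs a \<sigma> b \<sigma>'" "\<not> P (tape_read (\<sigma> j)) \<Longrightarrow> runs c \<sigma> b \<sigma>'"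
  shows "runs (Cond j P a c) \<sigma> (Suc b) \<sigma>'"
  using assms unfolding runs_def
  by (metis Suc_le_mono exec.CondF exec.CondT)

text \<open>The invariant is given by naming the state \<open>S i\<close> after \<open>i\<close>
  rounds, which fixes the number of rounds and the final state at the same time.\<close>

lemma runs_while:
  assumes "\<And>i. i < n \<Longrightarrow> P (tape_read (S i j))" "\<And>i. i < n \<Longrightarrow> runs a (S i) b (S (Suc i))"
    and "\<not> P (tape_read (S n j))"
  shows "runs (While j P a) (S 0) (n * Suc b + 1) (S n)"
  using assms
proof (induction n arbitrary: S)
  case 0
  then show ?case unfolding runs_def by (intro exI[of _ 1]) (auto intro: exec.WhileF[simplified])
next
  case (Suc n)
  have "runs (While j P a) (S (Suc 0)) (n * Suc b + 1) (S (Suc n))"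
    using Suc.IH[of "\<lambda>i. S (Suc i)"] Suc.prems by auto
  then obtain u where u: "u \<le> n * Suc b + 1" "exec (While j P a) (S (Suc 0)) u (S (Suc n))"
    by (auto simp: runs_def)
  obtain t where t: "t \<le> b" "exec a (S 0) t (S (Suc 0))"
    using Suc.prems(2)[of 0] by (auto simp: runs_def)
  show ?case
    unfolding runs_def using u t Suc.prems(1)[of 0]
    by (intro exI[of _ "Suc (t + u)"]) (auto intro: exec.WhileT)
qed

lemma runs_seq_le:
  "runs a \<sigma> b1 \<sigma>1 \<Longrightarrow> runs b \<sigma>1 b2 \<sigma>2 \<Longrightarrow> b1 + b2 < k \<Longrightarrow> runs (a ;; b) \<sigma> k \<sigma>2"
  by (rule runs_mono[OF runs_seq]) auto

lemma runs_while_le: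
  assumes "\<And>i. i < n \<Longrightarrow> P (tape_read (S i j))" "\<And>i. i < n \<Longrightarrow> runs a (S i) b (S (Suc i))"
    and "\<not> P (tape_read (S n j))" "\<sigma> = S 0" "\<sigma>' = S n" "n * Suc b + 1 \<le> k"
  shows "runs (While j P a) \<sigma> k \<sigma>'"
  using runs_mono[OF runs_while[of n P S j a b, OF assms(1-3)] assms(6)] assms(4,5) by simp

lemma runs_while_store:
  assumes "\<And>i. i < n \<Longrightarrow> P (tape_read (store x y (S i) j))"
    and "\<And>i. i < n \<Longrightarrow> runs a (store x y (S i)) b (store x y (S (Suc i)))"
    and "\<not> P (tape_read (store x y (S n) j))" "\<nu> = S 0" "\<nu>' = S n" "n * Suc b + 1 \<le> k"
  shows "runs (While j P a) (store x y \<nu>) k (store x y \<nu>')"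
  using runs_while_le[of n P "\<lambda>i. store x y (S i)" j a b] assms by auto

lemma runs_inc_eq: "\<nu>' = \<nu>(j := Suc (\<nu> j)) \<Longrightarrow> runs (inc j) (store x y \<nu>) 1 (store x y \<nu>')"
  using runs_inc by simp

lemma runs_dec_eq:
  "0 < \<nu> j \<Longrightarrow> \<nu>' = \<nu>(j := \<nu> j - 1) \<Longrightarrow> runs (dec j) (store x y \<nu>) 1 (store x y \<nu>')"
  using runs_dec by simp

lemma runs_transfer:
  assumes "2 \<le> u" "u \<noteq> v" "4 * \<nu> u + 1 \<le> k" "\<nu>' = \<nu>(u := 0, v := \<nu> v + \<nu> u)"
  shows "runs (While u nonzero (dec u ;; inc v)) (store x y \<nu>) k (store x y \<nu>')"
proof -
  let ?S = "\<lambda>i. \<nu>(u := \<nu> u - i, v := \<nu> v + i)"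
  show ?thesis
  proof (rule runs_while_store[where S = "\<lambda>i. (?S i)" and n = "\<nu> u" and b = 3])
    fix i assume i: "i < \<nu> u"
    show "runs (dec u ;; inc v) (store x y (?S i)) 3 (store x y (?S (Suc i)))"
      by (rule runs_seq_le[OF runs_dec_eq[OF _ refl] runs_inc_eq]) (use assms i in \<open>auto simp: fun_eq_iff\<close>)
  qed (use assms in \<open>auto simp: read_counter intro!: arg_cong[of _ _ "store x y"]\<close>)
qed

lemma runs_drain:
  assumes "2 \<le> u" "2 * \<nu> u + 1 \<le> k" "\<nu>' = \<nu>(u := 0)"
  shows "runs (While u nonzero (dec u)) (store x y \<nu>) k (store x y \<nu>')"
proof (rule runs_while_store[where S = "\<lambda>i. (\<nu>(u := \<nu> u - i))" and n = "\<nu> u" and b = 1])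
  fix i assume i: "i < \<nu> u"
  show "runs (dec u) (store x y (\<nu>(u := \<nu> u - i))) 1 (store x y (\<nu>(u := \<nu> u - Suc i)))"
    by (rule runs_dec_eq) (use assms i in \<open>auto simp: fun_eq_iff\<close>)
qed (use assms in \<open>auto simp: read_counter intro!: arg_cong[of _ _ "store x y"]\<close>)

section \<open>Bounded summation terms\<close>

lemma poly_nat_mono: "a \<le> b \<Longrightarrow> poly p a \<le> poly p b" for p :: "nat poly"
  by (induction p) (auto intro!: add_mono mult_mono)

text \<open>Functions of one or two words and an environment of numbers; \<open>w\<close> tells whether the
  second word may be accessed. Bounded sums bind environment variable 0.\<close>

inductive pf :: "bool \<Rightarrow> (bool list \<Rightarrow> bool list \<Rightarrow> (nat \<Rightarrow> nat) \<Rightarrow> nat) \<Rightarrow> bool" for w where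
  zero: "pf w (\<lambda>x y e. 0)"
| one: "pf w (\<lambda>x y e. 1)"
| var: "pf w (\<lambda>x y e. e i)"
| add: "pf w f \<Longrightarrow> pf w g \<Longrightarrow> pf w (\<lambda>x y e. f x y e + g x y e)"
| monus: "pf w f \<Longrightarrow> pf w g \<Longrightarrow> pf w (\<lambda>x y e. f x y e - g x y e)"
| sum: "pf w t \<Longrightarrow> pf w f \<Longrightarrow> pf w (\<lambda>x y e. \<Sum>v<t x y e. f x y (case_nat v e))"
| len: "b = 0 \<or> w \<and> b = 1 \<Longrightarrow> pf w (\<lambda>x y e. length (word b x y))"
| bit: "b = 0 \<or> w \<and> b = 1 \<Longrightarrow> pf w t \<Longrightarrow>
    pf w (\<lambda>x y e. of_bool (t x y e < length (word b x y) \<and> word b x y ! t x y e))"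

text \<open>This frees the second tape for output while terms over the first word are
  evaluated.\<close>

lemma pf_second_word: "pf w f \<Longrightarrow> \<not> w \<Longrightarrow> f x y e = f x y' e"
proof (induction arbitrary: e rule: pf.induct)
  case (sum t f)
  show ?case using sum.IH(1)[of e] sum.IH(2) sum.prems by simp
qed (auto simp: word_def)

text \<open>The result is added to tape \<open>d\<close> and all else is restored, so that programs
  can be composed and repeated in loops. Tapes from \<open>n\<close> on are scratch tapes. Without
  \<open>w\<close> the second head may stand anywhere, since \<open>pf_computable\<close> prints
  with it.\<close>

definition computes ::
  "bool \<Rightarrow> (bool list \<Rightarrow> bool list \<Rightarrow> (nat \<Rightarrow> nat) \<Rightarrow> nat) \<Rightarrow> (nat \<Rightarrow> nat) \<Rightarrow> nat \<Rightarrow> nat \<Rightarrow> com \<Rightarrow>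
    nat poly \<Rightarrow> bool" where
  "computes w f \<sigma> n d c P \<longleftrightarrow>
     (\<forall>x y \<nu> e M. (\<forall>i. \<nu> (\<sigma> i) = e i \<and> e i \<le> M) \<longrightarrow> (\<forall>j\<ge>n. \<nu> j = 0) \<longrightarrow> \<nu> 0 = 0 \<longrightarrow>
        (w \<longrightarrow> \<nu> 1 = 0) \<longrightarrow>
        f x y e \<le> poly P (length x + (if w then length y else 0) + M) \<and>
        runs c (store x y \<nu>) (poly P (length x + (if w then length y else 0) + M))
          (store x y (\<nu>(d := \<nu> d + f x y e))))"

text \<open>Infinitely many variables live on finitely many tapes: variables may share a tape, and
  then they have equal values.\<close>

definition placed :: "(nat \<Rightarrow> nat) \<Rightarrow> nat \<Rightarrow> nat \<Rightarrow> bool" where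
  "placed \<sigma> n d \<longleftrightarrow> 2 \<le> d \<and> d < n \<and> (\<forall>i. 2 \<le> \<sigma> i \<and> \<sigma> i < n \<and> \<sigma> i \<noteq> d)"

text \<open>All placements are considered because the body of a sum is compiled with one more bound
  variable and with a later first scratch tape.\<close>

definition compilable :: "bool \<Rightarrow> (bool list \<Rightarrow> bool list \<Rightarrow> (nat \<Rightarrow> nat) \<Rightarrow> nat) \<Rightarrow> bool" where
  "compilable w f \<longleftrightarrow>
     (\<forall>\<sigma> n d. placed \<sigma> n d \<longrightarrow> (\<exists>c N P. wf_com N c \<and> computes w f \<sigma> n d c P))"

lemma compilableI:
  assumes "\<And>\<sigma> n d. placed \<sigma> n d \<Longrightarrow> \<exists>c N P. wf_com N c \<and> computes w f \<sigma> n d c P"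
  shows "compilable w f"
  using assms by (auto simp: compilable_def)

lemma computesI:
  assumes "\<And>x y \<nu> e M L. \<forall>i. \<nu> (\<sigma> i) = e i \<Longrightarrow> \<forall>i. e i \<le> M \<Longrightarrow> \<forall>j\<ge>n. \<nu> j = 0 \<Longrightarrow> \<nu> 0 = 0 \<Longrightarrow>
    (w \<Longrightarrow> \<nu> 1 = 0) \<Longrightarrow> L = length x + (if w then length y else 0) \<Longrightarrow>
    f x y e \<le> poly P (L + M) \<and>
    runs c (store x y \<nu>) (poly P (L + M)) (store x y (\<nu>(d := \<nu> d + f x y e)))"
  shows "computes w f \<sigma> n d c P"
  using assms unfolding computes_def by blast

lemma
  assumes "computes w f \<sigma> n d c P" "\<forall>i. \<nu> (\<sigma> i) = e i" "\<forall>i. e i \<le> M" "\<forall>j\<ge>n. \<nu> j = 0" "\<nu> 0 = 0"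
    "w \<Longrightarrow> \<nu> 1 = 0" "L = length x + (if w then length y else 0)"
  shows computes_le: "f x y e \<le> poly P (L + M)"
    and computes_runs: "\<nu>' = \<nu>(d := \<nu> d + f x y e) \<Longrightarrow>
      runs c (store x y \<nu>) (poly P (L + M)) (store x y \<nu>')"
  using assms unfolding computes_def by blast+

section \<open>Compilation of summation terms\<close>

lemma compilable_zero: "compilable w (\<lambda>x y e. 0)"
proof (rule compilableI)
  fix \<sigma> :: "nat \<Rightarrow> nat" and n d
  have "computes w (\<lambda>x y e. 0) \<sigma> n d nop 1"
    by (rule computesI) (simp add: runs_nop[simplified])
  moreover have "wf_com 1 nop" by simp
  ultimately show "\<exists>c N P. wf_com N c \<and> computes w (\<lambda>x y e. 0) \<sigma> n d c P" by blast
qed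

lemma compilable_one: "compilable w (\<lambda>x y e. 1)"
proof (rule compilableI)
  fix \<sigma> :: "nat \<Rightarrow> nat" and n d
  have "computes w (\<lambda>x y e. 1) \<sigma> n d (inc d) 1"
    by (rule computesI) (simp add: runs_inc[simplified])
  moreover have "wf_com (Suc d) (inc d)" by simp
  ultimately show "\<exists>c N P. wf_com N c \<and> computes w (\<lambda>x y e. 1) \<sigma> n d c P" by blast
qed

text \<open>Counting a tape down destroys its value, so the value is moved to \<open>d\<close> and
  at the same time to the scratch tape \<open>n\<close>, from which it is transferred back.\<close>

lemma compilable_var: "compilable w (\<lambda>x y e. e i)"
proof (rule compilableI)
  fix \<sigma> :: "nat \<Rightarrow> nat" and n d
  assume p: "placed \<sigma> n d"
  define v where "v = \<sigma> i"
  have v: "2 \<le> v" "v < n" "v \<noteq> d" "d < n" "2 \<le> d"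
    using p by (auto simp: placed_def v_def)
  define c where "c = While v nonzero (dec v ;; inc d ;; inc n) ;; While n nonzero (dec n ;; inc v)"
  have "computes w (\<lambda>x y e. e i) \<sigma> n d c [:10, 10:]"
  proof (rule computesI)
    fix x y :: "bool list" and \<nu> e :: "nat \<Rightarrow> nat" and M L
    assume h: "\<forall>i. \<nu> (\<sigma> i) = e i" "\<forall>i. e i \<le> M" "\<forall>j\<ge>n. \<nu> j = (0::nat)"
    have e: "\<nu> v = e i" "e i \<le> M" "\<nu> n = 0" using h by (auto simp: v_def)
    let ?S = "\<lambda>k. \<nu>(v := e i - k, d := \<nu> d + k, n := k)"
    have 1: "runs (While v nonzero (dec v ;; inc d ;; inc n)) (store x y \<nu>) (6 * M + 1) (store x y (?S (e i)))"
    proof (rule runs_while_store[where S = "\<lambda>k. (?S k)" and n = "e i" and b = 5])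
      fix k assume k: "k < e i"
      show "runs (dec v ;; inc d ;; inc n) (store x y (?S k)) 5 (store x y (?S (Suc k)))"
        by (rule runs_seq_le[OF runs_dec_eq[OF _ refl] runs_seq[OF runs_inc_eq[OF refl] runs_inc_eq]])
          (use v k in \<open>auto simp: fun_eq_iff\<close>)
    qed (use v e in \<open>auto simp: read_counter fun_eq_iff intro!: arg_cong[of _ _ "store x y"]\<close>)
    have 2: "runs (While n nonzero (dec n ;; inc v)) (store x y (?S (e i))) (4 * M + 1)
        (store x y (\<nu>(d := \<nu> d + e i)))"
      by (rule runs_transfer) (use v e in \<open>auto simp: fun_eq_iff\<close>)
    show "e i \<le> poly [:10, 10:] (L + M) \<and>
        runs c (store x y \<nu>) (poly [:10, 10:] (L + M)) (store x y (\<nu>(d := \<nu> d + e i)))"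
      unfolding c_def using e by (intro conjI runs_seq_le[OF 1 2]) auto
  qed
  moreover have "wf_com (Suc n) c" using v by (simp add: c_def)
  ultimately show "\<exists>c N P. wf_com N c \<and> computes w (\<lambda>x y e. e i) \<sigma> n d c P" by blast
qed

lemma compilable_add:
  assumes "compilable w f" "compilable w g"
  shows "compilable w (\<lambda>x y e. f x y e + g x y e)"
proof (rule compilableI)
  fix \<sigma> :: "nat \<Rightarrow> nat" and n d
  assume p: "placed \<sigma> n d"
  then obtain c1 N1 P1 c2 N2 P2 where c: "wf_com N1 c1" "computes w f \<sigma> n d c1 P1"
    "wf_com N2 c2" "computes w g \<sigma> n d c2 P2"
    using assms unfolding compilable_def by meson
  have "computes w (\<lambda>x y e. f x y e + g x y e) \<sigma> n d (c1 ;; c2) (P1 + P2 + 1)"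
  proof (rule computesI)
    fix x y :: "bool list" and \<nu> e :: "nat \<Rightarrow> nat" and M L
    assume h: "\<forall>i. \<nu> (\<sigma> i) = e i" "\<forall>i. e i \<le> M" "\<forall>j\<ge>n. \<nu> j = (0::nat)" "\<nu> 0 = 0"
      "w \<Longrightarrow> \<nu> 1 = 0" "L = length x + (if w then length y else 0)"
    have 1: "f x y e \<le> poly P1 (L + M)"
      "runs c1 (store x y \<nu>) (poly P1 (L + M)) (store x y (\<nu>(d := \<nu> d + f x y e)))"
      by ((rule computes_runs[where \<nu> = \<nu>, OF c(2)] | rule computes_le[where \<nu> = \<nu>, OF c(2)]); use h in auto)+
    have "runs c2 (store x y (\<nu>(d := \<nu> d + f x y e))) (poly P2 (L + M))
        (store x y (\<nu>(d := \<nu> d + (f x y e + g x y e))))"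
      and b: "g x y e \<le> poly P2 (L + M)"
      by ((rule computes_runs[where \<nu> = "\<nu>(d := \<nu> d + f x y e)", OF c(4)] | rule computes_le[where \<nu> = "\<nu>(d := \<nu> d + f x y e)", OF c(4)]); use h p in \<open>auto simp: placed_def fun_eq_iff\<close>)+
    then show "f x y e + g x y e \<le> poly (P1 + P2 + 1) (L + M) \<and>
        runs (c1 ;; c2) (store x y \<nu>) (poly (P1 + P2 + 1) (L + M))
          (store x y (\<nu>(d := \<nu> d + (f x y e + g x y e))))"
      using 1(1) b by (intro conjI runs_seq_le[OF 1(2)]) auto
  qed
  moreover have "wf_com (max N1 N2) (c1 ;; c2)"
    using c wf_com_mono by auto
  ultimately show "\<exists>c N P. wf_com N c \<and> computes w (\<lambda>x y e. f x y e + g x y e) \<sigma> n d c P" by blast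
qed

lemma compilable_monus:
  assumes "compilable w f" "compilable w g"
  shows "compilable w (\<lambda>x y e. f x y e - g x y e)"
proof (rule compilableI)
  fix \<sigma> :: "nat \<Rightarrow> nat" and n d
  assume p: "placed \<sigma> n d"
  then have "placed \<sigma> (n + 2) n" "placed \<sigma> (n + 2) (n + 1)"
    by (auto simp: placed_def less_imp_neq trans_less_add1) (metis less_irrefl lessI less_trans)+
  then obtain c1 N1 P1 c2 N2 P2 where c: "wf_com N1 c1" "computes w f \<sigma> (n + 2) n c1 P1"
    "wf_com N2 c2" "computes w g \<sigma> (n + 2) (n + 1) c2 P2"
    using assms unfolding compilable_def by meson
  \<comment> \<open>Tape \<open>n\<close> holds the minuend and \<open>n + 1\<close> the subtrahend.
    Each unit of the minuend cancels a unit of the subtrahend or, when none is left, counts.\<close>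
  define c3 where "c3 = While n nonzero (dec n ;; Cond (n + 1) nonzero (dec (n + 1)) (inc d))"
  define c4 where "c4 = While (n + 1) nonzero (dec (n + 1))"
  define P where "P = smult 10 P1 + smult 10 P2 + [:10:]"
  have d: "2 \<le> d" "d < n" using p by (auto simp: placed_def)
  have \<sigma>: "\<sigma> i < n" for i using p by (auto simp: placed_def)
  then have \<sigma>n: "\<sigma> i \<noteq> n" for i using less_irrefl by metis
  have "computes w (\<lambda>x y e. f x y e - g x y e) \<sigma> n d (c1 ;; c2 ;; c3 ;; c4) P"
  proof (rule computesI)
    fix x y :: "bool list" and \<nu> e :: "nat \<Rightarrow> nat" and M L
    assume h: "\<forall>i. \<nu> (\<sigma> i) = e i" "\<forall>i. e i \<le> M" "\<forall>j\<ge>n. \<nu> j = (0::nat)" "\<nu> 0 = 0"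
      "w \<Longrightarrow> \<nu> 1 = 0" "L = length x + (if w then length y else 0)"
    define a b where ab: "a = f x y e" "b = g x y e"
    have 1: "runs c1 (store x y \<nu>) (poly P1 (L + M)) (store x y (\<nu>(n := a)))"
      and a: "a \<le> poly P1 (L + M)"
      unfolding ab by ((rule computes_runs[where \<nu> = \<nu>, OF c(2)] | rule computes_le[where \<nu> = \<nu>, OF c(2)]); use h in auto)+
    have 2: "runs c2 (store x y (\<nu>(n := a))) (poly P2 (L + M)) (store x y (\<nu>(n := a, n + 1 := b)))"
      and b: "b \<le> poly P2 (L + M)"
      unfolding ab by ((rule computes_runs[where \<nu> = "\<nu>(n := f x y e)", OF c(4)] | rule computes_le[where \<nu> = "\<nu>(n := f x y e)", OF c(4)]); use h \<sigma>n d in auto)+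
    let ?S = "\<lambda>i. \<nu>(n := a - i, n + 1 := b - i, d := \<nu> d + (i - b))"
    have 3: "runs c3 (store x y (\<nu>(n := a, n + 1 := b))) (5 * a + 1) (store x y (?S a))"
      unfolding c3_def
    proof (rule runs_while_store[where S = "\<lambda>k. (?S k)" and n = a and b = 4])
      fix k assume k: "k < a"
      show "runs (dec n ;; Cond (n + 1) nonzero (dec (n + 1)) (inc d)) (store x y (?S k)) 4
          (store x y (?S (Suc k)))"
      proof (rule runs_seq_le[OF runs_dec_eq[OF _ refl] runs_cond])
        show "runs (dec (n + 1)) (store x y ((?S k)(n := ?S k n - 1))) 1 (store x y (?S (Suc k)))"
          if "nonzero (tape_read (store x y ((?S k)(n := ?S k n - 1)) (n + 1)))"
          by (rule runs_dec_eq) (use that d k in \<open>auto simp: read_counter fun_eq_iff split: if_splits\<close>)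
        show "runs (inc d) (store x y ((?S k)(n := ?S k n - 1))) 1 (store x y (?S (Suc k)))"
          if "\<not> nonzero (tape_read (store x y ((?S k)(n := ?S k n - 1)) (n + 1)))"
          by (rule runs_inc_eq) (use that d k in \<open>auto simp: read_counter fun_eq_iff Suc_diff_le split: if_splits\<close>)
      qed (use d k in auto)
    qed (use d in \<open>auto simp: read_counter fun_eq_iff intro!: arg_cong[of _ _ "store x y"]\<close>)
    have 4: "runs c4 (store x y (?S a)) (2 * b + 1) (store x y (\<nu>(d := \<nu> d + (a - b))))"
      unfolding c4_def by (rule runs_drain) (use d h in \<open>auto simp: fun_eq_iff\<close>)
    show "f x y e - g x y e \<le> poly P (L + M) \<and>
        runs (c1 ;; c2 ;; c3 ;; c4) (store x y \<nu>) (poly P (L + M))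
          (store x y (\<nu>(d := \<nu> d + (f x y e - g x y e))))"
      using a b unfolding ab[symmetric]
      by (intro conjI runs_seq_le[OF 1 runs_seq[OF 2 runs_seq[OF 3 4]]]) (auto simp: P_def)
  qed
  moreover have "wf_com (Max {N1, N2, n + 2}) (c1 ;; c2 ;; c3 ;; c4)"
    using c d wf_com_mono by (auto simp: c3_def c4_def)
  ultimately show "\<exists>c N P. wf_com N c \<and> computes w (\<lambda>x y e. f x y e - g x y e) \<sigma> n d c P" by blast
qed


lemma compilable_sum:
  assumes "compilable w t" "compilable w f"
  shows "compilable w (\<lambda>x y e. \<Sum>v<t x y e. f x y (case_nat v e))"
proof (rule compilableI)
  fix \<sigma> :: "nat \<Rightarrow> nat" and n d
  assume p: "placed \<sigma> n d"
  have d: "2 \<le> d" "d < n" using p by (auto simp: placed_def)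
  have \<sigma>: "2 \<le> \<sigma> i" "\<sigma> i < n" "\<sigma> i \<noteq> d" for i using p by (auto simp: placed_def)
  then have \<sigma>n: "\<sigma> i \<noteq> n" "\<sigma> i \<noteq> Suc n" for i by (metis less_irrefl, metis not_less_eq less_Suc_eq)
  \<comment> \<open>Tape \<open>n\<close> counts the rounds down, while \<open>n + 1\<close> counts
    up and is the bound variable. The body has its scratch tapes from \<open>n + 2\<close>
    on.\<close>
  have "placed \<sigma> (n + 2) n" "placed (case_nat (n + 1) \<sigma>) (n + 2) d"
    using d \<sigma> \<sigma>n by (auto simp: placed_def less_SucI split: nat.split)
  then obtain c1 N1 P1 c2 N2 P2 where c: "wf_com N1 c1" "computes w t \<sigma> (n + 2) n c1 P1"
    "wf_com N2 c2" "computes w f (case_nat (n + 1) \<sigma>) (n + 2) d c2 P2"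
    using assms unfolding compilable_def by meson
  define c3 where "c3 = While n nonzero (c2 ;; inc (n + 1) ;; dec n)"
  define c4 where "c4 = While (n + 1) nonzero (dec (n + 1))"
  \<comment> \<open>The bound variable may be as large as the value of \<open>t\<close>, hence the
    body is estimated at the argument enlarged by \<open>P1\<close>.\<close>
  define P where "P = smult 10 P1 + P1 * pcompose P2 ([:0, 1:] + P1) + [:10:]"
  have "computes w (\<lambda>x y e. \<Sum>v<t x y e. f x y (case_nat v e)) \<sigma> n d (c1 ;; c3 ;; c4) P"
  proof (rule computesI)
    fix x y :: "bool list" and \<nu> e :: "nat \<Rightarrow> nat" and M L
    assume h: "\<forall>i. \<nu> (\<sigma> i) = e i" "\<forall>i. e i \<le> M" "\<forall>j\<ge>n. \<nu> j = (0::nat)" "\<nu> 0 = 0"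
      "w \<Longrightarrow> \<nu> 1 = 0" "L = length x + (if w then length y else 0)"
    define a where "a = t x y e"
    define A where "A = poly P1 (L + M)"
    define B where "B = poly P2 (L + (M + A))"
    have 1: "runs c1 (store x y \<nu>) A (store x y (\<nu>(n := a)))" and a: "a \<le> A"
      unfolding a_def A_def by ((rule computes_runs[where \<nu> = \<nu>, OF c(2)] | rule computes_le[where \<nu> = \<nu>, OF c(2)]); use h in auto)+
    let ?S = "\<lambda>i. \<nu>(n := a - i, n + 1 := i, d := \<nu> d + (\<Sum>v<i. f x y (case_nat v e)))"
    have 2: "runs c2 (store x y (?S k)) B
          (store x y (\<nu>(n := a - k, n + 1 := k, d := \<nu> d + (\<Sum>v<Suc k. f x y (case_nat v e)))))"
      and b: "f x y (case_nat k e) \<le> B" if k: "k < a" for k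
      unfolding B_def
      by ((rule computes_runs[where \<nu> = "?S k", OF c(4)] | rule computes_le[where \<nu> = "?S k", OF c(4)]); use h d \<sigma> \<sigma>n k a in
          \<open>auto simp: fun_eq_iff trans_le_add1 split: nat.split\<close>)+
    have 3: "runs c3 (store x y (\<nu>(n := a))) (a * (B + 5) + 1) (store x y (?S a))"
      unfolding c3_def
    proof (rule runs_while_store[where S = ?S and n = a and b = "B + 4"])
      fix k assume k: "k < a"
      show "runs (c2 ;; inc (n + 1) ;; dec n) (store x y (?S k)) (B + 4) (store x y (?S (Suc k)))"
        by (rule runs_seq_le[OF 2[OF k] runs_seq[OF runs_inc_eq[OF refl] runs_dec_eq]])
          (use k d in \<open>auto simp: fun_eq_iff\<close>)
    qed (use d h in \<open>auto simp: read_counter fun_eq_iff\<close>)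
    have 4: "runs c4 (store x y (?S a)) (2 * a + 1)
        (store x y (\<nu>(d := \<nu> d + (\<Sum>v<a. f x y (case_nat v e)))))"
      unfolding c4_def by (rule runs_drain) (use d h in \<open>auto simp: fun_eq_iff\<close>)
    have "(\<Sum>v<a. f x y (case_nat v e)) \<le> a * B"
      using sum_bounded_above[of "{..<a}" "\<lambda>v. f x y (case_nat v e)" B] b by simp
    also have aB: "a * B \<le> A * B"
      using a by simp
    finally have "(\<Sum>v<a. f x y (case_nat v e)) \<le> A * B" .
    moreover have "a * (B + 5) \<le> A * B + 5 * A"
      using a aB by (simp add: algebra_simps add_mono)
    moreover have P: "poly P (L + M) = 10 * A + A * B + 10"
      by (simp add: P_def A_def B_def poly_pcompose add.assoc)
    ultimately show "(\<Sum>v<t x y e. f x y (case_nat v e)) \<le> poly P (L + M) \<and>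
        runs (c1 ;; c3 ;; c4) (store x y \<nu>) (poly P (L + M))
          (store x y (\<nu>(d := \<nu> d + (\<Sum>v<t x y e. f x y (case_nat v e)))))"
      using a unfolding a_def[symmetric] P
      by (intro conjI runs_seq_le[OF 1 runs_seq[OF 3 4]]) auto
  qed
  moreover have "wf_com (Max {N1, N2, n + 2}) (c1 ;; c3 ;; c4)"
    using c wf_com_mono by (auto simp: c3_def c4_def)
  ultimately show "\<exists>c N P. wf_com N c \<and>
      computes w (\<lambda>x y e. \<Sum>v<t x y e. f x y (case_nat v e)) \<sigma> n d c P" by blast
qed

lemma compilable_len:
  assumes b: "b = 0 \<or> w \<and> b = 1"
  shows "compilable w (\<lambda>x y e. length (word b x y))"
proof (rule compilableI)
  fix \<sigma> :: "nat \<Rightarrow> nat" and n d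
  assume p: "placed \<sigma> n d"
  have d: "2 \<le> d" "d < n" "b < 2" using p b by (auto simp: placed_def)
  define c1 where "c1 = While b nonblank (inc b ;; inc d ;; inc n)"
  define c2 where "c2 = While n nonzero (dec n ;; dec b)"
  have "computes w (\<lambda>x y e. length (word b x y)) \<sigma> n d (c1 ;; c2) [:10, 10:]"
  proof (rule computesI)
    fix x y :: "bool list" and \<nu> e :: "nat \<Rightarrow> nat" and M L
    assume h: "\<forall>j\<ge>n. \<nu> j = (0::nat)" "\<nu> 0 = 0" "w \<Longrightarrow> \<nu> 1 = 0" "L = length x + (if w then length y else 0)"
    define a where "a = length (word b x y)"
    have a: "a \<le> L" and \<nu>: "\<nu> b = 0" using b h by (auto simp: a_def word_def)
    have 1: "runs c1 (store x y \<nu>) (6 * a + 1) (store x y (\<nu>(b := a, d := \<nu> d + a, n := a)))"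
      unfolding c1_def
    proof (rule runs_while_store[where S = "\<lambda>i. \<nu>(b := i, d := \<nu> d + i, n := i)" and n = a and b = 5])
      fix k assume k: "k < a"
      show "runs (inc b ;; inc d ;; inc n) (store x y (\<nu>(b := k, d := \<nu> d + k, n := k))) 5
         (store x y (\<nu>(b := Suc k, d := \<nu> d + Suc k, n := Suc k)))"
        by (rule runs_seq_le[OF runs_inc_eq[OF refl] runs_seq[OF runs_inc_eq[OF refl] runs_inc_eq]])
          (use d in \<open>auto simp: fun_eq_iff\<close>)
    qed (use d h \<nu> in \<open>auto simp: read_word a_def bit_symbol_def fun_eq_iff\<close>)
    have 2: "runs c2 (store x y (\<nu>(b := a, d := \<nu> d + a, n := a))) (4 * a + 1)
        (store x y (\<nu>(d := \<nu> d + a)))"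
      unfolding c2_def
    proof (rule runs_while_store[where S = "\<lambda>i. \<nu>(b := a - i, d := \<nu> d + a, n := a - i)" and n = a and b = 3])
      fix k assume k: "k < a"
      show "runs (dec n ;; dec b) (store x y (\<nu>(b := a - k, d := \<nu> d + a, n := a - k))) 3
         (store x y (\<nu>(b := a - Suc k, d := \<nu> d + a, n := a - Suc k)))"
        by (rule runs_seq_le[OF runs_dec_eq[OF _ refl] runs_dec_eq])
          (use d k in \<open>auto simp: fun_eq_iff\<close>)
    qed (use d h \<nu> in \<open>auto simp: read_counter fun_eq_iff\<close>)
    show "length (word b x y) \<le> poly [:10, 10:] (L + M) \<and>
        runs (c1 ;; c2) (store x y \<nu>) (poly [:10, 10:] (L + M)) (store x y (\<nu>(d := \<nu> d + length (word b x y))))"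
      using a unfolding a_def[symmetric] by (intro conjI runs_seq_le[OF 1 2]) auto
  qed
  moreover have "wf_com (Suc n) (c1 ;; c2)"
    using d by (auto simp: c1_def c2_def)
  ultimately show "\<exists>c N P. wf_com N c \<and> computes w (\<lambda>x y e. length (word b x y)) \<sigma> n d c P" by blast
qed

text \<open>The head of the word walks to the address, and a copy of the address on
  \<open>n + 1\<close> brings it back. Beyond the word it scans a blank, which counts as a
  zero.\<close>

lemma compilable_bit:
  assumes b: "b = 0 \<or> w \<and> b = 1" and "compilable w t"
  shows "compilable w (\<lambda>x y e. of_bool (t x y e < length (word b x y) \<and> word b x y ! t x y e))"
proof (rule compilableI)
  fix \<sigma> :: "nat \<Rightarrow> nat" and n d
  assume p: "placed \<sigma> n d"
  have d: "2 \<le> d" "d < n" "b < 2" using p b by (auto simp: placed_def)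
  have "\<sigma> i < n" for i using p by (auto simp: placed_def)
  then have "placed \<sigma> (n + 2) n"
    using p d by (auto simp: placed_def less_SucI)
  then obtain c0 N P where c: "wf_com N c0" "computes w t \<sigma> (n + 2) n c0 P"
    using assms unfolding compilable_def by meson
  define c1 where "c1 = While n nonzero (dec n ;; inc b ;; inc (n + 1))"
  define c2 where "c2 = Cond b (\<lambda>s. s = 2) (inc d) nop"
  define c3 where "c3 = While (n + 1) nonzero (dec (n + 1) ;; dec b)"
  have "computes w (\<lambda>x y e. of_bool (t x y e < length (word b x y) \<and> word b x y ! t x y e)) \<sigma> n d
    (c0 ;; c1 ;; c2 ;; c3) (smult 20 P + [:20:])"
  proof (rule computesI)
    fix x y :: "bool list" and \<nu> e :: "nat \<Rightarrow> nat" and M L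
    assume h: "\<forall>i. \<nu> (\<sigma> i) = e i" "\<forall>i. e i \<le> M" "\<forall>j\<ge>n. \<nu> j = (0::nat)" "\<nu> 0 = 0"
      "w \<Longrightarrow> \<nu> 1 = 0" "L = length x + (if w then length y else 0)"
    define a where "a = t x y e"
    define r :: nat where "r = of_bool (a < length (word b x y) \<and> word b x y ! a)"
    have \<nu>: "\<nu> b = 0" using b h by auto
    have 0: "runs c0 (store x y \<nu>) (poly P (L + M)) (store x y (\<nu>(n := a)))" and a: "a \<le> poly P (L + M)"
      unfolding a_def by ((rule computes_runs[where \<nu> = \<nu>, OF c(2)] | rule computes_le[where \<nu> = \<nu>, OF c(2)]); use h in auto)+
    have 1: "runs c1 (store x y (\<nu>(n := a))) (6 * a + 1) (store x y (\<nu>(b := a, n + 1 := a)))"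
      unfolding c1_def
    proof (rule runs_while_store[where S = "\<lambda>i. \<nu>(n := a - i, b := i, n + 1 := i)" and n = a and b = 5])
      fix k assume k: "k < a"
      show "runs (dec n ;; inc b ;; inc (n + 1)) (store x y (\<nu>(n := a - k, b := k, n + 1 := k))) 5
         (store x y (\<nu>(n := a - Suc k, b := Suc k, n + 1 := Suc k)))"
        by (rule runs_seq_le[OF runs_dec_eq[OF _ refl] runs_seq[OF runs_inc_eq[OF refl] runs_inc_eq]])
          (use d k in \<open>auto simp: fun_eq_iff\<close>)
    qed (use d h \<nu> in \<open>auto simp: read_counter fun_eq_iff\<close>)
    have 2: "runs c2 (store x y (\<nu>(b := a, n + 1 := a))) 2 (store x y (\<nu>(b := a, n + 1 := a, d := \<nu> d + r)))"
      unfolding c2_def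
    proof (rule runs_mono[OF runs_cond])
      show "runs (inc d) (store x y (\<nu>(b := a, n + 1 := a))) 1 (store x y (\<nu>(b := a, n + 1 := a, d := \<nu> d + r)))"
        if "tape_read (store x y (\<nu>(b := a, n + 1 := a)) b) = 2"
        by (rule runs_inc_eq) (use that d in \<open>auto simp: r_def read_word bit_symbol_def fun_eq_iff split: if_splits\<close>)
      show "runs nop (store x y (\<nu>(b := a, n + 1 := a))) 1 (store x y (\<nu>(b := a, n + 1 := a, d := \<nu> d + r)))"
        if "tape_read (store x y (\<nu>(b := a, n + 1 := a)) b) \<noteq> 2"
      proof -
        have "r = 0" using that d by (auto simp: r_def read_word bit_symbol_def split: if_splits)
        then have "\<nu>(b := a, n + 1 := a, d := \<nu> d + r) = \<nu>(b := a, n + 1 := a)"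
          using d by (auto simp: fun_eq_iff)
        then show ?thesis using runs_nop by simp
      qed
    qed simp
    have 3: "runs c3 (store x y (\<nu>(b := a, n + 1 := a, d := \<nu> d + r))) (4 * a + 1)
        (store x y (\<nu>(d := \<nu> d + r)))"
      unfolding c3_def
    proof (rule runs_while_store[where S = "\<lambda>i. \<nu>(b := a - i, n + 1 := a - i, d := \<nu> d + r)" and n = a and b = 3])
      fix k assume k: "k < a"
      show "runs (dec (n + 1) ;; dec b) (store x y (\<nu>(b := a - k, n + 1 := a - k, d := \<nu> d + r))) 3
         (store x y (\<nu>(b := a - Suc k, n + 1 := a - Suc k, d := \<nu> d + r)))"
        by (rule runs_seq_le[OF runs_dec_eq[OF _ refl] runs_dec_eq])
          (use d k in \<open>auto simp: fun_eq_iff\<close>)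
    qed (use d h \<nu> in \<open>auto simp: read_counter fun_eq_iff\<close>)
    have "r \<le> 1" by (simp add: r_def)
    then show "of_bool (t x y e < length (word b x y) \<and> word b x y ! t x y e) \<le> poly (smult 20 P + [:20:]) (L + M) \<and>
        runs (c0 ;; c1 ;; c2 ;; c3) (store x y \<nu>) (poly (smult 20 P + [:20:]) (L + M))
         (store x y (\<nu>(d := \<nu> d + of_bool (t x y e < length (word b x y) \<and> word b x y ! t x y e))))"
      using a unfolding a_def[symmetric] r_def[symmetric]
      by (intro conjI runs_seq_le[OF 0 runs_seq[OF 1 runs_seq[OF 2 3]]]) auto
  qed
  moreover have "wf_com (max N (n + 2)) (c0 ;; c1 ;; c2 ;; c3)"
    using c d wf_com_mono by (auto simp: c1_def c2_def c3_def)
  ultimately show "\<exists>c N P. wf_com N c \<and>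
      computes w (\<lambda>x y e. of_bool (t x y e < length (word b x y) \<and> word b x y ! t x y e)) \<sigma> n d c P" by blast
qed

lemma pf_compilable: "pf w f \<Longrightarrow> compilable w f"
  by (induction rule: pf.induct)
    (auto simp del: One_nat_def intro: compilable_zero compilable_one compilable_var compilable_add
      compilable_monus compilable_sum compilable_len compilable_bit)

section \<open>Initialisation, decision and output\<close>

definition marks :: "nat list \<Rightarrow> com" where
  "marks js = foldr (\<lambda>j c. Act j (\<lambda>_. 1) Stay ;; c) js nop"

lemma runs_marks:
  "distinct js \<Longrightarrow> runs (marks js) \<sigma> (2 * length js + 1)
     (\<lambda>j. if j \<in> set js then tape_act (1, Stay) (\<sigma> j) else \<sigma> j)"
proof (induction js arbitrary: \<sigma>)
  case Nil
  then show ?case using runs_nop by (simp add: marks_def)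
next
  case (Cons i js)
  have "runs (marks (i # js)) \<sigma> (2 * length (i # js) + 1)
      (\<lambda>j. if j \<in> set js then tape_act (1, Stay) ((\<sigma>(i := tape_act (1, Stay) (\<sigma> i))) j)
        else (\<sigma>(i := tape_act (1, Stay) (\<sigma> i))) j)"
    unfolding marks_def foldr_Cons comp_def
    by (rule runs_seq_le[OF runs_act Cons.IH[unfolded marks_def]]) (use Cons.prems in auto)
  moreover have "(\<lambda>j. if j \<in> set js then tape_act (1, Stay) ((\<sigma>(i := tape_act (1, Stay) (\<sigma> i))) j)
        else (\<sigma>(i := tape_act (1, Stay) (\<sigma> i))) j) =
      (\<lambda>j. if j \<in> set (i # js) then tape_act (1, Stay) (\<sigma> j) else \<sigma> j)"
    using Cons.prems by (auto simp: fun_eq_iff)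
  ultimately show ?case by simp
qed

text \<open>The machine has no tapes from \<open>k\<close> on. Declaring them to be counters with
  value 0 makes the state after setting the markers literally a \<open>store\<close>.\<close>

definition initial :: "nat \<Rightarrow> bool list \<Rightarrow> bool list \<Rightarrow> nat \<Rightarrow> tape" where
  "initial k x y j =
     (if j < 2 then (word_cells (word j x y), 0) else if j < k then (word_cells [], 0) else counter 0)"

lemma runs_init: "runs (marks [2..<k]) (initial k x y) (2 * k + 1) (store x y (\<lambda>_. 0))"
proof (rule runs_mono)
  have "(\<lambda>j. if j \<in> set [2..<k] then tape_act (1, Stay) (initial k x y j) else initial k x y j)
      = store x y (\<lambda>_. 0)"
    by (auto simp: fun_eq_iff initial_def store_def counter_def word_def word_cells_def)
  then show "runs (marks [2..<k]) (initial k x y) (2 * length [2..<k] + 1) (store x y (\<lambda>_. 0))"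
    using runs_marks[of "[2..<k]" "initial k x y"] by simp
qed simp

lemma wf_marks: "wf_com k (marks js) \<longleftrightarrow> 0 < k \<and> (\<forall>j\<in>set js. j < k)"
  by (induction js) (auto simp: marks_def)

lemma init_config_of:
  assumes "2 \<le> k"
  shows "init_config (tm_of k p) [x, y] = (stack_index p [p], map (initial k x y) [0..<k])"
    and "init_config (tm_of k p) [x] = (stack_index p [p], map (initial k x []) [0..<k])"
  using assms by (auto simp: init_config_def tm_of_def initial_def word_def less_Suc_eq)

lemma runs_tm:
  assumes "runs c \<sigma> b \<sigma>'" "wf_com k c" "c # K \<in> program_stacks p"
  shows "K \<in> program_stacks p" "\<exists>t\<le>b. (tm_step (tm_of k p) ^^ t) (stack_index p (c # K), map \<sigma> [0..<k]) =
    (stack_index p K, map \<sigma>' [0..<k])"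
  using assms exec_tm unfolding runs_def by blast+

text \<open>A rejecting run is not covered by \<open>exec\<close>, so only the evaluation of
  \<open>f\<close> is treated that way. The final test and the passage to \<open>[Reject]\<close>
  are followed in the machine itself.\<close>

theorem pf_decidable:
  assumes "pf True f"
  shows "polytime_decidable2 (\<lambda>x y. 0 < f x y (\<lambda>_. 0))"
proof -
  \<comment> \<open>All variables share tape 2, whose counter stays 0 because the environment is
    constantly 0; tape 3 receives the result.\<close>
  have "placed (\<lambda>_. 2) 4 3" by (simp add: placed_def)
  then obtain c N P where c: "wf_com N c" "computes True f (\<lambda>_. 2) 4 3 c P"
    using pf_compilable[OF assms] unfolding compilable_def by meson
  define k where "k = N + 4"
  define a where "a = marks [2..<k] ;; c"
  define q where "q = Cond 3 nonzero nop Reject"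
  define p where "p = a ;; q"
  let ?M = "tm_of k p"
  have wfa: "wf_com k a" and wf: "wf_com k p"
    using wf_com_mono[OF c(1), of k] by (auto simp: p_def q_def a_def wf_marks k_def)
  have mem: "[p] \<in> program_stacks p" "a # [q] \<in> program_stacks p"
    using program_stacks_closed[OF program_stacks_start, of "\<lambda>_. 0" p]
    by (auto simp: program_stacks_start p_def)
  have "\<exists>t\<le>poly (P + [:2 * k + 10:]) (length x + length y).
          let cf = tm_run ?M t (init_config ?M [x, y])
          in halted ?M cf \<and> (fst cf = tm_accept ?M \<longleftrightarrow> 0 < f x y (\<lambda>_. 0))" for x y
  proof -
    define L where "L = length x + length y"
    define \<nu> :: "nat \<Rightarrow> nat" where "\<nu> = (\<lambda>_. 0)(3 := f x y (\<lambda>_. 0))"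
    have "runs c (store x y (\<lambda>_. 0)) (poly P (L + 0)) (store x y \<nu>)"
      by (rule computes_runs[OF c(2)]) (auto simp: L_def \<nu>_def)
    then have "runs a (initial k x y) (2 * k + 2 + poly P L) (store x y \<nu>)"
      unfolding a_def by (intro runs_seq_le[OF runs_init]) auto
    note r = runs_tm[OF this wfa mem(2)]
    then obtain t where t: "t \<le> 2 * k + 2 + poly P L"
      "(tm_step ?M ^^ t) (stack_index p (a # [q]), map (initial k x y) [0..<k]) =
        (stack_index p [q], map (store x y \<nu>) [0..<k])" by blast
    have s1: "tm_step ?M (stack_index p [p], map (initial k x y) [0..<k])
        = (stack_index p (a # [q]), map (initial k x y) [0..<k])"
      by (rule tm_step_silent) (use mem in \<open>auto simp: p_def\<close>)
    define z where "z = (if f x y (\<lambda>_. 0) = 0 then Reject else nop)"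
    have s2: "tm_step ?M (stack_index p [q], map (store x y \<nu>) [0..<k])
        = (stack_index p [z], map (store x y \<nu>) [0..<k])"
      unfolding q_def
      by (rule tm_step_silent) (use r(1) in \<open>auto simp: q_def k_def read_counter \<nu>_def z_def\<close>)
    have z: "[z] \<in> program_stacks p"
      using program_stacks_closed[OF r(1), of "\<lambda>_. if f x y (\<lambda>_. 0) = 0 then 1 else 0"]
      by (auto simp: q_def z_def split: if_splits)
    have fin: "[] \<in> program_stacks p" "[Reject] \<in> program_stacks p"
      by (auto simp: program_stacks_def)
    have "\<exists>u\<le>1. (tm_step ?M ^^ u) (stack_index p [z], map (store x y \<nu>) [0..<k])
        = (stack_index p (if f x y (\<lambda>_. 0) = 0 then [Reject] else []), map (store x y \<nu>) [0..<k])"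
    proof (cases "f x y (\<lambda>_. 0) = 0")
      case True
      then show ?thesis by (intro exI[of _ 0]) (simp add: z_def)
    next
      case False
      then show ?thesis
        using runs_tm(2)[OF runs_nop, of k "[]" p "store x y \<nu>"] z by (auto simp: z_def k_def)
    qed
    then obtain u where u: "u \<le> 1" "(tm_step ?M ^^ Suc u) (stack_index p [q], map (store x y \<nu>) [0..<k])
        = (stack_index p (if f x y (\<lambda>_. 0) = 0 then [Reject] else []), map (store x y \<nu>) [0..<k])"
      using s2 by (auto simp: funpow_swap1)
    have run: "tm_run ?M (Suc (t + Suc u)) (init_config ?M [x, y]) =
        (stack_index p (if f x y (\<lambda>_. 0) = 0 then [Reject] else []), map (store x y \<nu>) [0..<k])"
      unfolding tm_run_def init_config_of(1)[of k, simplified k_def, simplified, folded k_def]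
      by (rule funpow_Suc_add[OF s1 t(2) u(2)])
    show ?thesis
    proof (intro exI conjI)
      show "Suc (t + Suc u) \<le> poly (P + [:2 * k + 10:]) (length x + length y)"
        using t u by (simp add: L_def)
      show "let cf = tm_run ?M (Suc (t + Suc u)) (init_config ?M [x, y])
          in halted ?M cf \<and> (fst cf = tm_accept ?M \<longleftrightarrow> 0 < f x y (\<lambda>_. 0))"
        unfolding run Let_def using fin
        by (auto simp: halted_def stack_index_eq tm_of_def)
    qed
  qed
  moreover have "wf_tm ?M" by (rule wf_tm_of[OF wf]) (simp add: k_def)
  ultimately show ?thesis
    unfolding polytime_decidable2_def by blast
qed

theorem pf_computable:
  assumes l: "pf False l" and b: "pf False b"
  shows "polytime_computable (\<lambda>x. map (\<lambda>i. 0 < b x [] (case_nat i (\<lambda>_. 0))) [0..<l x [] (\<lambda>_. 0)])"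
proof -
  have "placed (\<lambda>_. 2) 6 3" by (simp add: placed_def)
  then obtain c1 N1 P1 where c1: "wf_com N1 c1" "computes False l (\<lambda>_. 2) 6 3 c1 P1"
    using pf_compilable[OF l] unfolding compilable_def by meson
  have "placed (case_nat 4 (\<lambda>_. 2)) 6 5" by (simp add: placed_def split: nat.split)
  then obtain c2 N2 P2 where c2: "wf_com N2 c2" "computes False b (case_nat 4 (\<lambda>_. 2)) 6 5 c2 P2"
    using pf_compilable[OF b] unfolding compilable_def by meson
  define emit :: "nat \<Rightarrow> com" where "emit s = Act 1 (\<lambda>_. s) MoveR" for s
  \<comment> \<open>Tape 3 counts the bits still to be printed, tape 4 is the position and serves as
    variable 0, and tape 5 receives the value that decides the bit.\<close>
  define body where "body = c2 ;; Cond 5 nonzero (emit 2) (emit 1) ;; While 5 nonzero (dec 5) ;; inc 4 ;; dec 3"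
  define k where "k = N1 + N2 + 6"
  define p where "p = marks [2..<k] ;; c1 ;; While 3 nonzero body"
  define Q where "Q = P1 + P1 * (smult 3 (pcompose P2 ([:0, 1:] + P1)) + [:20:]) + [:2 * k + 20:]"
  let ?M = "tm_of k p"
  have wf: "wf_com k p"
    using wf_com_mono[OF c1(1), of k] wf_com_mono[OF c2(1), of k]
    by (auto simp: p_def body_def emit_def wf_marks k_def)
  have "\<exists>t\<le>poly Q (length x). let c = tm_run ?M t (init_config ?M [x]) in halted ?M c \<and>
      has_output c (map (\<lambda>i. 0 < b x [] (case_nat i (\<lambda>_. 0))) [0..<l x [] (\<lambda>_. 0)])" for x
  proof -
    define n where "n = l x [] (\<lambda>_. 0)"
    define g where "g i = (0 < b x [] (case_nat i (\<lambda>_. 0)))" for i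
    define out where "out i = map g [0..<i]" for i
    define A where "A = poly P1 (length x)"
    define B where "B = poly P2 (length x + A)"
    have 1: "runs c1 (store x [] (\<lambda>_. 0)) A (store x [] ((\<lambda>_. 0)(3 := n)))" and n: "n \<le> A"
      using computes_runs[OF c1(2), of "\<lambda>_. 0" "\<lambda>_. 0" 0 "length x" x "[]"]
        computes_le[OF c1(2), of "\<lambda>_. 0" "\<lambda>_. 0" 0 "length x" x "[]"]
      by (auto simp: A_def n_def)
    let ?\<nu> = "\<lambda>i. (\<lambda>_. 0)(1 := i, 3 := n - i, 4 := i)"
    have body: "runs body (store x (out i) (?\<nu> i)) (3 * B + 10) (store x (out (Suc i)) (?\<nu> (Suc i)))"
      if i: "i < n" for i
    proof -
      define v where "v = b x [] (case_nat i (\<lambda>_. 0))"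
      \<comment> \<open>By now the second tape holds the output so far, which \<open>b\<close> does
        not see.\<close>
      have "b x (out i) (case_nat i (\<lambda>_. 0)) = v"
        unfolding v_def by (rule pf_second_word[OF b]) simp
      then have r: "runs c2 (store x (out i) (?\<nu> i)) B (store x (out i) ((?\<nu> i)(5 := v)))" and v: "v \<le> B"
        using computes_runs[OF c2(2), of "?\<nu> i" "case_nat i (\<lambda>_. 0)" A "length x" x "out i"]
          computes_le[OF c2(2), of "?\<nu> i" "case_nat i (\<lambda>_. 0)" A "length x" x "out i"] i n
        by (auto simp: B_def split: nat.split)
      have e: "runs (emit (bit_symbol (g i))) (store x (out i) ((?\<nu> i)(5 := v))) 1
          (store x (out (Suc i)) ((?\<nu> i)(5 := v, 1 := Suc i)))"
        unfolding emit_def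
        by (rule back_subst[of "runs _ _ _", OF runs_act])
          (auto simp: store_def fun_eq_iff out_def word_cells_def nth_append counter_def)
      have g: "g i \<longleftrightarrow> v \<noteq> 0" by (simp add: g_def v_def)
      have r2: "runs (Cond 5 nonzero (emit 2) (emit 1)) (store x (out i) ((?\<nu> i)(5 := v))) (Suc 1)
          (store x (out (Suc i)) ((?\<nu> i)(5 := v, 1 := Suc i)))"
      proof (rule runs_cond)
        have t: "tape_read (store x (out i) ((?\<nu> i)(5 := v)) 5) = (if v = 0 then 1 else 0)"
          by (subst read_counter) auto
        show "runs (emit 2) (store x (out i) ((?\<nu> i)(5 := v))) 1 (store x (out (Suc i)) ((?\<nu> i)(5 := v, 1 := Suc i)))"
          if "nonzero (tape_read (store x (out i) ((?\<nu> i)(5 := v)) 5))"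
          using e that unfolding t g bit_symbol_def by (cases "v = 0") (simp_all only: if_True if_False simp_thms)
        show "runs (emit 1) (store x (out i) ((?\<nu> i)(5 := v))) 1 (store x (out (Suc i)) ((?\<nu> i)(5 := v, 1 := Suc i)))"
          if "\<not> nonzero (tape_read (store x (out i) ((?\<nu> i)(5 := v)) 5))"
          using e that unfolding t g bit_symbol_def by (cases "v = 0") (simp_all only: if_True if_False simp_thms)
      qed
      have r3: "runs (While 5 nonzero (dec 5)) (store x (out (Suc i)) ((?\<nu> i)(5 := v, 1 := Suc i))) (2 * B + 1)
          (store x (out (Suc i)) ((?\<nu> i)(1 := Suc i)))"
        by (rule runs_drain) (use v in \<open>auto simp: fun_eq_iff\<close>)
      show ?thesis
        unfolding body_def
        by (rule runs_seq_le[OF r runs_seq[OF r2 runs_seq[OF r3 runs_seq[OF runs_inc_eq[OF refl] runs_dec_eq]]]])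
          (use i in \<open>auto simp: fun_eq_iff\<close>)
    qed
    have 2: "runs (While 3 nonzero body) (store x [] ((\<lambda>_. 0)(3 := n))) (n * (3 * B + 11) + 1)
        (store x (out n) (?\<nu> n))"
    proof (rule runs_while_le[where S = "\<lambda>i. store x (out i) (?\<nu> i)" and n = n and b = "3 * B + 10"])
      show "store x [] ((\<lambda>_. 0)(3 := n)) = store x (out 0) (?\<nu> 0)"
        by (simp add: out_def fun_upd_def cong: if_cong) (rule arg_cong[of _ _ "store x []"], auto)
    qed (use body in \<open>auto simp: read_counter\<close>)
    have "n * (3 * B + 11) \<le> A * (3 * B + 11)" using n by (rule mult_le_mono1)
    moreover have "poly Q (length x) = A + A * (3 * B + 20) + (2 * k + 20)"
      by (simp add: Q_def A_def B_def poly_pcompose)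
    ultimately have "runs p (initial k x []) (poly Q (length x)) (store x (out n) (?\<nu> n))"
      unfolding p_def
      by (intro runs_seq_le[OF runs_init runs_seq[OF 1 2]]) (auto simp: algebra_simps)
    then obtain t where t: "t \<le> poly Q (length x)" "exec p (initial k x []) t (store x (out n) (?\<nu> n))"
      by (auto simp: runs_def)
    have k: "2 \<le> k" by (simp add: k_def)
    have run: "tm_run ?M t (init_config ?M [x]) = (stack_index p [], map (store x (out n) (?\<nu> n)) [0..<k])"
      unfolding init_config_of(2)[OF k] by (rule exec_program[OF t(2) wf])
    have "has_output (stack_index p [], map (store x (out n) (?\<nu> n)) [0..<k]) (out n)"
      using k by (auto simp: has_output_def store_def)
    moreover have "tm_accept ?M = stack_index p []" by (simp add: tm_of_def)
    moreover have "map (\<lambda>i. 0 < b x [] (case_nat i (\<lambda>_. 0))) [0..<l x [] (\<lambda>_. 0)] = out n"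
      by (simp add: out_def g_def n_def)
    ultimately show ?thesis
      using t(1) by (intro exI[of _ t]) (simp add: run Let_def halted_def)
  qed
  moreover have "wf_tm ?M" by (rule wf_tm_of[OF wf]) (simp add: k_def)
  ultimately show ?thesis
    unfolding polytime_computable_def by blast
qed

section \<open>Closure properties of definable functions and predicates\<close>

definition pp :: "bool \<Rightarrow> (bool list \<Rightarrow> bool list \<Rightarrow> (nat \<Rightarrow> nat) \<Rightarrow> bool) \<Rightarrow> bool" where
  "pp w P \<longleftrightarrow> pf w (\<lambda>x y e. of_bool (P x y e))"

named_theorems pf_intros

lemma pf_cong:
  assumes "pf w f" "\<And>x y e. f x y e = g x y e"
  shows "pf w g"
proof -
  have "f = g" by (intro ext assms(2))
  with assms(1) show ?thesis by simp
qed

text \<open>Variables behave like de Bruijn indices. The case of the renaming \<open>Suc\<close> is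
  the weakening that moves a term below the binder of a sum.\<close>

lemma pf_rename: "pf w f \<Longrightarrow> pf w (\<lambda>x y e. f x y (\<lambda>i. e (\<rho> i)))"
proof (induction arbitrary: \<rho> rule: pf.induct)
  case (sum t f)
  have "(\<lambda>i. case_nat v e (case_nat 0 (\<lambda>i. Suc (\<rho> i)) i)) = case_nat v (\<lambda>i. e (\<rho> i))"
    for v :: nat and e
    by (auto simp: fun_eq_iff split: nat.split)
  with pf.sum[OF sum.IH(1)[of \<rho>] sum.IH(2)[of "case_nat 0 (\<lambda>i. Suc (\<rho> i))"]]
  show ?case by simp
qed (auto simp del: One_nat_def intro: pf.intros)

lemma pp_rename: "pp w P \<Longrightarrow> pp w (\<lambda>x y e. P x y (\<lambda>i. e (\<rho> i)))"
  unfolding pp_def by (rule pf_rename)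

lemma pp_cong:
  assumes "pp w f" "\<And>x y e. f x y e = g x y e"
  shows "pp w g"
proof -
  have "f = g" by (intro ext assms(2))
  with assms(1) show ?thesis by simp
qed

declare pf.var[pf_intros] pf.add[pf_intros] pf.monus[pf_intros]

lemma pf_const[pf_intros]: "pf w (\<lambda>x y e. c)"
proof (induction c)
  case (Suc c)
  then show ?case using pf.add[OF pf.one Suc] by simp
qed (rule pf.zero)

lemma pf_Suc[pf_intros]: "pf w f \<Longrightarrow> pf w (\<lambda>x y e. Suc (f x y e))"
  using pf.add[OF pf.one] by simp

lemma pf_sum[pf_intros]:
  assumes "pf w t" "pf w (\<lambda>x y e. f (e 0) x y (\<lambda>i. e (Suc i)))"
  shows "pf w (\<lambda>x y e. \<Sum>v<t x y e. f v x y e)"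
  using pf.sum[OF assms] by simp

text \<open>A product is a sum whose summand ignores the bound variable.\<close>

lemma pf_mult[pf_intros]:
  assumes "pf w f" "pf w g"
  shows "pf w (\<lambda>x y e. f x y e * g x y e)"
  using pf_sum[OF assms(1), of "\<lambda>_. g"] pf_rename[OF assms(2)] by simp

lemma pp_not[pf_intros]: "pp w P \<Longrightarrow> pp w (\<lambda>x y e. \<not> P x y e)"
  unfolding pp_def by (drule pf.monus[OF pf.one], erule pf_cong) auto

lemma pp_conj[pf_intros]: "pp w P \<Longrightarrow> pp w Q \<Longrightarrow> pp w (\<lambda>x y e. P x y e \<and> Q x y e)"
  unfolding pp_def by (drule (1) pf_mult, erule pf_cong) auto

lemma pp_disj[pf_intros]: "pp w P \<Longrightarrow> pp w Q \<Longrightarrow> pp w (\<lambda>x y e. P x y e \<or> Q x y e)"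
  by (drule pp_not, drule pp_not[of _ Q], drule (1) pp_conj, drule pp_not, erule pp_cong) auto

lemma pp_imp[pf_intros]: "pp w P \<Longrightarrow> pp w Q \<Longrightarrow> pp w (\<lambda>x y e. P x y e \<longrightarrow> Q x y e)"
  by (drule pp_not[of _ P], drule (1) pp_disj, erule pp_cong) auto

lemma pp_iff[pf_intros]: "pp w P \<Longrightarrow> pp w Q \<Longrightarrow> pp w (\<lambda>x y e. P x y e = Q x y e)"
  by (rule pp_cong[OF pp_conj[OF pp_imp[of w P Q] pp_imp[of w Q P]]]) auto

lemma pp_const[pf_intros]: "pp w (\<lambda>x y e. c)"
  unfolding pp_def by (rule pf_const)

lemma pp_less[pf_intros]: "pf w f \<Longrightarrow> pf w g \<Longrightarrow> pp w (\<lambda>x y e. f x y e < g x y e)"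
  unfolding pp_def
  by (rule pf_cong[OF pf.monus[OF pf.one pf.monus[OF pf.one pf.monus[of w g f]]]]) auto

lemma pp_le[pf_intros]: "pf w f \<Longrightarrow> pf w g \<Longrightarrow> pp w (\<lambda>x y e. f x y e \<le> g x y e)"
  by (rule pp_cong[OF pp_not[OF pp_less[of w g f]]]) auto

lemma pp_eq[pf_intros]:
  "pf w f \<Longrightarrow> pf w g \<Longrightarrow> pp w (\<lambda>x y e. f x y e = g x y e)" for f g :: "_ \<Rightarrow> _ \<Rightarrow> _ \<Rightarrow> nat"
  by (rule pp_cong[OF pp_conj[OF pp_le[of w f g] pp_le[of w g f]]]) auto

lemma pf_of_bool[pf_intros]: "pp w P \<Longrightarrow> pf w (\<lambda>x y e. of_bool (P x y e))"
  by (simp add: pp_def)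

lemma pf_if[pf_intros]:
  assumes "pp w P" "pf w f" "pf w g"
  shows "pf w (\<lambda>x y e. if P x y e then f x y e else g x y e)"
  by (rule pf_cong[OF pf.add[OF pf_mult[OF pf_of_bool[OF assms(1)] assms(2)]
      pf_mult[OF pf_of_bool[OF pp_not[OF assms(1)]] assms(3)]]]) auto

lemma pp_if[pf_intros]:
  "pp w P \<Longrightarrow> pp w Q \<Longrightarrow> pp w R \<Longrightarrow> pp w (\<lambda>x y e. if P x y e then Q x y e else R x y e)"
  by (rule pp_cong[OF pp_conj[OF pp_imp[of w P Q] pp_imp[OF pp_not[of w P], of R]]]) auto

lemma pp_ex[pf_intros]:
  assumes "pf w t" "pp w (\<lambda>x y e. P (e 0) x y (\<lambda>i. e (Suc i)))"
  shows "pp w (\<lambda>x y e. \<exists>v<t x y e. P v x y e)"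
proof -
  have "pf w (\<lambda>x y e. \<Sum>v<t x y e. of_bool (P v x y e))"
    by (rule pf_sum[OF assms(1)]) (use assms(2) in \<open>simp add: pp_def\<close>)
  from pp_less[OF pf.zero this] show ?thesis
    by (rule pp_cong) (auto simp: card_gt_0_iff)
qed

lemma pp_all[pf_intros]:
  assumes "pf w t" "pp w (\<lambda>x y e. P (e 0) x y (\<lambda>i. e (Suc i)))"
  shows "pp w (\<lambda>x y e. \<forall>v<t x y e. P v x y e)"
  by (rule pp_cong[OF pp_not[OF pp_ex[OF assms(1), where P = "\<lambda>v x y e. \<not> P v x y e", OF pp_not[OF assms(2)]]]]) auto

text \<open>Substitution is not a constructor of terms. It is obtained from a sum with a single
  relevant summand, the one where the bound variable equals \<open>t\<close>.\<close>

lemma pf_let: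
  assumes "pf w t" "pf w f"
  shows "pf w (\<lambda>x y e. f x y (case_nat (t x y e) e))"
proof -
  have "pf w (\<lambda>x y e. \<Sum>v<Suc (t x y e). of_bool (v = t x y e) * f x y (case_nat v e))"
  proof (intro pf_intros assms pf_rename[OF assms(1)])
    have "(\<lambda>e::nat \<Rightarrow> nat. case_nat (e 0) (\<lambda>i. e (Suc i))) = (\<lambda>e. e)"
      by (auto simp: fun_eq_iff split: nat.split)
    then have "(\<lambda>x y e. f x y (case_nat (e 0) (\<lambda>i. e (Suc i)))) = (\<lambda>x y e. f x y e)"
      by metis
    then show "pf w (\<lambda>x y e. f x y (case_nat (e 0) (\<lambda>i. e (Suc i))))"
      using assms(2) by simp
  qed
  then show ?thesis
    by (rule pf_cong) (simp add: of_bool_def if_distrib[of "\<lambda>z. z * _"] sum.delta)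
qed

lemma pp_let: "pf w t \<Longrightarrow> pp w P \<Longrightarrow> pp w (\<lambda>x y e. P x y (case_nat (t x y e) e))"
  unfolding pp_def by (rule pf_let)

lemma pf_div[pf_intros]:
  assumes "pf w f" "pf w g"
  shows "pf w (\<lambda>x y e. f x y e div g x y e)"
proof -
  \<comment> \<open>The quotient is the number of positive multiples of \<open>b\<close> that do not
    exceed \<open>a\<close>.\<close>
  have *: "a div b = (\<Sum>v<a. of_bool (0 < b \<and> Suc v * b \<le> a))" for a b :: nat
  proof (cases "b = 0")
    case False
    have "v < a div b" if "Suc v * b \<le> a" for v
      using False that less_eq_div_iff_mult_less_eq[of b "Suc v" a] by simp
    moreover have "Suc v * b \<le> a" if "v < a div b" for v
      using False that less_eq_div_iff_mult_less_eq[of b "Suc v" a] by simp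
    ultimately have "{v. v < a \<and> Suc v * b \<le> a} = {..<a div b}"
      by (auto simp: div_le_dividend less_le_trans)
    then show ?thesis
      using False by (simp add: of_bool_def sum.If_cases Int_def lessThan_def)
  qed simp
  have "pf w (\<lambda>x y e. \<Sum>v<f x y e. of_bool (0 < g x y e \<and> Suc v * g x y e \<le> f x y e))"
    by (intro pf_intros assms assms[THEN pf_rename])
  then show ?thesis unfolding * .
qed

lemma pf_mod[pf_intros]: "pf w f \<Longrightarrow> pf w g \<Longrightarrow> pf w (\<lambda>x y e. f x y e mod g x y e)"
  unfolding modulo_nat_def by (intro pf_intros)

lemma pf_poly[pf_intros]: "pf w t \<Longrightarrow> pf w (\<lambda>x y e. poly p (t x y e))"
  by (induction p) (auto intro!: pf_intros)

text \<open>The functions \<open>f k\<close> need not be uniform in \<open>k\<close>: for a fixed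
  \<open>N\<close> the table is a nested case distinction.\<close>

lemma pf_table:
  assumes "pf w t" "\<And>k. k < N \<Longrightarrow> pf w (f k)"
  shows "pf w (\<lambda>x y e. if t x y e < N then f (t x y e) x y e else 0)"
  using assms(2)
proof (induction N)
  case (Suc N)
  then have "pf w (\<lambda>x y e. if t x y e = N then f N x y e else if t x y e < N then f (t x y e) x y e else 0)"
    by (intro pf_if[OF pp_eq[OF assms(1) pf_const] Suc.prems[OF lessI]] Suc.IH) auto
  then show ?case by (rule pf_cong) (auto simp: less_Suc_eq)
qed (simp add: pf_const)

lemma pp_table:
  assumes "pf w t" "\<And>k. k < N \<Longrightarrow> pp w (P k)"
  shows "pp w (\<lambda>x y e. t x y e < N \<and> P (t x y e) x y e)"
  using pf_table[OF assms(1), of N "\<lambda>k x y e. of_bool (P k x y e)"] assms(2)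
  unfolding pp_def by (auto elim!: pf_cong)

section \<open>Access to the input and definable words\<close>

lemma pf_length_fst[pf_intros]: "pf w (\<lambda>x y e. length x)"
  using pf.len[of 0 w] by (simp add: word_def)

lemma pf_length_snd[pf_intros]: "pf True (\<lambda>x y e. length y)"
  using pf.len[of 1 True] by (simp add: word_def)

lemma pp_bit_fst[pf_intros]: "pf w t \<Longrightarrow> pp w (\<lambda>x y e. t x y e < length x \<and> x ! t x y e)"
  using pf.bit[of 0 w t] by (simp add: word_def pp_def)

lemma pp_bit_snd[pf_intros]: "pf True t \<Longrightarrow> pp True (\<lambda>x y e. t x y e < length y \<and> y ! t x y e)"
  using pf.bit[of 1 True t] by (simp add: word_def pp_def)

text \<open>A word is represented by its length and the predicate of its bits, with the position as
  variable 0. This is the form in which a machine prints it bit by bit.\<close>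

definition pg :: "bool \<Rightarrow> (bool list \<Rightarrow> bool list \<Rightarrow> (nat \<Rightarrow> nat) \<Rightarrow> bool list) \<Rightarrow> bool" where
  "pg w g \<longleftrightarrow> pf w (\<lambda>x y e. length (g x y e)) \<and>
     pp w (\<lambda>x y e. e 0 < length (g x y (\<lambda>i. e (Suc i))) \<and> g x y (\<lambda>i. e (Suc i)) ! e 0)"

lemma pg_length: "pg w g \<Longrightarrow> pf w (\<lambda>x y e. length (g x y e))"
  by (simp add: pg_def)

lemma pg_nth: "pg w g \<Longrightarrow> pf w t \<Longrightarrow> pp w (\<lambda>x y e. t x y e < length (g x y e) \<and> g x y e ! t x y e)"
  unfolding pg_def using pp_let[of w t] by fastforce

lemma pg_rename: "pg w g \<Longrightarrow> pg w (\<lambda>x y e. g x y (\<lambda>i. e (\<rho> i)))"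
  unfolding pg_def
  using pf_rename[of w "\<lambda>x y e. length (g x y e)" \<rho>]
    pp_rename[of w "\<lambda>x y e. e 0 < length (g x y (\<lambda>i. e (Suc i))) \<and> g x y (\<lambda>i. e (Suc i)) ! e 0"
      "case_nat 0 (\<lambda>i. Suc (\<rho> i))"] by simp

lemma pg_Nil[pf_intros]: "pg w (\<lambda>x y e. [])"
  unfolding pg_def by (simp add: pf_const pp_const)

lemma pg_single[pf_intros]: "pp w P \<Longrightarrow> pg w (\<lambda>x y e. [P x y e])"
proof -
  assume P: "pp w P"
  have "pp w (\<lambda>x y e. e 0 = 0 \<and> P x y (\<lambda>i. e (Suc i)))"
    by (intro pf_intros P[THEN pp_rename])
  then have "pp w (\<lambda>x y e. e 0 < length [P x y (\<lambda>i. e (Suc i))] \<and> [P x y (\<lambda>i. e (Suc i))] ! e 0)"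
    by (rule pp_cong) auto
  then show ?thesis unfolding pg_def by (simp add: pf_const)
qed

lemma pg_append[pf_intros]:
  assumes "pg w f" "pg w g"
  shows "pg w (\<lambda>x y e. f x y e @ g x y e)"
proof -
  note f = pg_length[OF assms(1)] and g = pg_length[OF assms(2)]
  have "pp w (\<lambda>x y e. e 0 < length (f x y (\<lambda>i. e (Suc i))) \<and> f x y (\<lambda>i. e (Suc i)) ! e 0 \<or>
      length (f x y (\<lambda>i. e (Suc i))) \<le> e 0 \<and>
      e 0 - length (f x y (\<lambda>i. e (Suc i))) < length (g x y (\<lambda>i. e (Suc i))) \<and>
      g x y (\<lambda>i. e (Suc i)) ! (e 0 - length (f x y (\<lambda>i. e (Suc i)))))"
    by (intro pp_disj pp_conj pp_le pg_nth assms[THEN pg_rename] pf.var pf.monus f[THEN pf_rename])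
  then have "pp w (\<lambda>x y e. e 0 < length (f x y (\<lambda>i. e (Suc i)) @ g x y (\<lambda>i. e (Suc i))) \<and>
      (f x y (\<lambda>i. e (Suc i)) @ g x y (\<lambda>i. e (Suc i))) ! e 0)"
    by (rule pp_cong) (auto simp: nth_append)
  then show ?thesis
    unfolding pg_def using pf.add[OF f g] by simp
qed

lemma pg_if[pf_intros]:
  assumes "pp w P" "pg w f" "pg w g"
  shows "pg w (\<lambda>x y e. if P x y e then f x y e else g x y e)"
proof -
  have "pp w (\<lambda>x y e. if P x y (\<lambda>i. e (Suc i))
      then e 0 < length (f x y (\<lambda>i. e (Suc i))) \<and> f x y (\<lambda>i. e (Suc i)) ! e 0
      else e 0 < length (g x y (\<lambda>i. e (Suc i))) \<and> g x y (\<lambda>i. e (Suc i)) ! e 0)"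
    by (intro pp_if pg_nth assms(2,3)[THEN pg_rename] assms(1)[THEN pp_rename] pf.var)
  then have "pp w (\<lambda>x y e. e 0 < length (if P x y (\<lambda>i. e (Suc i)) then f x y (\<lambda>i. e (Suc i)) else g x y (\<lambda>i. e (Suc i)))
      \<and> (if P x y (\<lambda>i. e (Suc i)) then f x y (\<lambda>i. e (Suc i)) else g x y (\<lambda>i. e (Suc i))) ! e 0)"
    by (rule pp_cong) auto
  moreover have "pf w (\<lambda>x y e. length (if P x y e then f x y e else g x y e))"
    by (rule pf_cong[OF pf_if[OF assms(1) pg_length[OF assms(2)] pg_length[OF assms(3)]]]) auto
  ultimately show ?thesis unfolding pg_def by simp
qed

text \<open>Position \<open>i\<close> is located by the block \<open>j\<close> that contains it. A
  block starts at a sum of lengths of earlier blocks, so the lookup remains definable.\<close>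

lemma nth_concat_map:
  "i < length (concat (map h [0..<t])) \<and> concat (map h [0..<t]) ! i \<longleftrightarrow>
     (\<exists>j<t. (\<Sum>k<j. length (h k)) \<le> i \<and> i - (\<Sum>k<j. length (h k)) < length (h j) \<and>
        h j ! (i - (\<Sum>k<j. length (h k))))"
proof (induction t)
  case (Suc t)
  have l: "length (concat (map h [0..<t])) = (\<Sum>k<t. length (h k))"
    by (simp add: length_concat comp_def interv_sum_list_conv_sum_set_nat atLeast0LessThan)
  have "i < length (concat (map h [0..<Suc t])) \<and> concat (map h [0..<Suc t]) ! i \<longleftrightarrow>
      (i < length (concat (map h [0..<t])) \<and> concat (map h [0..<t]) ! i) \<or>
      ((\<Sum>k<t. length (h k)) \<le> i \<and> i - (\<Sum>k<t. length (h k)) < length (h t) \<and>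
        h t ! (i - (\<Sum>k<t. length (h k))))"
    by (auto simp: nth_append l)
  then show ?case unfolding Suc by (metis less_Suc_eq)
qed simp

lemma pg_concat[pf_intros]:
  assumes t: "pf w t" and g: "pg w (\<lambda>x y e. g (e 0) x y (\<lambda>i. e (Suc i)))"
  shows "pg w (\<lambda>x y e. concat (map (\<lambda>v. g v x y e) [0..<t x y e]))"
proof -
  define S where "S j x y e = (\<Sum>k<j. length (g k x y e))" for j x y e
  have l: "pf w (\<lambda>x y e. length (g (e k) x y (\<lambda>i. e (\<rho> i))))" for k and \<rho> :: "nat \<Rightarrow> nat"
    using pf_rename[OF pg_length[OF g], of "case_nat k \<rho>"] by simp
  have S: "pf w (\<lambda>x y e. S (e k) x y (\<lambda>i. e (\<rho> i)))" for k and \<rho> :: "nat \<Rightarrow> nat"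
    unfolding S_def by (intro pf_sum pf.var l)
  have nth: "pg w (\<lambda>x y e. g (e k) x y (\<lambda>i. e (\<rho> i)))" for k and \<rho> :: "nat \<Rightarrow> nat"
    using pg_rename[OF g, of "case_nat k \<rho>"] by simp
  have "pp w (\<lambda>x y e. \<exists>j<t x y (\<lambda>i. e (Suc i)). S j x y (\<lambda>i. e (Suc i)) \<le> e 0 \<and>
      e 0 - S j x y (\<lambda>i. e (Suc i)) < length (g j x y (\<lambda>i. e (Suc i))) \<and>
      g j x y (\<lambda>i. e (Suc i)) ! (e 0 - S j x y (\<lambda>i. e (Suc i))))"
    by (intro pp_ex t[THEN pf_rename] pp_conj pp_le S pf.monus pg_nth nth pf.var)
  then have "pp w (\<lambda>x y e. e 0 < length (concat (map (\<lambda>v. g v x y (\<lambda>i. e (Suc i))) [0..<t x y (\<lambda>i. e (Suc i))]))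
      \<and> concat (map (\<lambda>v. g v x y (\<lambda>i. e (Suc i))) [0..<t x y (\<lambda>i. e (Suc i))]) ! e 0)"
    unfolding nth_concat_map S_def .
  moreover have "pf w (\<lambda>x y e. length (concat (map (\<lambda>v. g v x y e) [0..<t x y e])))"
    by (rule pf_cong[OF pf_sum[OF t pg_length[OF g]]])
      (simp add: length_concat comp_def interv_sum_list_conv_sum_set_nat atLeast0LessThan)
  ultimately show ?thesis unfolding pg_def by simp
qed

lemma pg_map[pf_intros]:
  assumes "pf w t" "pp w (\<lambda>x y e. P (e 0) x y (\<lambda>i. e (Suc i)))"
  shows "pg w (\<lambda>x y e. map (\<lambda>v. P v x y e) [0..<t x y e])"
  using pg_concat[OF assms(1), where g = "\<lambda>v x y e. [P v x y e]", OF pg_single[OF assms(2)]] by simp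

lemma pg_enc_nat[pf_intros]: "pf w t \<Longrightarrow> pg w (\<lambda>x y e. enc_nat (t x y e))"
  unfolding enc_nat_def
  using pg_append[OF pg_map[where P = "\<lambda>_ _ _ _. True", OF _ pp_const] pg_single[OF pp_const[of w False]]]
  by (simp add: map_replicate_const)

lemma enc_list_map: "enc_list f (map g xs) = enc_list (\<lambda>v. f (g v)) xs"
  by (simp add: enc_list_def comp_def)

lemma pg_enc_list[pf_intros]:
  assumes "pf w t" "pg w (\<lambda>x y e. g (e 0) x y (\<lambda>i. e (Suc i)))"
  shows "pg w (\<lambda>x y e. enc_list (\<lambda>v. g v x y e) [0..<t x y e])"
  unfolding enc_list_def using pg_append[OF pg_enc_nat[OF assms(1)] pg_concat[OF assms]] by simp

lemma word_eq_iff: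
  "length x = length z \<and> (\<forall>i<length x. (i < length x \<and> x ! i) = (i < length z \<and> z ! i)) \<longleftrightarrow> x = z"
  for x z :: "bool list"
  by (auto intro: nth_equalityI)

text \<open>Recognition by generation: the input is compared with the encoding of the structures
  that a certificate claims.\<close>

lemma pp_eq_word:
  assumes "pg w g"
  shows "pp w (\<lambda>x y e. x = g x y e)"
proof -
  have "pp w (\<lambda>x y e. length x = length (g x y e) \<and>
      (\<forall>i<length x. (i < length x \<and> x ! i) = (i < length (g x y e) \<and> g x y e ! i)))"
    by (rule pp_conj[OF pp_eq[OF pf_length_fst pg_length[OF assms]] pp_all[OF pf_length_fst]])
      (rule pp_iff[OF pp_bit_fst[OF pf.var] pg_nth[OF pg_rename[OF assms, of Suc] pf.var]])
  then show ?thesis unfolding word_eq_iff .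
qed

theorem pg_computable:
  assumes "pg False g"
  shows "polytime_computable (\<lambda>x. g x [] (\<lambda>_. 0))"
proof -
  have z: "map (\<lambda>i. 0 < (of_bool (i < length z \<and> z ! i) :: nat)) [0..<length z] = z" for z :: "bool list"
    by (rule nth_equalityI) auto
  note b = assms[unfolded pg_def pp_def, THEN conjunct2]
  show ?thesis
    using pf_computable[OF pg_length[OF assms] b] unfolding nat.case z .
qed

theorem pp_decidable:
  assumes "pp True P"
  shows "polytime_decidable2 (\<lambda>x y. P x y (\<lambda>_. 0))"
  using pf_decidable[OF assms[unfolded pp_def]] by (simp only: of_bool_def split: if_splits) simp

section \<open>Fixpoint characterisation of strategic modalities\<close>

definition agree :: "nat set \<Rightarrow> nat list \<Rightarrow> nat list \<Rightarrow> bool" where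
  "agree A \<alpha> \<beta> \<longleftrightarrow> (\<forall>a\<in>A. \<beta> ! (a - 1) = \<alpha> ! (a - 1))"

text \<open>The controllable predecessor: the coalition fixes its part of \<alpha>, and the other
  agents complete this part to an arbitrary legal \<beta>.\<close>

definition pre :: "nat \<Rightarrow> cgs \<Rightarrow> nat set \<Rightarrow> (nat \<Rightarrow> bool) \<Rightarrow> nat \<Rightarrow> bool" where
  "pre k C A X q \<longleftrightarrow> (\<exists>\<alpha>\<in>legal_tuples k C q. \<forall>\<beta>\<in>legal_tuples k C q.
     agree A \<alpha> \<beta> \<longrightarrow> X (cgs_delta C q \<beta>))"

lemma pre_mono: "pre k C A X q \<Longrightarrow> (\<And>q'. X q' \<Longrightarrow> Y q') \<Longrightarrow> pre k C A Y q"
  unfolding pre_def by blast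

lemma pre_cong:
  assumes "wf_cgs k Props C" "q < cgs_states C" "\<And>q'. q' < cgs_states C \<Longrightarrow> X q' = Y q'"
  shows "pre k C A X q = pre k C A Y q"
proof -
  have "X (cgs_delta C q \<beta>) = Y (cgs_delta C q \<beta>)" if "\<beta> \<in> legal_tuples k C q" for \<beta>
    using assms that by (auto simp: wf_cgs_def)
  then show ?thesis unfolding pre_def by (intro bex_cong ball_cong imp_cong refl)
qed

text \<open>A memoryless strategy is enough: in each state the coalition plays its part of a witness
  of \<open>pre\<close>. The target may depend on the current state, as decreasing ranks
  require.\<close>

lemma strategies_exist:
  assumes wf: "wf_cgs k Props C" and A: "A \<subseteq> {1..k}"
    and R: "\<And>q. q < cgs_states C \<Longrightarrow> pre k C A (R q) q"
  shows "\<exists>s. (\<forall>a\<in>A. strategy C a (s a)) \<and>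
    (\<forall>q<cgs_states C. \<forall>\<rho>\<in>outcomes k C A q s. \<forall>i. \<rho> i < cgs_states C \<and> R (\<rho> i) (\<rho> (Suc i)))"
proof -
  obtain f where f: "\<And>q. q < cgs_states C \<Longrightarrow> f q \<in> legal_tuples k C q \<and>
      (\<forall>\<beta>\<in>legal_tuples k C q. agree A (f q) \<beta> \<longrightarrow> R q (cgs_delta C q \<beta>))"
    using R unfolding pre_def by metis
  define s where "s a h = f (last h) ! (a - 1)" for a h
  have "strategy C a (s a)" if "a \<in> A" for a
    unfolding strategy_def
  proof (intro allI impI)
    fix h assume h: "h \<noteq> [] \<and> set h \<subseteq> {..<cgs_states C}"
    then have "last h < cgs_states C" using last_in_set by fastforce
    then have "f (last h) \<in> legal_tuples k C (last h)" using f by blast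
    then show "s a h \<in> {1..cgs_actions C (last h) a}"
      using that A by (auto simp: legal_tuples_def s_def)
  qed
  moreover have "\<rho> i < cgs_states C \<and> R (\<rho> i) (\<rho> (Suc i))"
    if q: "q < cgs_states C" and \<rho>: "\<rho> \<in> outcomes k C A q s" for q \<rho> i
  proof -
    have step: "\<rho> (Suc i) < cgs_states C \<and> R (\<rho> i) (\<rho> (Suc i))" if "\<rho> i < cgs_states C" for i
    proof -
      obtain \<beta> where \<beta>: "\<beta> \<in> legal_tuples k C (\<rho> i)" "\<forall>a\<in>A. \<beta> ! (a - 1) = s a (map \<rho> [0..<Suc i])"
        "\<rho> (Suc i) = cgs_delta C (\<rho> i) \<beta>"
        using \<rho> by (auto simp: outcomes_def)
      then have "agree A (f (\<rho> i)) \<beta>" by (simp add: agree_def s_def)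
      then show ?thesis using f[OF that] \<beta> wf that by (auto simp: wf_cgs_def)
    qed
    have "\<rho> i < cgs_states C" for i
      by (induction i) (use q \<rho> step in \<open>auto simp: outcomes_def\<close>)
    then show ?thesis using step by blast
  qed
  ultimately show ?thesis by blast
qed

text \<open>The opponents answer an arbitrary strategy, which may use the whole history. Hence the
  path is built as a growing history, and \<rho> consists of the last states.\<close>

lemma outcome_exists:
  assumes wf: "wf_cgs k Props C" and A: "A \<subseteq> {1..k}"
    and s: "\<forall>a\<in>A. strategy C a (s a)" and q: "q < cgs_states C"
    and R: "\<And>q. q < cgs_states C \<Longrightarrow> \<not> pre k C A (\<lambda>q'. \<not> R q q') q"
  shows "\<exists>\<rho>\<in>outcomes k C A q s. \<forall>i. \<rho> i < cgs_states C \<and> R (\<rho> i) (\<rho> (Suc i))"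
proof -
  define good where "good h \<longleftrightarrow> h \<noteq> [] \<and> set h \<subseteq> {..<cgs_states C}" for h
  have "\<exists>\<beta>\<in>legal_tuples k C (last h). (\<forall>a\<in>A. \<beta> ! (a - 1) = s a h) \<and>
      R (last h) (cgs_delta C (last h) \<beta>)" if h: "good h" for h
  proof -
    have l: "last h < cgs_states C" using h last_in_set unfolding good_def by fastforce
    \<comment> \<open>Action 1 is always legal. It completes the moves of \<open>A\<close> to a
      tuple for which the failure of \<open>pre\<close> provides an answer.\<close>
    define \<alpha> where "\<alpha> = map (\<lambda>i. if Suc i \<in> A then s (Suc i) h else 1) [0..<k]"
    have "\<alpha> ! (a - 1) \<in> {1..cgs_actions C (last h) a}" if a: "a \<in> {1..k}" for a
    proof -
      have "a - 1 < k" "Suc (a - 1) = a" using a by auto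
      then have "\<alpha> ! (a - 1) = (if a \<in> A then s a h else 1)" by (simp add: \<alpha>_def)
      moreover have "1 \<le> cgs_actions C (last h) a" using wf l a by (auto simp: wf_cgs_def)
      moreover have "s a h \<in> {1..cgs_actions C (last h) a}" if "a \<in> A"
        using s h that unfolding strategy_def good_def by blast
      ultimately show ?thesis by auto
    qed
    then have "\<alpha> \<in> legal_tuples k C (last h)" by (simp add: legal_tuples_def \<alpha>_def)
    with R[OF l] obtain \<beta> where "\<beta> \<in> legal_tuples k C (last h)" "agree A \<alpha> \<beta>"
      "R (last h) (cgs_delta C (last h) \<beta>)"
      unfolding pre_def by blast
    moreover have "\<alpha> ! (a - 1) = s a h" if "a \<in> A" for a
    proof -
      have "a \<in> {1..k}" using A that by blast
      then have "a - 1 < k" "Suc (a - 1) = a" by auto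
      then show ?thesis using that by (simp add: \<alpha>_def)
    qed
    ultimately show ?thesis unfolding agree_def by metis
  qed
  then obtain g where g: "\<And>h. good h \<Longrightarrow> g h \<in> legal_tuples k C (last h) \<and>
      (\<forall>a\<in>A. g h ! (a - 1) = s a h) \<and> R (last h) (cgs_delta C (last h) (g h))"
    by metis
  define nxt where "nxt h = h @ [cgs_delta C (last h) (g h)]" for h
  define hist where "hist i = (nxt ^^ i) [q]" for i
  define \<rho> where "\<rho> i = last (hist i)" for i
  have hist_Suc: "hist (Suc i) = hist i @ [cgs_delta C (last (hist i)) (g (hist i))]" for i
    by (simp add: hist_def nxt_def)
  have good: "good (hist i)" for i
  proof (induction i)
    case (Suc i)
    then have "last (hist i) < cgs_states C" using last_in_set unfolding good_def by fastforce
    then have "cgs_delta C (last (hist i)) (g (hist i)) < cgs_states C"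
      using g[OF Suc] wf unfolding wf_cgs_def by blast
    then show ?case using Suc by (simp add: hist_Suc good_def)
  qed (simp add: hist_def good_def q)
  have map: "map \<rho> [0..<Suc i] = hist i" for i
  proof (induction i)
    case (Suc i)
    have "map \<rho> [0..<Suc (Suc i)] = hist i @ [\<rho> (Suc i)]" using Suc by simp
    moreover have "\<rho> (Suc i) = cgs_delta C (last (hist i)) (g (hist i))" by (simp add: \<rho>_def hist_Suc)
    ultimately show ?case by (simp only: hist_Suc)
  qed (simp add: \<rho>_def hist_def)
  have \<rho>S: "\<rho> (Suc i) = cgs_delta C (\<rho> i) (g (hist i))" for i
    by (simp add: \<rho>_def hist_Suc)
  have "\<rho> \<in> outcomes k C A q s"
    unfolding outcomes_def
  proof (intro CollectI conjI allI)
    show "\<rho> 0 = q" by (simp add: \<rho>_def hist_def)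
    fix i
    show "\<exists>\<alpha>\<in>legal_tuples k C (\<rho> i). (\<forall>a\<in>A. \<alpha> ! (a - 1) = s a (map \<rho> [0..<Suc i])) \<and>
        \<rho> (Suc i) = cgs_delta C (\<rho> i) \<alpha>"
      using g[OF good[of i]] unfolding map \<rho>S[of i] by (auto simp: \<rho>_def)
  qed
  moreover have "\<rho> i < cgs_states C" for i
    using good[of i] last_in_set unfolding good_def \<rho>_def by fastforce
  moreover have "R (\<rho> i) (\<rho> (Suc i))" for i
    using g[OF good[of i]] by (simp add: \<rho>S) (simp add: \<rho>_def)
  ultimately show ?thesis by blast
qed

text \<open>The table \<open>v\<close> lists the truth values of a strategic formula. The ranks \<open>r\<close> witness
  that it is the least (for \<open>Future\<close>) or greatest (for \<open>Globally\<close>) fixpoint.\<close>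

definition table_ok ::
  "nat \<Rightarrow> cgs \<Rightarrow> nat set \<Rightarrow> tempop \<Rightarrow> (nat \<Rightarrow> bool) \<Rightarrow> (nat \<Rightarrow> bool) \<Rightarrow> (nat \<Rightarrow> nat) \<Rightarrow> bool" where
  "table_ok k C A t \<phi> v r \<longleftrightarrow>
     (\<forall>q<cgs_states C.
        if t = Future
        then if v q then \<phi> q \<or> pre k C A (\<lambda>q'. v q' \<and> r q' < r q) q else \<not> \<phi> q \<and> \<not> pre k C A v q
        else if v q then \<phi> q \<and> pre k C A v q else \<phi> q \<longrightarrow> \<not> pre k C A (\<lambda>q'. \<not> (\<not> v q' \<and> r q' < r q)) q)"

lemma pre_total:
  assumes "wf_cgs k Props C" "q < cgs_states C"
  shows "pre k C A (\<lambda>_. True) q"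
proof -
  have "replicate k 1 \<in> legal_tuples k C q"
    using assms by (auto simp: legal_tuples_def wf_cgs_def)
  then show ?thesis unfolding pre_def by blast
qed

lemma not_pre_False:
  assumes "wf_cgs k Props C" "q < cgs_states C"
  shows "\<not> pre k C A (\<lambda>_. False) q"
  unfolding pre_def agree_def by blast

lemma rank_descent:
  assumes "\<And>i. r (\<rho> (Suc i)) < (r (\<rho> i) :: nat)"
  shows False
proof -
  have "r (\<rho> i) + i \<le> r (\<rho> 0)" for i
  proof (induction i)
    case (Suc i)
    then show ?case using assms[of i] by linarith
  qed simp
  from this[of "Suc (r (\<rho> 0))"] show False by simp
qed

text \<open>For \<open>Future\<close>, decreasing ranks cannot avoid \<phi> forever, and outside of
  \<open>v\<close> the opponents can stay outside. \<open>Globally\<close> is dual: inside of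
  \<open>v\<close> the coalition stays inside, and outside the opponents descend along the
  ranks.\<close>

lemma table_ok_sat:
  assumes wf: "wf_cgs k Props C" and A: "A \<subseteq> {1..k}" and t: "t \<in> {Future, Globally}"
    and tab: "table_ok k C A t (\<lambda>q. sat k C q \<phi>) v r" and q: "q < cgs_states C"
  shows "sat k C q (Coop A t \<phi>) \<longleftrightarrow> v q"
proof (cases "t = Future")
  case True
  show ?thesis
  proof
    assume v: "v q"
    \<comment> \<open>The relation is trivially true where nothing has to be achieved, so there the
      strategy exists by \<open>pre_total\<close>.\<close>
    let ?R = "\<lambda>q q'. v q \<and> \<not> sat k C q \<phi> \<longrightarrow> v q' \<and> r q' < r q"
    have "pre k C A (?R q) q" if "q < cgs_states C" for q
      using tab that True pre_total[OF wf that, of A]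
      by (cases "v q \<and> \<not> sat k C q \<phi>") (auto simp: table_ok_def elim: pre_mono)
    from strategies_exist[OF wf A, of ?R, OF this] obtain s where s: "\<forall>a\<in>A. strategy C a (s a)"
      "\<And>\<rho> i. \<rho> \<in> outcomes k C A q s \<Longrightarrow> ?R (\<rho> i) (\<rho> (Suc i))"
      using q by metis
    have "\<exists>i. sat k C (\<rho> i) \<phi>" if \<rho>: "\<rho> \<in> outcomes k C A q s" for \<rho>
    proof (rule ccontr)
      assume n: "\<nexists>i. sat k C (\<rho> i) \<phi>"
      have "v (\<rho> i)" for i
        by (induction i) (use v \<rho> s(2)[OF \<rho>] n in \<open>auto simp: outcomes_def\<close>)
      then show False using rank_descent[of r \<rho>] s(2)[OF \<rho>] n by blast
    qed
    then show "sat k C q (Coop A t \<phi>)" using s(1) True by auto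
  next
    assume "sat k C q (Coop A t \<phi>)"
    then obtain s where s: "\<forall>a\<in>A. strategy C a (s a)"
      "\<And>\<rho>. \<rho> \<in> outcomes k C A q s \<Longrightarrow> \<exists>i. sat k C (\<rho> i) \<phi>"
      using True by auto
    let ?R = "\<lambda>q q'. \<not> v q \<longrightarrow> \<not> v q'"
    have "\<not> pre k C A (\<lambda>q'. \<not> ?R q q') q" if "q < cgs_states C" for q
      using tab that True not_pre_False[OF wf that, of A] by (cases "v q") (auto simp: table_ok_def)
    from outcome_exists[OF wf A s(1) q, of ?R, OF this] obtain \<rho> where
      \<rho>: "\<rho> \<in> outcomes k C A q s" "\<And>i. \<rho> i < cgs_states C" "\<And>i. ?R (\<rho> i) (\<rho> (Suc i))" by blast
    show "v q"
    proof (rule ccontr)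
      assume "\<not> v q"
      then have "\<not> v (\<rho> i)" for i
        by (induction i) (use \<rho> in \<open>auto simp: outcomes_def\<close>)
      then show False using s(2)[OF \<rho>(1)] \<rho>(2) tab True by (auto simp: table_ok_def)
    qed
  qed
next
  case False
  then have G: "t = Globally" using t by simp
  show ?thesis
  proof
    assume v: "v q"
    let ?R = "\<lambda>q q'. v q \<longrightarrow> v q'"
    have "pre k C A (?R q) q" if "q < cgs_states C" for q
      using tab that False pre_total[OF wf that, of A]
      by (cases "v q") (auto simp: table_ok_def elim: pre_mono)
    from strategies_exist[OF wf A, of ?R, OF this] obtain s where s: "\<forall>a\<in>A. strategy C a (s a)"
      "\<And>\<rho> i. \<rho> \<in> outcomes k C A q s \<Longrightarrow> \<rho> i < cgs_states C \<and> ?R (\<rho> i) (\<rho> (Suc i))"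
      using q by metis
    have "sat k C (\<rho> i) \<phi>" if \<rho>: "\<rho> \<in> outcomes k C A q s" for \<rho> i
    proof -
      have "v (\<rho> i)" by (induction i) (use v \<rho> s(2)[OF \<rho>] in \<open>auto simp: outcomes_def\<close>)
      then show ?thesis using tab False s(2)[OF \<rho>, of i] by (auto simp: table_ok_def)
    qed
    then show "sat k C q (Coop A t \<phi>)" using s(1) G by auto
  next
    assume "sat k C q (Coop A t \<phi>)"
    then obtain s where s: "\<forall>a\<in>A. strategy C a (s a)"
      "\<And>\<rho> i. \<rho> \<in> outcomes k C A q s \<Longrightarrow> sat k C (\<rho> i) \<phi>"
      using G by auto
    let ?R = "\<lambda>q q'. \<not> v q \<and> sat k C q \<phi> \<longrightarrow> \<not> v q' \<and> r q' < r q"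
    have "\<not> pre k C A (\<lambda>q'. \<not> ?R q q') q" if "q < cgs_states C" for q
      using tab that False not_pre_False[OF wf that, of A]
      by (cases "\<not> v q \<and> sat k C q \<phi>") (auto simp: table_ok_def)
    from outcome_exists[OF wf A s(1) q, of ?R, OF this] obtain \<rho> where
      \<rho>: "\<rho> \<in> outcomes k C A q s" "\<And>i. \<rho> i < cgs_states C" "\<And>i. ?R (\<rho> i) (\<rho> (Suc i))" by blast
    show "v q"
    proof (rule ccontr)
      assume "\<not> v q"
      then have "\<not> v (\<rho> i)" for i
        by (induction i) (use \<rho> s(2) in \<open>auto simp: outcomes_def\<close>)
      then show False using rank_descent[of r \<rho>] \<rho>(3) s(2)[OF \<rho>(1)] by blast
    qed
  qed
qed

text \<open>A longest list in which every entry is justified by earlier entries is closed, since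
  otherwise it could be extended. Positions in the list serve as ranks, and the list is distinct,
  which bounds them by the number of states.\<close>

lemma ranked_closure:
  fixes X :: "nat \<Rightarrow> bool" and G :: "(nat \<Rightarrow> bool) \<Rightarrow> nat \<Rightarrow> bool"
  assumes mono: "\<And>Y Z q. G Y q \<Longrightarrow> (\<And>q'. Y q' \<Longrightarrow> Z q') \<Longrightarrow> G Z q"
  shows "\<exists>Y r. (\<forall>q. r q < Suc S) \<and> (\<forall>q<S. X q \<or> G Y q \<longrightarrow> Y q) \<and>
    (\<forall>q. Y q \<longrightarrow> q < S \<and> (X q \<or> G (\<lambda>q'. Y q' \<and> r q' < r q) q))"
proof -
  define ok where "ok ys \<longleftrightarrow> distinct ys \<and> set ys \<subseteq> {..<S} \<and>
    (\<forall>i<length ys. X (ys ! i) \<or> G (\<lambda>q. q \<in> set (take i ys)) (ys ! i))" for ys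
  have len: "length ys \<le> S" if "ok ys" for ys
    using that card_mono[of "{..<S}" "set ys"] by (simp add: ok_def distinct_card)
  have "ok []" by (simp add: ok_def)
  then obtain ys where ys: "ok ys" "\<And>zs. ok zs \<Longrightarrow> length zs \<le> length ys"
    using ex_has_greatest_nat[of ok "[]" length "Suc S"] len by (metis le_imp_less_Suc)
  define Y where "Y q \<longleftrightarrow> q \<in> set ys" for q
  \<comment> \<open>The default 0 outside of \<open>Y\<close> keeps all ranks below the
    bound.\<close>
  define r where "r q = (if Y q then LEAST i. i < length ys \<and> ys ! i = q else 0)" for q
  have r: "r (ys ! i) = i" if "i < length ys" for i
    unfolding r_def Y_def using that ys(1)
    by (auto simp: ok_def nth_eq_iff_index_eq intro!: Least_equality)
  have "X q \<or> G Y q \<longrightarrow> Y q" if "q < S" for q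
  proof (rule impI, rule ccontr)
    assume q: "X q \<or> G Y q" "\<not> Y q"
    then have "ok (ys @ [q])"
      using ys(1) that by (auto simp: ok_def nth_append less_Suc_eq Y_def[abs_def])
    then show False using ys(2) by fastforce
  qed
  moreover have "q < S \<and> (X q \<or> G (\<lambda>q'. Y q' \<and> r q' < r q) q)" if Y: "Y q" for q
  proof -
    obtain i where i: "i < length ys" "q = ys ! i"
      using Y unfolding Y_def in_set_conv_nth by blast
    have "X q \<or> G (\<lambda>q. q \<in> set (take i ys)) q"
      using i(1) ys(1) unfolding ok_def i(2) by blast
    moreover have below: "Y q' \<and> r q' < r q" if q': "q' \<in> set (take i ys)" for q'
    proof -
      obtain l where l: "l < i" "q' = ys ! l"
        using q' i(1) by (metis in_set_conv_nth length_take min.absorb4 nth_take)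
      then show ?thesis using r[of l] r[of i] i by (simp add: Y_def)
    qed
    ultimately have "X q \<or> G (\<lambda>q'. Y q' \<and> r q' < r q) q"
      using mono[of "\<lambda>q. q \<in> set (take i ys)" q "\<lambda>q'. Y q' \<and> r q' < r q"] by blast
    moreover have "q < S" using ys(1) Y unfolding ok_def Y_def by blast
    ultimately show ?thesis by blast
  qed
  moreover have "r q < Suc S" for q
  proof (cases "Y q")
    case True
    then obtain i where "i < length ys" "q = ys ! i" unfolding Y_def in_set_conv_nth by blast
    then show ?thesis using r len[OF ys(1)] by simp
  qed (simp add: r_def)
  ultimately show ?thesis by blast
qed

lemma table_ok_exists:
  assumes wf: "wf_cgs k Props C" and A: "A \<subseteq> {1..k}" and t: "t \<in> {Future, Globally}"
  shows "\<exists>r. (\<forall>q. r q < Suc (cgs_states C)) \<and>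
    table_ok k C A t (\<lambda>q. sat k C q \<phi>) (\<lambda>q. sat k C q (Coop A t \<phi>)) r"
proof -
  have "\<exists>v r. (\<forall>q. r q < Suc (cgs_states C)) \<and> table_ok k C A t (\<lambda>q. sat k C q \<phi>) v r"
  proof (cases "t = Future")
    case True
    have "\<exists>Y r. (\<forall>q. r q < Suc (cgs_states C)) \<and>
      (\<forall>q<cgs_states C. sat k C q \<phi> \<or> pre k C A Y q \<longrightarrow> Y q) \<and>
      (\<forall>q. Y q \<longrightarrow> q < cgs_states C \<and> (sat k C q \<phi> \<or> pre k C A (\<lambda>q'. Y q' \<and> r q' < r q) q))"
      by (rule ranked_closure) (erule pre_mono, blast)
    then obtain Y r where h: "\<forall>q. r q < Suc (cgs_states C)"
      "\<forall>q<cgs_states C. sat k C q \<phi> \<or> pre k C A Y q \<longrightarrow> Y q"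
      "\<forall>q. Y q \<longrightarrow> q < cgs_states C \<and> (sat k C q \<phi> \<or> pre k C A (\<lambda>q'. Y q' \<and> r q' < r q) q)"
      by blast
    have "table_ok k C A t (\<lambda>q. sat k C q \<phi>) Y r"
      unfolding table_ok_def
    proof (intro allI impI)
      fix q assume q: "q < cgs_states C"
      note ab = h(2)[THEN spec, THEN mp, OF q] h(3)[rule_format, of q]
      show "if t = Future
        then if Y q then sat k C q \<phi> \<or> pre k C A (\<lambda>q'. Y q' \<and> r q' < r q) q else \<not> sat k C q \<phi> \<and> \<not> pre k C A Y q
        else if Y q then sat k C q \<phi> \<and> pre k C A Y q
          else sat k C q \<phi> \<longrightarrow> \<not> pre k C A (\<lambda>q'. \<not> (\<not> Y q' \<and> r q' < r q)) q"
        unfolding if_P[OF True] using ab by (cases "Y q") simp_all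
    qed
    then show ?thesis using h(1) by blast
  next
    case False
    \<comment> \<open>The complement of a greatest fixpoint is a least fixpoint of the dual operator
      \<open>G\<close>, so the closure lemma is applied to the states where the formula
      fails.\<close>
    define G where "G Y q \<longleftrightarrow> \<not> pre k C A (\<lambda>q. \<not> Y q) q" for Y q
    have "G Z q" if "G Y q" "\<And>q'. Y q' \<Longrightarrow> Z q'" for Y Z q
      using that(1) pre_mono[of k C A "\<lambda>q. \<not> Z q" q "\<lambda>q. \<not> Y q"] that(2) unfolding G_def by blast
    then obtain Y r where h: "\<forall>q. r q < Suc (cgs_states C)"
      "\<forall>q<cgs_states C. \<not> sat k C q \<phi> \<or> G Y q \<longrightarrow> Y q"
      "\<forall>q. Y q \<longrightarrow> q < cgs_states C \<and> (\<not> sat k C q \<phi> \<or> G (\<lambda>q'. Y q' \<and> r q' < r q) q)"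
      using ranked_closure[of G "cgs_states C" "\<lambda>q. \<not> sat k C q \<phi>"] by blast
    have "table_ok k C A t (\<lambda>q. sat k C q \<phi>) (\<lambda>q. \<not> Y q) r"
      unfolding table_ok_def not_not
    proof (intro allI impI)
      fix q assume q: "q < cgs_states C"
      note ab = h(2)[THEN spec, THEN mp, OF q] h(3)[rule_format, of q]
      show "if t = Future
        then if \<not> Y q then sat k C q \<phi> \<or> pre k C A (\<lambda>q'. \<not> Y q' \<and> r q' < r q) q
          else \<not> sat k C q \<phi> \<and> \<not> pre k C A (\<lambda>q. \<not> Y q) q
        else if \<not> Y q then sat k C q \<phi> \<and> pre k C A (\<lambda>q. \<not> Y q) q
          else sat k C q \<phi> \<longrightarrow> \<not> pre k C A (\<lambda>q'. \<not> (Y q' \<and> r q' < r q)) q"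
        unfolding if_not_P[OF False] using ab by (cases "Y q") (simp_all add: G_def)
    qed
    then show ?thesis using h(1) by blast
  qed
  then obtain v r where vr: "\<forall>q. r q < Suc (cgs_states C)" "table_ok k C A t (\<lambda>q. sat k C q \<phi>) v r" by blast
  \<comment> \<open>By uniqueness the table found is the satisfaction table on all states of the
    structure, and \<open>pre\<close> looks at no others.\<close>
  have eq: "sat k C q (Coop A t \<phi>) = v q" if "q < cgs_states C" for q
    by (rule table_ok_sat[OF wf A t vr(2) that])
  have "table_ok k C A t (\<lambda>q. sat k C q \<phi>) (\<lambda>q. sat k C q (Coop A t \<phi>)) r"
    unfolding table_ok_def
  proof (intro allI impI)
    fix q assume q: "q < cgs_states C"
    have c: "pre k C A (\<lambda>q'. sat k C q' (Coop A t \<phi>) \<and> r q' < r q) q = pre k C A (\<lambda>q'. v q' \<and> r q' < r q) q"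
      "pre k C A (\<lambda>q'. sat k C q' (Coop A t \<phi>)) q = pre k C A v q"
      "pre k C A (\<lambda>q'. \<not> (\<not> sat k C q' (Coop A t \<phi>) \<and> r q' < r q)) q =
        pre k C A (\<lambda>q'. \<not> (\<not> v q' \<and> r q' < r q)) q"
      by (rule pre_cong[OF wf q]; simp only: eq)+
    show "if t = Future
      then if sat k C q (Coop A t \<phi>) then sat k C q \<phi> \<or> pre k C A (\<lambda>q'. sat k C q' (Coop A t \<phi>) \<and> r q' < r q) q
        else \<not> sat k C q \<phi> \<and> \<not> pre k C A (\<lambda>q. sat k C q (Coop A t \<phi>)) q
      else if sat k C q (Coop A t \<phi>) then sat k C q \<phi> \<and> pre k C A (\<lambda>q. sat k C q (Coop A t \<phi>)) q
        else sat k C q \<phi> \<longrightarrow> \<not> pre k C A (\<lambda>q'. \<not> (\<not> sat k C q' (Coop A t \<phi>) \<and> r q' < r q)) q"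
      unfolding c eq[OF q] by (rule vr(2)[unfolded table_ok_def, THEN spec, THEN mp, OF q])
  qed
  then show ?thesis using vr(1) by blast
qed

section \<open>Owned structures\<close>

text \<open>Every state belongs to one of the two agents. Its owner may stay, move along an edge, or
  choose the last action, which hands the choice of an arbitrary successor to the other agent.
  Jointly the agents can therefore reach every state in one step, whereas a single agent only
  controls the edges of its own states.\<close>

definition owned_cgs ::
  "nat \<Rightarrow> (nat \<Rightarrow> nat) \<Rightarrow> (nat \<Rightarrow> nat \<Rightarrow> bool) \<Rightarrow> (nat \<Rightarrow> bool) \<Rightarrow> nat \<Rightarrow> cgs" where
  "owned_cgs S own ed lab q0 =
     \<lparr>cgs_states = S, cgs_init = {q0}, cgs_label = (\<lambda>q. if lab q then {0} else {}),
      cgs_actions = (\<lambda>q a. if a = own q then Suc S else S),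
      cgs_delta = (\<lambda>q \<alpha>. let a = \<alpha> ! (own q - 1); b = \<alpha> ! (2 - own q) in
        if a \<le> S then if ed q (a - 1) then a - 1 else q else b - 1)\<rparr>"

text \<open>After an edge the other agent is in charge or there is no further edge. So no agent can
  take two edges in a row, which keeps all fixpoints one step deep.\<close>

definition owned :: "nat \<Rightarrow> (nat \<Rightarrow> nat) \<Rightarrow> (nat \<Rightarrow> nat \<Rightarrow> bool) \<Rightarrow> bool" where
  "owned S own ed \<longleftrightarrow> (\<forall>q. own q \<in> {1, 2}) \<and>
     (\<forall>q<S. \<forall>q'. ed q q' \<longrightarrow> q' < S \<and> (own q' \<noteq> own q \<or> (\<forall>q''. \<not> ed q' q'')))"

text \<open>The closed form of a strategic modality. The owner of a state may always stay, so
  coalitions without the owner gain nothing for \<open>Future\<close>, and an owner alone gains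
  exactly its edges.\<close>

definition modal ::
  "nat \<Rightarrow> (nat \<Rightarrow> nat) \<Rightarrow> (nat \<Rightarrow> nat \<Rightarrow> bool) \<Rightarrow> nat set \<Rightarrow> tempop \<Rightarrow> (nat \<Rightarrow> bool) \<Rightarrow> nat \<Rightarrow> bool" where
  "modal S own ed A t X q \<longleftrightarrow>
     (if t = Future
      then if A = {1, 2} then \<exists>q'<S. X q'
        else X q \<or> A = {own q} \<and> (\<exists>q'. ed q q' \<and> X q')
      else if A = {} then \<forall>q'<S. X q'
        else X q \<and> (A = {3 - own q} \<longrightarrow> (\<forall>q'. ed q q' \<longrightarrow> X q')))"

section \<open>Moves and forcing in owned structures\<close>

definition owned_move :: "nat \<Rightarrow> (nat \<Rightarrow> nat \<Rightarrow> bool) \<Rightarrow> nat \<Rightarrow> nat \<Rightarrow> nat \<Rightarrow> nat" where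
  "owned_move S ed q a b = (if a \<le> S then if ed q (a - 1) then a - 1 else q else b - 1)"

definition owner_first :: "nat \<Rightarrow> nat \<Rightarrow> nat \<Rightarrow> nat list" where
  "owner_first ow a b = (if ow = 1 then [a, b] else [b, a])"

lemma legal_tuples_two:
  "legal_tuples 2 C q = {\<alpha>. \<exists>a\<in>{1..cgs_actions C q 1}. \<exists>b\<in>{1..cgs_actions C q 2}. \<alpha> = [a, b]}"
proof -
  have two: "{1..2} = {1::nat, 2}" by auto
  have "length \<alpha> = 2 \<longleftrightarrow> (\<exists>a b. \<alpha> = [a, b])" for \<alpha> :: "nat list"
    by (auto simp: length_Suc_conv numeral_2_eq_2)
  note len = this
  show ?thesis
    unfolding legal_tuples_def two
  proof (intro Collect_cong)
    fix \<alpha>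
    show "length \<alpha> = 2 \<and> (\<forall>a\<in>{1, 2}. \<alpha> ! (a - 1) \<in> {1..cgs_actions C q a}) \<longleftrightarrow>
        (\<exists>a\<in>{1..cgs_actions C q 1}. \<exists>b\<in>{1..cgs_actions C q 2}. \<alpha> = [a, b])"
    proof (cases "length \<alpha> = 2")
      case True
      then obtain a b where "\<alpha> = [a, b]" using len by blast
      then show ?thesis by simp
    next
      case False
      then show ?thesis using len by auto
    qed
  qed
qed

lemma owned_legal_tuples:
  assumes "own q \<in> {1, 2}"
  shows "legal_tuples 2 (owned_cgs S own ed lab q0) q =
    (\<lambda>(a, b). owner_first (own q) a b) ` ({1..Suc S} \<times> {1..S})"
  using assms by (auto simp: legal_tuples_two owned_cgs_def owner_first_def image_iff)

lemma owned_delta: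
  assumes "own q \<in> {1, 2}"
  shows "cgs_delta (owned_cgs S own ed lab q0) q (owner_first (own q) a b) = owned_move S ed q a b"
  using assms by (auto simp: owned_cgs_def owner_first_def owned_move_def Let_def)

lemma owned_move_less:
  assumes "owned S own ed" "q < S" "a \<in> {1..Suc S}" "b \<in> {1..S}"
  shows "owned_move S ed q a b < S"
proof -
  have "ed q (a - 1) \<Longrightarrow> a - 1 < S" using assms(1,2) unfolding owned_def by blast
  then show ?thesis using assms(2-4) unfolding owned_move_def by auto
qed

lemma wf_owned_cgs:
  assumes own: "owned S own ed" and q0: "q0 < S"
  shows "wf_cgs 2 {..<1} (owned_cgs S own ed lab q0)"
proof -
  have "own q \<in> {1, 2}" for q using own unfolding owned_def by blast
  then have "cgs_delta (owned_cgs S own ed lab q0) q \<alpha> < S"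
    if "q < S" "\<alpha> \<in> legal_tuples 2 (owned_cgs S own ed lab q0) q" for q \<alpha>
    using that owned_legal_tuples[of own q] owned_delta[of own q] owned_move_less[OF own that(1)] by auto
  then show ?thesis
    using q0 by (auto simp: wf_cgs_def) (auto simp: owned_cgs_def split: if_splits)
qed

lemma owned_pre:
  assumes own: "owned S own ed" and q: "q < S"
  shows "pre 2 (owned_cgs S own ed lab q0) A X q \<longleftrightarrow>
    (\<exists>a\<in>{1..Suc S}. \<exists>b\<in>{1..S}. \<forall>a'\<in>{1..Suc S}. \<forall>b'\<in>{1..S}.
      agree A (owner_first (own q) a b) (owner_first (own q) a' b') \<longrightarrow> X (owned_move S ed q a' b'))"
proof -
  have o: "own q \<in> {1, 2}" using own unfolding owned_def by blast
  show ?thesis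
    unfolding pre_def owned_legal_tuples[of own, OF o]
    by (simp add: owned_delta[of own, OF o] split_beta del: atLeastAtMost_iff)
qed

lemma owner_first_agree:
  assumes "ow \<in> {1, 2}"
  shows "agree {ow} (owner_first ow a b) (owner_first ow a' b') \<longleftrightarrow> a' = a"
    and "agree {3 - ow} (owner_first ow a b) (owner_first ow a' b') \<longleftrightarrow> b' = b"
    and "agree {1, 2} (owner_first ow a b) (owner_first ow a' b') \<longleftrightarrow> a' = a \<and> b' = b"
    and "agree {} (owner_first ow a b) (owner_first ow a' b')"
  using assms by (auto simp: agree_def owner_first_def)

text \<open>If the owner alone hands over, the other agent may answer with \<open>q\<close> itself,
  and a lone opponent can always answer in this way. So handing over only matters for the coalition
  of both agents and the empty one.\<close>

lemma owned_pre_cases: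
  assumes own: "owned S own ed" and q: "q < S" and C_def: "C = owned_cgs S own ed lab q0"
  shows "pre 2 C {own q} X q \<longleftrightarrow> X q \<or> (\<exists>q'. ed q q' \<and> X q')"
    and "pre 2 C {3 - own q} X q \<longleftrightarrow> X q \<and> (\<forall>q'. ed q q' \<longrightarrow> X q')"
    and "pre 2 C {1, 2} X q \<longleftrightarrow> (\<exists>q'<S. X q')"
    and "pre 2 C {} X q \<longleftrightarrow> (\<forall>q'<S. X q')"
proof -
  have o: "own q \<in> {1, 2}" using own unfolding owned_def by blast
  note p = owned_pre[OF own q, of lab q0, folded C_def] and ag = owner_first_agree[OF o]
  have stay: "owned_move S ed q (Suc q) b = q" for b
    using q by (simp add: owned_move_def)
  have go: "owned_move S ed q (Suc q') b = q'" "q' < S" if "ed q q'" for q' b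
  proof -
    show "q' < S" using that own q unfolding owned_def by blast
    then show "owned_move S ed q (Suc q') b = q'" using that by (simp add: owned_move_def)
  qed
  have joint: "owned_move S ed q (Suc S) (Suc q') = q'" for q'
    by (simp add: owned_move_def)
  have mv: "owned_move S ed q a b = q \<or> ed q (owned_move S ed q a b) \<or> a = Suc S \<and> owned_move S ed q a b = b - 1"
    if "a \<in> {1..Suc S}" for a b
    using that by (auto simp: owned_move_def)
  have S: "Suc q \<in> {1..Suc S}" "Suc q \<in> {1..S}" using q by auto
  have go': "Suc q' \<in> {1..Suc S}" if "ed q q'" for q' using go(2)[OF that] by auto
  have less: "owned_move S ed q a b < S" if "a \<in> {1..Suc S}" "b \<in> {1..S}" for a b
    by (rule owned_move_less[OF own q that])
  show "pre 2 C {own q} X q \<longleftrightarrow> X q \<or> (\<exists>q'. ed q q' \<and> X q')"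
  proof
    assume "pre 2 C {own q} X q"
    then obtain a where a: "a \<in> {1..Suc S}" "\<And>b. b \<in> {1..S} \<Longrightarrow> X (owned_move S ed q a b)"
      unfolding p ag by blast
    show "X q \<or> (\<exists>q'. ed q q' \<and> X q')"
      using mv[OF a(1), of "Suc q"] a(2)[OF S(2)] by auto
  next
    assume "X q \<or> (\<exists>q'. ed q q' \<and> X q')"
    then have "\<exists>a\<in>{1..Suc S}. \<forall>b. X (owned_move S ed q a b)"
    proof
      assume "X q"
      then show ?thesis using stay by (intro bexI[OF _ S(1)]) simp
    next
      assume "\<exists>q'. ed q q' \<and> X q'"
      then obtain q' where "ed q q'" "X q'" by blast
      then show ?thesis using go(1) by (intro bexI[OF _ go'[of q']]) auto
    qed
    then show "pre 2 C {own q} X q" unfolding p ag using S(2) by blast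
  qed
  show "pre 2 C {3 - own q} X q \<longleftrightarrow> X q \<and> (\<forall>q'. ed q q' \<longrightarrow> X q')"
  proof
    assume "pre 2 C {3 - own q} X q"
    then obtain b where b: "b \<in> {1..S}" "\<And>a. a \<in> {1..Suc S} \<Longrightarrow> X (owned_move S ed q a b)"
      unfolding p ag by blast
    show "X q \<and> (\<forall>q'. ed q q' \<longrightarrow> X q')"
    proof (intro conjI allI impI)
      show "X q" using b(2)[OF S(1)] unfolding stay .
      show "X q'" if "ed q q'" for q' using b(2)[OF go'[OF that]] unfolding go(1)[OF that] .
    qed
  next
    assume r: "X q \<and> (\<forall>q'. ed q q' \<longrightarrow> X q')"
    have "X (owned_move S ed q a (Suc q))" if "a \<in> {1..Suc S}" for a
      using mv[OF that, of "Suc q"] r by auto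
    then show "pre 2 C {3 - own q} X q" unfolding p ag using S by blast
  qed
  show "pre 2 C {1, 2} X q \<longleftrightarrow> (\<exists>q'<S. X q')"
  proof
    assume "\<exists>q'<S. X q'"
    then obtain q' where q': "q' < S" "X q'" by blast
    show "pre 2 C {1, 2} X q"
      unfolding p ag using q' joint[of q'] by (intro bexI[of _ "Suc S"] bexI[of _ "Suc q'"]) auto
  next
    assume "pre 2 C {1, 2} X q"
    then obtain a b where ab: "a \<in> {1..Suc S}" "b \<in> {1..S}"
      "\<And>a' b'. a' \<in> {1..Suc S} \<Longrightarrow> b' \<in> {1..S} \<Longrightarrow> a' = a \<and> b' = b \<Longrightarrow> X (owned_move S ed q a' b')"
      unfolding p ag by blast
    then have "X (owned_move S ed q a b)" by blast
    then show "\<exists>q'<S. X q'" using less[OF ab(1,2)] by blast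
  qed
  show "pre 2 C {} X q \<longleftrightarrow> (\<forall>q'<S. X q')"
  proof
    assume r: "pre 2 C {} X q"
    show "\<forall>q'<S. X q'"
    proof (intro allI impI)
      fix q' assume "q' < S"
      then have "Suc q' \<in> {1..S}" "Suc S \<in> {1..Suc S}" by auto
      then show "X q'" using r joint[of q'] ag(4) unfolding p by metis
    qed
  next
    assume "\<forall>q'<S. X q'"
    then have "\<forall>a'\<in>{1..Suc S}. \<forall>b'\<in>{1..S}. X (owned_move S ed q a' b')" using less by blast
    then show "pre 2 C {} X q" unfolding p using S by blast
  qed
qed

lemma subset_two:
  fixes A :: "nat set"
  assumes "A \<subseteq> {1..2}" "ow \<in> {1, 2}"
  shows "A \<in> {{}, {1, 2}, {ow}, {3 - ow}}"
proof -
  have "{1..2} = {1::nat, 2}" by auto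
  then have "A \<in> Pow {1, 2}" using assms(1) by simp
  then have "A \<in> {{}, {2}, {1}, {1, 2}}"
    by (simp only: Pow_insert Pow_empty image_insert image_empty Un_insert_left Un_empty_left
        Un_insert_right Un_empty_right insert_commute)
  then have "A = {} \<or> A = {1} \<or> A = {2} \<or> A = {1, 2}" by blast
  moreover have "ow = 1 \<or> ow = 2" using assms(2) by simp
  ultimately show ?thesis by fastforce
qed

lemma owner_sets:
  fixes x y :: nat
  assumes "x \<in> {1, 2}" "y \<in> {1, 2}"
  shows "({x} = {y}) = (y = x)" "({x} = {3 - y}) = (y \<noteq> x)" "({3 - x} = {y}) = (y \<noteq> x)"
    "({3 - x} = {3 - y}) = (y = x)"
  using assms by (elim insertE emptyE; simp)+

lemma owned_sat:
  assumes own: "owned S own ed" and q0: "q0 < S" and A: "A \<subseteq> {1..2}" and t: "t \<in> {Future, Globally}"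
    and q: "q < S" and C_def: "C = owned_cgs S own ed lab q0"
  shows "sat 2 C q (Coop A t \<phi>) \<longleftrightarrow> modal S own ed A t (\<lambda>q. sat 2 C q \<phi>) q"
proof -
  define X where "X = (\<lambda>q. sat 2 C q \<phi>)"
  define v where "v = modal S own ed A t X"
  \<comment> \<open>A single edge is the longest way to a decision. Rank 0 marks the states that
    settle the modality at once, rank 1 all others.\<close>
  define r :: "nat \<Rightarrow> nat" where "r q = (if (t = Future) = X q then 0 else 1)" for q
  have "table_ok 2 C A t X v r"
    unfolding table_ok_def
  proof (intro allI impI)
    fix q assume "q < cgs_states C"
    then have q: "q < S" by (simp add: C_def owned_cgs_def)
    have o: "own q \<in> {1, 2}" for q using own unfolding owned_def by blast
    have e: "q' < S" "own q' \<noteq> own q \<or> (\<forall>q''. \<not> ed q' q'')" if "ed q q'" for q'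
      using own q that unfolding owned_def by blast+
    have other: "own q' = 3 - own q \<longleftrightarrow> own q' \<noteq> own q" "3 - own q \<noteq> own q" for q'
      using o[of q] o[of q'] by auto
    have ne: "{1, 2} \<noteq> {own q'}" "{1, 2} \<noteq> {3 - own q'}" for q' using o[of q'] by auto
    have m: "v q' = (if t = Future
        then if A = {1, 2} then \<exists>q'<S. X q' else X q' \<or> A = {own q'} \<and> (\<exists>q''. ed q' q'' \<and> X q'')
        else if A = {} then \<forall>q'<S. X q' else X q' \<and> (A = {3 - own q'} \<longrightarrow> (\<forall>q''. ed q' q'' \<longrightarrow> X q'')))" for q'
      by (simp add: v_def modal_def)
    note p = owned_pre_cases[OF own q C_def]
    note p = p(1,2) p(3)[unfolded One_nat_def] p(4)
    consider "A = {}" | "A = {1, 2}" | "A = {own q}" | "A = {3 - own q}"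
      using subset_two[OF A o[of q]] by blast
    then show "if t = Future
      then if v q then X q \<or> pre 2 C A (\<lambda>q'. v q' \<and> r q' < r q) q else \<not> X q \<and> \<not> pre 2 C A v q
      else if v q then X q \<and> pre 2 C A v q else X q \<longrightarrow> \<not> pre 2 C A (\<lambda>q'. \<not> (\<not> v q' \<and> r q' < r q)) q"
    proof cases
      case 1
      have "v q' = (if t = Future then X q' else \<forall>q'<S. X q')" for q' using 1 m by simp
      then show ?thesis using t q p(4) 1 by (auto simp: r_def)
    next
      case 2
      have "v q' = (if t = Future then \<exists>q'<S. X q' else X q')" for q'
        unfolding m[of q'] 2 by (simp only: ne simp_thms refl if_True if_False insert_not_empty)
      then show ?thesis using t q p(3) 2 by (auto simp: r_def)
    next
      case 3
      have v: "v q' = (if t = Future then X q' \<or> own q' = own q \<and> (\<exists>q''. ed q' q'' \<and> X q'')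
          else X q' \<and> (own q' \<noteq> own q \<longrightarrow> (\<forall>q''. ed q' q'' \<longrightarrow> X q'')))" for q'
      proof -
        have "{own q} \<noteq> {1, 2}" using ne(1)[of q] by (rule not_sym)
        then show ?thesis
          unfolding m[of q'] 3 by (simp only: owner_sets[OF o[of q] o[of q']] if_False insert_not_empty simp_thms)
      qed
      show ?thesis using t e unfolding 3 p(1) v r_def by auto
    next
      case 4
      have v: "v q' = (if t = Future then X q' \<or> own q' \<noteq> own q \<and> (\<exists>q''. ed q' q'' \<and> X q'')
          else X q' \<and> (own q' = own q \<longrightarrow> (\<forall>q''. ed q' q'' \<longrightarrow> X q'')))" for q'
      proof -
        have "{3 - own q} \<noteq> {1, 2}" using ne(2)[of q] by (rule not_sym)
        then show ?thesis
          unfolding m[of q'] 4 by (simp only: owner_sets[OF o[of q] o[of q']] if_False insert_not_empty simp_thms)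
      qed
      show ?thesis using t e unfolding 4 p(2) v r_def by auto
    qed
  qed
  then have tab: "table_ok 2 C A t (\<lambda>q. sat 2 C q \<phi>) v r" unfolding X_def .
  have wf: "wf_cgs 2 {..<1} C" unfolding C_def by (rule wf_owned_cgs[OF own q0])
  have "q < cgs_states C" using q by (simp add: C_def owned_cgs_def)
  from table_ok_sat[OF wf A t tab this] show ?thesis unfolding v_def X_def .
qed

section \<open>A levelled structure that forces long formulas\<close>

text \<open>States 0 and 1 are sinks without and with the proposition. All other states are addressed by
  a level, a rail and a side. The two sides are twins which only differ in the sink below
  level 0, so that telling apart their top states takes as many modalities as there are levels.
  The modality that has to be applied at time \<open>i\<close> in order to propagate this difference to
  level \<open>i\<close> is a diamond or a box of the owner of level \<open>i\<close>. It is a matter of free choice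
  on the first of every block of 12 levels, and it is dictated on all others.\<close>

definition gst :: "nat \<Rightarrow> nat \<Rightarrow> nat \<Rightarrow> nat" where
  "gst i r sd = 2 + 4 * i + 2 * r + sd"

definition lev :: "nat \<Rightarrow> nat" where "lev q = (q - 2) div 4"
definition rail :: "nat \<Rightarrow> nat" where "rail q = (q - 2) div 2 mod 2"
definition side :: "nat \<Rightarrow> nat" where "side q = (q - 2) mod 2"

lemma gst_simps:
  assumes "r < 2" "sd < 2"
  shows "lev (gst i r sd) = i" "rail (gst i r sd) = r" "side (gst i r sd) = sd" "2 \<le> gst i r sd"
proof -
  define u where "u = sd + (2 * i + r) * 2"
  have u: "gst i r sd - 2 = u" by (simp add: gst_def u_def)
  have "u mod 2 = sd" unfolding u_def mod_mult_self1 using assms(2) by simp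
  moreover have "u div 2 = 2 * i + r" by (rule div_nat_eqI) (use assms in \<open>simp_all add: u_def\<close>)
  moreover have "u div 4 = i" by (rule div_nat_eqI) (use assms in \<open>simp_all add: u_def\<close>)
  ultimately show "lev (gst i r sd) = i" "rail (gst i r sd) = r" "side (gst i r sd) = sd"
    using assms(1) by (simp_all add: lev_def rail_def side_def u)
qed (simp add: gst_def)

lemma gst_cases:
  assumes "2 \<le> q"
  shows "q = gst (lev q) (rail q) (side q)" "rail q < 2" "side q < 2"
proof -
  define u where "u = q - 2"
  have "u = 2 * (u div 2) + u mod 2" "u div 2 = 2 * (u div 2 div 2) + u div 2 mod 2"
    by simp_all
  moreover have "u div 4 = u div 2 div 2" by (simp add: div_mult2_eq[symmetric])
  ultimately have "u = 4 * (u div 4) + 2 * (u div 2 mod 2) + u mod 2" by linarith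
  then show "q = gst (lev q) (rail q) (side q)"
    using assms unfolding gst_def lev_def rail_def side_def u_def[symmetric] by (simp add: u_def)
qed (auto simp: rail_def side_def)

text \<open>The sink seen by the states of a level, 2 standing for none.\<close>

definition sink :: "nat \<Rightarrow> nat \<Rightarrow> nat" where
  "sink k r = (if k = 0 then r else if k = 2 then 2 else if k = 3 \<or> k = 4 \<or> k = 10 \<or> k = 11 then 1 else 0)"

text \<open>Labels and sinks are tuned together: a level has to be false when its diamond is due and
  true when its box is due (\<open>tab_diag\<close>), and a block has to restore the initial values
  (\<open>tab_period\<close>).\<close>

definition lab0 :: "nat \<Rightarrow> nat \<Rightarrow> bool" where
  "lab0 k r \<longleftrightarrow> k = 0 \<and> r = 1 \<or> k = 2 \<or> k = 3 \<or> k = 4"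

definition lown :: "nat \<Rightarrow> nat" where "lown i = (if even i then 1 else 2)"
definition gown :: "nat \<Rightarrow> nat" where "gown q = (if 2 \<le> q then lown (lev q) else 1)"

definition glab :: "nat \<Rightarrow> bool" where
  "glab q \<longleftrightarrow> q = 1 \<or> 2 \<le> q \<and> lab0 (lev q mod 12) (rail q)"

text \<open>Literals sit on the first level of a block, where side 0 crosses over to side 1: on rail
  0 for a positive and on rail 1 for a negative literal. On level 0 the result names a sink instead
  of a side.\<close>

definition below :: "(nat \<Rightarrow> bool) \<Rightarrow> (nat \<Rightarrow> bool) \<Rightarrow> nat \<Rightarrow> nat \<Rightarrow> nat \<Rightarrow> nat" where
  "below pos neg i r sd =
     (if sd = 1 \<or> i mod 12 = 0 \<and> (if r = 0 then pos (i div 12) else neg (i div 12)) then 1 else 0)"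

text \<open>On residue 2 a state sees both rails of the level below; this is where the rails are
  merged.\<close>

definition gedge :: "(nat \<Rightarrow> bool) \<Rightarrow> (nat \<Rightarrow> bool) \<Rightarrow> nat \<Rightarrow> nat \<Rightarrow> bool" where
  "gedge pos neg q q' \<longleftrightarrow> 2 \<le> q \<and>
     (sink (lev q mod 12) (rail q) < 2 \<and> q' = sink (lev q mod 12) (rail q) \<or>
      (if lev q = 0 then q' = below pos neg (lev q) (rail q) (side q)
       else \<exists>r'<2. (lev q mod 12 = 2 \<or> r' = rail q) \<and>
          q' = gst (lev q - 1) r' (below pos neg (lev q) (rail q) (side q))))"

definition gadget :: "nat \<Rightarrow> (nat \<Rightarrow> bool) \<Rightarrow> (nat \<Rightarrow> bool) \<Rightarrow> nat \<Rightarrow> cgs" where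
  "gadget m pos neg q0 = owned_cgs (2 + 48 * m) gown (gedge pos neg) glab q0"

lemma below_less: "below pos neg i r sd < 2"
  by (simp add: below_def)

lemma gst_less: "i < 12 * m \<Longrightarrow> r < 2 \<Longrightarrow> sd < 2 \<Longrightarrow> gst i r sd < 2 + 48 * m"
  by (simp add: gst_def)

lemma gown_gst: "r < 2 \<Longrightarrow> sd < 2 \<Longrightarrow> gown (gst i r sd) = lown i"
  by (simp add: gown_def gst_simps)

lemma gedge_gst:
  assumes "r < 2" "sd < 2"
  shows "gedge pos neg (gst i r sd) q' \<longleftrightarrow>
    sink (i mod 12) r < 2 \<and> q' = sink (i mod 12) r \<or>
    (if i = 0 then q' = below pos neg i r sd
     else \<exists>r'<2. (i mod 12 = 2 \<or> r' = r) \<and> q' = gst (i - 1) r' (below pos neg i r sd))"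
  unfolding gedge_def gst_simps[OF assms] using gst_simps(4)[OF assms] by simp

lemma owned_gadget: "owned (2 + 48 * m) gown (gedge pos neg)"
  unfolding owned_def
proof (intro conjI allI impI)
  show "gown q \<in> {1, 2}" for q by (simp add: gown_def lown_def)
next
  fix q q' assume q: "q < 2 + 48 * m" and e: "gedge pos neg q q'"
  have "2 \<le> q" using e by (simp add: gedge_def)
  note g = gst_cases[OF this]
  have lev: "lev q < 12 * m" using q \<open>2 \<le> q\<close> by (simp add: lev_def less_mult_imp_div_less)
  have "q' < 2 \<or> 0 < lev q \<and> (\<exists>r'<2. q' = gst (lev q - 1) r' (below pos neg (lev q) (rail q) (side q)))"
    using e below_less by (auto simp: gedge_def split: if_splits)
  then show "q' < 2 + 48 * m" "gown q' \<noteq> gown q \<or> (\<forall>q''. \<not> gedge pos neg q' q'')"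
  proof (atomize (full), elim disjE)
    assume "q' < 2"
    then show "q' < 2 + 48 * m \<and> (gown q' \<noteq> gown q \<or> (\<forall>q''. \<not> gedge pos neg q' q''))"
      by (simp add: gedge_def)
  next
    assume "0 < lev q \<and> (\<exists>r'<2. q' = gst (lev q - 1) r' (below pos neg (lev q) (rail q) (side q)))"
    then obtain r' where r': "0 < lev q" "r' < 2" "q' = gst (lev q - 1) r' (below pos neg (lev q) (rail q) (side q))"
      by blast
    have "gown q' = lown (lev q - 1)" "gown q = lown (lev q)"
      using r' \<open>2 \<le> q\<close> by (simp_all add: gown_gst below_less) (simp add: gown_def)
    moreover have "lown (lev q - 1) \<noteq> lown (lev q)" using r'(1) by (simp add: lown_def)
    moreover have "q' < 2 + 48 * m" unfolding r'(3) by (rule gst_less) (use lev r' below_less in auto)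
    ultimately show "q' < 2 + 48 * m \<and> (gown q' \<noteq> gown q \<or> (\<forall>q''. \<not> gedge pos neg q' q''))"
      by simp
  qed
qed

text \<open>\<open>letter a True\<close> is a diamond and \<open>letter a False\<close> a box over the edges of agent \<open>a\<close>.\<close>

definition letter :: "nat \<Rightarrow> bool \<Rightarrow> nat set \<times> tempop" where
  "letter a x = (if x then ({a}, Future) else ({3 - a}, Globally))"

text \<open>Residue 2 reverses the choice. After a diamond, rail 1 is constantly true and has to be
  merged by a conjunction; after a box, rail 0 is constantly false and needs a disjunction.\<close>

definition dictated :: "nat \<Rightarrow> bool \<Rightarrow> bool" where
  "dictated k c = (if k = 0 then c else if k = 2 then \<not> c else k = 1 \<or> 5 \<le> k \<and> k \<le> 9)"

text \<open>\<open>tab c j\<close> lists the truth values, at time \<open>j\<close> of a block with choice \<open>c\<close>, of the states on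
  levels that have not been reached yet; the entry for residue \<open>k\<close> and rail \<open>r\<close> is \<open>2 * k + r\<close>.\<close>

definition tab_step :: "bool \<Rightarrow> nat \<Rightarrow> bool list \<Rightarrow> bool list" where
  "tab_step c j T = map (\<lambda>n.
     let k = n div 2; p = 2 * ((k + 11) mod 12) in
     if even k \<noteq> even j then T ! n
     else if dictated j c then T ! n \<or> sink k (n mod 2) = 1 \<or> T ! (p + n mod 2) \<or> k = 2 \<and> (T ! p \<or> T ! (p + 1))
     else T ! n \<and> sink k (n mod 2) \<noteq> 0 \<and> T ! (p + n mod 2) \<and> (k = 2 \<longrightarrow> T ! p \<and> T ! (p + 1))) [0..<24]"

primrec tab :: "bool \<Rightarrow> nat \<Rightarrow> bool list" where
  "tab c 0 = map (\<lambda>n. lab0 (n div 2) (n mod 2)) [0..<24]"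
| "tab c (Suc j) = tab_step c j (tab c j)"

text \<open>The current row is passed along, so that the whole diagonal is checked in one evaluation
  of the table.\<close>

primrec tab_check :: "bool \<Rightarrow> nat \<Rightarrow> bool list \<Rightarrow> nat \<Rightarrow> bool" where
  "tab_check c j T 0 \<longleftrightarrow> True"
| "tab_check c j T (Suc n) \<longleftrightarrow>
     T ! (2 * j) = (j \<noteq> 0 \<and> \<not> dictated j c) \<and> T ! (2 * j + 1) = (j = 0 \<or> \<not> dictated j c) \<and>
     tab_check c (Suc j) (tab_step c j T) n"

lemma tab_check_diag:
  assumes "tab_check c j (tab c j) n" "j \<le> k" "k < j + n" "r < 2"
  shows "tab c k ! (2 * k + r) = (if k = 0 then r = 1 else \<not> dictated k c)"
  using assms
proof (induction n arbitrary: j)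
  case (Suc n)
  show ?case
  proof (cases "k = j")
    case True
    then show ?thesis using Suc.prems by (auto simp: less_2_cases_iff)
  next
    case False
    then show ?thesis using Suc.IH[of "Suc j"] Suc.prems by simp
  qed
qed simp

text \<open>A finite computation for both choices. That the initial row returns independently of the
  choice is what allows blocks to be stacked.\<close>

lemma tab_period: "tab c 12 = tab c' 0"
proof -
  have "tab True 12 = tab True 0" "tab False 12 = tab True 0" "tab False 0 = tab True 0" by code_simp+
  then show ?thesis by (cases c; cases c') simp_all
qed

text \<open>The value of a level at its turn is neutral for the dictated modality: false under a
  diamond and true under a box. Only on residue 0 do the rails differ, which leaves both modalities
  possible there.\<close>

lemma tab_diag:
  assumes "k < 12" "r < 2"
  shows "tab c k ! (2 * k + r) = (if k = 0 then r = 1 else \<not> dictated k c)"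
proof -
  have "tab_check True 0 (tab True 0) 12" "tab_check False 0 (tab False 0) 12" by code_simp+
  then have "tab_check c 0 (tab c 0) 12" by (cases c) simp_all
  from tab_check_diag[OF this _ _ assms(2), of k] assms(1) show ?thesis by simp
qed

lemma tab_Suc_nth:
  assumes "k < 12" "r < 2"
  shows "tab c (Suc j) ! (2 * k + r) = (let T = tab c j; p = 2 * ((k + 11) mod 12) in
     if even k \<noteq> even j then T ! (2 * k + r)
     else if dictated j c then T ! (2 * k + r) \<or> sink k r = 1 \<or> T ! (p + r) \<or> k = 2 \<and> (T ! p \<or> T ! (p + 1))
     else T ! (2 * k + r) \<and> sink k r \<noteq> 0 \<and> T ! (p + r) \<and> (k = 2 \<longrightarrow> T ! p \<and> T ! (p + 1)))"
proof -
  have n: "2 * k + r < 24" and d: "(2 * k + r) div 2 = k" "(2 * k + r) mod 2 = r" using assms by auto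
  have nth: "map f [0..<24] ! (2 * k + r) = f (2 * k + r)" for f :: "nat \<Rightarrow> bool"
    using n by simp
  show ?thesis unfolding tab.simps tab_step_def Let_def nth d ..
qed

lemma modal_letter:
  assumes "a \<in> {1, 2}" "own q \<in> {1, 2}"
  shows "modal S own ed (fst (letter a x)) (snd (letter a x)) X q \<longleftrightarrow>
    (if x then X q \<or> own q = a \<and> (\<exists>q'. ed q q' \<and> X q') else X q \<and> (own q = a \<longrightarrow> (\<forall>q'. ed q q' \<longrightarrow> X q')))"
proof -
  have "a = 1 \<or> a = 2" using assms(1) by blast
  then have "{a} \<noteq> {1, 2}" by (elim disjE) simp_all
  then show ?thesis
    by (cases x) (simp_all only: letter_def if_True if_False fst_conv snd_conv modal_def simp_thms
        owner_sets[OF assms] insert_not_empty tempop.distinct)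
qed

subsection \<open>Words of modalities\<close>

definition chain :: "nat \<Rightarrow> (nat set \<times> tempop) list \<Rightarrow> atl" where
  "chain p ops = foldl (\<lambda>\<phi> (A, t). Coop A t \<phi>) (Atom p) ops"

lemma chain_snoc: "chain p (ops @ [(A, t)]) = Coop A t (chain p ops)"
  by (simp add: chain_def)

locale op_word =
  fixes m :: nat and pos neg :: "nat \<Rightarrow> bool" and q0 :: nat and ops :: "(nat set \<times> tempop) list"
  assumes len: "length ops = 12 * m" and q0: "q0 < 2 + 48 * m"
    and ops: "\<And>A t. (A, t) \<in> set ops \<Longrightarrow> A \<subseteq> {1..2} \<and> t \<in> {Future, Globally}"
begin

definition X :: "nat \<Rightarrow> nat \<Rightarrow> bool" where
  "X t q = sat 2 (gadget m pos neg q0) q (chain 0 (take t ops))"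

lemma X_0: "X 0 q = glab q"
  by (simp add: X_def chain_def gadget_def owned_cgs_def)

lemma X_Suc:
  assumes "t < 12 * m" "q < 2 + 48 * m"
  shows "X (Suc t) q = modal (2 + 48 * m) gown (gedge pos neg) (fst (ops ! t)) (snd (ops ! t)) (X t) q"
proof -
  obtain A tt where At: "ops ! t = (A, tt)" by (cases "ops ! t")
  have "(A, tt) \<in> set ops" using At nth_mem[of t ops] assms(1) len by simp
  note o = ops[OF this]
  have "chain 0 (take (Suc t) ops) = Coop A tt (chain 0 (take t ops))"
    using assms(1) len At by (simp add: take_Suc_conv_app_nth chain_snoc)
  then show ?thesis
    using owned_sat[OF owned_gadget q0 conjunct1[OF o] conjunct2[OF o] assms(2) gadget_def]
    unfolding X_def At fst_conv snd_conv by (simp del: sat.simps)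
qed

definition conform :: "(nat \<Rightarrow> bool) \<Rightarrow> nat \<Rightarrow> bool" where
  "conform c t \<longleftrightarrow> (\<forall>s<t. ops ! s = letter (lown s) (dictated (s mod 12) (c (s div 12))))"

lemma X_letter:
  assumes "conform c (Suc t)" "t < 12 * m" "q < 2 + 48 * m"
  shows "X (Suc t) q \<longleftrightarrow> (if dictated (t mod 12) (c (t div 12))
     then X t q \<or> gown q = lown t \<and> (\<exists>q'. gedge pos neg q q' \<and> X t q')
     else X t q \<and> (gown q = lown t \<longrightarrow> (\<forall>q'. gedge pos neg q q' \<longrightarrow> X t q')))"
proof -
  have "ops ! t = letter (lown t) (dictated (t mod 12) (c (t div 12)))"
    using assms(1) by (simp add: conform_def)
  then show ?thesis
    unfolding X_Suc[OF assms(2,3)] by (simp only:) (rule modal_letter, simp_all add: lown_def gown_def)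
qed

lemma conform_mono: "conform c t \<Longrightarrow> s \<le> t \<Longrightarrow> conform c s"
  by (simp add: conform_def)

lemma X_sink:
  assumes "conform c t" "t \<le> 12 * m"
  shows "\<not> X t 0" "X t 1"
proof -
  have "\<not> X t 0 \<and> X t 1"
    using assms
  proof (induction t)
    case 0
    then show ?case by (simp add: X_0 glab_def)
  next
    case (Suc t)
    have "\<not> gedge pos neg 0 q'" "\<not> gedge pos neg 1 q'" for q' by (simp_all add: gedge_def)
    then show ?case
      using Suc conform_mono[of c "Suc t" t] X_letter[OF Suc.prems(1), of 0] X_letter[OF Suc.prems(1), of 1] by simp
  qed
  then show "\<not> X t 0" "X t 1" by auto
qed

lemma ex_gedge:
  assumes "conform c t" "t \<le> 12 * m" "r < 2" "sd < 2" "0 < i"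
  shows "(\<exists>q'. gedge pos neg (gst i r sd) q' \<and> X t q') \<longleftrightarrow> sink (i mod 12) r = 1 \<or>
      X t (gst (i - 1) r (below pos neg i r sd)) \<or>
      i mod 12 = 2 \<and> (X t (gst (i - 1) 0 (below pos neg i r sd)) \<or> X t (gst (i - 1) 1 (below pos neg i r sd)))"
    and "(\<forall>q'. gedge pos neg (gst i r sd) q' \<longrightarrow> X t q') \<longleftrightarrow> sink (i mod 12) r \<noteq> 0 \<and>
      X t (gst (i - 1) r (below pos neg i r sd)) \<and>
      (i mod 12 = 2 \<longrightarrow> X t (gst (i - 1) 0 (below pos neg i r sd)) \<and> X t (gst (i - 1) 1 (below pos neg i r sd)))"
proof -
  note x = X_sink[OF assms(1,2)]
  have "sink (i mod 12) r < 2 \<and> X t (sink (i mod 12) r) \<longleftrightarrow> sink (i mod 12) r = 1"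
    "(sink (i mod 12) r < 2 \<longrightarrow> X t (sink (i mod 12) r)) \<longleftrightarrow> sink (i mod 12) r \<noteq> 0"
    using x by (auto simp: less_2_cases_iff)
  moreover have "(\<exists>r'<2. (i mod 12 = 2 \<or> r' = r) \<and> P r') \<longleftrightarrow> P r \<or> i mod 12 = 2 \<and> (P 0 \<or> P 1)" for P
    using assms(3) by (auto simp: less_2_cases_iff)
  moreover have "(\<forall>r'<2. i mod 12 = 2 \<or> r' = r \<longrightarrow> P r') \<longleftrightarrow> P r \<and> (i mod 12 = 2 \<longrightarrow> P 0 \<and> P 1)" for P
    using assms(3) by (auto simp: less_2_cases_iff)
  ultimately show "(\<exists>q'. gedge pos neg (gst i r sd) q' \<and> X t q') \<longleftrightarrow> sink (i mod 12) r = 1 \<or>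
      X t (gst (i - 1) r (below pos neg i r sd)) \<or>
      i mod 12 = 2 \<and> (X t (gst (i - 1) 0 (below pos neg i r sd)) \<or> X t (gst (i - 1) 1 (below pos neg i r sd)))"
    and "(\<forall>q'. gedge pos neg (gst i r sd) q' \<longrightarrow> X t q') \<longleftrightarrow> sink (i mod 12) r \<noteq> 0 \<and>
      X t (gst (i - 1) r (below pos neg i r sd)) \<and>
      (i mod 12 = 2 \<longrightarrow> X t (gst (i - 1) 0 (below pos neg i r sd)) \<and> X t (gst (i - 1) 1 (below pos neg i r sd)))"
    unfolding gedge_gst[OF assms(3,4)] using assms(5) by (simp_all, blast+)
qed

text \<open>A level that has not been reached was only influenced by sinks and by other levels that
  were not reached either. So sides and literals do not matter yet, and the values are
  periodic.\<close>

lemma X_unreached: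
  assumes "conform c t" "t \<le> i" "i < 12 * m" "r < 2" "sd < 2"
  shows "X t (gst i r sd) = tab (c (t div 12)) (t mod 12) ! (2 * (i mod 12) + r)"
  using assms
proof (induction t arbitrary: i r sd)
  case 0
  then have "2 * (i mod 12) + r < 24" by simp
  moreover have "(2 * (i mod 12) + r) div 2 = i mod 12" "(2 * (i mod 12) + r) mod 2 = r"
    using 0 by auto
  ultimately show ?case
    using 0 by (simp add: X_0 glab_def gst_simps) (simp add: gst_def)
next
  case (Suc t)
  define c' where "c' = c (t div 12)"
  define T where "T = tab c' (t mod 12)"
  define k where "k = i mod 12"
  define s where "s = below pos neg i r sd"
  have cf: "conform c t" using Suc.prems(1) conform_mono by auto
  have i: "0 < i" "t < 12 * m" "i - 1 < 12 * m" "t \<le> i - 1" using Suc.prems by auto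
  have IH: "X t (gst i r sd) = T ! (2 * k + r)"
    "X t (gst (i - 1) r' s) = T ! (2 * ((i - 1) mod 12) + r')" if "r' < 2" for r'
    using Suc.IH[OF cf _ Suc.prems(3,4,5)] Suc.IH[OF cf i(4,3) that, of s] Suc.prems(2) below_less
    by (simp_all add: T_def c'_def k_def s_def)
  have pk: "(i - 1) mod 12 = (k + 11) mod 12"
  proof -
    have "(i - 1) mod 12 = (i - 1 + 12) mod 12" by simp
    also have "i - 1 + 12 = i + 11" using i(1) by simp
    finally show ?thesis unfolding k_def mod_add_left_eq .
  qed
  have par: "lown i = lown t \<longleftrightarrow> even k = even (t mod 12)"
  proof -
    have "even (x mod 12) = even x" for x :: nat by (rule dvd_mod_iff) simp
    then show ?thesis by (simp add: lown_def k_def)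
  qed
  have k12: "k < 12" by (simp add: k_def)
  have two: "0 < (2::nat)" "1 < (2::nat)" by simp_all
  have "X (Suc t) (gst i r sd) = tab c' (Suc (t mod 12)) ! (2 * k + r)"
    unfolding X_letter[OF Suc.prems(1) i(2) gst_less[OF Suc.prems(3-5)]] gown_gst[OF Suc.prems(4,5)] par
      ex_gedge[OF cf less_imp_le[OF i(2)] Suc.prems(4,5) i(1)] s_def[symmetric] IH(1)[OF Suc.prems(4)]
      IH(2)[OF Suc.prems(4)] IH(2)[OF two(1)] IH(2)[OF two(2)]
    unfolding pk k_def[symmetric] c'_def[symmetric] tab_Suc_nth[OF k12 Suc.prems(4)] T_def[symmetric] Let_def
      add_0_right
    by (cases "even k = even (t mod 12)"; cases "dictated (t mod 12) c'") simp_all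
  also have "tab c' (Suc (t mod 12)) = tab (c (Suc t div 12)) (Suc t mod 12)"
  proof (cases "Suc (t mod 12) = 12")
    case True
    then have "Suc t mod 12 = 0" by (simp add: mod_Suc)
    then show ?thesis using tab_period[of c'] True by simp
  next
    case False
    then show ?thesis by (simp add: mod_Suc div_Suc c'_def)
  qed
  finally show ?case by (simp add: k_def)
qed

lemma ex_gedge_0:
  assumes "conform c t" "t \<le> 12 * m" "r < 2" "sd < 2"
  shows "(\<exists>q'. gedge pos neg (gst 0 r sd) q' \<and> X t q') \<longleftrightarrow> sink 0 r = 1 \<or> below pos neg 0 r sd = 1"
    and "(\<forall>q'. gedge pos neg (gst 0 r sd) q' \<longrightarrow> X t q') \<longleftrightarrow> sink 0 r \<noteq> 0 \<and> below pos neg 0 r sd = 1"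
proof -
  note x = X_sink[OF assms(1,2)]
  define a where "a = sink 0 r"
  define b where "b = below pos neg 0 r sd"
  have a: "a = 0 \<or> a = 1" using assms(3) by (auto simp: sink_def a_def)
  have b: "b = 0 \<or> b = 1" by (simp add: below_def b_def)
  have X: "X t v \<longleftrightarrow> v = 1" if "v = 0 \<or> v = 1" for v using x that by auto
  have e: "gedge pos neg (gst 0 r sd) q' \<longleftrightarrow> q' = a \<or> q' = b" for q'
    using gedge_gst[OF assms(3,4), of pos neg 0 q'] a by (auto simp: a_def b_def)
  have "(\<exists>q'. gedge pos neg (gst 0 r sd) q' \<and> X t q') \<longleftrightarrow> X t a \<or> X t b" unfolding e by blast
  moreover have "(\<forall>q'. gedge pos neg (gst 0 r sd) q' \<longrightarrow> X t q') \<longleftrightarrow> X t a \<and> X t b" unfolding e by blast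
  moreover have "a = 1 \<longleftrightarrow> a \<noteq> 0" using a by auto
  ultimately show "(\<exists>q'. gedge pos neg (gst 0 r sd) q' \<and> X t q') \<longleftrightarrow> sink 0 r = 1 \<or> below pos neg 0 r sd = 1"
    and "(\<forall>q'. gedge pos neg (gst 0 r sd) q' \<longrightarrow> X t q') \<longleftrightarrow> sink 0 r \<noteq> 0 \<and> below pos neg 0 r sd = 1"
    unfolding a_def[symmetric] b_def[symmetric] X[OF a] X[OF b] by blast+
qed

text \<open>The carried signal: it is true if the descent can end in sink 1, either because it
  starts on side 1 or because it crosses over at a true literal of a lower block.\<close>

definition star :: "(nat \<Rightarrow> bool) \<Rightarrow> nat \<Rightarrow> nat \<Rightarrow> bool" where
  "star c sd b \<longleftrightarrow> sd = 1 \<or> (\<exists>b'<b. c b' \<and> pos b' \<or> \<not> c b' \<and> neg b')"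

text \<open>The choice opens one rail to the signal and makes the other one constant, true on rail 1
  after a diamond and false on rail 0 after a box. Residue 2 merges the rails, and the remaining
  levels of the block copy the signal.\<close>

lemma X_carry:
  assumes cf: "conform c (12 * m)" and "i < 12 * m" "r < 2" "sd < 2"
  shows "X (Suc i) (gst i r sd) \<longleftrightarrow>
    (if i mod 12 < 2 then if r = 0 then c (i div 12) \<and> (star c sd (i div 12) \<or> pos (i div 12))
       else c (i div 12) \<or> star c sd (i div 12) \<or> neg (i div 12)
     else star c sd (Suc (i div 12)))"
  using assms(2-)
proof (induction i arbitrary: r sd)
  case 0
  have cf0: "conform c 0" "conform c (Suc 0)" using conform_mono[OF cf] 0 by auto
  have "X 0 (gst 0 r sd) = (r = 1)"
    using X_unreached[OF cf0(1), of 0 r sd] 0 tab_diag[of 0 r "c 0"] by (simp del: tab.simps)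
  then show ?case
    unfolding X_letter[OF cf0(2) 0(1) gst_less[OF 0]] gown_gst[OF 0(2,3)] ex_gedge_0[OF cf0(1) le0 0(2,3)]
    using 0 by (auto simp: dictated_def sink_def below_def star_def less_2_cases_iff)
next
  case (Suc i)
  define k where "k = Suc i mod 12"
  define b where "b = Suc i div 12"
  define s where "s = below pos neg (Suc i) r sd"
  have cfi: "conform c (Suc i)" "conform c (Suc (Suc i))" using conform_mono[OF cf] Suc.prems by auto
  have k: "k < 12" by (simp add: k_def)
  have V: "X (Suc i) (gst (Suc i) r sd) = (if k = 0 then r = 1 else \<not> dictated k (c b))"
    using X_unreached[OF cfi(1) order_refl Suc.prems] tab_diag[OF k Suc.prems(2), of "c b"]
    by (simp add: k_def b_def)
  have step: "X (Suc (Suc i)) (gst (Suc i) r sd) \<longleftrightarrow> (if dictated k (c b)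
      then (if k = 0 then r = 1 else False) \<or> sink k r = 1 \<or> X (Suc i) (gst i r s) \<or>
        k = 2 \<and> (X (Suc i) (gst i 0 s) \<or> X (Suc i) (gst i 1 s))
      else (if k = 0 then r = 1 else True) \<and> sink k r \<noteq> 0 \<and> X (Suc i) (gst i r s) \<and>
        (k = 2 \<longrightarrow> X (Suc i) (gst i 0 s) \<and> X (Suc i) (gst i 1 s)))"
    unfolding X_letter[OF cfi(2) Suc.prems(1) gst_less[OF Suc.prems]] gown_gst[OF Suc.prems(2,3)]
      ex_gedge[OF cfi(1) less_imp_le[OF Suc.prems(1)] Suc.prems(2,3) zero_less_Suc] diff_Suc_1 s_def[symmetric] V
      k_def[symmetric] b_def[symmetric]
    by (simp only: refl simp_thms if_True split: if_split) blast
  have s: "s < 2" by (simp add: s_def below_less)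
  note IH = Suc.IH[OF Suc_lessD[OF Suc.prems(1)] _ s]
  show ?case
  proof (cases "Suc (i mod 12) = 12")
    case True
    then have kb: "k = 0" "b = Suc (i div 12)" by (simp_all add: k_def b_def mod_Suc div_Suc)
    \<comment> \<open>Only here, on the first level of a block, can the descent change
      sides.\<close>
    have "s = 1 \<longleftrightarrow> sd = 1 \<or> (if r = 0 then pos b else neg b)"
      using kb(1) Suc.prems(3) by (auto simp: s_def below_def k_def b_def)
    then have "star c s b \<longleftrightarrow> star c sd b \<or> (if r = 0 then pos b else neg b)"
      by (auto simp: star_def)
    moreover have "X (Suc i) (gst i r s) = star c s b"
      using IH[OF Suc.prems(2)] True by (simp add: kb(2))
    ultimately show ?thesis
      unfolding step kb(1) k_def[symmetric] b_def[symmetric]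
      using Suc.prems(2) by (auto simp: dictated_def sink_def less_2_cases_iff)
  next
    case False
    then have kb: "k = Suc (i mod 12)" "b = i div 12" by (simp_all add: k_def b_def mod_Suc div_Suc)
    have "s = sd" using kb Suc.prems(3) by (auto simp: s_def below_def k_def)
    note IH = IH[unfolded this kb(2)[symmetric]]
    have i: "i mod 12 = k - 1" "0 < k" using kb by auto
    have IH2: "k \<noteq> 2 \<Longrightarrow> k \<noteq> 1 \<Longrightarrow> r' < 2 \<Longrightarrow> X (Suc i) (gst i r' sd) = star c sd (Suc b)"
      "k = 2 \<or> k = 1 \<Longrightarrow> r' < 2 \<Longrightarrow> X (Suc i) (gst i r' sd) =
         (if r' = 0 then c b \<and> (star c sd b \<or> pos b) else c b \<or> star c sd b \<or> neg b)" for r'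
      using IH[of r'] i by auto
    have st: "star c sd (Suc b) \<longleftrightarrow> star c sd b \<or> c b \<and> pos b \<or> \<not> c b \<and> neg b"
      by (auto simp: star_def less_Suc_eq)
    consider "k = 1" | "k = 2" | "3 \<le> k" using i(2) by linarith
    then show ?thesis
      unfolding step \<open>s = sd\<close> k_def[symmetric] b_def[symmetric]
    proof cases
      case 1
      then show "(if dictated k (c b) then (if k = 0 then r = 1 else False) \<or> sink k r = 1 \<or> X (Suc i) (gst i r sd) \<or>
          k = 2 \<and> (X (Suc i) (gst i 0 sd) \<or> X (Suc i) (gst i 1 sd))
        else (if k = 0 then r = 1 else True) \<and> sink k r \<noteq> 0 \<and> X (Suc i) (gst i r sd) \<and>
          (k = 2 \<longrightarrow> X (Suc i) (gst i 0 sd) \<and> X (Suc i) (gst i 1 sd))) =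
        (if k < 2 then if r = 0 then c b \<and> (star c sd b \<or> pos b) else c b \<or> star c sd b \<or> neg b
         else star c sd (Suc b))"
        using IH2(2)[OF _ Suc.prems(2)] by (simp add: dictated_def sink_def)
    next
      case 2
      then show "(if dictated k (c b) then (if k = 0 then r = 1 else False) \<or> sink k r = 1 \<or> X (Suc i) (gst i r sd) \<or>
          k = 2 \<and> (X (Suc i) (gst i 0 sd) \<or> X (Suc i) (gst i 1 sd))
        else (if k = 0 then r = 1 else True) \<and> sink k r \<noteq> 0 \<and> X (Suc i) (gst i r sd) \<and>
          (k = 2 \<longrightarrow> X (Suc i) (gst i 0 sd) \<and> X (Suc i) (gst i 1 sd))) =
        (if k < 2 then if r = 0 then c b \<and> (star c sd b \<or> pos b) else c b \<or> star c sd b \<or> neg b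
         else star c sd (Suc b))"
        using IH2(2)[of r] IH2(2)[of 0] IH2(2)[of 1] Suc.prems(2) st by (simp add: dictated_def sink_def)
    next
      case 3
      then show "(if dictated k (c b) then (if k = 0 then r = 1 else False) \<or> sink k r = 1 \<or> X (Suc i) (gst i r sd) \<or>
          k = 2 \<and> (X (Suc i) (gst i 0 sd) \<or> X (Suc i) (gst i 1 sd))
        else (if k = 0 then r = 1 else True) \<and> sink k r \<noteq> 0 \<and> X (Suc i) (gst i r sd) \<and>
          (k = 2 \<longrightarrow> X (Suc i) (gst i 0 sd) \<and> X (Suc i) (gst i 1 sd))) =
        (if k < 2 then if r = 0 then c b \<and> (star c sd b \<or> pos b) else c b \<or> star c sd b \<or> neg b
         else star c sd (Suc b))"
        using IH2(1)[of r] Suc.prems(2) k by (auto simp: dictated_def sink_def)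
    qed
  qed
qed

lemma X_top:
  assumes "conform c (12 * m)" "0 < m" "sd < 2"
  shows "X (12 * m) (gst (12 * m - 1) 0 sd) = star c sd m"
proof -
  have "Suc (12 * m - 1) = 12 * m" "(12 * m - 1) mod 12 = 11" "Suc ((12 * m - 1) div 12) = m" "12 * m - 1 < 12 * m"
  proof -
    obtain m' where m: "m = Suc m'" using assms(2) gr0_implies_Suc by blast
    have "12 * m - 1 = 11 + m' * 12" by (simp add: m)
    then show "Suc (12 * m - 1) = 12 * m" "(12 * m - 1) mod 12 = 11" "Suc ((12 * m - 1) div 12) = m" "12 * m - 1 < 12 * m"
      by (simp_all add: m)
  qed
  then show ?thesis using X_carry[OF assms(1), of "12 * m - 1" 0 sd] assms(3) by simp
qed

end

section \<open>Twin states and modal depth\<close>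

definition twin :: "nat \<Rightarrow> nat \<Rightarrow> (nat \<Rightarrow> bool) \<Rightarrow> bool" where
  "twin m h Y \<longleftrightarrow> (\<forall>i r. h \<le> i \<and> i < 12 * m \<and> r < 2 \<longrightarrow> Y (gst i r 0) = Y (gst i r 1))"

abbreviation no_literal :: "nat \<Rightarrow> bool" where "no_literal \<equiv> \<lambda>_. False"

lemma twin_mono: "twin m h Y \<Longrightarrow> h \<le> h' \<Longrightarrow> twin m h' Y"
  by (auto simp: twin_def)

text \<open>Without literals every edge stays on its side or leads to a shared sink, and it descends
  by one level only. So a modality lifts the difference by at most one level, whatever the coalition
  is.\<close>

lemma twin_modal:
  assumes "twin m h Y"
  shows "twin m (Suc h) (modal (2 + 48 * m) gown (gedge no_literal no_literal) A t Y)"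
  unfolding twin_def
proof (intro allI impI)
  fix i r :: nat assume i: "Suc h \<le> i \<and> i < 12 * m \<and> r < 2"
  have Y: "Y (gst i' r' 0) = Y (gst i' r' 1)" if "h \<le> i'" "i' < 12 * m" "r' < 2" for i' r'
    using assms that by (auto simp: twin_def)
  have e: "gedge no_literal no_literal (gst i r sd) q' \<longleftrightarrow>
      sink (i mod 12) r < 2 \<and> q' = sink (i mod 12) r \<or> (\<exists>r'<2. (i mod 12 = 2 \<or> r' = r) \<and> q' = gst (i - 1) r' sd)"
    if "sd < 2" for sd q'
    using i that by (auto simp: gedge_gst below_def less_2_cases_iff)
  have "(\<exists>q'. gedge no_literal no_literal (gst i r sd) q' \<and> Y q') \<longleftrightarrow>
      sink (i mod 12) r < 2 \<and> Y (sink (i mod 12) r) \<or> (\<exists>r'<2. (i mod 12 = 2 \<or> r' = r) \<and> Y (gst (i - 1) r' 0))"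
    "(\<forall>q'. gedge no_literal no_literal (gst i r sd) q' \<longrightarrow> Y q') \<longleftrightarrow>
      (sink (i mod 12) r < 2 \<longrightarrow> Y (sink (i mod 12) r)) \<and> (\<forall>r'<2. i mod 12 = 2 \<or> r' = r \<longrightarrow> Y (gst (i - 1) r' 0))"
    if sd: "sd = 0 \<or> sd = 1" for sd
  proof -
    have sd2: "sd < 2" using sd by auto
    have Y': "Y (gst (i - 1) r' sd) = Y (gst (i - 1) r' 0)" if "r' < 2" for r'
      using Y[of "i - 1" r'] i that sd by auto
    show "(\<exists>q'. gedge no_literal no_literal (gst i r sd) q' \<and> Y q') \<longleftrightarrow>
      sink (i mod 12) r < 2 \<and> Y (sink (i mod 12) r) \<or> (\<exists>r'<2. (i mod 12 = 2 \<or> r' = r) \<and> Y (gst (i - 1) r' 0))"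
      unfolding e[OF sd2] using Y' by blast
    show "(\<forall>q'. gedge no_literal no_literal (gst i r sd) q' \<longrightarrow> Y q') \<longleftrightarrow>
      (sink (i mod 12) r < 2 \<longrightarrow> Y (sink (i mod 12) r)) \<and> (\<forall>r'<2. i mod 12 = 2 \<or> r' = r \<longrightarrow> Y (gst (i - 1) r' 0))"
      unfolding e[OF sd2] using Y' by blast
  qed
  note ed = this[of 0, simplified] this[of 1, simplified]
  have "(\<exists>q'. gedge no_literal no_literal (gst i r 0) q' \<and> Y q') = (\<exists>q'. gedge no_literal no_literal (gst i r 1) q' \<and> Y q')"
    "(\<forall>q'. gedge no_literal no_literal (gst i r 0) q' \<longrightarrow> Y q') = (\<forall>q'. gedge no_literal no_literal (gst i r 1) q' \<longrightarrow> Y q')"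
    unfolding One_nat_def ed by (rule refl)+
  then show "modal (2 + 48 * m) gown (gedge no_literal no_literal) A t Y (gst i r 0) =
      modal (2 + 48 * m) gown (gedge no_literal no_literal) A t Y (gst i r 1)"
    using Y[of i r] i by (simp add: modal_def gown_gst)
qed


subsection \<open>Depth and size of formulas\<close>

primrec td :: "atl \<Rightarrow> nat" where
  "td (Atom p) = 0"
| "td (Neg \<phi>) = td \<phi>"
| "td (Bin b \<phi> \<psi>) = max (td \<phi>) (td \<psi>)"
| "td (Coop A t \<phi>) = Suc (td \<phi>)"

lemma finite_subformulas: "finite (subformulas \<phi>)"
  by (induction \<phi>) auto

lemma subformula_size: "\<psi> \<in> subformulas \<phi> \<Longrightarrow> size \<psi> \<le> size \<phi>"
  by (induction \<phi>) auto

lemma atl_size_simps: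
  "atl_size (Atom p) = 1" "atl_size (Neg \<phi>) = Suc (atl_size \<phi>)"
  "atl_size (Coop A t \<phi>) = Suc (atl_size \<phi>)"
  "atl_size \<phi> < atl_size (Bin b \<phi> \<psi>)" "atl_size \<psi> < atl_size (Bin b \<phi> \<psi>)"
proof -
  have "Neg \<phi> \<notin> subformulas \<phi>" "Coop A t \<phi> \<notin> subformulas \<phi>"
    using subformula_size[of "Neg \<phi>" \<phi>] subformula_size[of "Coop A t \<phi>" \<phi>] by auto
  then show "atl_size (Neg \<phi>) = Suc (atl_size \<phi>)" "atl_size (Coop A t \<phi>) = Suc (atl_size \<phi>)"
    by (simp_all add: atl_size_def finite_subformulas)
  have "Bin b \<phi> \<psi> \<notin> subformulas \<phi>" "Bin b \<phi> \<psi> \<notin> subformulas \<psi>"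
    using subformula_size[of "Bin b \<phi> \<psi>" \<phi>] subformula_size[of "Bin b \<phi> \<psi>" \<psi>] by auto
  then show "atl_size \<phi> < atl_size (Bin b \<phi> \<psi>)" "atl_size \<psi> < atl_size (Bin b \<phi> \<psi>)"
    by (simp_all add: atl_size_def finite_subformulas less_Suc_eq_le card_mono)
qed (simp add: atl_size_def)

lemma td_less_size: "td \<phi> < atl_size \<phi>"
proof (induction \<phi>)
  case (Bin b \<phi> \<psi>)
  then show ?case using atl_size_simps(4)[of \<phi> b \<psi>] atl_size_simps(5)[of \<psi> b \<phi>] by simp
qed (simp_all add: atl_size_simps)

text \<open>A negation or a binary operator adds a subformula but no depth. Since the size always
  exceeds the depth, there is no room for such an operator under this bound.\<close>

lemma tight_formula:
  "atl_size \<phi> \<le> Suc (td \<phi>) \<Longrightarrow> \<exists>p ops. \<phi> = chain p ops \<and> length ops = td \<phi>"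
proof (induction \<phi>)
  case (Atom p)
  then show ?case by (intro exI[of _ p] exI[of _ "[]"]) (simp add: chain_def)
next
  case (Neg \<phi>)
  then show ?case using td_less_size[of \<phi>] by (simp add: atl_size_simps)
next
  case (Bin b \<phi> \<psi>)
  then show ?case
    using atl_size_simps(4)[of \<phi> b \<psi>] atl_size_simps(5)[of \<psi> b \<phi>] td_less_size[of \<phi>] td_less_size[of \<psi>]
    by simp
next
  case (Coop A t \<phi>)
  then obtain p ops where "\<phi> = chain p ops" "length ops = td \<phi>" by (auto simp: atl_size_simps)
  then show ?case by (intro exI[of _ p] exI[of _ "ops @ [(A, t)]"]) (simp add: chain_snoc)
qed

lemma chain_fragment:
  "in_fragment k Props U Bl (chain p ops) \<longleftrightarrow> p \<in> Props \<and> (\<forall>(A, t)\<in>set ops. A \<subseteq> {1..k} \<and> UTemp t \<in> U)"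
proof (induction ops rule: rev_induct)
  case (snoc op ops)
  then show ?case by (cases op) (auto simp: chain_snoc)
qed (simp add: chain_def)

lemma chain_sizes: "atl_size (chain p ops) = Suc (length ops)" "atl_bin_size (chain p ops) = 0"
proof -
  have "atl_size (chain p ops) = Suc (length ops) \<and> (\<forall>\<psi>\<in>subformulas (chain p ops). \<forall>b \<psi>1 \<psi>2. \<psi> \<noteq> Bin b \<psi>1 \<psi>2)"
  proof (induction ops rule: rev_induct)
    case (snoc op ops)
    then show ?case by (cases op) (simp add: chain_snoc atl_size_simps)
  qed (simp add: chain_def atl_size_simps)
  then have "atl_size (chain p ops) = Suc (length ops)"
    "{\<psi> \<in> subformulas (chain p ops). \<exists>b \<psi>1 \<psi>2. \<psi> = Bin b \<psi>1 \<psi>2} = {}" by blast+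
  then show "atl_size (chain p ops) = Suc (length ops)" "atl_bin_size (chain p ops) = 0"
    by (simp_all only: atl_bin_size_def card.empty)
qed

lemma sat_init: "sat k (C\<lparr>cgs_init := I\<rparr>) q \<phi> = sat k C q \<phi>"
proof (induction \<phi> arbitrary: q)
  case (Coop A t \<phi>)
  have "strategy (C\<lparr>cgs_init := I\<rparr>) = strategy C"
    "outcomes k (C\<lparr>cgs_init := I\<rparr>) = outcomes k C"
    by (simp_all add: strategy_def outcomes_def legal_tuples_def fun_eq_iff)
  then show ?case using Coop by simp
qed simp_all

text \<open>Allows the positive and the negative structure to be compared as two states of a single
  one.\<close>

lemma sat_gadget_init: "sat k (gadget m pos neg q0) q \<phi> = sat k (gadget m pos neg q1) q \<phi>"
proof -
  have "gadget m pos neg q0 = (gadget m pos neg q1)\<lparr>cgs_init := {q0}\<rparr>"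
    by (simp add: gadget_def owned_cgs_def)
  then show ?thesis by (simp add: sat_init)
qed

text \<open>Labels do not depend on the side, connectives preserve agreement, and each modality
  costs one level. So depth below the number of levels cannot tell the top states apart.\<close>

lemma twin_formula:
  assumes U: "U \<subseteq> {UTemp Future, UTemp Globally, UNeg}" and q0: "q0 < 2 + 48 * m"
    and "in_fragment 2 Props U Bl \<phi>"
  shows "twin m (td \<phi>) (\<lambda>q. sat 2 (gadget m no_literal no_literal q0) q \<phi>)"
  using assms(3)
proof (induction \<phi>)
  case (Atom p)
  then show ?case
    by (auto simp: twin_def gadget_def owned_cgs_def glab_def gst_simps) (simp_all add: gst_def)
next
  case (Bin b \<phi> \<psi>)
  then have "twin m (td (Bin b \<phi> \<psi>)) (\<lambda>q. sat 2 (gadget m no_literal no_literal q0) q \<phi>)"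
    "twin m (td (Bin b \<phi> \<psi>)) (\<lambda>q. sat 2 (gadget m no_literal no_literal q0) q \<psi>)"
    by (auto intro: twin_mono)
  then show ?case by (simp add: twin_def)
next
  case (Coop A t \<phi>)
  then have A: "A \<subseteq> {1..2}" and t: "t \<in> {Future, Globally}" using U by auto
  have "sat 2 (gadget m no_literal no_literal q0) (gst i r sd) (Coop A t \<phi>) =
      modal (2 + 48 * m) gown (gedge no_literal no_literal) A t (\<lambda>q. sat 2 (gadget m no_literal no_literal q0) q \<phi>) (gst i r sd)"
    if "i < 12 * m" "r < 2" "sd < 2" for i r sd
    by (rule owned_sat[OF owned_gadget q0 A t gst_less[OF that] gadget_def])
  moreover have "twin m (Suc (td \<phi>)) (modal (2 + 48 * m) gown (gedge no_literal no_literal) A t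
      (\<lambda>q. sat 2 (gadget m no_literal no_literal q0) q \<phi>))"
    by (rule twin_modal) (use Coop in simp)
  ultimately show ?case unfolding twin_def by (simp del: sat.simps)
qed (auto simp: twin_def)


subsection \<open>Forced words\<close>

text \<open>Neither the identity nor a constant can make a difference between states with equal
  values; this excludes all modalities other than the two letters in \<open>forced\<close>.\<close>

lemma modal_idle:
  assumes "A \<subseteq> {1..2}" "t \<in> {Future, Globally}" "a \<in> {1, 2}" "(A, t) \<noteq> letter a True" "(A, t) \<noteq> letter a False"
  shows "(\<forall>q. own q = a \<longrightarrow> modal S own ed A t Y q = Y q) \<or> (\<exists>B. \<forall>q. own q = a \<longrightarrow> modal S own ed A t Y q = B)"
proof -
  have "a = 1 \<or> a = 2" using assms(3) by blast
  then have ne: "{a} \<noteq> {1, 2}" "{3 - a} \<noteq> {1, 2}" "{1, 2} \<noteq> {a}" "{1, 2} \<noteq> {3 - a}" "{a} \<noteq> {3 - a}" "{3 - a} \<noteq> {a}"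
    by (elim disjE; simp)+
  have l: "letter a True = ({a}, Future)" "letter a False = ({3 - a}, Globally)" by (simp_all add: letter_def)
  have t: "t = Future \<or> t = Globally" using assms(2) by blast
  have "(A = {} \<or> A = {1, 2}) \<or> A = {a} \<or> A = {3 - a}"
    using subset_two[OF assms(1,3)] by blast
  then show ?thesis
  proof (elim disjE)
    assume A: "A = {}"
    from t show ?thesis unfolding A modal_def by (elim disjE) auto
  next
    assume A: "A = {1, 2}"
    from t show ?thesis
    proof
      assume "t = Future"
      then show ?thesis unfolding A modal_def by auto
    next
      assume "t = Globally"
      then have "modal S own ed A t Y q = Y q" if "own q = a" for q
        unfolding A modal_def that by (simp only: ne tempop.distinct simp_thms insert_not_empty if_False)
      then show ?thesis by blast
    qed
  next
    assume A: "A = {a}"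
    then have "t = Globally" using t assms(4) unfolding l(1) by blast
    then have "modal S own ed A t Y q = Y q" if "own q = a" for q
      unfolding A modal_def that by (simp only: ne tempop.distinct simp_thms insert_not_empty if_False)
    then show ?thesis by blast
  next
    assume A: "A = {3 - a}"
    then have "t = Future" using t assms(5) unfolding l(2) by blast
    then have "modal S own ed A t Y q = Y q" if "own q = a" for q
      unfolding A modal_def that by (simp only: ne tempop.distinct simp_thms insert_not_empty if_False if_True)
    then show ?thesis by blast
  qed
qed

context op_word
begin

text \<open>A delay is never made up: if the difference is one level late at some time, it is still
  late at the end.\<close>

lemma twin_persist:
  assumes "pos = no_literal" "neg = no_literal" "twin m h (X s)" "s + n \<le> 12 * m"
  shows "twin m (h + n) (X (s + n))"
  using assms(4)
proof (induction n)
  case (Suc n)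
  have "twin m (Suc (h + n)) (modal (2 + 48 * m) gown (gedge pos neg) (fst (ops ! (s + n))) (snd (ops ! (s + n))) (X (s + n)))"
    by (subst assms(1), subst assms(2), rule twin_modal, rule Suc.IH) (use Suc.prems in simp)
  moreover have "X (Suc (s + n)) (gst i r sd) = modal (2 + 48 * m) gown (gedge pos neg) (fst (ops ! (s + n)))
      (snd (ops ! (s + n))) (X (s + n)) (gst i r sd)" if "i < 12 * m" "r < 2" "sd < 2" for i r sd
    by (rule X_Suc[OF _ gst_less[OF that]]) (use Suc in simp)
  ultimately show ?case by (simp add: twin_def)
qed (simp add: assms(3))

text \<open>At its turn a level has equal values on both sides. On residues other than 0 a diamond
  in place of a box keeps these values true, and a box in place of a diamond keeps them false; any
  other modality is idle. So a wrong modality leaves the twins of the level equal, and the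
  difference is late for good.\<close>

lemma forced:
  assumes lit: "pos = no_literal" "neg = no_literal" and "0 < m"
    and top_state: "X (12 * m) (gst (12 * m - 1) 0 1) \<noteq> X (12 * m) (gst (12 * m - 1) 0 0)"
  shows "\<exists>c. conform c (12 * m)"
proof -
  \<comment> \<open>Whatever is not a diamond at the start of a block is provisionally taken for a
    box; that it is one follows from the idle case below.\<close>
  define c where "c b \<longleftrightarrow> ops ! (12 * b) = letter (lown (12 * b)) True" for b
  have "twin m 0 (X 0)"
    by (auto simp: twin_def X_0 glab_def gst_simps) (simp_all add: gst_def)
  then have tw: "twin m t (X t)" if "t \<le> 12 * m" for t
    using twin_persist[OF lit, of 0 0 t] that by simp
  have "conform c t" if "t \<le> 12 * m" for t
    using that
  proof (induction t)
    case 0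
    then show ?case by (simp add: conform_def)
  next
    case (Suc t)
    then have cf: "conform c t" and t: "t < 12 * m" by auto
    define k where "k = t mod 12"
    define b where "b = t div 12"
    define a where "a = lown t"
    have a: "a \<in> {1, 2}" by (simp add: a_def lown_def)
    have V: "X t (gst t r sd) = (if k = 0 then r = 1 else \<not> dictated k (c b))" if "r < 2" "sd < 2" for r sd
      using X_unreached[OF cf order_refl t that] tab_diag[OF _ that(1), of k "c b"] by (simp add: k_def b_def)
    have k0: "c b \<longleftrightarrow> ops ! t = letter a True" if "k = 0"
    proof -
      have "t = 12 * b" using that by (auto simp: k_def b_def)
      then show ?thesis by (simp add: c_def a_def)
    qed
    have "ops ! t = letter a (dictated k (c b))"
    proof (rule ccontr)
      assume bad: "ops ! t \<noteq> letter a (dictated k (c b))"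
      obtain A tt where At: "ops ! t = (A, tt)" by (cases "ops ! t")
      have "(A, tt) \<in> set ops" using At nth_mem[of t ops] t len by simp
      note o = ops[OF this]
      have X1: "X (Suc t) (gst t r sd) = modal (2 + 48 * m) gown (gedge pos neg) A tt (X t) (gst t r sd)"
        if "r < 2" "sd < 2" for r sd
        using X_Suc[OF t gst_less[OF t that]] At by simp
      have g: "gown (gst t r sd) = a" if "r < 2" "sd < 2" for r sd
        using gown_gst[OF that] by (simp add: a_def)
      have "X (Suc t) (gst t r 0) = X (Suc t) (gst t r 1)" if r: "r < 2" for r
      proof -
        have s: "(0::nat) < 2" "(1::nat) < 2" by simp_all
        have own: "gown q \<in> {1, 2}" for q by (simp add: gown_def lown_def)
        consider (T) "(A, tt) = letter a True" | (F) "(A, tt) = letter a False"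
          | (I) "(A, tt) \<noteq> letter a True" "(A, tt) \<noteq> letter a False" by blast
        then show ?thesis
        proof cases
          case T
          have "\<not> dictated k (c b)" using bad T At by (metis (full_types))
          moreover from this have "k \<noteq> 0" using k0 T At by (cases "k = 0") (simp_all add: dictated_def)
          ultimately have "X t (gst t r sd)" if "sd < 2" for sd using V[OF r that] by simp
          then have "X (Suc t) (gst t r sd)" if "sd < 2" for sd
            using X1[OF r that] that modal_letter[where own = gown and q = "gst t r sd" and S = "2 + 48 * m" and
                ed = "gedge pos neg" and x = True and X = "X t", OF a own] by (simp add: T[symmetric])
          then show ?thesis using s by blast
        next
          case F
          have d: "dictated k (c b)" using bad F At by (metis (full_types))
          have "letter a True \<noteq> letter a False" by (simp add: letter_def)
          with d have "k \<noteq> 0" using k0 F At by (cases "k = 0") (simp_all add: dictated_def)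
          with d have "\<not> X t (gst t r sd)" if "sd < 2" for sd using V[OF r that] by simp
          then have "\<not> X (Suc t) (gst t r sd)" if "sd < 2" for sd
            using X1[OF r that] that modal_letter[where own = gown and q = "gst t r sd" and S = "2 + 48 * m" and
                ed = "gedge pos neg" and x = False and X = "X t", OF a own] by (simp add: F[symmetric])
          then show ?thesis using s by blast
        next
          case I
          have "X t (gst t r 0) = X t (gst t r 1)" using V[OF r s(1)] V[OF r s(2)] by simp
          then show ?thesis
            using modal_idle[OF conjunct1[OF o] conjunct2[OF o] a I, of gown "2 + 48 * m" "gedge pos neg" "X t"]
              g[OF r s(1)] g[OF r s(2)] X1[OF r s(1)] X1[OF r s(2)] by metis
        qed
      qed
      moreover have "twin m (Suc t) (X (Suc t))" using tw[of "Suc t"] Suc.prems by simp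
      \<comment> \<open>Level \<open>t\<close> should differ by now, but it does not: the difference
        is one level late.\<close>
      ultimately have "twin m t (X (Suc t))"
        unfolding twin_def by (metis Suc_leI le_neq_implies_less)
      then have "twin m (t + (12 * m - Suc t)) (X (Suc t + (12 * m - Suc t)))"
        by (rule twin_persist[OF lit]) (use Suc.prems in simp)
      moreover have "t + (12 * m - Suc t) = 12 * m - 1" "Suc t + (12 * m - Suc t) = 12 * m" using t by simp_all
      ultimately have "twin m (12 * m - 1) (X (12 * m))" by simp
      then show False using top_state \<open>0 < m\<close> by (auto simp: twin_def)
    qed
    then show ?case using cf by (auto simp: conform_def less_Suc_eq k_def b_def a_def)
  qed
  then show ?thesis by blast
qed

end

section \<open>Clauses as learning instances\<close>

definition top_state :: "nat \<Rightarrow> nat \<Rightarrow> nat" where "top_state m sd = gst (12 * m - 1) 0 sd"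

lemma top_state_less: "0 < m \<Longrightarrow> sd < 2 \<Longrightarrow> top_state m sd < 2 + 48 * m"
  unfolding top_state_def by (rule gst_less) auto

text \<open>The two structures without literals force the shape of the formula and thereby an
  assignment \<open>c\<close>. In the structure of a clause side 0 gets the value of side 1 only by
  crossing over at a literal that is true under \<open>c\<close>. The bound counts one modality per
  level and the atom.\<close>

theorem gadget_separable:
  assumes U1: "{UTemp Future, UTemp Globally} \<subseteq> U" and U2: "U \<subseteq> {UTemp Future, UTemp Globally, UNeg}"
    and m: "0 < m"
  shows "separable 2 U Bl n {..<1}
      (insert (gadget m no_literal no_literal (top_state m 1)) ((\<lambda>j. gadget m (pos j) (neg j) (top_state m 0)) ` J))
      {gadget m no_literal no_literal (top_state m 0)} (12 * m + 1) \<longleftrightarrow>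
    (\<exists>c. \<forall>j\<in>J. \<exists>b<m. c b \<and> pos j b \<or> \<not> c b \<and> neg j b)"
proof -
  have init: "cgs_sat 2 (gadget m p q q0) \<phi> \<longleftrightarrow> sat 2 (gadget m p q q0) q0 \<phi>" for p q q0 \<phi>
    by (simp add: cgs_sat_def gadget_def owned_cgs_def)
  have topl: "top_state m 0 < 2 + 48 * m" "top_state m 1 < 2 + 48 * m" using top_state_less[OF m] by simp_all
  have star0: "op_word.star p q c 0 m \<longleftrightarrow> (\<exists>b<m. c b \<and> p b \<or> \<not> c b \<and> q b)"
    if "op_word m q0 ops" for p q c q0 ops
    using that by (simp add: op_word.star_def)
  show ?thesis
  proof
    assume "separable 2 U Bl n {..<1}
      (insert (gadget m no_literal no_literal (top_state m 1)) ((\<lambda>j. gadget m (pos j) (neg j) (top_state m 0)) ` J))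
      {gadget m no_literal no_literal (top_state m 0)} (12 * m + 1)"
    then obtain \<phi> where \<phi>: "in_fragment 2 {..<1} U Bl \<phi>" "atl_size \<phi> \<le> 12 * m + 1"
      "sat 2 (gadget m no_literal no_literal (top_state m 1)) (top_state m 1) \<phi>"
      "\<And>j. j \<in> J \<Longrightarrow> sat 2 (gadget m (pos j) (neg j) (top_state m 0)) (top_state m 0) \<phi>"
      "\<not> sat 2 (gadget m no_literal no_literal (top_state m 0)) (top_state m 0) \<phi>"
      unfolding separable_def by (auto simp: init)
    have ne: "sat 2 (gadget m no_literal no_literal (top_state m 1)) (top_state m 1) \<phi> \<noteq>
        sat 2 (gadget m no_literal no_literal (top_state m 1)) (top_state m 0) \<phi>"
      using \<phi>(3,5) sat_gadget_init by metis
    have "12 * m \<le> td \<phi>"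
    proof (rule ccontr)
      assume "\<not> 12 * m \<le> td \<phi>"
      then have "twin m (12 * m - 1) (\<lambda>q. sat 2 (gadget m no_literal no_literal (top_state m 1)) q \<phi>)"
        by (intro twin_mono[OF twin_formula[OF U2 topl(2) \<phi>(1)]]) simp
      then show False using ne m by (auto simp: twin_def top_state_def)
    qed
    then obtain p ops where ops: "\<phi> = chain p ops" "length ops = td \<phi>"
      using tight_formula[of \<phi>] \<phi>(2) by auto
    have len: "length ops = 12 * m"
      using \<open>12 * m \<le> td \<phi>\<close> ops \<phi>(2) chain_sizes(1)[of p ops] by simp
    have frag: "p = 0" "\<And>A t. (A, t) \<in> set ops \<Longrightarrow> A \<subseteq> {1..2} \<and> UTemp t \<in> U"
      using \<phi>(1) unfolding ops(1) chain_fragment by auto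
    have valid: "A \<subseteq> {1..2} \<and> t \<in> {Future, Globally}" if "(A, t) \<in> set ops" for A t
      using frag(2)[OF that] U2 by auto
    have w: "op_word m q0 ops" if "q0 < 2 + 48 * m" for q0
      using len that valid by (simp add: op_word_def)
    have X: "op_word.X m p q q0 ops (12 * m) r = sat 2 (gadget m p q q0) r \<phi>" if "q0 < 2 + 48 * m" for p q q0 r
      unfolding op_word.X_def[OF w[OF that]] ops(1) frag(1) using len by simp
    have "\<exists>c. op_word.conform ops c (12 * m)"
      by (rule op_word.forced[OF w[OF topl(2)] refl refl m]) (use ne X[OF topl(2)] in \<open>simp add: top_state_def\<close>)
    then obtain c where c: "op_word.conform ops c (12 * m)" by blast
    have "\<exists>b<m. c b \<and> pos j b \<or> \<not> c b \<and> neg j b" if "j \<in> J" for j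
      using op_word.X_top[OF w[OF topl(1)] c m, of 0 "pos j" "neg j"] \<phi>(4)[OF that] X[OF topl(1)]
        star0[OF w[OF topl(1)]] by (simp add: top_state_def)
    then show "\<exists>c. \<forall>j\<in>J. \<exists>b<m. c b \<and> pos j b \<or> \<not> c b \<and> neg j b" by blast
  next
    assume "\<exists>c. \<forall>j\<in>J. \<exists>b<m. c b \<and> pos j b \<or> \<not> c b \<and> neg j b"
    then obtain c where c: "\<And>j. j \<in> J \<Longrightarrow> \<exists>b<m. c b \<and> pos j b \<or> \<not> c b \<and> neg j b" by blast
    define ops where "ops = map (\<lambda>s. letter (lown s) (dictated (s mod 12) (c (s div 12)))) [0..<12 * m]"
    define \<phi> where "\<phi> = chain 0 ops"
    have len: "length ops = 12 * m" by (simp add: ops_def)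
    have valid: "A \<subseteq> {1..2} \<and> t \<in> {Future, Globally}" if "(A, t) \<in> set ops" for A t
      using that by (auto simp: ops_def letter_def lown_def split: if_splits)
    have w: "op_word m q0 ops" if "q0 < 2 + 48 * m" for q0
      using len that valid by (simp add: op_word_def)
    have X: "op_word.X m p q q0 ops (12 * m) r = sat 2 (gadget m p q q0) r \<phi>" if "q0 < 2 + 48 * m" for p q q0 r
      unfolding op_word.X_def[OF w[OF that]] \<phi>_def using len by simp
    have cf: "op_word.conform ops c (12 * m)"
      unfolding op_word.conform_def[OF w[OF topl(1)]] by (simp add: ops_def)
    have star: "sat 2 (gadget m p q (top_state m sd)) (top_state m sd) \<phi> = op_word.star p q c sd m" if "sd < 2" for p q sd
      using op_word.X_top[OF w[OF top_state_less[OF m that]] cf m that, of p q] X[OF top_state_less[OF m that], of p q "top_state m sd"]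
      by (simp add: top_state_def)
    show "separable 2 U Bl n {..<1}
      (insert (gadget m no_literal no_literal (top_state m 1)) ((\<lambda>j. gadget m (pos j) (neg j) (top_state m 0)) ` J))
      {gadget m no_literal no_literal (top_state m 0)} (12 * m + 1)"
      unfolding separable_def
    proof (intro exI conjI ballI)
      have "UTemp t \<in> U" if "(A, t) \<in> set ops" for A t
        using valid[OF that] U1 by auto
      then show "in_fragment 2 {..<1} U Bl \<phi>"
        unfolding \<phi>_def chain_fragment using valid by blast
      show "atl_size \<phi> \<le> 12 * m + 1" "atl_bin_size \<phi> \<le> n"
        by (simp_all add: \<phi>_def chain_sizes len)
      show "cgs_sat 2 C \<phi>"
        if "C \<in> insert (gadget m no_literal no_literal (top_state m 1)) ((\<lambda>j. gadget m (pos j) (neg j) (top_state m 0)) ` J)" for C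
        using that c star0[OF w[OF topl(1)]] star[of 1] star[of 0]
        by (auto simp: init op_word.star_def[OF w[OF topl(1)]])
      show "\<not> cgs_sat 2 C \<phi>" if "C \<in> {gadget m no_literal no_literal (top_state m 0)}" for C
        using that star0[OF w[OF topl(1)]] star[of 0] by (auto simp: init)
    qed
  qed
qed

section \<open>Membership in NP\<close>

lemma concat_concat_map: "concat (concat (map f xs)) = concat (map (\<lambda>x. concat (f x)) xs)"
  by (induction xs) auto

lemma enc_state_two:
  "enc_state 2 m C q = [q \<in> cgs_init C] @ map (\<lambda>p. p \<in> cgs_label C q) [0..<m] @
     enc_nat (cgs_actions C q 1) @ enc_nat (cgs_actions C q 2) @
     concat (map (\<lambda>i. concat (map (\<lambda>j. enc_nat (cgs_delta C q [Suc i, Suc j])) [0..<cgs_actions C q 2]))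
       [0..<cgs_actions C q 1])"
proof -
  have a: "[1..<Suc n] = map Suc [0..<n]" for n by (simp add: map_Suc_upt)
  have two: "[1..<Suc 2] = [1, 2]" by (simp add: upt_rec)
  have "map (\<lambda>\<alpha>. enc_nat (cgs_delta C q \<alpha>)) (tuple_list 2 C q) =
      concat (map (\<lambda>i. map (\<lambda>j. enc_nat (cgs_delta C q [Suc i, Suc j])) [0..<cgs_actions C q 2]) [0..<cgs_actions C q 1])"
    unfolding tuple_list_def two unfolding list.map product_lists.simps unfolding a map_map comp_def
    by (simp add: map_concat comp_def concat_map_singleton)
  then have "concat (map (\<lambda>\<alpha>. enc_nat (cgs_delta C q \<alpha>)) (tuple_list 2 C q)) =
      concat (map (\<lambda>i. concat (map (\<lambda>j. enc_nat (cgs_delta C q [Suc i, Suc j])) [0..<cgs_actions C q 2])) [0..<cgs_actions C q 1])"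
    by (simp only: concat_concat_map)
  then show ?thesis unfolding enc_state_def two by simp
qed

text \<open>A certificate is a function of a tag and four arguments. Tags: 0 global parameters
  (propositions, positive and negative structures, bound, nodes); 1 states; 2 initial states;
  3 labels; 4 and 5 actions; 6 transitions; 7 operator codes of the nodes of the formula, and 8, 9
  their arguments; 10 truth values; 11 ranks. Operator codes: 0 atom; 1 negation; 2 to 11 binary
  operators; 12 to 15 \<open>Future\<close> and 16 to 19 \<open>Globally\<close>, each with a code for the coalition.\<close>

type_synonym cert = "nat \<Rightarrow> nat \<Rightarrow> nat \<Rightarrow> nat \<Rightarrow> nat \<Rightarrow> nat"

definition cert_cgs :: "cert \<Rightarrow> nat \<Rightarrow> cgs" where
  "cert_cgs F c =
     \<lparr>cgs_states = F 1 c 0 0 0, cgs_init = {q. q < F 1 c 0 0 0 \<and> 0 < F 2 c q 0 0},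
      cgs_label = (\<lambda>q. {p. p < F 0 0 0 0 0 \<and> 0 < F 3 c q p 0}),
      cgs_actions = (\<lambda>q a. if a = 1 then F 4 c q 0 0 else F 5 c q 0 0),
      cgs_delta = (\<lambda>q \<alpha>. F 6 c q (\<alpha> ! 0) (\<alpha> ! 1))\<rparr>"

definition coalition :: "nat \<Rightarrow> nat set" where
  "coalition cd = {a. a = 1 \<and> cd mod 2 = 1 \<or> a = 2 \<and> cd div 2 = 1}"

definition binops :: "binop list" where
  "binops = [Or, And, Imp, RevImp, Iff, NOr, NAnd, NImp, NRevImp, NIff]"

definition cert_pre :: "cert \<Rightarrow> nat \<Rightarrow> nat \<Rightarrow> (nat \<Rightarrow> bool) \<Rightarrow> nat \<Rightarrow> bool" where
  "cert_pre F c cd X q \<longleftrightarrow>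
     (\<exists>i<F 4 c q 0 0. \<exists>j<F 5 c q 0 0. \<forall>i'<F 4 c q 0 0. \<forall>j'<F 5 c q 0 0.
        (cd mod 2 = 1 \<longrightarrow> i' = i) \<and> (cd div 2 = 1 \<longrightarrow> j' = j) \<longrightarrow> X (F 6 c q (Suc i') (Suc j')))"

definition cert_node :: "unop set \<Rightarrow> binop set \<Rightarrow> cert \<Rightarrow> nat \<Rightarrow> bool" where
  "cert_node U Bl F j \<longleftrightarrow> F 7 j 0 0 0 < 20 \<and>
     (F 7 j 0 0 0 = 0 \<longrightarrow> F 8 j 0 0 0 < F 0 0 0 0 0) \<and>
     (0 < F 7 j 0 0 0 \<longrightarrow> F 8 j 0 0 0 < j) \<and>
     (F 7 j 0 0 0 = 1 \<longrightarrow> UNeg \<in> U) \<and>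
     (2 \<le> F 7 j 0 0 0 \<and> F 7 j 0 0 0 < 12 \<longrightarrow>
        F 9 j 0 0 0 < j \<and> (F 7 j 0 0 0 - 2 < 10 \<and> binops ! (F 7 j 0 0 0 - 2) \<in> Bl))"

definition cert_value :: "cert \<Rightarrow> nat \<Rightarrow> nat \<Rightarrow> nat \<Rightarrow> bool" where
  "cert_value F c j q \<longleftrightarrow>
     (F 7 j 0 0 0 = 0 \<longrightarrow> (0 < F 10 c j q 0) = (0 < F 3 c q (F 8 j 0 0 0) 0)) \<and>
     (F 7 j 0 0 0 = 1 \<longrightarrow> (0 < F 10 c j q 0) = (\<not> 0 < F 10 c (F 8 j 0 0 0) q 0)) \<and>
     (2 \<le> F 7 j 0 0 0 \<and> F 7 j 0 0 0 < 12 \<longrightarrow> (F 7 j 0 0 0 - 2 < 10 \<and> (0 < F 10 c j q 0) =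
        binop_sem (binops ! (F 7 j 0 0 0 - 2)) (0 < F 10 c (F 8 j 0 0 0) q 0) (0 < F 10 c (F 9 j 0 0 0) q 0))) \<and>
     (12 \<le> F 7 j 0 0 0 \<and> F 7 j 0 0 0 < 16 \<longrightarrow>
        (if 0 < F 10 c j q 0
         then 0 < F 10 c (F 8 j 0 0 0) q 0 \<or>
           cert_pre F c (F 7 j 0 0 0 - 12) (\<lambda>q'. 0 < F 10 c j q' 0 \<and> F 11 c j q' 0 < F 11 c j q 0) q
         else \<not> 0 < F 10 c (F 8 j 0 0 0) q 0 \<and>
           \<not> cert_pre F c (F 7 j 0 0 0 - 12) (\<lambda>q'. 0 < F 10 c j q' 0) q)) \<and>
     (16 \<le> F 7 j 0 0 0 \<longrightarrow>
        (if 0 < F 10 c j q 0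
         then 0 < F 10 c (F 8 j 0 0 0) q 0 \<and> cert_pre F c (F 7 j 0 0 0 - 16) (\<lambda>q'. 0 < F 10 c j q' 0) q
         else 0 < F 10 c (F 8 j 0 0 0) q 0 \<longrightarrow>
           \<not> cert_pre F c (F 7 j 0 0 0 - 16) (\<lambda>q'. \<not> (\<not> 0 < F 10 c j q' 0 \<and> F 11 c j q' 0 < F 11 c j q 0)) q))"

text \<open>The last node is the formula. Producing the encoding in the first conjunct replaces any
  decoding of \<open>x\<close>.\<close>

definition cert_ok :: "unop set \<Rightarrow> binop set \<Rightarrow> nat \<Rightarrow> bool list \<Rightarrow> cert \<Rightarrow> bool" where
  "cert_ok U Bl n x F \<longleftrightarrow>
     x = enc_input 2 (F 0 0 0 0 0) (map (cert_cgs F) [0..<F 0 1 0 0 0])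
       (map (\<lambda>c. cert_cgs F (F 0 1 0 0 0 + c)) [0..<F 0 2 0 0 0]) (F 0 3 0 0 0) \<and>
     (\<forall>c<F 0 1 0 0 0 + F 0 2 0 0 0. \<forall>q<F 1 c 0 0 0. 1 \<le> F 4 c q 0 0 \<and> 1 \<le> F 5 c q 0 0 \<and>
        (\<forall>i<F 4 c q 0 0. \<forall>j<F 5 c q 0 0. F 6 c q (Suc i) (Suc j) < F 1 c 0 0 0)) \<and>
     0 < F 0 4 0 0 0 \<and> F 0 4 0 0 0 \<le> F 0 3 0 0 0 \<and>
     (\<Sum>j<F 0 4 0 0 0. of_bool (2 \<le> F 7 j 0 0 0 \<and> F 7 j 0 0 0 < 12)) \<le> n \<and>
     (\<forall>j<F 0 4 0 0 0. cert_node U Bl F j) \<and>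
     (\<forall>c<F 0 1 0 0 0 + F 0 2 0 0 0. \<forall>j<F 0 4 0 0 0. \<forall>q<F 1 c 0 0 0. cert_value F c j q) \<and>
     (\<forall>c<F 0 1 0 0 0. \<forall>q<F 1 c 0 0 0. 0 < F 2 c q 0 0 \<longrightarrow> 0 < F 10 c (F 0 4 0 0 0 - 1) q 0) \<and>
     (\<forall>c<F 0 2 0 0 0. \<exists>q<F 1 (F 0 1 0 0 0 + c) 0 0 0. 0 < F 2 (F 0 1 0 0 0 + c) q 0 0 \<and>
        \<not> 0 < F 10 (F 0 1 0 0 0 + c) (F 0 4 0 0 0 - 1) q 0)"

section \<open>Soundness of certificates\<close>

lemma coalition_subset: "coalition cd \<subseteq> {1..2}"
  by (auto simp: coalition_def)

lemma pre_two:
  "pre 2 C (coalition cd) X q \<longleftrightarrow>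
     (\<exists>i<cgs_actions C q 1. \<exists>j<cgs_actions C q 2. \<forall>i'<cgs_actions C q 1. \<forall>j'<cgs_actions C q 2.
        (cd mod 2 = 1 \<longrightarrow> i' = i) \<and> (cd div 2 = 1 \<longrightarrow> j' = j) \<longrightarrow> X (cgs_delta C q [Suc i', Suc j']))"
proof -
  have l: "legal_tuples 2 C q = (\<lambda>(i, j). [Suc i, Suc j]) ` ({..<cgs_actions C q 1} \<times> {..<cgs_actions C q 2})"
    (is "_ = ?R")
  proof (rule set_eqI)
    fix \<alpha>
    show "\<alpha> \<in> legal_tuples 2 C q \<longleftrightarrow> \<alpha> \<in> ?R"
    proof
      assume "\<alpha> \<in> legal_tuples 2 C q"
      then obtain a b where ab: "a \<in> {1..cgs_actions C q 1}" "b \<in> {1..cgs_actions C q 2}" "\<alpha> = [a, b]"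
        unfolding legal_tuples_two by blast
      then show "\<alpha> \<in> ?R" by (intro image_eqI[of _ _ "(a - 1, b - 1)"]) auto
    qed (auto simp: legal_tuples_two)
  qed
  have ag: "agree (coalition cd) [Suc i, Suc j] [Suc i', Suc j'] \<longleftrightarrow>
      (cd mod 2 = 1 \<longrightarrow> i' = i) \<and> (cd div 2 = 1 \<longrightarrow> j' = j)" for i j i' j'
    by (auto simp: agree_def coalition_def)
  have "pre 2 C (coalition cd) X q \<longleftrightarrow>
     (\<exists>i\<in>{..<cgs_actions C q 1}. \<exists>j\<in>{..<cgs_actions C q 2}. \<forall>i'\<in>{..<cgs_actions C q 1}. \<forall>j'\<in>{..<cgs_actions C q 2}.
        agree (coalition cd) [Suc i, Suc j] [Suc i', Suc j'] \<longrightarrow> X (cgs_delta C q [Suc i', Suc j']))"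
    unfolding pre_def l by (simp add: split_beta del: lessThan_iff)
  then show ?thesis unfolding ag by (simp only: Bex_def Ball_def lessThan_iff)
qed

lemma cert_pre_eq: "pre 2 (cert_cgs F c) (coalition cd) X q = cert_pre F c cd X q"
  unfolding pre_two cert_pre_def by (simp add: cert_cgs_def)

definition node_form :: "(nat \<Rightarrow> atl) \<Rightarrow> nat \<Rightarrow> nat \<Rightarrow> nat \<Rightarrow> atl" where
  "node_form f o' l r = (if o' = 0 then Atom l else if o' = 1 then Neg (f l)
     else if o' < 12 then Bin (binops ! (o' - 2)) (f l) (f r)
     else if o' < 16 then Coop (coalition (o' - 12)) Future (f l)
     else Coop (coalition (o' - 16)) Globally (f l))"

text \<open>Arguments have smaller numbers than the nodes that use them, so the formulas are defined
  by recursion on the node.\<close>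

lemma node_forms_exist:
  assumes "\<And>j. j < K \<Longrightarrow> 0 < op j \<Longrightarrow> l j < j"
    and "\<And>j. j < K \<Longrightarrow> 2 \<le> op j \<Longrightarrow> op j < 12 \<Longrightarrow> r j < j"
  shows "\<exists>f. \<forall>j<K. f j = node_form f (op j) (l j) (r j)"
  using assms
proof (induction K)
  case (Suc K)
  then obtain f where f: "\<And>j. j < K \<Longrightarrow> f j = node_form f (op j) (l j) (r j)" by force
  define g where "g = f(K := node_form f (op K) (l K) (r K))"
  have "g j = node_form g (op j) (l j) (r j)" if "j < Suc K" for j
  proof -
    have "node_form g (op j) (l j) (r j) = node_form f (op j) (l j) (r j)"
      using Suc.prems(1)[OF that] Suc.prems(2)[OF that] that by (auto simp: node_form_def g_def)
    then show ?thesis using f that by (cases "j = K") (auto simp: g_def)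
  qed
  then show ?case by blast
qed simp

text \<open>Different nodes may denote the same formula. This can only lower the number of
  subformulas, so the bounds on the numbers of nodes carry over to the formula.\<close>

theorem cert_sound:
  assumes U: "{UTemp Future, UTemp Globally} \<subseteq> U" and ok: "cert_ok U Bl n x F"
  shows "x \<in> ATL_Learn 2 U Bl n"
proof -
  define m nP nN B K where d: "m = F 0 0 0 0 0" "nP = F 0 1 0 0 0" "nN = F 0 2 0 0 0" "B = F 0 3 0 0 0" "K = F 0 4 0 0 0"
  let ?C = "cert_cgs F"
  note ok' = ok[unfolded cert_ok_def d[symmetric]]
  have node: "cert_node U Bl F j" if "j < K" for j using ok' that by blast
  obtain f where f: "\<And>j. j < K \<Longrightarrow> f j = node_form f (F 7 j 0 0 0) (F 8 j 0 0 0) (F 9 j 0 0 0)"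
    using node_forms_exist[of K "\<lambda>j. F 7 j 0 0 0" "\<lambda>j. F 8 j 0 0 0" "\<lambda>j. F 9 j 0 0 0"] node
    unfolding cert_node_def by blast
  have arg: "0 < F 7 j 0 0 0 \<Longrightarrow> F 8 j 0 0 0 < j"
    "2 \<le> F 7 j 0 0 0 \<Longrightarrow> F 7 j 0 0 0 < 12 \<Longrightarrow> F 9 j 0 0 0 < j" if "j < K" for j
    using node[OF that] unfolding cert_node_def by auto
  have frag: "in_fragment 2 {..<m} U Bl (f j)" if "j < K" for j
    using that
  proof (induction j rule: less_induct)
    case (less j)
    have "in_fragment 2 {..<m} U Bl (f (F 8 j 0 0 0))" if "0 < F 7 j 0 0 0"
      using less arg(1)[OF less.prems that] by simp
    moreover have "in_fragment 2 {..<m} U Bl (f (F 9 j 0 0 0))" if "2 \<le> F 7 j 0 0 0" "F 7 j 0 0 0 < 12"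
      using less arg(2)[OF less.prems that] by simp
    ultimately show ?case
      using f[OF less.prems] node[OF less.prems] U coalition_subset
      by (auto simp: node_form_def cert_node_def d)
  qed
  have sub: "subformulas (f j) \<subseteq> f ` {..j}" if "j < K" for j
    using that
  proof (induction j rule: less_induct)
    case (less j)
    have mono: "f ` {..i} \<subseteq> f ` {..j}" if "i < j" for i using that by auto
    have "subformulas (f (F 8 j 0 0 0)) \<subseteq> f ` {..j}" if "0 < F 7 j 0 0 0"
      using less.IH[OF arg(1)[OF less.prems that]] mono[OF arg(1)[OF less.prems that]]
        arg(1)[OF less.prems that] less.prems by auto
    moreover have "subformulas (f (F 9 j 0 0 0)) \<subseteq> f ` {..j}" if "2 \<le> F 7 j 0 0 0" "F 7 j 0 0 0 < 12"
      using less.IH[OF arg(2)[OF less.prems that]] mono[OF arg(2)[OF less.prems that]]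
        arg(2)[OF less.prems that] less.prems by auto
    moreover have "subformulas (f j) \<subseteq> insert (f j)
        ((if 0 < F 7 j 0 0 0 then subformulas (f (F 8 j 0 0 0)) else {}) \<union>
         (if 2 \<le> F 7 j 0 0 0 \<and> F 7 j 0 0 0 < 12 then subformulas (f (F 9 j 0 0 0)) else {}))"
      unfolding f[OF less.prems] node_form_def by auto
    ultimately show ?case by (auto split: if_splits)
  qed
  define \<phi> where "\<phi> = f (K - 1)"
  have K: "0 < K" "K \<le> B" using ok' by auto
  have subK: "subformulas \<phi> \<subseteq> f ` {..<K}"
    using sub[of "K - 1"] K by (auto simp: \<phi>_def)
  have "atl_size \<phi> \<le> card (f ` {..<K})" unfolding atl_size_def by (rule card_mono[OF _ subK]) simp
  then have size: "atl_size \<phi> \<le> B" using card_image_le[of "{..<K}" f] K by simp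
  have "{\<psi> \<in> subformulas \<phi>. \<exists>b \<psi>1 \<psi>2. \<psi> = Bin b \<psi>1 \<psi>2} \<subseteq> f ` {j \<in> {..<K}. 2 \<le> F 7 j 0 0 0 \<and> F 7 j 0 0 0 < 12}"
  proof
    fix \<psi> assume "\<psi> \<in> {\<psi> \<in> subformulas \<phi>. \<exists>b \<psi>1 \<psi>2. \<psi> = Bin b \<psi>1 \<psi>2}"
    then obtain b \<psi>1 \<psi>2 where b: "\<psi> \<in> subformulas \<phi>" "\<psi> = Bin b \<psi>1 \<psi>2" by blast
    then obtain j where "j < K" "\<psi> = f j" using subK by blast
    with b have j: "j < K" "\<psi> = f j" "f j = Bin b \<psi>1 \<psi>2" by simp_all
    then have "2 \<le> F 7 j 0 0 0 \<and> F 7 j 0 0 0 < 12"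
      using f[OF j(1)] by (auto simp: node_form_def split: if_splits)
    then show "\<psi> \<in> f ` {j \<in> {..<K}. 2 \<le> F 7 j 0 0 0 \<and> F 7 j 0 0 0 < 12}" using j by blast
  qed
  then have "atl_bin_size \<phi> \<le> card (f ` {j \<in> {..<K}. 2 \<le> F 7 j 0 0 0 \<and> F 7 j 0 0 0 < 12})"
    unfolding atl_bin_size_def by (rule card_mono[rotated]) simp
  also have "\<dots> \<le> card {j \<in> {..<K}. 2 \<le> F 7 j 0 0 0 \<and> F 7 j 0 0 0 < 12}" by (rule card_image_le) simp
  also have "\<dots> = (\<Sum>j<K. of_bool (2 \<le> F 7 j 0 0 0 \<and> F 7 j 0 0 0 < 12))"
    by (simp add: of_bool_def sum.If_cases Int_def)
  also have "\<dots> \<le> n" using ok' by blast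
  finally have bin: "atl_bin_size \<phi> \<le> n" .
  have wf: "wf_cgs 2 {..<m} (?C c)" if "c < nP + nN" for c
  proof -
    have h: "\<And>q. q < F 1 c 0 0 0 \<Longrightarrow> 1 \<le> F 4 c q 0 0 \<and> 1 \<le> F 5 c q 0 0 \<and>
        (\<forall>i<F 4 c q 0 0. \<forall>j<F 5 c q 0 0. F 6 c q (Suc i) (Suc j) < F 1 c 0 0 0)"
      using ok' that by blast
    have "F 6 c q a b < F 1 c 0 0 0" if q: "q < F 1 c 0 0 0" and ab: "a \<in> {1..F 4 c q 0 0}" "b \<in> {1..F 5 c q 0 0}" for q a b
    proof -
      obtain i j where "a = Suc i" "b = Suc j" "i < F 4 c q 0 0" "j < F 5 c q 0 0"
        using ab by (cases a; cases b) auto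
      then show ?thesis using h[OF q] by blast
    qed
    then show ?thesis
      using h by (auto simp: wf_cgs_def legal_tuples_two cert_cgs_def d)
  qed
  have val: "sat 2 (?C c) q (f j) = (0 < F 10 c j q 0)" if c: "c < nP + nN" and jq: "j < K" "q < F 1 c 0 0 0" for c j q
    using jq
  proof (induction j arbitrary: q rule: less_induct)
    case (less j)
    have S: "cgs_states (?C c) = F 1 c 0 0 0" by (simp add: cert_cgs_def)
    have v: "cert_value F c j q" if "q < F 1 c 0 0 0" for q using ok' c less.prems(1) that by blast
    note fj = f[OF less.prems(1)]
    have IH8: "sat 2 (?C c) q (f (F 8 j 0 0 0)) = (0 < F 10 c (F 8 j 0 0 0) q 0)" if "q < F 1 c 0 0 0" "0 < F 7 j 0 0 0" for q
      using less.IH[OF arg(1)[OF less.prems(1) that(2)] _ that(1)] arg(1)[OF less.prems(1) that(2)] less.prems(1) by simp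
    have IH9: "sat 2 (?C c) q (f (F 9 j 0 0 0)) = (0 < F 10 c (F 9 j 0 0 0) q 0)" if "2 \<le> F 7 j 0 0 0" "F 7 j 0 0 0 < 12"
      using less.IH[OF arg(2)[OF less.prems(1) that] _ less.prems(2)] arg(2)[OF less.prems(1) that] less.prems(1) by simp
    consider "F 7 j 0 0 0 = 0" | "F 7 j 0 0 0 = 1" | "2 \<le> F 7 j 0 0 0" "F 7 j 0 0 0 < 12"
      | "12 \<le> F 7 j 0 0 0" "F 7 j 0 0 0 < 16" | "16 \<le> F 7 j 0 0 0" by linarith
    then show ?case
    proof cases
      case 1
      then show ?thesis
        using fj v[OF less.prems(2)] node[OF less.prems(1)]
        by (simp add: node_form_def cert_value_def cert_node_def) (simp add: cert_cgs_def)
    next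
      case 2
      then show ?thesis
        using fj v[OF less.prems(2)] IH8[OF less.prems(2)] by (simp add: node_form_def cert_value_def)
    next
      case 3
      then show ?thesis
        using fj v[OF less.prems(2)] IH8[OF less.prems(2)] IH9 by (simp add: node_form_def cert_value_def)
    next
      case 4
      have fj': "f j = Coop (coalition (F 7 j 0 0 0 - 12)) Future (f (F 8 j 0 0 0))"
        using fj 4 by (simp add: node_form_def)
      have "table_ok 2 (?C c) (coalition (F 7 j 0 0 0 - 12)) Future (\<lambda>q. sat 2 (?C c) q (f (F 8 j 0 0 0)))
          (\<lambda>q. 0 < F 10 c j q 0) (\<lambda>q. F 11 c j q 0)"
        unfolding table_ok_def S
      proof (intro allI impI)
        fix q assume q: "q < F 1 c 0 0 0"
        show "if Future = Future then if 0 < F 10 c j q 0 then sat 2 (?C c) q (f (F 8 j 0 0 0)) \<or>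
            pre 2 (?C c) (coalition (F 7 j 0 0 0 - 12)) (\<lambda>q'. 0 < F 10 c j q' 0 \<and> F 11 c j q' 0 < F 11 c j q 0) q
          else \<not> sat 2 (?C c) q (f (F 8 j 0 0 0)) \<and> \<not> pre 2 (?C c) (coalition (F 7 j 0 0 0 - 12)) (\<lambda>q. 0 < F 10 c j q 0) q
          else if 0 < F 10 c j q 0 then sat 2 (?C c) q (f (F 8 j 0 0 0)) \<and>
            pre 2 (?C c) (coalition (F 7 j 0 0 0 - 12)) (\<lambda>q. 0 < F 10 c j q 0) q
          else sat 2 (?C c) q (f (F 8 j 0 0 0)) \<longrightarrow> \<not> pre 2 (?C c) (coalition (F 7 j 0 0 0 - 12))
            (\<lambda>q'. \<not> (\<not> 0 < F 10 c j q' 0 \<and> F 11 c j q' 0 < F 11 c j q 0)) q"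
          using v[OF q] IH8[OF q] 4 unfolding cert_pre_eq cert_value_def by simp
      qed
      from table_ok_sat[OF wf[OF c] coalition_subset _ this] less.prems(2) S
      show ?thesis unfolding fj' by simp
    next
      case 5
      have fj': "f j = Coop (coalition (F 7 j 0 0 0 - 16)) Globally (f (F 8 j 0 0 0))"
        using fj 5 by (simp add: node_form_def)
      have "table_ok 2 (?C c) (coalition (F 7 j 0 0 0 - 16)) Globally (\<lambda>q. sat 2 (?C c) q (f (F 8 j 0 0 0)))
          (\<lambda>q. 0 < F 10 c j q 0) (\<lambda>q. F 11 c j q 0)"
        unfolding table_ok_def S
      proof (intro allI impI)
        fix q assume q: "q < F 1 c 0 0 0"
        show "if Globally = Future then if 0 < F 10 c j q 0 then sat 2 (?C c) q (f (F 8 j 0 0 0)) \<or>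
            pre 2 (?C c) (coalition (F 7 j 0 0 0 - 16)) (\<lambda>q'. 0 < F 10 c j q' 0 \<and> F 11 c j q' 0 < F 11 c j q 0) q
          else \<not> sat 2 (?C c) q (f (F 8 j 0 0 0)) \<and> \<not> pre 2 (?C c) (coalition (F 7 j 0 0 0 - 16)) (\<lambda>q. 0 < F 10 c j q 0) q
          else if 0 < F 10 c j q 0 then sat 2 (?C c) q (f (F 8 j 0 0 0)) \<and>
            pre 2 (?C c) (coalition (F 7 j 0 0 0 - 16)) (\<lambda>q. 0 < F 10 c j q 0) q
          else sat 2 (?C c) q (f (F 8 j 0 0 0)) \<longrightarrow> \<not> pre 2 (?C c) (coalition (F 7 j 0 0 0 - 16))
            (\<lambda>q'. \<not> (\<not> 0 < F 10 c j q' 0 \<and> F 11 c j q' 0 < F 11 c j q 0)) q"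
          using v[OF q] IH8[OF q] 5 unfolding cert_pre_eq cert_value_def by (cases "0 < F 10 c j q 0") simp_all
      qed
      from table_ok_sat[OF wf[OF c] coalition_subset _ this] less.prems(2) S
      show ?thesis unfolding fj' by simp
    qed
  qed
  have "cgs_init (?C c) = {q. q < F 1 c 0 0 0 \<and> 0 < F 2 c q 0 0}" for c by (simp add: cert_cgs_def)
  then have cs: "cgs_sat 2 (?C c) \<phi> \<longleftrightarrow> (\<forall>q<F 1 c 0 0 0. 0 < F 2 c q 0 0 \<longrightarrow> 0 < F 10 c (K - 1) q 0)"
    if "c < nP + nN" for c
    using val[OF that, of "K - 1"] K unfolding cgs_sat_def \<phi>_def by auto
  have "separable 2 U Bl n {..<m} (set (map ?C [0..<nP])) (set (map (\<lambda>c. ?C (nP + c)) [0..<nN])) B"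
    unfolding separable_def
  proof (intro exI conjI ballI)
    show "in_fragment 2 {..<m} U Bl \<phi>" using frag[of "K - 1"] K by (simp add: \<phi>_def)
    show "cgs_sat 2 C \<phi>" if C: "C \<in> set (map ?C [0..<nP])" for C
    proof -
      obtain c where c: "c < nP" "C = ?C c" using C by auto
      then show ?thesis using cs[of c] ok' by simp
    qed
    show "\<not> cgs_sat 2 C \<phi>" if C: "C \<in> set (map (\<lambda>c. ?C (nP + c)) [0..<nN])" for C
    proof -
      obtain c where c: "c < nN" "C = ?C (nP + c)" using C by auto
      have "\<exists>q<F 1 (nP + c) 0 0 0. 0 < F 2 (nP + c) q 0 0 \<and> \<not> 0 < F 10 (nP + c) (K - 1) q 0"
        using ok' c(1) by blast
      then show ?thesis using cs[of "nP + c"] c by auto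
    qed
  qed (rule size bin)+
  moreover have "\<forall>C\<in>set (map ?C [0..<nP]) \<union> set (map (\<lambda>c. ?C (nP + c)) [0..<nN]). wf_cgs 2 {..<m} C"
    using wf by auto
  moreover have "x = enc_input 2 m (map ?C [0..<nP]) (map (\<lambda>c. ?C (nP + c)) [0..<nN]) B" using ok' by blast
  ultimately show ?thesis unfolding ATL_Learn_def by blast
qed


section \<open>Completeness of certificates\<close>

lemma length_enc_list: "length (enc_list e xs) = length xs + 1 + (\<Sum>z\<leftarrow>xs. length (e z))"
  by (simp add: enc_list_def enc_nat_def length_concat comp_def)

lemma length_enc_list_member: "z \<in> set xs \<Longrightarrow> length (e z) \<le> length (enc_list e xs)"
  using member_le_sum_list[of "length (e z)" "map (\<lambda>z. length (e z)) xs"] by (simp add: length_enc_list)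

lemma length_enc_cgs:
  assumes "q < cgs_states C"
  shows "cgs_actions C q 1 + cgs_actions C q 2 \<le> length (enc_cgs 2 m C)"
proof -
  have "cgs_actions C q 1 + cgs_actions C q 2 \<le> length (enc_state 2 m C q)"
    by (simp add: enc_state_two enc_nat_def)
  also have "\<dots> \<le> length (enc_cgs 2 m C)"
    unfolding enc_cgs_def by (rule length_enc_list_member) (use assms in simp)
  finally show ?thesis .
qed

lemma length_enc_cgs_states: "cgs_states C \<le> length (enc_cgs k m C)"
  by (simp add: enc_cgs_def length_enc_list)

lemma enc_list_cong:
  "length xs = length ys \<Longrightarrow> (\<And>i. i < length ys \<Longrightarrow> e (xs ! i) = e (ys ! i)) \<Longrightarrow> enc_list e xs = enc_list e ys"
proof -
  assume "length xs = length ys" "\<And>i. i < length ys \<Longrightarrow> e (xs ! i) = e (ys ! i)"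
  moreover from this have "map e xs = map e ys" by (intro nth_equalityI) auto
  ultimately show ?thesis by (simp add: enc_list_def)
qed

lemma subformula_trans: "\<psi> \<in> subformulas \<phi> \<Longrightarrow> subformulas \<psi> \<subseteq> subformulas \<phi>"
  by (induction \<phi>) auto

lemma subformula_refl: "\<phi> \<in> subformulas \<phi>"
  by (cases \<phi>) auto

lemma subformula_same_size: "\<psi> \<in> subformulas \<phi> \<Longrightarrow> size \<phi> \<le> size \<psi> \<Longrightarrow> \<psi> = \<phi>"
  by (cases \<phi>) (auto dest: subformula_size)

lemma subformula_fragment:
  "\<psi> \<in> subformulas \<phi> \<Longrightarrow> in_fragment k Props U Bl \<phi> \<Longrightarrow> in_fragment k Props U Bl \<psi>"
  by (induction \<phi>) auto

text \<open>Sorting by \<open>size\<close> puts arguments before the formulas that contain them, and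
  the whole formula at the end.\<close>

lemma subformula_list:
  "\<exists>\<psi>s. set \<psi>s = subformulas \<phi> \<and> distinct \<psi>s \<and> length \<psi>s = atl_size \<phi> \<and> \<psi>s ! (atl_size \<phi> - 1) = \<phi> \<and>
     (\<forall>i j. i < length \<psi>s \<and> j < length \<psi>s \<and> size (\<psi>s ! i) < size (\<psi>s ! j) \<longrightarrow> i < j)"
proof -
  obtain xs where xs: "set xs = subformulas \<phi>" "distinct xs"
    using finite_distinct_list[OF finite_subformulas] by blast
  define \<psi>s where "\<psi>s = sort_key size xs"
  have s: "set \<psi>s = subformulas \<phi>" "distinct \<psi>s" "sorted (map size \<psi>s)"
    using xs by (simp_all add: \<psi>s_def)
  then have len: "length \<psi>s = atl_size \<phi>" using distinct_card[OF s(2)] by (simp add: atl_size_def)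
  have le: "size (\<psi>s ! i) \<le> size (\<psi>s ! j)" if "i \<le> j" "j < length \<psi>s" for i j
    using sorted_nth_mono[OF s(3) that(1)] that by simp
  have "0 < atl_size \<phi>" using td_less_size[of \<phi>] by simp
  then have last: "\<psi>s ! (atl_size \<phi> - 1) \<in> subformulas \<phi>" using len s(1) nth_mem[of "atl_size \<phi> - 1" \<psi>s] by simp
  obtain i where i: "i < length \<psi>s" "\<psi>s ! i = \<phi>" using s(1) subformula_refl by (metis in_set_conv_nth)
  have "size \<phi> \<le> size (\<psi>s ! (atl_size \<phi> - 1))"
    using le[of i "atl_size \<phi> - 1"] i len by simp
  then have "\<psi>s ! (atl_size \<phi> - 1) = \<phi>" using subformula_same_size[OF last] by simp
  moreover have "i < j" if "i < length \<psi>s" "size (\<psi>s ! i) < size (\<psi>s ! j)" for i j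
    using le[of j i] that by (metis leD le_less_linear)
  ultimately show ?thesis using s len by blast
qed

definition binop_index :: "binop \<Rightarrow> nat" where
  "binop_index b = (LEAST i. i < 10 \<and> binops ! i = b)"

lemma binop_index: "binop_index b < 10" "binops ! binop_index b = b"
proof -
  have "\<exists>i<10. binops ! i = b"
  proof -
    have "b \<in> set binops" by (cases b) (simp_all add: binops_def)
    then obtain i where "i < length binops" "binops ! i = b" by (metis in_set_conv_nth)
    moreover have "length binops = 10" by (simp add: binops_def)
    ultimately show ?thesis by auto
  qed
  then have "binop_index b < 10 \<and> binops ! binop_index b = b"
    unfolding binop_index_def by (rule LeastI_ex)
  then show "binop_index b < 10" "binops ! binop_index b = b" by auto
qed

definition coalition_code :: "nat set \<Rightarrow> nat" where
  "coalition_code A = (if 1 \<in> A then 1 else 0) + (if 2 \<in> A then 2 else 0)"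

lemma coalition_code: "coalition_code A < 4" "A \<subseteq> {1..2} \<Longrightarrow> coalition (coalition_code A) = A"
proof -
  show "coalition_code A < 4" by (simp add: coalition_code_def)
  assume A: "A \<subseteq> {1..2}"
  have "a = 1 \<or> a = 2" if "a \<in> A" for a using A that by fastforce
  then show "coalition (coalition_code A) = A"
    by (auto simp: coalition_def coalition_code_def)
qed

fun op_code :: "atl \<Rightarrow> nat" where
  "op_code (Atom p) = 0"
| "op_code (Neg \<phi>) = 1"
| "op_code (Bin b \<phi> \<psi>) = 2 + binop_index b"
| "op_code (Coop A t \<phi>) = (if t = Future then 12 else 16) + coalition_code A"

lemma op_code_cases:
  "op_code \<phi> < 20"
  "(2 \<le> op_code \<phi> \<and> op_code \<phi> < 12) = (\<exists>b \<phi>1 \<phi>2. \<phi> = Bin b \<phi>1 \<phi>2)"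
proof -
  have "op_code \<phi> < 20 \<and> (2 \<le> op_code \<phi> \<and> op_code \<phi> < 12) = (\<exists>b \<phi>1 \<phi>2. \<phi> = Bin b \<phi>1 \<phi>2)"
  proof (cases \<phi>)
    case (Bin b \<phi>1 \<phi>2)
    then show ?thesis using binop_index(1)[of b] by simp
  next
    case (Coop A t \<phi>1)
    then show ?thesis using coalition_code(1)[of A] by simp
  qed simp_all
  then show "op_code \<phi> < 20" "(2 \<le> op_code \<phi> \<and> op_code \<phi> < 12) = (\<exists>b \<phi>1 \<phi>2. \<phi> = Bin b \<phi>1 \<phi>2)" by blast+
qed

text \<open>The data of a yes-instance: \<open>\<psi>s\<close> numbers the subformulas with
  arguments first, \<open>idx\<close> inverts this numbering, and \<open>rk\<close> supplies ranks
  for the strategic subformulas.\<close>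

locale instance_formula =
  fixes U :: "unop set" and Bl :: "binop set" and m B :: nat and Ps Ns :: "cgs list" and \<phi> :: atl
    and x :: "bool list" and \<psi>s :: "atl list" and idx :: "atl \<Rightarrow> nat"
    and rk :: "nat \<Rightarrow> atl \<Rightarrow> nat \<Rightarrow> nat"
  assumes U: "U \<subseteq> {UTemp Future, UTemp Globally, UNeg}"
    and x: "x = enc_input 2 m Ps Ns B"
    and wf: "\<And>C. C \<in> set (Ps @ Ns) \<Longrightarrow> wf_cgs 2 {..<m} C"
    and frag: "in_fragment 2 {..<m} U Bl \<phi>" and size: "atl_size \<phi> \<le> B"
    and \<psi>s: "set \<psi>s = subformulas \<phi>" "distinct \<psi>s" "length \<psi>s = atl_size \<phi>"
      "\<psi>s ! (atl_size \<phi> - 1) = \<phi>"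
      "\<And>i j. i < length \<psi>s \<Longrightarrow> j < length \<psi>s \<Longrightarrow> size (\<psi>s ! i) < size (\<psi>s ! j) \<Longrightarrow> i < j"
    and idx: "\<And>\<psi>. \<psi> \<in> subformulas \<phi> \<Longrightarrow> idx \<psi> < length \<psi>s \<and> \<psi>s ! idx \<psi> = \<psi>"
    and rk: "\<And>c A t \<psi>. c < length (Ps @ Ns) \<Longrightarrow> Coop A t \<psi> \<in> subformulas \<phi> \<Longrightarrow>
      (\<forall>q. rk c (Coop A t \<psi>) q < Suc (cgs_states ((Ps @ Ns) ! c))) \<and>
      table_ok 2 ((Ps @ Ns) ! c) A t (\<lambda>q. sat 2 ((Ps @ Ns) ! c) q \<psi>)
        (\<lambda>q. sat 2 ((Ps @ Ns) ! c) q (Coop A t \<psi>)) (rk c (Coop A t \<psi>))"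
begin

abbreviation Cs :: "cgs list" where "Cs \<equiv> Ps @ Ns"
text \<open>The summand 20 covers the tags and operator codes, which a short input would not; every
  other entry is at most \<open>length x + 1\<close>.\<close>

definition W :: nat where "W = length x + 20"
abbreviation K :: nat where "K \<equiv> length \<psi>s"

definition S :: "nat \<Rightarrow> nat" where "S c = (if c < length Cs then cgs_states (Cs ! c) else 0)"
definition In :: "nat \<Rightarrow> nat \<Rightarrow> nat" where "In c q = of_bool (q < S c \<and> q \<in> cgs_init (Cs ! c))"
definition Lb :: "nat \<Rightarrow> nat \<Rightarrow> nat \<Rightarrow> nat" where "Lb c q p = of_bool (q < S c \<and> p \<in> cgs_label (Cs ! c) q)"
definition A1 :: "nat \<Rightarrow> nat \<Rightarrow> nat" where "A1 c q = (if q < S c then cgs_actions (Cs ! c) q 1 else 0)"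
definition A2 :: "nat \<Rightarrow> nat \<Rightarrow> nat" where "A2 c q = (if q < S c then cgs_actions (Cs ! c) q 2 else 0)"
definition D :: "nat \<Rightarrow> nat \<Rightarrow> nat \<Rightarrow> nat \<Rightarrow> nat" where
  "D c q i j = (if 0 < i \<and> i \<le> A1 c q \<and> 0 < j \<and> j \<le> A2 c q then cgs_delta (Cs ! c) q [i, j] else 0)"
definition Op :: "nat \<Rightarrow> nat" where "Op j = (if j < K then op_code (\<psi>s ! j) else 0)"
definition L :: "nat \<Rightarrow> nat" where
  "L j = (if j < K then case \<psi>s ! j of Atom p \<Rightarrow> p | Neg \<psi> \<Rightarrow> idx \<psi> | Bin b \<psi> \<psi>' \<Rightarrow> idx \<psi> | Coop A t \<psi> \<Rightarrow> idx \<psi> else 0)"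
definition R :: "nat \<Rightarrow> nat" where
  "R j = (if j < K then case \<psi>s ! j of Bin b \<psi> \<psi>' \<Rightarrow> idx \<psi>' | _ \<Rightarrow> 0 else 0)"
definition V :: "nat \<Rightarrow> nat \<Rightarrow> nat \<Rightarrow> nat" where
  "V c j q = of_bool (j < K \<and> q < S c \<and> sat 2 (Cs ! c) q (\<psi>s ! j))"
definition Rk :: "nat \<Rightarrow> nat \<Rightarrow> nat \<Rightarrow> nat" where
  "Rk c j q = (if j < K \<and> q < S c \<and> (\<exists>A t \<psi>. \<psi>s ! j = Coop A t \<psi>) then rk c (\<psi>s ! j) q else 0)"

definition F :: cert where
  "F tg a b c d = (if tg < W \<and> a < W \<and> b < W \<and> c < W \<and> d < W then
     if tg = 0 then if a = 0 then m else if a = 1 then length Ps else if a = 2 then length Ns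
       else if a = 3 then B else if a = 4 then K else 0
     else if tg = 1 then S a else if tg = 2 then In a b else if tg = 3 then Lb a b c
     else if tg = 4 then A1 a b else if tg = 5 then A2 a b else if tg = 6 then D a b c d
     else if tg = 7 then Op a else if tg = 8 then L a else if tg = 9 then R a
     else if tg = 10 then V a b c else if tg = 11 then Rk a b c else 0 else 0)"

lemma lengths: "m \<le> length x" "length Ps \<le> length x" "length Ns \<le> length x" "B \<le> length x" "K \<le> length x"
  "length Cs \<le> length x"
  using size \<psi>s(3) by (auto simp: x enc_input_def length_enc_list enc_nat_def)

lemma length_cgs: "C \<in> set Cs \<Longrightarrow> length (enc_cgs 2 m C) \<le> length x"
  using length_enc_list_member[of C Ps "enc_cgs 2 m"] length_enc_list_member[of C Ns "enc_cgs 2 m"]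
  by (auto simp: x enc_input_def)

lemma S_le: "S c \<le> length x" "q < S c \<Longrightarrow> c < length Cs"
proof -
  show "q < S c \<Longrightarrow> c < length Cs" by (simp add: S_def split: if_splits)
  show "S c \<le> length x"
  proof (cases "c < length Cs")
    case True
    then show ?thesis
      using order_trans[OF length_enc_cgs_states length_cgs[OF nth_mem[OF True]]] by (simp only: S_def if_True)
  qed (simp add: S_def)
qed

lemma A_le: "A1 c q \<le> length x" "A2 c q \<le> length x"
proof -
  have "cgs_actions (Cs ! c) q 1 + cgs_actions (Cs ! c) q 2 \<le> length x" if "q < S c"
    using length_enc_cgs[of q "Cs ! c" m] length_cgs[OF nth_mem[OF S_le(2)[OF that]]] that S_le(2)[OF that]
    by (simp add: S_def)
  then show "A1 c q \<le> length x" "A2 c q \<le> length x" by (auto simp: A1_def A2_def)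
qed

lemma wf_c: "c < length Cs \<Longrightarrow> wf_cgs 2 {..<m} (Cs ! c)"
  using wf nth_mem by blast

lemma D_less: "0 < i \<Longrightarrow> i \<le> A1 c q \<Longrightarrow> 0 < j \<Longrightarrow> j \<le> A2 c q \<Longrightarrow> D c q i j < S c"
proof -
  assume ij: "0 < i" "i \<le> A1 c q" "0 < j" "j \<le> A2 c q"
  then have q: "q < S c" by (simp add: A1_def split: if_splits)
  have c: "c < length Cs" by (rule S_le(2)[OF q])
  have "[i, j] \<in> legal_tuples 2 (Cs ! c) q" using ij q by (auto simp: legal_tuples_two A1_def A2_def)
  then show ?thesis using wf_c[OF c] q c ij by (auto simp: wf_cgs_def D_def S_def)
qed

lemma Lb_pos: "0 < Lb c q p \<Longrightarrow> p < m"
proof -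
  assume l: "0 < Lb c q p"
  then have q: "q < S c" "p \<in> cgs_label (Cs ! c) q" by (auto simp: Lb_def split: if_splits)
  have c: "c < length Cs" by (rule S_le(2)[OF q(1)])
  show ?thesis using wf_c[OF c] q c by (auto simp: wf_cgs_def S_def)
qed

lemma child:
  assumes "j < K"
  shows "\<psi>s ! j = Atom p \<Longrightarrow> p < m"
    and "\<psi>s ! j = Neg \<psi> \<Longrightarrow> idx \<psi> < j \<and> \<psi>s ! idx \<psi> = \<psi> \<and> UNeg \<in> U"
    and "\<psi>s ! j = Bin b \<psi> \<psi>' \<Longrightarrow> idx \<psi> < j \<and> \<psi>s ! idx \<psi> = \<psi> \<and> idx \<psi>' < j \<and> \<psi>s ! idx \<psi>' = \<psi>' \<and> b \<in> Bl"
    and "\<psi>s ! j = Coop A t \<psi> \<Longrightarrow> idx \<psi> < j \<and> \<psi>s ! idx \<psi> = \<psi> \<and> A \<subseteq> {1..2} \<and> t \<in> {Future, Globally} \<and>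
      Coop A t \<psi> \<in> subformulas \<phi>"
proof -
  have mem: "\<psi>s ! j \<in> subformulas \<phi>" using nth_mem[OF assms] \<psi>s(1) by simp
  note fr = subformula_fragment[OF mem frag]
  have c: "idx \<psi> < j \<and> \<psi>s ! idx \<psi> = \<psi>" if "\<psi> \<in> subformulas (\<psi>s ! j)" "size \<psi> < size (\<psi>s ! j)" for \<psi>
  proof -
    have "\<psi> \<in> subformulas \<phi>" using subformula_trans[OF mem] that(1) by blast
    note i = idx[OF this]
    have "size (\<psi>s ! idx \<psi>) < size (\<psi>s ! j)" using i that(2) by simp
    then show ?thesis using i \<psi>s(5)[OF conjunct1[OF i] assms] by blast
  qed
  show "\<psi>s ! j = Atom p \<Longrightarrow> p < m" using fr by auto
  show "\<psi>s ! j = Neg \<psi> \<Longrightarrow> idx \<psi> < j \<and> \<psi>s ! idx \<psi> = \<psi> \<and> UNeg \<in> U"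
    using fr c[of \<psi>] subformula_refl[of \<psi>] by auto
  show "\<psi>s ! j = Bin b \<psi> \<psi>' \<Longrightarrow> idx \<psi> < j \<and> \<psi>s ! idx \<psi> = \<psi> \<and> idx \<psi>' < j \<and> \<psi>s ! idx \<psi>' = \<psi>' \<and> b \<in> Bl"
    using fr c[of \<psi>] c[of \<psi>'] subformula_refl[of \<psi>] subformula_refl[of \<psi>'] by auto
  show "\<psi>s ! j = Coop A t \<psi> \<Longrightarrow> idx \<psi> < j \<and> \<psi>s ! idx \<psi> = \<psi> \<and> A \<subseteq> {1..2} \<and> t \<in> {Future, Globally} \<and>
      Coop A t \<psi> \<in> subformulas \<phi>"
    using fr c[of \<psi>] subformula_refl[of \<psi>] U mem by auto
qed

lemma L_less: "L j \<le> length x" "R j \<le> length x"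
proof -
  have "L j \<le> length x \<and> R j \<le> length x"
  proof (cases "j < K")
    case True
    then show ?thesis
      using child[OF True] lengths by (cases "\<psi>s ! j") (auto simp: L_def R_def)
  qed (simp add: L_def R_def)
  then show "L j \<le> length x" "R j \<le> length x" by auto
qed

lemma Rk_le: "Rk c j q \<le> Suc (length x)"
proof (cases "j < K \<and> q < S c \<and> (\<exists>A t \<psi>. \<psi>s ! j = Coop A t \<psi>)")
  case True
  then obtain A t \<psi> where "\<psi>s ! j = Coop A t \<psi>" by blast
  moreover have c: "c < length Cs" using True S_le(2) by blast
  moreover have "Coop A t \<psi> \<in> subformulas \<phi>" using calculation(1) True \<psi>s(1) nth_mem by metis
  ultimately show ?thesis
    using rk[of c A t \<psi>] S_le(1)[of c] True by (auto simp: Rk_def S_def) (meson le_SucI le_trans less_Suc_eq_le)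
next
  case False
  then have "Rk c j q = 0" unfolding Rk_def by (rule if_not_P)
  then show ?thesis by simp
qed

lemma F_le: "F tg a b c d \<le> W"
proof -
  have "D a b c d \<le> W" using D_less[of c a b d] S_le(1)[of a] by (cases "D a b c d = 0") (auto simp: D_def W_def split: if_splits)
  moreover have "Op a \<le> W" using op_code_cases(1)[of "\<psi>s ! a"] by (simp add: Op_def W_def)
  moreover have "Rk a b c \<le> W" using Rk_le[of a b c] by (simp add: W_def)
  moreover have "In a b \<le> W" "Lb a b c \<le> W" "V a b c \<le> W" by (simp_all add: In_def Lb_def V_def W_def)
  moreover have "m \<le> W" "length Ps \<le> W" "length Ns \<le> W" "B \<le> W" "K \<le> W" "S a \<le> W" "A1 a b \<le> W" "A2 a b \<le> W"
    "L a \<le> W" "R a \<le> W"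
    using lengths S_le(1)[of a] A_le[of a b] L_less[of a] by (simp_all add: W_def)
  moreover have if_le: "P \<longrightarrow> u \<le> W \<Longrightarrow> v \<le> W \<Longrightarrow> (if P then u else v) \<le> W" for P u v by simp
  ultimately show ?thesis unfolding F_def by (intro if_le impI le0)
qed

lemma F_outside: "\<not> (tg < W \<and> a < W \<and> b < W \<and> c < W \<and> d < W) \<Longrightarrow> F tg a b c d = 0"
  unfolding F_def by (rule if_not_P)

text \<open>Each component vanishes as soon as an argument reaches \<open>W\<close>, so cutting the
  table off loses nothing.\<close>

lemma F_eq:
  "F 0 0 0 0 0 = m" "F 0 1 0 0 0 = length Ps" "F 0 2 0 0 0 = length Ns" "F 0 3 0 0 0 = B" "F 0 4 0 0 0 = K"
  "F 1 c 0 0 0 = S c" "F 2 c q 0 0 = In c q" "F 3 c q p 0 = Lb c q p" "F 4 c q 0 0 = A1 c q"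
  "F 5 c q 0 0 = A2 c q" "F 6 c q i j = D c q i j" "F 7 j 0 0 0 = Op j" "F 8 j 0 0 0 = L j"
  "F 9 j 0 0 0 = R j" "F 10 c j q 0 = V c j q" "F 11 c j q 0 = Rk c j q"
proof -
  have W: "20 \<le> W" "length x < W" by (simp_all add: W_def)
  have c: "c < W" if "q < S c" for c q using S_le(2)[OF that] lengths W by simp
  have q: "q < W" if "q < S c" for c q using that S_le(1)[of c] W by simp
  have j: "j < W" if "j < K" for j using that lengths W by simp
  have S0: "S c = 0" if "\<not> c < W" for c using c[of 0 c] that by (cases "S c") auto
  show "F 0 0 0 0 0 = m" "F 0 1 0 0 0 = length Ps" "F 0 2 0 0 0 = length Ns" "F 0 3 0 0 0 = B" "F 0 4 0 0 0 = K"
    using W by (simp_all add: F_def)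
  show "F 1 c 0 0 0 = S c" using W S0[of c] by (simp add: F_def)
  show "F 2 c q 0 0 = In c q" using W c[of q c] q[of q c] by (auto simp: F_def In_def)
  have "Lb c q p = 0" if "\<not> p < W" using that Lb_pos[of c q p] lengths W by (cases "Lb c q p") auto
  then show "F 3 c q p 0 = Lb c q p" using W c[of q c] q[of q c] by (auto simp: F_def Lb_def)
  have A: "A1 c q = 0 \<and> A2 c q = 0" if "\<not> (c < W \<and> q < W)" for c q
    using that c[of q c] q[of q c] by (auto simp: A1_def A2_def)
  show "F 4 c q 0 0 = A1 c q" "F 5 c q 0 0 = A2 c q" using W A[of c q] by (auto simp: F_def)
  have "D c q i j = 0" if "\<not> (c < W \<and> q < W \<and> i < W \<and> j < W)"
    using that A[of c q] A_le[of c q] W by (auto simp: D_def)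
  then show "F 6 c q i j = D c q i j" using W by (auto simp: F_def)
  show "F 7 j 0 0 0 = Op j" "F 8 j 0 0 0 = L j" "F 9 j 0 0 0 = R j"
    using W j[of j] by (auto simp: F_def Op_def L_def R_def)
  show "F 10 c j q 0 = V c j q" "F 11 c j q 0 = Rk c j q"
    using W j[of j] c[of q c] q[of q c] by (auto simp: F_def V_def Rk_def)
qed

lemmas F_eqs = F_eq F_eq[unfolded One_nat_def]

lemma enc_cert: "c < length Cs \<Longrightarrow> enc_cgs 2 m (cert_cgs F c) = enc_cgs 2 m (Cs ! c)"
proof -
  assume c: "c < length Cs"
  have "enc_state 2 m (cert_cgs F c) q = enc_state 2 m (Cs ! c) q" if q: "q < cgs_states (Cs ! c)" for q
  proof -
    have qS: "q < S c" using c q by (simp add: S_def)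
    have "concat (map (\<lambda>i. concat (map (\<lambda>j. enc_nat (cgs_delta (cert_cgs F c) q [Suc i, Suc j])) [0..<A2 c q])) [0..<A1 c q]) =
      concat (map (\<lambda>i. concat (map (\<lambda>j. enc_nat (cgs_delta (Cs ! c) q [Suc i, Suc j])) [0..<A2 c q])) [0..<A1 c q])"
      by (intro arg_cong[of _ _ concat] map_cong refl) (simp add: cert_cgs_def F_eqs D_def)
    moreover have "map (\<lambda>p. p \<in> cgs_label (cert_cgs F c) q) [0..<m] = map (\<lambda>p. p \<in> cgs_label (Cs ! c) q) [0..<m]"
      using qS by (simp add: cert_cgs_def F_eqs Lb_def)
    ultimately show ?thesis
      unfolding enc_state_two using qS by (simp add: cert_cgs_def F_eqs In_def A1_def A2_def)
  qed
  then have "map (enc_state 2 m (cert_cgs F c)) [0..<cgs_states (Cs ! c)] = map (enc_state 2 m (Cs ! c)) [0..<cgs_states (Cs ! c)]"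
    by (intro map_cong refl) simp
  moreover have "cgs_states (cert_cgs F c) = cgs_states (Cs ! c)" using c by (simp add: cert_cgs_def F_eqs S_def)
  ultimately show ?thesis unfolding enc_cgs_def enc_list_def by (simp only:)
qed

lemma cert_pre_Cs:
  assumes "q < S c" and "\<And>q'. q' < S c \<Longrightarrow> X q' = Y q'"
  shows "cert_pre F c cd X q = pre 2 (Cs ! c) (coalition cd) Y q"
proof -
  have "X (F 6 c q (Suc i) (Suc j)) = Y (cgs_delta (Cs ! c) q [Suc i, Suc j])" 
    if "i < cgs_actions (Cs ! c) q 1" "j < cgs_actions (Cs ! c) q 2" for i j
    using assms(2)[OF D_less[of "Suc i" c q "Suc j"]] that assms(1) by (simp add: F_eq D_def A1_def A2_def)
  moreover have "A1 c q = cgs_actions (Cs ! c) q 1" "A2 c q = cgs_actions (Cs ! c) q 2"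
    using assms(1) by (simp_all add: A1_def A2_def)
  ultimately show ?thesis unfolding cert_pre_def pre_two by (simp add: F_eq cong: conj_cong)
qed

lemma cert_node_F: "j < K \<Longrightarrow> cert_node U Bl F j"
proof -
  assume j: "j < K"
  note c = child[OF j]
  have op: "Op j = op_code (\<psi>s ! j)" using j by (simp add: Op_def)
  show ?thesis
  proof (cases "\<psi>s ! j")
    case (Atom p)
    then show ?thesis using c(1)[OF Atom] j unfolding cert_node_def F_eq op by (simp add: L_def)
  next
    case (Neg \<psi>)
    then show ?thesis using c(2)[OF Neg] j unfolding cert_node_def F_eq op by (simp add: L_def)
  next
    case (Bin b \<psi> \<psi>')
    then show ?thesis using c(3)[OF Bin] j binop_index[of b] unfolding cert_node_def F_eq op by (simp add: L_def R_def)
  next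
    case (Coop A t \<psi>)
    then show ?thesis using c(4)[OF Coop] j coalition_code(1)[of A] unfolding cert_node_def F_eq op by (auto simp: L_def)
  qed
qed

lemma cert_value_F:
  assumes j: "j < K" and q: "q < S c"
  shows "cert_value F c j q"
proof -
  note c = child[OF j]
  have op: "Op j = op_code (\<psi>s ! j)" using j by (simp add: Op_def)
  have V: "0 < V c i q' \<longleftrightarrow> sat 2 (Cs ! c) q' (\<psi>s ! i)" if "q' < S c" "i < K" for q' i
    using that by (simp add: V_def)
  show ?thesis
  proof (cases "\<psi>s ! j")
    case (Atom p)
    then show ?thesis using j q V[OF q j] unfolding cert_value_def F_eq op by (simp add: L_def Lb_def)
  next
    case (Neg \<psi>)
    note c = c(2)[OF Neg]
    have "L j = idx \<psi>" using Neg j by (simp add: L_def)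
    then show ?thesis using V[OF q j] V[OF q, of "idx \<psi>"] c j Neg unfolding cert_value_def F_eq op by simp
  next
    case (Bin b \<psi> \<psi>')
    note c = c(3)[OF Bin]
    have "L j = idx \<psi>" "R j = idx \<psi>'" using Bin j by (simp_all add: L_def R_def)
    then show ?thesis using V[OF q j] V[OF q, of "idx \<psi>"] V[OF q, of "idx \<psi>'"] c j Bin binop_index[of b]
      unfolding cert_value_def F_eq op by simp
  next
    case (Coop A t \<psi>)
    note c = c(4)[OF Coop]
    have L: "L j = idx \<psi>" using Coop j by (simp add: L_def)
    have Rk: "Rk c j q' = rk c (Coop A t \<psi>) q'" if "q' < S c" for q' using Coop j that by (simp add: Rk_def)
    have cC: "c < length Cs" by (rule S_le(2)[OF q])
    have S: "cgs_states (Cs ! c) = S c" using cC by (simp add: S_def)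
    define cd where "cd = coalition_code A"
    have cd: "cd < 4" "coalition cd = A" using coalition_code c by (simp_all add: cd_def)
    define v where "v q = sat 2 (Cs ! c) q (Coop A t \<psi>)" for q
    define r where "r = rk c (Coop A t \<psi>)"
    have Vj: "0 < V c j q' \<longleftrightarrow> v q'" if "q' < S c" for q' using V[OF that j] Coop by (simp add: v_def)
    have Vl: "0 < V c (idx \<psi>) q \<longleftrightarrow> sat 2 (Cs ! c) q \<psi>" using V[OF q, of "idx \<psi>"] c j by simp
    have "table_ok 2 (Cs ! c) A t (\<lambda>q. sat 2 (Cs ! c) q \<psi>) v r"
      using rk[OF cC] c unfolding v_def r_def by blast
    then have tab: "if t = Future
        then if v q then sat 2 (Cs ! c) q \<psi> \<or> pre 2 (Cs ! c) A (\<lambda>q'. v q' \<and> r q' < r q) q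
          else \<not> sat 2 (Cs ! c) q \<psi> \<and> \<not> pre 2 (Cs ! c) A v q
        else if v q then sat 2 (Cs ! c) q \<psi> \<and> pre 2 (Cs ! c) A v q
          else sat 2 (Cs ! c) q \<psi> \<longrightarrow> \<not> pre 2 (Cs ! c) A (\<lambda>q'. \<not> (\<not> v q' \<and> r q' < r q)) q"
      using q unfolding table_ok_def S by blast
    have p: "cert_pre F c cd (\<lambda>q'. 0 < V c j q' \<and> Rk c j q' < Rk c j q) q = pre 2 (Cs ! c) A (\<lambda>q'. v q' \<and> r q' < r q) q"
      "cert_pre F c cd (\<lambda>q'. 0 < V c j q') q = pre 2 (Cs ! c) A v q"
      "cert_pre F c cd (\<lambda>q'. \<not> (\<not> 0 < V c j q' \<and> Rk c j q' < Rk c j q)) q =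
        pre 2 (Cs ! c) A (\<lambda>q'. \<not> (\<not> v q' \<and> r q' < r q)) q"
      unfolding cd(2)[symmetric] by (rule cert_pre_Cs[OF q]; use Vj Rk q in \<open>simp add: r_def\<close>)+
    have o: "op_code (\<psi>s ! j) = (if t = Future then 12 else 16) + cd" using Coop by (simp add: cd_def)
    show ?thesis
      using tab cd(1) unfolding cert_value_def F_eq op o L
      by (cases "t = Future"; cases "v q")
        (simp_all only: p Vj[OF q] Vl if_True if_False add_diff_cancel_left' simp_thms, simp_all)
  qed
qed

theorem cert_ok_F:
  assumes bin: "atl_bin_size \<phi> \<le> n"
    and P: "\<And>C. C \<in> set Ps \<Longrightarrow> cgs_sat 2 C \<phi>" and N: "\<And>C. C \<in> set Ns \<Longrightarrow> \<not> cgs_sat 2 C \<phi>"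
  shows "cert_ok U Bl n x F"
  unfolding cert_ok_def F_eq
proof (intro conjI allI impI)
  have "enc_list (enc_cgs 2 m) (map (cert_cgs F) [0..<length Ps]) = enc_list (enc_cgs 2 m) Ps"
    by (rule enc_list_cong) (simp_all add: enc_cert nth_append)
  moreover have "enc_list (enc_cgs 2 m) (map (\<lambda>c. cert_cgs F (length Ps + c)) [0..<length Ns]) = enc_list (enc_cgs 2 m) Ns"
    by (rule enc_list_cong) (simp_all add: enc_cert nth_append)
  ultimately show "x = enc_input 2 m (map (cert_cgs F) [0..<length Ps]) (map (\<lambda>c. cert_cgs F (length Ps + c)) [0..<length Ns]) B"
    by (simp add: x enc_input_def)
next
  fix c q assume c: "c < length Ps + length Ns" and q: "q < S c"
  then have "q < cgs_states (Cs ! c)" "c < length Cs" by (simp_all add: S_def)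
  then show "1 \<le> A1 c q" "1 \<le> A2 c q" using wf_c[of c] q by (auto simp: wf_cgs_def A1_def A2_def)
  show "D c q (Suc i) (Suc j) < S c" if "i < A1 c q" "j < A2 c q" for i j
    using D_less[of "Suc i" c q "Suc j"] that by simp
next
  show "0 < K" using \<psi>s(3) td_less_size[of \<phi>] by simp
  show "K \<le> B" using \<psi>s(3) size by simp
next
  have "(\<Sum>j<K. of_bool (2 \<le> Op j \<and> Op j < 12)) = card {j \<in> {..<K}. 2 \<le> Op j \<and> Op j < 12}"
    by (simp add: of_bool_def sum.If_cases Int_def)
  \<comment> \<open>The list is distinct, so here nodes and subformulas are equally many.\<close>
  also have "\<dots> = card ((!) \<psi>s ` {j \<in> {..<K}. 2 \<le> Op j \<and> Op j < 12})"
    by (rule card_image[symmetric]) (auto simp: inj_on_def nth_eq_iff_index_eq[OF \<psi>s(2)])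
  also have "\<dots> \<le> card {\<psi> \<in> subformulas \<phi>. \<exists>b \<psi>1 \<psi>2. \<psi> = Bin b \<psi>1 \<psi>2}"
  proof (rule card_mono)
    show "(!) \<psi>s ` {j \<in> {..<K}. 2 \<le> Op j \<and> Op j < 12} \<subseteq> {\<psi> \<in> subformulas \<phi>. \<exists>b \<psi>1 \<psi>2. \<psi> = Bin b \<psi>1 \<psi>2}"
    proof
      fix \<psi> assume "\<psi> \<in> (!) \<psi>s ` {j \<in> {..<K}. 2 \<le> Op j \<and> Op j < 12}"
      then obtain j where j: "j < K" "\<psi> = \<psi>s ! j" "2 \<le> Op j \<and> Op j < 12" by blast
      then have "2 \<le> op_code \<psi> \<and> op_code \<psi> < 12" by (simp add: Op_def)
      then show "\<psi> \<in> {\<psi> \<in> subformulas \<phi>. \<exists>b \<psi>1 \<psi>2. \<psi> = Bin b \<psi>1 \<psi>2}"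
        using op_code_cases(2)[of \<psi>] nth_mem[OF j(1)] \<psi>s(1) j(2) by simp
    qed
  qed (simp add: finite_subformulas)
  finally show "(\<Sum>j<K. of_bool (2 \<le> Op j \<and> Op j < 12)) \<le> n" using bin by (simp add: atl_bin_size_def)
next
  show "cert_node U Bl F j" if "j < K" for j by (rule cert_node_F[OF that])
  show "cert_value F c j q" if "j < K" "q < S c" for c j q by (rule cert_value_F[OF that])
next
  have K: "K - 1 < K" "\<psi>s ! (K - 1) = \<phi>" using \<psi>s(3,4) td_less_size[of \<phi>] by simp_all
  show "0 < V c (K - 1) q" if c: "c < length Ps" and q: "q < S c" and i: "0 < In c q" for c q
  proof -
    have "Cs ! c \<in> set Ps" using c by (simp add: nth_append)
    moreover have "q \<in> cgs_init (Cs ! c)" using i by (simp add: In_def split: if_splits)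
    ultimately have "sat 2 (Cs ! c) q \<phi>" using P unfolding cgs_sat_def by blast
    then show ?thesis using K q by (simp add: V_def)
  qed
  show "\<exists>q<S (length Ps + c). 0 < In (length Ps + c) q \<and> \<not> 0 < V (length Ps + c) (K - 1) q" if c: "c < length Ns" for c
  proof -
    let ?C = "Cs ! (length Ps + c)"
    have lc: "length Ps + c < length Cs" using c by simp
    have "?C \<in> set Ns" using c by (simp add: nth_append)
    then obtain q where q: "q \<in> cgs_init ?C" "\<not> sat 2 ?C q \<phi>" using N unfolding cgs_sat_def by blast
    have "q < S (length Ps + c)" using wf_c[OF lc] q(1) lc by (auto simp: wf_cgs_def S_def)
    then show ?thesis using q K by (intro exI[of _ q]) (simp add: In_def V_def)
  qed
qed

end

text \<open>The bound on the entries and the vanishing outside a cube are what is needed to write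
  the certificate as a string of polynomial length.\<close>

theorem cert_complete:
  assumes U: "U \<subseteq> {UTemp Future, UTemp Globally, UNeg}" and x: "x \<in> ATL_Learn 2 U Bl n"
  defines "W \<equiv> length x + 20"
  shows "\<exists>F. cert_ok U Bl n x F \<and> (\<forall>tg a b c d. F tg a b c d \<le> W) \<and>
    (\<forall>tg a b c d. \<not> (tg < W \<and> a < W \<and> b < W \<and> c < W \<and> d < W) \<longrightarrow> F tg a b c d = 0)"
proof -
  obtain m Ps Ns B where i: "x = enc_input 2 m Ps Ns B" "\<forall>C\<in>set Ps \<union> set Ns. wf_cgs 2 {..<m} C"
    "separable 2 U Bl n {..<m} (set Ps) (set Ns) B"
    using x unfolding ATL_Learn_def by blast
  obtain \<phi> where \<phi>: "in_fragment 2 {..<m} U Bl \<phi>" "atl_size \<phi> \<le> B" "atl_bin_size \<phi> \<le> n"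
    "\<forall>C\<in>set Ps. cgs_sat 2 C \<phi>" "\<forall>C\<in>set Ns. \<not> cgs_sat 2 C \<phi>"
    using i(3) unfolding separable_def by blast
  obtain \<psi>s where \<psi>s: "set \<psi>s = subformulas \<phi>" "distinct \<psi>s" "length \<psi>s = atl_size \<phi>" "\<psi>s ! (atl_size \<phi> - 1) = \<phi>"
    "\<forall>i j. i < length \<psi>s \<and> j < length \<psi>s \<and> size (\<psi>s ! i) < size (\<psi>s ! j) \<longrightarrow> i < j"
    using subformula_list by blast
  have "\<forall>\<psi>. \<exists>k. \<psi> \<in> subformulas \<phi> \<longrightarrow> k < length \<psi>s \<and> \<psi>s ! k = \<psi>"
    using \<psi>s(1) by (metis in_set_conv_nth)
  then obtain idx where idx: "\<And>\<psi>. \<psi> \<in> subformulas \<phi> \<Longrightarrow> idx \<psi> < length \<psi>s \<and> \<psi>s ! idx \<psi> = \<psi>" by metis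
  have "\<forall>c \<xi>. \<exists>r. \<forall>A t \<psi>. c < length (Ps @ Ns) \<longrightarrow> \<xi> \<in> subformulas \<phi> \<longrightarrow> \<xi> = Coop A t \<psi> \<longrightarrow>
      (\<forall>q. r q < Suc (cgs_states ((Ps @ Ns) ! c))) \<and>
      table_ok 2 ((Ps @ Ns) ! c) A t (\<lambda>q. sat 2 ((Ps @ Ns) ! c) q \<psi>) (\<lambda>q. sat 2 ((Ps @ Ns) ! c) q \<xi>) r"
  proof (intro allI)
    fix c \<xi>
    show "\<exists>r. \<forall>A t \<psi>. c < length (Ps @ Ns) \<longrightarrow> \<xi> \<in> subformulas \<phi> \<longrightarrow> \<xi> = Coop A t \<psi> \<longrightarrow>
      (\<forall>q. r q < Suc (cgs_states ((Ps @ Ns) ! c))) \<and>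
      table_ok 2 ((Ps @ Ns) ! c) A t (\<lambda>q. sat 2 ((Ps @ Ns) ! c) q \<psi>) (\<lambda>q. sat 2 ((Ps @ Ns) ! c) q \<xi>) r"
    proof (cases "c < length (Ps @ Ns) \<and> \<xi> \<in> subformulas \<phi> \<and> (\<exists>A t \<psi>. \<xi> = Coop A t \<psi>)")
      case True
      then obtain A t \<psi> where \<xi>: "\<xi> = Coop A t \<psi>" "\<xi> \<in> subformulas \<phi>" "c < length (Ps @ Ns)" by blast
      have "A \<subseteq> {1..2}" "t \<in> {Future, Globally}"
        using subformula_fragment[OF \<xi>(2) \<phi>(1)] U \<xi>(1) by auto
      moreover have "wf_cgs 2 {..<m} ((Ps @ Ns) ! c)" using nth_mem[OF \<xi>(3)] i(2) by simp
      ultimately obtain r where "\<forall>q. r q < Suc (cgs_states ((Ps @ Ns) ! c))"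
        "table_ok 2 ((Ps @ Ns) ! c) A t (\<lambda>q. sat 2 ((Ps @ Ns) ! c) q \<psi>) (\<lambda>q. sat 2 ((Ps @ Ns) ! c) q \<xi>) r"
        using table_ok_exists[of 2 "{..<m}" "(Ps @ Ns) ! c" A t \<psi>] \<xi>(1) by blast
      then show ?thesis using \<xi>(1) by (intro exI[of _ r]) (simp del: sat.simps)
    qed blast
  qed
  then obtain rk where rk: "\<And>c \<xi> A t \<psi>. c < length (Ps @ Ns) \<Longrightarrow> \<xi> \<in> subformulas \<phi> \<Longrightarrow> \<xi> = Coop A t \<psi> \<Longrightarrow>
      (\<forall>q. rk c \<xi> q < Suc (cgs_states ((Ps @ Ns) ! c))) \<and>
      table_ok 2 ((Ps @ Ns) ! c) A t (\<lambda>q. sat 2 ((Ps @ Ns) ! c) q \<psi>) (\<lambda>q. sat 2 ((Ps @ Ns) ! c) q \<xi>) (rk c \<xi>)"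
    by metis
  have "instance_formula U Bl m B Ps Ns \<phi> x \<psi>s idx rk"
  proof (rule instance_formula.intro)
    show "wf_cgs 2 {..<m} C" if "C \<in> set (Ps @ Ns)" for C using that i(2) by auto
    show "i < j" if "i < length \<psi>s" "j < length \<psi>s" "size (\<psi>s ! i) < size (\<psi>s ! j)" for i j
      using \<psi>s(5) that by blast
    show "(\<forall>q. rk c (Coop A t \<psi>) q < Suc (cgs_states ((Ps @ Ns) ! c))) \<and>
      table_ok 2 ((Ps @ Ns) ! c) A t (\<lambda>q. sat 2 ((Ps @ Ns) ! c) q \<psi>)
        (\<lambda>q. sat 2 ((Ps @ Ns) ! c) q (Coop A t \<psi>)) (rk c (Coop A t \<psi>))"
      if "c < length (Ps @ Ns)" "Coop A t \<psi> \<in> subformulas \<phi>" for c A t \<psi>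
      by (rule rk[OF that refl])
    show "idx \<psi> < length \<psi>s \<and> \<psi>s ! idx \<psi> = \<psi>" if "\<psi> \<in> subformulas \<phi>" for \<psi> by (rule idx[OF that])
  qed (rule U i(1) \<phi>(1) \<phi>(2) \<psi>s(1) \<psi>s(2) \<psi>s(3) \<psi>s(4))+
  then interpret instance_formula U Bl m B Ps Ns \<phi> x \<psi>s idx rk .
  have "cert_ok U Bl n x F" by (rule cert_ok_F) (use \<phi> in auto)
  then show ?thesis using F_le F_outside unfolding assms(3) W_def by blast
qed

section \<open>Certificates as bit strings\<close>

definition bit_at :: "bool list \<Rightarrow> nat \<Rightarrow> bool" where
  "bit_at y i \<longleftrightarrow> i < length y \<and> y ! i"

lemma pp_bit_at: "pf True t \<Longrightarrow> pp True (\<lambda>x y e. bit_at y (t x y e))"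
  unfolding bit_at_def by (rule pp_bit_snd)

text \<open>The second word is read as a table of numbers: an entry is the number of ones in a block.\<close>

definition cert_of :: "bool list \<Rightarrow> bool list \<Rightarrow> cert" where
  "cert_of x y tg a b c d =
     (if tg < length x + 20 \<and> a < length x + 20 \<and> b < length x + 20 \<and> c < length x + 20 \<and> d < length x + 20
      then \<Sum>j<length x + 20. of_bool (bit_at y
        (((((tg * (length x + 20) + a) * (length x + 20) + b) * (length x + 20) + c) * (length x + 20) + d) *
          (length x + 20) + j))
      else 0)"

lemma pair_bound: "u < A \<Longrightarrow> d < W \<Longrightarrow> u * W + d < A * W" for u d A W :: nat
proof -
  assume "u < A" "d < W"
  then have "u * W + d < Suc u * W" "Suc u * W \<le> A * W" by (simp, intro mult_le_mono1, simp)
  then show ?thesis by linarith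
qed

lemma cert_of_exists:
  assumes le: "\<And>tg a b c d. F tg a b c d \<le> length x + 20"
    and out: "\<And>tg a b c d. \<not> (tg < length x + 20 \<and> a < length x + 20 \<and> b < length x + 20 \<and> c < length x + 20 \<and>
      d < length x + 20) \<Longrightarrow> F tg a b c d = 0"
  shows "\<exists>y. length y = (length x + 20) ^ 6 \<and> cert_of x y = F"
proof -
  define W where "W = length x + 20"
  \<comment> \<open>The five arguments are the digits in base \<open>W\<close> of the block number.
    An entry is stored as that many ones at the start of a block of \<open>W\<close> bits.\<close>
  define G where "G i = F (i div W div W div W div W) (i div W div W div W mod W) (i div W div W mod W)
    (i div W mod W) (i mod W)" for i
  define y where "y = map (\<lambda>n. n mod W < G (n div W)) [0..<W ^ 6]"
  have "cert_of x y tg a b c d = F tg a b c d" for tg a b c d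
  proof (cases "tg < W \<and> a < W \<and> b < W \<and> c < W \<and> d < W")
    case True
    define u1 where "u1 = tg * W + a"
    define u2 where "u2 = u1 * W + b"
    define u3 where "u3 = u2 * W + c"
    define i where "i = u3 * W + d"
    have dm: "(u * W + v) div W = u" "(u * W + v) mod W = v" if "v < W" for u v
      using that by simp_all
    have G: "G i = F tg a b c d"
    proof -
      have "i div W = u3" "i mod W = d" "u3 div W = u2" "u3 mod W = c" "u2 div W = u1" "u2 mod W = b"
        "u1 div W = tg" "u1 mod W = a"
        using True unfolding i_def u3_def u2_def u1_def by (blast intro: dm)+
      then show ?thesis unfolding G_def by simp
    qed
    have u1: "u1 < W * W" unfolding u1_def by (rule pair_bound) (use True in blast)+
    have u2: "u2 < W * W * W" unfolding u2_def by (rule pair_bound[OF u1]) (use True in blast)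
    have u3: "u3 < W * W * W * W" unfolding u3_def by (rule pair_bound[OF u2]) (use True in blast)
    have "i < W * W * W * W * W" unfolding i_def by (rule pair_bound[OF u3]) (use True in blast)
    then have bnd: "i * W + j < W ^ 6" if "j < W" for j
      using pair_bound[OF \<open>i < _\<close> that] by (simp add: numeral_eq_Suc mult.assoc)
    have bit: "bit_at y (i * W + j) = (j < F tg a b c d)" if "j < W" for j
      using bnd[OF that] dm[OF that, of i] by (simp add: bit_at_def y_def G)
    have "cert_of x y tg a b c d = (\<Sum>j<W. of_bool (bit_at y (i * W + j)))"
      unfolding cert_of_def W_def[symmetric] i_def u3_def u2_def u1_def using True by simp
    also have "\<dots> = (\<Sum>j<W. of_bool (j < F tg a b c d))"
      by (rule sum.cong) (simp_all add: bit)
    also have "\<dots> = card {j. j < W \<and> j < F tg a b c d}"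
      by (simp add: of_bool_def sum.If_cases Int_def)
    also have "{j. j < W \<and> j < F tg a b c d} = {..<F tg a b c d}"
      using le[of tg a b c d] unfolding W_def by auto
    finally show ?thesis by simp
  next
    case False
    then show ?thesis using out[OF False[unfolded W_def]] unfolding cert_of_def W_def by (simp only: if_False)
  qed
  then have "cert_of x y = F" by (intro ext)
  moreover have "length y = (length x + 20) ^ 6" by (simp add: y_def W_def)
  ultimately show ?thesis by blast
qed

lemma pf_cert_of:
  assumes "pf True tg" "pf True a" "pf True b" "pf True c" "pf True d"
  shows "pf True (\<lambda>x y e. cert_of x y (tg x y e) (a x y e) (b x y e) (c x y e) (d x y e))"
proof -
  note r = assms[THEN pf_rename[of _ _ Suc]]
  show ?thesis
    unfolding cert_of_def
    by (intro pf_if pp_conj pp_less pf_sum pf_of_bool pp_bit_at pf.add pf_mult pf_length_fst pf_const pf.var assms r)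
qed

text \<open>With the bound on the index inside, this is a finite table in the sense of
  \<open>pp_table\<close>; the same holds for \<open>binop_app\<close>.\<close>

definition binop_in :: "binop set \<Rightarrow> nat \<Rightarrow> bool" where
  "binop_in Bl k \<longleftrightarrow> k < 10 \<and> binops ! k \<in> Bl"

definition binop_app :: "nat \<Rightarrow> bool \<Rightarrow> bool \<Rightarrow> bool" where
  "binop_app k p q \<longleftrightarrow> k < 10 \<and> binop_sem (binops ! k) p q"

lemma pp_binop_in: "pf True t \<Longrightarrow> pp True (\<lambda>x y e. binop_in Bl (t x y e))"
  unfolding binop_in_def by (rule pp_table[where P = "\<lambda>k _ _ _. binops ! k \<in> Bl"]) (assumption, rule pp_const)

lemma pp_binop_sem: "pp w P \<Longrightarrow> pp w Q \<Longrightarrow> pp w (\<lambda>x y e. binop_sem b (P x y e) (Q x y e))"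
  by (cases b; simp only: binop_sem.simps; intro pf_intros; assumption)

lemma pp_binop_app:
  assumes "pf w t" "pp w P" "pp w Q"
  shows "pp w (\<lambda>x y e. binop_app (t x y e) (P x y e) (Q x y e))"
  unfolding binop_app_def
  by (rule pp_table[OF assms(1), where P = "\<lambda>k x y e. binop_sem (binops ! k) (P x y e) (Q x y e)"])
    (rule pp_binop_sem[OF assms(2,3)])

lemma cert_node_alt: "cert_node U Bl F j \<longleftrightarrow> F 7 j 0 0 0 < 20 \<and>
     (F 7 j 0 0 0 = 0 \<longrightarrow> F 8 j 0 0 0 < F 0 0 0 0 0) \<and>
     (0 < F 7 j 0 0 0 \<longrightarrow> F 8 j 0 0 0 < j) \<and>
     (F 7 j 0 0 0 = 1 \<longrightarrow> UNeg \<in> U) \<and>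
     (2 \<le> F 7 j 0 0 0 \<and> F 7 j 0 0 0 < 12 \<longrightarrow> F 9 j 0 0 0 < j \<and> binop_in Bl (F 7 j 0 0 0 - 2))"
  unfolding cert_node_def binop_in_def ..

lemma cert_value_alt: "cert_value F c j q \<longleftrightarrow>
     (F 7 j 0 0 0 = 0 \<longrightarrow> (0 < F 10 c j q 0) = (0 < F 3 c q (F 8 j 0 0 0) 0)) \<and>
     (F 7 j 0 0 0 = 1 \<longrightarrow> (0 < F 10 c j q 0) = (\<not> 0 < F 10 c (F 8 j 0 0 0) q 0)) \<and>
     (2 \<le> F 7 j 0 0 0 \<and> F 7 j 0 0 0 < 12 \<longrightarrow> ((0 < F 10 c j q 0) =
        binop_app (F 7 j 0 0 0 - 2) (0 < F 10 c (F 8 j 0 0 0) q 0) (0 < F 10 c (F 9 j 0 0 0) q 0))) \<and>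
     (12 \<le> F 7 j 0 0 0 \<and> F 7 j 0 0 0 < 16 \<longrightarrow>
        (if 0 < F 10 c j q 0
         then 0 < F 10 c (F 8 j 0 0 0) q 0 \<or>
           cert_pre F c (F 7 j 0 0 0 - 12) (\<lambda>q'. 0 < F 10 c j q' 0 \<and> F 11 c j q' 0 < F 11 c j q 0) q
         else \<not> 0 < F 10 c (F 8 j 0 0 0) q 0 \<and>
           \<not> cert_pre F c (F 7 j 0 0 0 - 12) (\<lambda>q'. 0 < F 10 c j q' 0) q)) \<and>
     (16 \<le> F 7 j 0 0 0 \<longrightarrow>
        (if 0 < F 10 c j q 0
         then 0 < F 10 c (F 8 j 0 0 0) q 0 \<and> cert_pre F c (F 7 j 0 0 0 - 16) (\<lambda>q'. 0 < F 10 c j q' 0) q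
         else 0 < F 10 c (F 8 j 0 0 0) q 0 \<longrightarrow>
           \<not> cert_pre F c (F 7 j 0 0 0 - 16) (\<lambda>q'. \<not> (\<not> 0 < F 10 c j q' 0 \<and> F 11 c j q' 0 < F 11 c j q 0)) q))"
proof -
  have "F 7 j 0 0 0 - 2 < 10" if "2 \<le> F 7 j 0 0 0 \<and> F 7 j 0 0 0 < 12" using that by linarith
  then show ?thesis unfolding cert_value_def binop_app_def by blast
qed

lemmas cert_intros = pf_cert_of pp_binop_in pp_binop_app pf_intros

lemma pp_cert_node:
  assumes "pf True j"
  shows "pp True (\<lambda>x y e. cert_node U Bl (cert_of x y) (j x y e))"
  unfolding cert_node_alt by (intro cert_intros assms)

text \<open>Variables 2, 1 and 0 belong to the three enclosing quantifiers over structures, nodes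
  and states.\<close>

lemma pp_cert_value: "pp True (\<lambda>x y e. cert_value (cert_of x y) (e 2) (e 1) (e 0))"
  unfolding cert_value_alt cert_pre_def by (intro cert_intros)

lemma enc_cert_cgs:
  "enc_cgs 2 m (cert_cgs F c) = enc_list (\<lambda>q. [q < F 1 c 0 0 0 \<and> 0 < F 2 c q 0 0] @
     map (\<lambda>p. p < F 0 0 0 0 0 \<and> 0 < F 3 c q p 0) [0..<m] @ enc_nat (F 4 c q 0 0) @ enc_nat (F 5 c q 0 0) @
     concat (map (\<lambda>i. concat (map (\<lambda>j. enc_nat (F 6 c q (Suc i) (Suc j))) [0..<F 5 c q 0 0])) [0..<F 4 c q 0 0]))
     [0..<F 1 c 0 0 0]"
  by (simp add: enc_cgs_def enc_state_two[abs_def] cert_cgs_def)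

lemma pg_enc_cert:
  assumes "pf True m" "pf True c"
  shows "pg True (\<lambda>x y e. enc_cgs 2 (m x y e) (cert_cgs (cert_of x y) (c x y e)))"
proof -
  note r1 = assms[THEN pf_rename[of _ _ Suc]]
  note r2 = assms[THEN pf_rename[of _ _ "\<lambda>i. Suc (Suc i)"]]
  note r3 = assms[THEN pf_rename[of _ _ "\<lambda>i. Suc (Suc (Suc i))"]]
  show ?thesis unfolding enc_cert_cgs by (intro cert_intros assms r1 r2 r3)
qed

lemma pp_cert_ok: "pp True (\<lambda>x y e. cert_ok U Bl n x (cert_of x y))"
proof -
  have "pg True (\<lambda>x y e. enc_input 2 (cert_of x y 0 0 0 0 0) (map (cert_cgs (cert_of x y)) [0..<cert_of x y 0 1 0 0 0])
      (map (\<lambda>c. cert_cgs (cert_of x y) (cert_of x y 0 1 0 0 0 + c)) [0..<cert_of x y 0 2 0 0 0]) (cert_of x y 0 3 0 0 0))"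
    unfolding enc_input_def enc_list_map
    by (intro pg_append pg_enc_nat pg_enc_list pg_enc_cert pf_cert_of pf_const pf.add pf.var)
  note enc = pp_eq_word[OF this]
  have val: "pp True (\<lambda>x y e. \<forall>c<cert_of x y 0 1 0 0 0 + cert_of x y 0 2 0 0 0. \<forall>j<cert_of x y 0 4 0 0 0.
      \<forall>q<cert_of x y 1 c 0 0 0. cert_value (cert_of x y) c j q)"
  proof (rule pp_all, intro cert_intros, rule pp_all, intro cert_intros, rule pp_all, intro cert_intros)
    show "pp True (\<lambda>x y e. cert_value (cert_of x y) (e (Suc (Suc 0))) (e (Suc 0)) (e 0))"
      using pp_cert_value by (simp add: numeral_2_eq_2)
  qed
  show ?thesis
    unfolding cert_ok_def
    by (rule pp_conj[OF enc pp_conj[OF _ pp_conj[OF _ pp_conj[OF _ pp_conj[OF _ pp_conj[OF _ pp_conj[OF val pp_conj]]]]]]])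
      (intro cert_intros pp_cert_node)+
qed

theorem ATL_Learn_in_NP:
  assumes U1: "{UTemp Future, UTemp Globally} \<subseteq> U" and U2: "U \<subseteq> {UTemp Future, UTemp Globally, UNeg}"
  shows "in_NP (ATL_Learn 2 U Bl n)"
proof -
  have "polytime_decidable2 (\<lambda>x y. cert_ok U Bl n x (cert_of x y))"
    by (rule pp_decidable[OF pp_cert_ok])
  \<comment> \<open>The exponent 6 accounts for the five arguments and the unary notation of the
    entries.\<close>
  moreover have "x \<in> ATL_Learn 2 U Bl n \<longleftrightarrow>
      (\<exists>y. length y \<le> poly ([:20, 1:] ^ 6) (length x) \<and> cert_ok U Bl n x (cert_of x y))" for x
  proof
    assume "x \<in> ATL_Learn 2 U Bl n"
    then obtain F where F: "cert_ok U Bl n x F" "\<And>tg a b c d. F tg a b c d \<le> length x + 20"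
      "\<And>tg a b c d. \<not> (tg < length x + 20 \<and> a < length x + 20 \<and> b < length x + 20 \<and> c < length x + 20 \<and>
        d < length x + 20) \<Longrightarrow> F tg a b c d = 0"
      using cert_complete[OF U2, of x Bl n] by blast
    from cert_of_exists[of F x, OF F(2,3)] obtain y where "length y = (length x + 20) ^ 6" "cert_of x y = F"
      by blast
    then show "\<exists>y. length y \<le> poly ([:20, 1:] ^ 6) (length x) \<and> cert_ok U Bl n x (cert_of x y)"
      using F(1) by (intro exI[of _ y]) (simp add: poly_power add.commute)
  next
    assume "\<exists>y. length y \<le> poly ([:20, 1:] ^ 6) (length x) \<and> cert_ok U Bl n x (cert_of x y)"
    then show "x \<in> ATL_Learn 2 U Bl n" using cert_sound[OF U1] by blast
  qed
  ultimately show ?thesis unfolding in_NP_def by blast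
qed

section \<open>Computation tableaux as propositional clauses\<close>

text \<open>Propositional variables \<open>c tg t z\<close> describe time \<open>t\<close> and cell \<open>z\<close>: \<open>St q\<close> is the state,
  \<open>Hd i\<close> the head of tape \<open>i\<close>, \<open>Cl i a\<close> the symbol \<open>a\<close> in the cell, and \<open>Rd i a\<close> the symbol scanned on
  tape \<open>i\<close>. The latter lets a clause inspect all tapes without mentioning all head positions.\<close>

datatype tag = St nat | Hd nat | Cl nat nat | Rd nat nat

instance tag :: countable
  by countable_datatype

text \<open>A literal consists of sign, tag, time offset, and a selector for one of the cells \<open>0\<close>, \<open>z\<close>, \<open>z'\<close>.
  A family of clauses is guarded and indexed by \<open>t\<close>, \<open>z\<close>, \<open>z'\<close>.\<close>

type_synonym lit = "bool \<times> tag \<times> nat \<times> nat"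
type_synonym family = "(bool list \<Rightarrow> nat \<Rightarrow> nat \<Rightarrow> nat \<Rightarrow> bool) \<times> lit list"

definition holds :: "(tag \<Rightarrow> nat \<Rightarrow> nat \<Rightarrow> bool) \<Rightarrow> lit list \<Rightarrow> nat \<Rightarrow> nat \<Rightarrow> nat \<Rightarrow> bool" where
  "holds c ls t z z' \<longleftrightarrow> (\<exists>(s, tg, d, k) \<in> set ls. c tg (t + d) ([0, z, z'] ! k) = s)"

definition models :: "bool list \<Rightarrow> nat \<Rightarrow> family set \<Rightarrow> (tag \<Rightarrow> nat \<Rightarrow> nat \<Rightarrow> bool) \<Rightarrow> bool" where
  "models x W F c \<longleftrightarrow>
     (\<forall>(g, ls)\<in>F. \<forall>t<W. \<forall>z<W. \<forall>z'<W. g x t z z' \<longrightarrow> holds c ls t z z')"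

lemma modelsD:
  "models x W F c \<Longrightarrow> (g, ls) \<in> F \<Longrightarrow> t < W \<Longrightarrow> z < W \<Longrightarrow> z' < W \<Longrightarrow> g x t z z' \<Longrightarrow> holds c ls t z z'"
  unfolding models_def by (drule (1) bspec) simp

lemma modelsI:
  assumes "\<And>g ls t z z'. (g, ls) \<in> F \<Longrightarrow> t < W \<Longrightarrow> z < W \<Longrightarrow> z' < W \<Longrightarrow> g x t z z' \<Longrightarrow> holds c ls t z z'"
  shows "models x W F c"
  unfolding models_def
proof
  fix f assume "f \<in> F"
  then show "case f of (g, ls) \<Rightarrow> \<forall>t<W. \<forall>z<W. \<forall>z'<W. g x t z z' \<longrightarrow> holds c ls t z z'"
    using assms by (cases f) simp
qed

definition guard_ok :: "(bool list \<Rightarrow> nat \<Rightarrow> nat \<Rightarrow> nat \<Rightarrow> bool) \<Rightarrow> bool" where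
  "guard_ok g \<longleftrightarrow> (\<forall>t z z'. pf False t \<longrightarrow> pf False z \<longrightarrow> pf False z' \<longrightarrow>
     pp False (\<lambda>x y e. g x (t x y e) (z x y e) (z' x y e)))"

lemma pp_list_ex:
  "(\<And>l. l \<in> set ls \<Longrightarrow> pp w (P l)) \<Longrightarrow> pp w (\<lambda>x y e. \<exists>l\<in>set ls. P l x y e)"
proof (induction ls)
  case Nil
  then show ?case by (simp add: pp_const)
next
  case (Cons l ls)
  have "pp w (\<lambda>x y e. P l x y e \<or> (\<exists>l\<in>set ls. P l x y e))"
    by (rule pp_disj) (simp_all add: Cons)
  then show ?case by simp
qed

definition idx :: "nat \<Rightarrow> tag \<Rightarrow> nat \<Rightarrow> nat \<Rightarrow> nat" where
  "idx W tg t z = (to_nat tg * W + t) * W + z"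

definition fam_lit ::
  "bool \<Rightarrow> nat \<Rightarrow> family \<Rightarrow> bool list \<Rightarrow> nat \<Rightarrow> nat \<Rightarrow> nat \<Rightarrow> nat \<Rightarrow> bool" where
  "fam_lit s W f x t z z' i \<longleftrightarrow> \<not> fst f x t z z' \<or>
     (\<exists>l\<in>set (snd f). fst l = s \<and>
        i = idx W (fst (snd l)) (t + fst (snd (snd l))) ([0, z, z'] ! snd (snd (snd l))))"

lemma pf_nth3:
  assumes "k < 3" "pf w z" "pf w z'"
  shows "pf w (\<lambda>x y e. [0, z x y e, z' x y e] ! k)"
proof -
  have "k = 0 \<or> k = 1 \<or> k = 2" using assms(1) by linarith
  then show ?thesis using assms(2,3) pf_const[of w 0] by (elim disjE) simp_all
qed

lemma pp_fam_lit:
  assumes "guard_ok (fst f)" "\<And>l. l \<in> set (snd f) \<Longrightarrow> snd (snd (snd l)) < 3"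
    and "pf False (\<lambda>x y e. W x)" "pf False t" "pf False z" "pf False z'" "pf False i"
  shows "pp False (\<lambda>x y e. fam_lit s (W x) f x (t x y e) (z x y e) (z' x y e) (i x y e))"
proof -
  have g: "pp False (\<lambda>x y e. fst f x (t x y e) (z x y e) (z' x y e))"
    using assms(1,4-6) unfolding guard_ok_def by blast
  show ?thesis
    unfolding fam_lit_def idx_def
    by (intro pp_disj pp_not g pp_list_ex pp_conj pp_const pp_eq pf_mult pf.add pf_const pf_nth3 assms)
qed

lemma div_mod_pair: "d < W \<Longrightarrow> (u * W + d) div W = u" "d < W \<Longrightarrow> (u * W + d) mod W = d" for u d W :: nat
  by simp_all

lemma div_less_mult: "j < n * W \<Longrightarrow> j div W < n" for j n W :: nat
  by (simp add: less_mult_imp_div_less)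

text \<open>The uniformity of a clause set: occurrences of literals are definable from the input and
  the two numbers, so the reduction can print them.\<close>

definition expressible :: "(bool list \<Rightarrow> nat \<Rightarrow> nat \<Rightarrow> bool) \<Rightarrow> bool" where
  "expressible P \<longleftrightarrow> (\<forall>j i. pf False j \<longrightarrow> pf False i \<longrightarrow> pp False (\<lambda>x y e. P x (j x y e) (i x y e)))"

text \<open>A clause whose guard fails contains all literals.\<close>

lemma cnf_of_families:
  assumes fin: "finite F" and W: "pf False (\<lambda>x y e. W x)" and W0: "\<And>x. 0 < W x"
    and g: "\<And>g ls. (g, ls) \<in> F \<Longrightarrow> guard_ok g"
    and sel: "\<And>g ls s tg d k. (g, ls) \<in> F \<Longrightarrow> (s, tg, d, k) \<in> set ls \<Longrightarrow> k < 3"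
    and time: "\<And>g ls s tg d k x t z z'. (g, ls) \<in> F \<Longrightarrow> (s, tg, d, k) \<in> set ls \<Longrightarrow> t < W x \<Longrightarrow>
      g x t z z' \<Longrightarrow> t + d < W x"
  shows "\<exists>m J pos neg. pf False (\<lambda>x y e. m x) \<and> pf False (\<lambda>x y e. J x) \<and> expressible pos \<and> expressible neg \<and>
    (\<forall>x. 0 < m x) \<and>
    (\<forall>x. (\<exists>c. models x (W x) F c) \<longleftrightarrow>
       (\<exists>c. \<forall>j<J x. \<exists>i<m x. c i \<and> pos x j i \<or> \<not> c i \<and> neg x j i))"
proof -
  obtain fs where fs: "set fs = F" using finite_list[OF fin] by blast
  have "finite (\<Union>f\<in>F. to_nat ` fst ` snd ` set (snd f))" using fin by simp
  then obtain K0 where K0: "\<forall>k\<in>(\<Union>f\<in>F. to_nat ` fst ` snd ` set (snd f)). k < K0"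
    unfolding finite_nat_set_iff_bounded by blast
  \<comment> \<open>\<open>Suc\<close> guarantees a variable even if no literal occurs, because
    clauses with a failing guard are satisfied by variable 0.\<close>
  define K where "K = Suc K0"
  have K: "to_nat tg < K" if "(g, ls) \<in> F" "(s, tg, d, k) \<in> set ls" for g ls s tg d k
  proof -
    have "to_nat tg \<in> (\<Union>f\<in>F. to_nat ` fst ` snd ` set (snd f))" using that by force
    then show ?thesis using K0 unfolding K_def by (meson less_SucI)
  qed
  define m where "m x = K * W x * W x" for x
  define J where "J x = length fs * W x * W x * W x" for x
  \<comment> \<open>In base \<open>W x\<close> the digits of a clause number are two cells and a
    time; the leading part selects the family.\<close>
  define P where "P s x j i \<longleftrightarrow> j div W x div W x div W x < length fs \<and>
    fam_lit s (W x) (fs ! (j div W x div W x div W x)) x (j div W x div W x mod W x) (j div W x mod W x) (j mod W x) i"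
    for s x j i
  have expr: "expressible (P s)" for s
    unfolding expressible_def P_def
  proof (intro allI impI)
    fix j i :: "bool list \<Rightarrow> bool list \<Rightarrow> (nat \<Rightarrow> nat) \<Rightarrow> nat"
    assume ji: "pf False j" "pf False i"
    define G where "G k x y e \<longleftrightarrow> fam_lit s (W x) (fs ! k) x (j x y e div W x div W x mod W x)
      (j x y e div W x mod W x) (j x y e mod W x) (i x y e)" for k x y e
    have h: "pp False (G k)" if "k < length fs" for k
      unfolding G_def[abs_def]
    proof (rule pp_fam_lit)
      obtain g' ls where k: "fs ! k = (g', ls)" by (cases "fs ! k")
      then have mem: "(g', ls) \<in> F" using that fs nth_mem by metis
      show "guard_ok (fst (fs ! k))" using g[OF mem] k by simp
      show "snd (snd (snd l)) < 3" if "l \<in> set (snd (fs ! k))" for l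
        using sel[OF mem, of "fst l" "fst (snd l)" "fst (snd (snd l))" "snd (snd (snd l))"] that k by simp
    qed (intro pf_div pf_mod W ji)+
    have "pf False (\<lambda>x y e. j x y e div W x div W x div W x)" by (intro pf_div W ji)
    from pp_table[OF this h]
    show "pp False (\<lambda>x y e. j x y e div W x div W x div W x < length fs \<and>
      fam_lit s (W x) (fs ! (j x y e div W x div W x div W x)) x (j x y e div W x div W x mod W x)
        (j x y e div W x mod W x) (j x y e mod W x) (i x y e))"
      unfolding G_def .
  qed
  have "(\<exists>c. models x (W x) F c) \<longleftrightarrow>
       (\<exists>c. \<forall>j<J x. \<exists>i<m x. c i \<and> P True x j i \<or> \<not> c i \<and> P False x j i)" for x
  proof
    assume "\<exists>c. models x (W x) F c"
    then obtain c where c: "models x (W x) F c" by blast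
    define c' where "c' i = c (from_nat (i div W x div W x)) (i div W x mod W x) (i mod W x)" for i
    have "\<exists>i<m x. c' i \<and> P True x j i \<or> \<not> c' i \<and> P False x j i" if j: "j < J x" for j
    proof -
      define f t z z' where ftz: "f = j div W x div W x div W x" "t = j div W x div W x mod W x"
        "z = j div W x mod W x" "z' = j mod W x"
      have f: "f < length fs" using j unfolding ftz J_def by (intro div_less_mult)
      have b: "t < W x" "z < W x" "z' < W x" unfolding ftz using W0 by simp_all
      obtain g' ls where k: "fs ! f = (g', ls)" by (cases "fs ! f")
      then have mem: "(g', ls) \<in> F" using f fs nth_mem by metis
      have P: "P s x j i = fam_lit s (W x) (g', ls) x t z z' i" for s i
        unfolding P_def ftz[symmetric] k using f by simp
      show ?thesis
      proof (cases "g' x t z z'")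
        case False
        then have "P s x j 0" for s unfolding P fam_lit_def by simp
        moreover have "0 < m x" unfolding m_def K_def using W0 by simp
        ultimately show ?thesis by blast
      next
        case True
        then have "holds c ls t z z'" by (rule modelsD[OF c mem b])
        then obtain s tg d k where l: "(s, tg, d, k) \<in> set ls" and s: "c tg (t + d) ([0, z, z'] ! k) = s"
          by (auto simp: holds_def)
        have td: "t + d < W x" by (rule time[OF mem l b(1) True])
        have "k = 0 \<or> k = 1 \<or> k = 2" using sel[OF mem l] by linarith
        then have p: "[0, z, z'] ! k < W x" using b W0[of x] by (elim disjE) simp_all
        define i where "i = idx (W x) tg (t + d) ([0, z, z'] ! k)"
        have "i div W x = to_nat tg * W x + (t + d)" "i mod W x = [0, z, z'] ! k"
          unfolding i_def idx_def using div_mod_pair[OF p] by blast+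
        then have "c' i = s" unfolding c'_def using div_mod_pair[OF td] s by simp
        moreover have "i < m x"
          unfolding i_def idx_def m_def by (intro pair_bound K[OF mem l] td p)
        moreover have "P s x j i" unfolding P fam_lit_def i_def using l by force
        ultimately show ?thesis by (cases s) auto
      qed
    qed
    then show "\<exists>c. \<forall>j<J x. \<exists>i<m x. c i \<and> P True x j i \<or> \<not> c i \<and> P False x j i" by blast
  next
    assume "\<exists>c. \<forall>j<J x. \<exists>i<m x. c i \<and> P True x j i \<or> \<not> c i \<and> P False x j i"
    then obtain c where c: "\<And>j. j < J x \<Longrightarrow> \<exists>i<m x. c i \<and> P True x j i \<or> \<not> c i \<and> P False x j i" by blast
    have "holds (\<lambda>tg t z. c (idx (W x) tg t z)) ls t z z'"
      if mem: "(g', ls) \<in> F" and b: "t < W x" "z < W x" "z' < W x" and gd: "g' x t z z'" for g' ls t z z'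
    proof -
      obtain f where f: "f < length fs" "fs ! f = (g', ls)" using mem fs by (metis in_set_conv_nth)
      define j where "j = ((f * W x + t) * W x + z) * W x + z'"
      have "j < J x" unfolding j_def J_def by (intro pair_bound f b)
      have d: "j mod W x = z'" "j div W x = (f * W x + t) * W x + z"
        "((f * W x + t) * W x + z) mod W x = z" "((f * W x + t) * W x + z) div W x = f * W x + t"
        "(f * W x + t) mod W x = t" "(f * W x + t) div W x = f"
        unfolding j_def using div_mod_pair b by blast+
      have P: "P s x j i = fam_lit s (W x) (g', ls) x t z z' i" for s i
        unfolding P_def d f(2) using f(1) by simp
      obtain s i where "c i = s" "P s x j i" using c[OF \<open>j < J x\<close>] by (metis (full_types))
      then obtain l where "l \<in> set ls" "fst l = s"
        "i = idx (W x) (fst (snd l)) (t + fst (snd (snd l))) ([0, z, z'] ! snd (snd (snd l)))"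
        unfolding P fam_lit_def using gd by auto
      then show ?thesis unfolding holds_def using \<open>c i = s\<close> by (intro bexI[of _ l]) (auto simp: case_prod_beta)
    qed
    then have "models x (W x) F (\<lambda>tg t z. c (idx (W x) tg t z))" by (rule modelsI)
    then show "\<exists>c. models x (W x) F c" by blast
  qed
  moreover have "pf False (\<lambda>x y e. m x)" "pf False (\<lambda>x y e. J x)"
    unfolding m_def J_def by (intro pf_mult pf_const W)+
  moreover have "0 < m x" for x unfolding m_def K_def using W0 by simp
  ultimately have "pf False (\<lambda>x y e. m x) \<and> pf False (\<lambda>x y e. J x) \<and> expressible (P True) \<and>
      expressible (P False) \<and> (\<forall>x. 0 < m x) \<and> (\<forall>x. (\<exists>c. models x (W x) F c) \<longleftrightarrow>
       (\<exists>c. \<forall>j<J x. \<exists>i<m x. c i \<and> P True x j i \<or> \<not> c i \<and> P False x j i))"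
    by (intro conjI allI expr)
  then show ?thesis by (intro exI)
qed


section \<open>Clauses of a computation tableau\<close>

fun shift :: "move \<Rightarrow> nat" where
  "shift MoveL = 0"
| "shift Stay = 1"
| "shift MoveR = 2"

text \<open>Moves are raised by one so that the clauses about head positions stay within the natural
  numbers.\<close>

lemma int_shift: "int (shift m) = move_offset m + 1"
  by (cases m) simp_all

text \<open>Halted configurations stay put, so that acceptance within the time bound becomes
  acceptance at time \<open>T x\<close>.\<close>

definition full_trans :: "tm \<Rightarrow> nat \<Rightarrow> nat list \<Rightarrow> nat \<times> (nat \<times> move) list" where
  "full_trans M q ss =
     (if q = tm_accept M \<or> q = tm_reject M then (q, map (\<lambda>a. (a, Stay)) ss) else tm_trans M q ss)"

definition entries :: "tm \<Rightarrow> (nat \<times> nat list) set" where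
  "entries M = {..<tm_states M} \<times> {ss. set ss \<subseteq> {..<tm_symbols M} \<and> length ss = tm_tapes M}"

definition prems :: "tm \<Rightarrow> nat \<Rightarrow> nat list \<Rightarrow> lit list" where
  "prems M q ss = (False, St q, 0, 0) # map (\<lambda>i. (False, Rd i (ss ! i), 0, 0)) [0..<tm_tapes M]"

definition cell :: "bool list \<Rightarrow> nat \<Rightarrow> nat \<Rightarrow> nat" where
  "cell x Z z = (if Z \<le> z \<and> z - Z < length x \<and> x ! (z - Z) then 2 else if Z \<le> z \<and> z - Z < length x then 1 else 0)"

text \<open>Cell \<open>Suc (T x)\<close> of the tableau is cell 0 of the tape, and the second word has length at most \<open>Y x\<close>.\<close>

definition families :: "tm \<Rightarrow> (bool list \<Rightarrow> nat) \<Rightarrow> (bool list \<Rightarrow> nat) \<Rightarrow> family set" where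
  "families M T Y =
     {(\<lambda>x t z z'. t = 0, [(True, St (tm_start M), 0, 0)])} \<union>
     (\<lambda>i. (\<lambda>x t z z'. t = 0 \<and> z = Suc (T x), [(True, Hd i, 0, 1)])) ` {..<tm_tapes M} \<union>
     (\<lambda>i. (\<lambda>x t z z'. z \<noteq> z', [(False, Hd i, 0, 1), (False, Hd i, 0, 2)])) ` {..<tm_tapes M} \<union>
     (\<lambda>a. (\<lambda>x t z z'. t = 0 \<and> cell x (Suc (T x)) z = a, [(True, Cl 0 a, 0, 1)])) ` {..<3} \<union>
     (\<lambda>i. (\<lambda>x t z z'. t = 0 \<and> (Suc (T x) \<le> z \<and> z < Suc (T x) + Y x \<longrightarrow> i \<noteq> 1), [(True, Cl i 0, 0, 1)]))
       ` {0<..<tm_tapes M} \<union>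
     {(\<lambda>x t z z'. t = 0, [(True, Cl 1 0, 0, 1), (True, Cl 1 1, 0, 1), (True, Cl 1 2, 0, 1)])} \<union>
     {(\<lambda>x t z z'. t = 0 \<and> Suc (T x) \<le> z \<and> z' = Suc z, [(False, Cl 1 0, 0, 1), (True, Cl 1 0, 0, 2)])} \<union>
     (\<lambda>(i, a). (\<lambda>x t z z'. True, [(False, Hd i, 0, 1), (False, Cl i a, 0, 1), (True, Rd i a, 0, 0)]))
       ` ({..<tm_tapes M} \<times> {..<tm_symbols M}) \<union>
     (\<lambda>(q, ss). (\<lambda>x t z z'. t < T x, (True, St (fst (full_trans M q ss)), 1, 0) # prems M q ss)) ` entries M \<union>
     (\<lambda>((q, ss), i). (\<lambda>x t z z'. t < T x, (False, Hd i, 0, 1) #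
         (True, Cl i (fst (snd (full_trans M q ss) ! i)), 1, 1) # prems M q ss)) ` (entries M \<times> {..<tm_tapes M}) \<union>
     (\<lambda>((q, ss), i). (\<lambda>x t z z'. t < T x \<and> Suc z' = z + shift (snd (snd (full_trans M q ss) ! i)),
         (False, Hd i, 0, 1) # (True, Hd i, 1, 2) # prems M q ss)) ` (entries M \<times> {..<tm_tapes M}) \<union>
     (\<lambda>(i, a). (\<lambda>x t z z'. t < T x, [(True, Hd i, 0, 1), (False, Cl i a, 0, 1), (True, Cl i a, 1, 1)]))
       ` ({..<tm_tapes M} \<times> {..<tm_symbols M}) \<union>
     (\<lambda>q. (\<lambda>x t z z'. t = T x, [(False, St q, 0, 0)])) ` ({..<tm_states M} - {tm_accept M})"

lemma holds_simps:
  "\<not> holds c [] t z z'"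
  "holds c ((s, tg, d, k) # ls) t z z' \<longleftrightarrow> c tg (t + d) ([0, z, z'] ! k) = s \<or> holds c ls t z z'"
  by (auto simp: holds_def)

lemma holds_prems:
  "holds c (prems M q ss) t z z' \<longleftrightarrow> \<not> (c (St q) t 0 \<and> (\<forall>i<tm_tapes M. c (Rd i (ss ! i)) t 0))"
  by (auto simp: holds_def prems_def)

lemma finite_families: "finite (families M T Y)"
  unfolding families_def entries_def
  by (intro finite_UnI finite_imageI finite_cartesian_product finite_Diff finite_lists_length_eq finite_lessThan
      finite_greaterThanLessThan finite.emptyI finite.insertI)

lemma guard_ok_families:
  assumes T: "pf False (\<lambda>x y e. T x)" and Y: "pf False (\<lambda>x y e. Y x)" and mem: "(g, ls) \<in> families M T Y"
  shows "guard_ok g"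
proof -
  have c: "pf False (\<lambda>x y e. cell x (Suc (T x)) (z x y e))" if "pf False z" for z
    unfolding cell_def
    by (intro pp_conj pf_if pp_bit_fst pf_const pp_le pp_less pf.monus pf_length_fst pf_Suc T that)
  show ?thesis
    using mem unfolding families_def guard_ok_def
    by (elim UnE imageE singletonE) (auto split: prod.splits intro!: c pp_const pp_conj pp_eq pp_le pp_less pp_imp
      pp_not pf.add pf_Suc pf_const T Y)
qed

lemma sel_families: "(g, ls) \<in> families M T Y \<Longrightarrow> (s, tg, d, k) \<in> set ls \<Longrightarrow> k < 3"
  unfolding families_def by (elim UnE imageE singletonE) (auto simp: prems_def split: prod.splits)

lemma time_families:
  "(g, ls) \<in> families M T Y \<Longrightarrow> (s, tg, d, k) \<in> set ls \<Longrightarrow> t < W \<Longrightarrow> T x < W \<Longrightarrow> g x t z z' \<Longrightarrow> t + d < W"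
  unfolding families_def by (elim UnE imageE singletonE) (auto simp: prems_def split: prod.splits)

section \<open>Configurations and the range of the heads\<close>

definition valid :: "tm \<Rightarrow> config \<Rightarrow> bool" where
  "valid M C \<longleftrightarrow> fst C < tm_states M \<and> length (snd C) = tm_tapes M \<and>
     (\<forall>i<tm_tapes M. \<forall>z. fst (snd C ! i) z < tm_symbols M)"

lemma tape_act_simps:
  "fst (tape_act a V) = (fst V)(snd V := fst a)" "snd (tape_act a V) = snd V + move_offset (snd a)"
  by (cases a; cases V; simp)+

lemma tm_run_Suc: "tm_run M (Suc t) C = tm_step M (tm_run M t C)"
  by (simp add: tm_run_def)

context
  fixes M :: tm
  assumes wf: "wf_tm M"
begin

lemma valid_entry: "valid M C \<Longrightarrow> (fst C, map tape_read (snd C)) \<in> entries M"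
  unfolding valid_def entries_def by (force simp: tape_read_def in_set_conv_nth)

lemma full_trans_ok:
  assumes "(q, ss) \<in> entries M"
  shows "fst (full_trans M q ss) < tm_states M" "length (snd (full_trans M q ss)) = tm_tapes M"
    "i < tm_tapes M \<Longrightarrow> fst (snd (full_trans M q ss) ! i) < tm_symbols M"
proof -
  have e: "q < tm_states M" "set ss \<subseteq> {..<tm_symbols M}" "length ss = tm_tapes M"
    using assms unfolding entries_def by auto
  have t: "fst (tm_trans M q ss) < tm_states M" "length (snd (tm_trans M q ss)) = tm_tapes M"
    "fst ` set (snd (tm_trans M q ss)) \<subseteq> {..<tm_symbols M}"
    using wf e unfolding wf_tm_def by blast+
  show "fst (full_trans M q ss) < tm_states M" "length (snd (full_trans M q ss)) = tm_tapes M"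
    using t e by (simp_all add: full_trans_def)
  show "fst (snd (full_trans M q ss) ! i) < tm_symbols M" if i: "i < tm_tapes M"
  proof (cases "q = tm_accept M \<or> q = tm_reject M")
    case True
    have "ss ! i \<in> set ss" using e(3) i by simp
    then have "ss ! i < tm_symbols M" using e(2) by auto
    then show ?thesis using True e(3) i by (simp add: full_trans_def)
  next
    case False
    have "fst (snd (tm_trans M q ss) ! i) \<in> fst ` set (snd (tm_trans M q ss))"
      using i t(2) by simp
    then show ?thesis using t(3) False by (auto simp: full_trans_def)
  qed
qed

lemma step_full_trans:
  assumes "valid M C"
  defines "r \<equiv> full_trans M (fst C) (map tape_read (snd C))"
  shows "fst (tm_step M C) = fst r" "length (snd (tm_step M C)) = tm_tapes M"
    "i < tm_tapes M \<Longrightarrow> snd (tm_step M C) ! i = tape_act (snd r ! i) (snd C ! i)"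
proof -
  have l: "length (snd C) = tm_tapes M" using assms by (simp add: valid_def)
  have r: "length (snd r) = tm_tapes M" unfolding r_def by (rule full_trans_ok[OF valid_entry[OF assms(1)]])
  have *: "tm_step M C = (fst r, map2 tape_act (snd r) (snd C))"
  proof (cases "halted M C")
    case True
    have "map2 tape_act (map (\<lambda>a. (a, Stay)) (map tape_read (snd C))) (snd C) = snd C"
      by (rule nth_equalityI) (simp_all add: tape_act_stay)
    then show ?thesis using True by (simp add: tm_step_def r_def full_trans_def halted_def)
  next
    case False
    then show ?thesis by (simp add: tm_step_def r_def full_trans_def halted_def split: prod.split)
  qed
  show "fst (tm_step M C) = fst r" "length (snd (tm_step M C)) = tm_tapes M"
    "i < tm_tapes M \<Longrightarrow> snd (tm_step M C) ! i = tape_act (snd r ! i) (snd C ! i)"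
    unfolding * using l r by simp_all
qed

lemma valid_step:
  assumes "valid M C"
  shows "valid M (tm_step M C)"
  unfolding valid_def
proof (intro conjI allI impI)
  note e = full_trans_ok[OF valid_entry[OF assms]]
  show "fst (tm_step M C) < tm_states M" using step_full_trans(1)[OF assms] e(1) by simp
  show "length (snd (tm_step M C)) = tm_tapes M" by (rule step_full_trans(2)[OF assms])
  fix i z
  assume i: "i < tm_tapes M"
  show "fst (snd (tm_step M C) ! i) z < tm_symbols M"
    using assms i e(3)[OF i] unfolding step_full_trans(3)[OF assms i] tape_act_simps valid_def by simp
qed

lemma init_tape:
  "i < tm_tapes M \<Longrightarrow>
    snd (init_config M [x, y]) ! i = (word_cells (if i = 0 then x else if i = 1 then y else []), 0)"
  by (auto simp: init_config_def nth_Cons' numeral_2_eq_2)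

lemma word_cells_less: "word_cells x z < 3"
  by (simp add: word_cells_def bit_symbol_def)

lemma valid_init: "valid M (init_config M [x, y])"
proof -
  have "fst (snd (init_config M [x, y]) ! i) z < tm_symbols M" if "i < tm_tapes M" for i z
    using wf word_cells_less unfolding init_tape[OF that] fst_conv wf_tm_def by (meson less_le_trans)
  moreover have "fst (init_config M [x, y]) < tm_states M" "length (snd (init_config M [x, y])) = tm_tapes M"
    using wf by (simp_all add: init_config_def wf_tm_def)
  ultimately show ?thesis unfolding valid_def by blast
qed

lemma valid_run: "valid M (tm_run M t (init_config M [x, y]))"
  by (induction t) (simp_all add: tm_run_Suc valid_step, simp add: tm_run_def valid_init)

text \<open>Keeps the heads inside the tableau, whose cell 0 of the tape has \<open>T x\<close>
  further cells and a margin on its left.\<close>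

lemma head_bound: "i < tm_tapes M \<Longrightarrow> \<bar>snd (snd (tm_run M t (init_config M [x, y])) ! i)\<bar> \<le> int t"
proof (induction t)
  case 0
  then show ?case by (simp add: tm_run_def init_tape)
next
  case (Suc t)
  have "\<bar>move_offset m\<bar> \<le> 1" for m by (cases m) simp_all
  note m = this[of "snd (snd (full_trans M (fst (tm_run M t (init_config M [x, y])))
    (map tape_read (snd (tm_run M t (init_config M [x, y]))))) ! i)"]
  show ?case
    unfolding tm_run_Suc step_full_trans(3)[OF valid_run Suc.prems] tape_act_simps
    using Suc.IH[OF Suc.prems] m by linarith
qed

end

section \<open>Models of the clauses and accepting runs\<close>

context
  fixes M :: tm
  assumes wf: "wf_tm M"
begin

lemma cell_eq: "cell x Z z = word_cells x (int z - int Z)"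
proof (cases "Z \<le> z")
  case True
  then have "nat (int z - int Z) = z - Z" "int z - int Z < int (length x) \<longleftrightarrow> z - Z < length x" by linarith+
  then show ?thesis using True by (simp add: cell_def word_cells_def bit_symbol_def)
qed (simp add: cell_def word_cells_def)

lemma entries_regroup:
  "(\<forall>e\<in>E. P e \<longrightarrow> S e \<and> (\<forall>i<k. H i \<longrightarrow> A e i \<and> (G e i \<longrightarrow> B e i))) \<longleftrightarrow>
     (\<forall>e\<in>E. P e \<longrightarrow> S e) \<and> (\<forall>e\<in>E. \<forall>i<k. P e \<longrightarrow> H i \<longrightarrow> A e i) \<and>
     (\<forall>e\<in>E. \<forall>i<k. P e \<longrightarrow> H i \<longrightarrow> G e i \<longrightarrow> B e i)"
  by blast

text \<open>The clauses read as implications; the three families of a transition have common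
  premises, under which \<open>entries_regroup\<close> joins them.\<close>

lemma models_families:
  "models x W (families M T Y) c \<longleftrightarrow>
     (\<forall>t<W. \<forall>z<W. \<forall>z'<W.
       (t = 0 \<longrightarrow> c (St (tm_start M)) 0 0) \<and>
       (\<forall>i<tm_tapes M. t = 0 \<and> z = Suc (T x) \<longrightarrow> c (Hd i) 0 z) \<and>
       (\<forall>i<tm_tapes M. z \<noteq> z' \<longrightarrow> \<not> c (Hd i) t z \<or> \<not> c (Hd i) t z') \<and>
       (t = 0 \<longrightarrow> c (Cl 0 (cell x (Suc (T x)) z)) 0 z) \<and>
       (\<forall>i<tm_tapes M. 0 < i \<and> t = 0 \<and> (Suc (T x) \<le> z \<and> z < Suc (T x) + Y x \<longrightarrow> i \<noteq> 1) \<longrightarrow> c (Cl i 0) 0 z) \<and>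
       (t = 0 \<longrightarrow> c (Cl 1 0) 0 z \<or> c (Cl 1 1) 0 z \<or> c (Cl 1 2) 0 z) \<and>
       (t = 0 \<and> Suc (T x) \<le> z \<and> z' = Suc z \<longrightarrow> c (Cl 1 0) 0 z \<longrightarrow> c (Cl 1 0) 0 z') \<and>
       (\<forall>i<tm_tapes M. \<forall>a<tm_symbols M. c (Hd i) t z \<and> c (Cl i a) t z \<longrightarrow> c (Rd i a) t 0) \<and>
       (\<forall>(q, ss)\<in>entries M. t < T x \<and> c (St q) t 0 \<and> (\<forall>i<tm_tapes M. c (Rd i (ss ! i)) t 0) \<longrightarrow>
          c (St (fst (full_trans M q ss))) (Suc t) 0 \<and>
          (\<forall>i<tm_tapes M. c (Hd i) t z \<longrightarrow> c (Cl i (fst (snd (full_trans M q ss) ! i))) (Suc t) z \<and>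
             (Suc z' = z + shift (snd (snd (full_trans M q ss) ! i)) \<longrightarrow> c (Hd i) (Suc t) z'))) \<and>
       (\<forall>i<tm_tapes M. \<forall>a<tm_symbols M. t < T x \<and> \<not> c (Hd i) t z \<and> c (Cl i a) t z \<longrightarrow> c (Cl i a) (Suc t) z) \<and>
       (\<forall>q<tm_states M. q \<noteq> tm_accept M \<and> t = T x \<longrightarrow> \<not> c (St q) t 0))" (is "_ \<longleftrightarrow> ?R")
proof -
  have cell3: "cell x (Suc (T x)) z < 3" for z by (simp add: cell_def)
  have "models x W (families M T Y) c \<longleftrightarrow> (\<forall>t<W. \<forall>z<W. \<forall>z'<W. \<forall>(g, ls)\<in>families M T Y.
      g x t z z' \<longrightarrow> holds c ls t z z')"
    unfolding models_def case_prod_beta by blast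
  also have "\<dots> \<longleftrightarrow> ?R"
  proof (intro all_cong)
    fix t z z'
    show "(\<forall>(g, ls)\<in>families M T Y. g x t z z' \<longrightarrow> holds c ls t z z') \<longleftrightarrow>
      (t = 0 \<longrightarrow> c (St (tm_start M)) 0 0) \<and>
       (\<forall>i<tm_tapes M. t = 0 \<and> z = Suc (T x) \<longrightarrow> c (Hd i) 0 z) \<and>
       (\<forall>i<tm_tapes M. z \<noteq> z' \<longrightarrow> \<not> c (Hd i) t z \<or> \<not> c (Hd i) t z') \<and>
       (t = 0 \<longrightarrow> c (Cl 0 (cell x (Suc (T x)) z)) 0 z) \<and>
       (\<forall>i<tm_tapes M. 0 < i \<and> t = 0 \<and> (Suc (T x) \<le> z \<and> z < Suc (T x) + Y x \<longrightarrow> i \<noteq> 1) \<longrightarrow> c (Cl i 0) 0 z) \<and>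
       (t = 0 \<longrightarrow> c (Cl 1 0) 0 z \<or> c (Cl 1 1) 0 z \<or> c (Cl 1 2) 0 z) \<and>
       (t = 0 \<and> Suc (T x) \<le> z \<and> z' = Suc z \<longrightarrow> c (Cl 1 0) 0 z \<longrightarrow> c (Cl 1 0) 0 z') \<and>
       (\<forall>i<tm_tapes M. \<forall>a<tm_symbols M. c (Hd i) t z \<and> c (Cl i a) t z \<longrightarrow> c (Rd i a) t 0) \<and>
       (\<forall>(q, ss)\<in>entries M. t < T x \<and> c (St q) t 0 \<and> (\<forall>i<tm_tapes M. c (Rd i (ss ! i)) t 0) \<longrightarrow>
          c (St (fst (full_trans M q ss))) (Suc t) 0 \<and>
          (\<forall>i<tm_tapes M. c (Hd i) t z \<longrightarrow> c (Cl i (fst (snd (full_trans M q ss) ! i))) (Suc t) z \<and>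
             (Suc z' = z + shift (snd (snd (full_trans M q ss) ! i)) \<longrightarrow> c (Hd i) (Suc t) z'))) \<and>
       (\<forall>i<tm_tapes M. \<forall>a<tm_symbols M. t < T x \<and> \<not> c (Hd i) t z \<and> c (Cl i a) t z \<longrightarrow> c (Cl i a) (Suc t) z) \<and>
       (\<forall>q<tm_states M. q \<noteq> tm_accept M \<and> t = T x \<longrightarrow> \<not> c (St q) t 0)"
      unfolding families_def ball_Un case_prod_beta[of _ "_ :: nat \<times> nat list"] entries_regroup conj_assoc
      by (intro arg_cong2[where f = "(\<and>)"]) (auto simp: holds_simps holds_prems cell3)
  qed
  finally show ?thesis .
qed

lemma models_run:
  assumes "length y \<le> Y x" and acc: "fst (tm_run M (T x) (init_config M [x, y])) = tm_accept M"
  shows "\<exists>c. models x W (families M T Y) c"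
proof -
  define C where "C t = tm_run M t (init_config M [x, y])" for t
  define tp where "tp t i = snd (C t) ! i" for t i
  define Z where "Z = Suc (T x)"
  define c where "c tg t z = (case tg of St q \<Rightarrow> q = fst (C t) | Hd i \<Rightarrow> int z - int Z = snd (tp t i)
    | Cl i a \<Rightarrow> fst (tp t i) (int z - int Z) = a | Rd i a \<Rightarrow> tape_read (tp t i) = a)" for tg t and z :: nat
  have c: "c (St q) t z \<longleftrightarrow> q = fst (C t)" "c (Hd i) t z \<longleftrightarrow> int z - int Z = snd (tp t i)"
    "c (Cl i a) t z \<longleftrightarrow> fst (tp t i) (int z - int Z) = a" "c (Rd i a) t z \<longleftrightarrow> tape_read (tp t i) = a" for q i a t z
    by (simp_all add: c_def)
  have tp0: "tp 0 i = (word_cells (if i = 0 then x else if i = 1 then y else []), 0)" if "i < tm_tapes M" for i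
    using init_tape[OF wf that] by (simp add: tp_def C_def tm_run_def)
  have C0: "fst (C 0) = tm_start M" by (simp add: C_def tm_run_def init_config_def)
  have k: "0 < tm_tapes M" "1 < tm_tapes M" using wf by (simp_all add: wf_tm_def)
  have valid: "valid M (C t)" for t unfolding C_def by (rule valid_run[OF wf])
  have rd: "ss = map tape_read (snd (C t))"
    if "(q, ss) \<in> entries M" "\<forall>i<tm_tapes M. tape_read (tp t i) = ss ! i" for q ss t
  proof (rule nth_equalityI)
    show "length ss = length (map tape_read (snd (C t)))" using that(1) valid[of t] by (simp add: entries_def valid_def)
    then show "ss ! i = map tape_read (snd (C t)) ! i" if "i < length ss" for i
      using that \<open>\<forall>i<tm_tapes M. _ i\<close> valid[of t] by (simp add: tp_def valid_def)
  qed
  have step: "fst (C (Suc t)) = fst (full_trans M (fst (C t)) (map tape_read (snd (C t))))"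
    "i < tm_tapes M \<Longrightarrow> tp (Suc t) i =
      tape_act (snd (full_trans M (fst (C t)) (map tape_read (snd (C t)))) ! i) (tp t i)" for t i
    using step_full_trans[OF wf valid[of t]] unfolding tp_def by (simp_all add: C_def tm_run_Suc)
  have w0: "word_cells y z = 0" if "z < 0 \<or> int (Y x) \<le> z" for z
    using that assms(1) by (auto simp: word_cells_def)
  have w2: "word_cells y z = 0 \<or> word_cells y z = 1 \<or> word_cells y z = 2" for z
    by (simp add: word_cells_def bit_symbol_def)
  have "models x W (families M T Y) c"
    unfolding models_families c
  proof (intro allI impI conjI ballI)
    fix t z z' i assume i: "i < tm_tapes M" "0 < i \<and> t = 0 \<and> (Suc (T x) \<le> z \<and> z < Suc (T x) + Y x \<longrightarrow> i \<noteq> 1)"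
    then show "fst (tp 0 i) (int z - int Z) = 0"
    proof (cases "i = 1")
      case True
      then have "\<not> (Z \<le> z \<and> z < Z + Y x)" using i unfolding Z_def by blast
      then have "int z - int Z < 0 \<or> int (Y x) \<le> int z - int Z" by linarith
      then show ?thesis using w0 k tp0[of i] True by simp
    qed (use i tp0[of i] in \<open>simp add: word_cells_def\<close>)
  next
    fix t z z' :: nat assume z: "t = 0 \<and> Suc (T x) \<le> z \<and> z' = Suc z" "fst (tp 0 1) (int z - int Z) = 0"
    then have "word_cells y (int z - int Z) = 0" "int z' - int Z = int z - int Z + 1" "0 \<le> int z - int Z"
      using k tp0[of 1] by (simp_all add: Z_def)
    then show "fst (tp 0 1) (int z' - int Z) = 0"
      using k tp0[of 1] by (auto simp: word_cells_def bit_symbol_def split: if_splits)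
  next
    fix t z z' e assume "e \<in> entries M"
    then obtain q ss where e: "e = (q, ss)" "(q, ss) \<in> entries M" by (cases e) blast
    show "case e of (q, ss) \<Rightarrow> t < T x \<and> q = fst (C t) \<and> (\<forall>i<tm_tapes M. tape_read (tp t i) = ss ! i) \<longrightarrow>
          fst (full_trans M q ss) = fst (C (Suc t)) \<and>
          (\<forall>i<tm_tapes M. int z - int Z = snd (tp t i) \<longrightarrow>
             fst (tp (Suc t) i) (int z - int Z) = fst (snd (full_trans M q ss) ! i) \<and>
             (Suc z' = z + shift (snd (snd (full_trans M q ss) ! i)) \<longrightarrow> int z' - int Z = snd (tp (Suc t) i)))"
      unfolding e(1) prod.case
    proof (intro impI, elim conjE, intro conjI allI impI)
      assume q: "q = fst (C t)" and "\<forall>i<tm_tapes M. tape_read (tp t i) = ss ! i"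
      then have ss: "ss = map tape_read (snd (C t))" using rd[OF e(2)] by blast
      show "fst (full_trans M q ss) = fst (C (Suc t))" unfolding q ss step ..
      fix i assume i: "i < tm_tapes M" and z: "int z - int Z = snd (tp t i)"
      show "fst (tp (Suc t) i) (int z - int Z) = fst (snd (full_trans M q ss) ! i)"
        unfolding q ss step(2)[OF i] tape_act_simps z by simp
      assume z': "Suc z' = z + shift (snd (snd (full_trans M q ss) ! i))"
      have "int (Suc z') = int z + (move_offset (snd (snd (full_trans M q ss) ! i)) + 1)"
        unfolding z' by (simp add: int_shift)
      then show "int z' - int Z = snd (tp (Suc t) i)"
        unfolding step(2)[OF i] tape_act_simps q[symmetric] ss[symmetric] using z by linarith
    qed
  next
    fix t z z' i a
    assume i: "i < tm_tapes M" and h: "t < T x \<and> \<not> int z - int Z = snd (tp t i) \<and> fst (tp t i) (int z - int Z) = a"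
    then show "fst (tp (Suc t) i) (int z - int Z) = a"
      unfolding step(2)[OF i] tape_act_simps by simp
  next
    fix t z z' q assume "q \<noteq> tm_accept M \<and> t = T x"
    then show "\<not> q = fst (C t)" using acc by (auto simp: C_def)
  qed (use k w2 in \<open>auto simp: C0 tp0 cell_eq Z_def tape_read_def\<close>)
  then show ?thesis by blast
qed

text \<open>A model may satisfy several state or symbol variables at once. It is enough that those
  of the actual run are among them: the clauses propagate these, and at time \<open>T x\<close>
  every state but the accepting one is refuted. Heads must be unique, as unchanged cells are
  recognised by the absence of a head.\<close>

lemma run_of_model:
  assumes W: "2 * T x + Y x + 4 \<le> W" and c: "models x W (families M T Y) c"
  shows "\<exists>y. length y \<le> Y x \<and> fst (tm_run M (T x) (init_config M [x, y])) = tm_accept M"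
proof -
  define Z where "Z = Suc (T x)"
  note mm = c[unfolded models_families, folded Z_def, THEN spec, THEN mp, THEN spec, THEN mp, THEN spec, THEN mp]
  note m1 = mm[THEN conjunct1] and n1 = mm[THEN conjunct2]
  note m2 = n1[THEN conjunct1] and n2 = n1[THEN conjunct2]
  note m3 = n2[THEN conjunct1] and n3 = n2[THEN conjunct2]
  note m4 = n3[THEN conjunct1] and n4 = n3[THEN conjunct2]
  note m5 = n4[THEN conjunct1] and n5 = n4[THEN conjunct2]
  note m6 = n5[THEN conjunct1] and n6 = n5[THEN conjunct2]
  note m7 = n6[THEN conjunct1] and n7 = n6[THEN conjunct2]
  note m8 = n7[THEN conjunct1] and n8 = n7[THEN conjunct2]
  note m9 = n8[THEN conjunct1] and n9 = n8[THEN conjunct2]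
  note m10 = n9[THEN conjunct1] and m11 = n9[THEN conjunct2]
  have W0: "0 < W" "Z < W" using W by (simp_all add: Z_def)
  have k: "0 < tm_tapes M" "1 < tm_tapes M" using wf by (simp_all add: wf_tm_def)
  have start: "c (St (tm_start M)) 0 0" using m1[OF W0(1) W0(1) W0(1)] by simp
  have uniq: "z = z'" if "i < tm_tapes M" "t < W" "z < W" "z' < W" "c (Hd i) t z" "c (Hd i) t z'" for i t z z'
    using m3[OF that(2-4)] that(1,5,6) by blast
  have head0: "c (Hd i) 0 Z" if "i < tm_tapes M" for i
    using m2[OF W0(1) W0(2) W0(1)] that by simp
  have cell0: "c (Cl 0 (cell x Z z)) 0 z" if "z < W" for z
    using m4[OF W0(1) that W0(1)] by simp
  have blank: "c (Cl i 0) 0 z" if "i < tm_tapes M" "z < W" "0 < i" "Z \<le> z \<and> z < Z + Y x \<longrightarrow> i \<noteq> 1" for i z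
    using m5[OF W0(1) that(2) W0(1)] that(1,3,4) by blast
  have guess: "c (Cl 1 0) 0 z \<or> c (Cl 1 1) 0 z \<or> c (Cl 1 2) 0 z" if "z < W" for z
    using m6[OF W0(1) that W0(1)] by blast
  have guess_mono: "c (Cl 1 0) 0 (Suc z)" if "Suc z < W" "Z \<le> z" "c (Cl 1 0) 0 z" for z
    using m7[OF W0(1) Suc_lessD[OF that(1)] that(1)] that(2,3) by blast
  have scan: "c (Rd i a) t 0" if "i < tm_tapes M" "a < tm_symbols M" "t < W" "z < W" "c (Hd i) t z" "c (Cl i a) t z" for i a t z
    using m8[OF that(3,4) W0(1)] that(1,2,5,6) by blast
  have keep: "c (Cl i a) (Suc t) z" if "i < tm_tapes M" "a < tm_symbols M" "t < W" "z < W" "t < T x" "\<not> c (Hd i) t z"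
    "c (Cl i a) t z" for i a t z
    using m10[OF that(3,4) W0(1)] that(1,2,5,6,7) by blast
  have final: "\<not> c (St q) (T x) 0" if "q < tm_states M" "q \<noteq> tm_accept M" for q
  proof -
    have "T x < W" using W by linarith
    from m11[OF this W0(1) W0(1)] show ?thesis using that by blast
  qed
  have trans: "c (St (fst (full_trans M q ss))) (Suc t) 0 \<and>
      (\<forall>i<tm_tapes M. c (Hd i) t z \<longrightarrow> c (Cl i (fst (snd (full_trans M q ss) ! i))) (Suc t) z \<and>
         (Suc z' = z + shift (snd (snd (full_trans M q ss) ! i)) \<longrightarrow> c (Hd i) (Suc t) z'))"
    if "(q, ss) \<in> entries M" "t < T x" "z < W" "z' < W" "c (St q) t 0" "\<forall>i<tm_tapes M. c (Rd i (ss ! i)) t 0" for q ss t z z'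
  proof -
    have "t < W" using that(2) W by linarith
    note m9[OF this that(3,4), THEN bspec, OF that(1), unfolded prod.case]
    then show ?thesis by (rule mp) (use that(2,5,6) in blast)
  qed
  \<comment> \<open>The guessed word ends at the first blank of its window or else fills the window.
    If a cell claims both bits, symbol 1 is taken.\<close>
  define n where "n = (LEAST i. i = Y x \<or> c (Cl 1 0) 0 (Z + i))"
  define y where "y = map (\<lambda>i. \<not> c (Cl 1 1) 0 (Z + i)) [0..<n]"
  have n: "n = Y x \<or> c (Cl 1 0) 0 (Z + n)" "n \<le> Y x"
    unfolding n_def by (rule LeastI[of _ "Y x"], simp, rule Least_le, simp)
  have before: "\<not> c (Cl 1 0) 0 (Z + i)" if "i < n" for i
    using not_less_Least[OF that[unfolded n_def]] by blast
  have after: "c (Cl 1 0) 0 (Z + i)" if "n \<le> i" "i < Y x" for i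
    using that
  proof (induction i rule: dec_induct)
    case base
    then show ?case using n(1) by simp
  next
    case (step i)
    then show ?case using guess_mono[of "Z + i"] W by (simp add: Z_def)
  qed
  define C where "C t = tm_run M t (init_config M [x, y])" for t
  define tp where "tp t i = snd (C t) ! i" for t i
  have tp0: "tp 0 i = (word_cells (if i = 0 then x else if i = 1 then y else []), 0)" if "i < tm_tapes M" for i
    using init_tape[OF wf that] by (simp add: tp_def C_def tm_run_def)
  have valid: "valid M (C t)" for t unfolding C_def by (rule valid_run[OF wf])
  have step: "fst (C (Suc t)) = fst (full_trans M (fst (C t)) (map tape_read (snd (C t))))"
    "i < tm_tapes M \<Longrightarrow> tp (Suc t) i =
      tape_act (snd (full_trans M (fst (C t)) (map tape_read (snd (C t)))) ! i) (tp t i)" for t i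
    using step_full_trans[OF wf valid[of t]] unfolding tp_def by (simp_all add: C_def tm_run_Suc)
  have content0: "c (Cl i (fst (tp 0 i) (int z - int Z))) 0 z" if i: "i < tm_tapes M" and z: "z < W" for i z
  proof (cases "i = 1")
    case False
    have "i = 0 \<or> 1 < i" using False by linarith
    then show ?thesis
      using cell0[OF z] blank[OF i z] tp0[OF i] by (auto simp: cell_eq word_cells_def[of "[]"])
  next
    case True
    then have tp: "fst (tp 0 i) = word_cells y" using tp0[OF i] by simp
    have len: "length y = n" by (simp add: y_def)
    show ?thesis
    proof (cases "Z \<le> z \<and> z < Z + Y x")
      case False
      then have "word_cells y (int z - int Z) = 0" using n(2) by (auto simp: word_cells_def len)
      then show ?thesis using blank[OF i z] False True tp by simp
    next
      case in_range: True
      define j where "j = z - Z"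
      have z: "z = Z + j" "int z - int Z = int j" "j < Y x" using in_range by (auto simp: j_def)
      show ?thesis
      proof (cases "j < n")
        case True
        then have "word_cells y (int j) = (if c (Cl 1 1) 0 z then 1 else 2)"
          by (simp add: word_cells_def len y_def bit_symbol_def z(1))
        then show ?thesis unfolding tp z(2) using guess[OF \<open>z < W\<close>] before[OF True] \<open>i = 1\<close> z(1) by auto
      next
        case False
        then have "word_cells y (int j) = 0" by (simp add: word_cells_def len)
        then show ?thesis unfolding tp z(2) using after[of j] False z(3) \<open>i = 1\<close> by (simp add: z(1))
      qed
    qed
  qed
  have inv: "c (St (fst (C t))) t 0 \<and> (\<forall>i<tm_tapes M. \<forall>z<W.
      (c (Hd i) t z \<longleftrightarrow> int z - int Z = snd (tp t i)) \<and> c (Cl i (fst (tp t i) (int z - int Z))) t z)" if "t \<le> T x" for t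
    using that
  proof (induction t)
    case 0
    have "c (Hd i) 0 z \<longleftrightarrow> int z - int Z = snd (tp 0 i)" if "i < tm_tapes M" "z < W" for i z
      using head0[OF that(1)] uniq[OF that(1) W0(1) that(2) W0(2)] tp0[OF that(1)] by auto
    then show ?case using start content0 by (simp add: C_def tm_run_def init_config_def)
  next
    case (Suc t)
    then have t: "t < T x" "t < W" and St: "c (St (fst (C t))) t 0"
      and Hd: "\<And>i z. i < tm_tapes M \<Longrightarrow> z < W \<Longrightarrow> c (Hd i) t z \<longleftrightarrow> int z - int Z = snd (tp t i)"
      and Cl: "\<And>i z. i < tm_tapes M \<Longrightarrow> z < W \<Longrightarrow> c (Cl i (fst (tp t i) (int z - int Z))) t z"
      using W by auto
    define ss where "ss = map tape_read (snd (C t))"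
    define r where "r = full_trans M (fst (C t)) ss"
    have len: "length (snd (C t)) = tm_tapes M" using valid[of t] by (simp add: valid_def)
    \<comment> \<open>The head position in the tableau. It keeps a distance from both borders, so
      that the next position lies in the tableau, too.\<close>
    define hd where "hd i = nat (snd (tp t i) + int Z)" for i
    have hd: "int (hd i) - int Z = snd (tp t i)" "1 \<le> hd i" "Suc (hd i) < W" if "i < tm_tapes M" for i
    proof -
      have "\<bar>snd (tp t i)\<bar> \<le> int t" unfolding tp_def C_def by (rule head_bound[OF wf that])
      then show "int (hd i) - int Z = snd (tp t i)" "1 \<le> hd i" "Suc (hd i) < W"
        using t(1) W unfolding hd_def Z_def by linarith+
    qed
    have ss: "ss ! i = fst (tp t i) (snd (tp t i))" if "i < tm_tapes M" for i
      using that len by (simp add: ss_def tape_read_def tp_def)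
    have Rd: "\<forall>i<tm_tapes M. c (Rd i (ss ! i)) t 0"
    proof (intro allI impI)
      fix i assume i: "i < tm_tapes M"
      have h: "hd i < W" using hd(3)[OF i] by simp
      have "ss ! i < tm_symbols M" using valid[of t] i unfolding ss[OF i] valid_def tp_def by blast
      then show "c (Rd i (ss ! i)) t 0"
        by (rule scan[OF i _ t(2) h]) (use Hd[OF i h] Cl[OF i h] hd(1)[OF i] ss[OF i] in simp_all)
    qed
    have ent: "(fst (C t), ss) \<in> entries M" unfolding ss_def by (rule valid_entry[OF wf valid])
    note tr = trans[OF ent t(1) _ _ St Rd, folded r_def]
    have C': "fst (C (Suc t)) = fst r" "\<And>i. i < tm_tapes M \<Longrightarrow> tp (Suc t) i = tape_act (snd r ! i) (tp t i)"
      unfolding r_def ss_def by (rule step(1), rule step(2))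
    have "c (St (fst (C (Suc t)))) (Suc t) 0" unfolding C' using tr[OF W0(1) W0(1)] by blast
    moreover have "c (Hd i) (Suc t) z \<longleftrightarrow> int z - int Z = snd (tp (Suc t) i)" if i: "i < tm_tapes M" and z: "z < W" for i z
    proof -
      have sh: "shift v \<le> 2" for v by (cases v) simp_all
      define z' where "z' = hd i + shift (snd (snd r ! i)) - 1"
      have z': "Suc z' = hd i + shift (snd (snd r ! i))" "z' < W"
        using hd(2,3)[OF i] sh[of "snd (snd r ! i)"] unfolding z'_def by linarith+
      have h: "hd i < W" using hd(3)[OF i] by simp
      have "c (Hd i) t (hd i)" using Hd[OF i h] hd(1)[OF i] by simp
      then have H: "c (Hd i) (Suc t) z'" using tr[OF h z'(2)] i z'(1) by blast
      have "int z' = int (hd i) + int (shift (snd (snd r ! i))) - 1" using z'(1) by linarith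
      then have e: "int z' - int Z = snd (tp (Suc t) i)"
        unfolding C'(2)[OF i] tape_act_simps int_shift using hd(1)[OF i] by linarith
      have "Suc t < W" using t(1) W by linarith
      note u = uniq[OF i this z z'(2) _ H]
      show ?thesis
      proof
        show "int z - int Z = snd (tp (Suc t) i)" if "c (Hd i) (Suc t) z" using u[OF that] e by simp
        show "c (Hd i) (Suc t) z" if "int z - int Z = snd (tp (Suc t) i)"
        proof -
          have "z = z'" using that e by linarith
          then show ?thesis using H by simp
        qed
      qed
    qed
    moreover have "c (Cl i (fst (tp (Suc t) i) (int z - int Z))) (Suc t) z" if i: "i < tm_tapes M" and z: "z < W" for i z
    proof (cases "c (Hd i) t z")
      case True
      then have "c (Cl i (fst (snd r ! i))) (Suc t) z" using tr[OF z W0(1)] i by blast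
      moreover have "fst (tp (Suc t) i) (int z - int Z) = fst (snd r ! i)"
        unfolding C'(2)[OF i] tape_act_simps using Hd[OF i z] True by simp
      ultimately show ?thesis by simp
    next
      case False
      have "fst (tp (Suc t) i) (int z - int Z) = fst (tp t i) (int z - int Z)"
        unfolding C'(2)[OF i] tape_act_simps using Hd[OF i z] False by simp
      moreover have "fst (tp t i) (int z - int Z) < tm_symbols M"
        using valid[of t] i unfolding valid_def tp_def by blast
      ultimately show ?thesis using keep[OF i _ t(2) z t(1) False] Cl[OF i z] by simp
    qed
    ultimately show ?case by blast
  qed
  have "fst (C (T x)) = tm_accept M"
    using inv[OF order_refl] final[of "fst (C (T x))"] valid[of "T x"] unfolding valid_def by blast
  then show ?thesis using n(2) by (intro exI[of _ y]) (simp add: y_def C_def)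
qed

end

lemma tm_run_halted: "halted M (tm_run M t C) \<Longrightarrow> t \<le> t' \<Longrightarrow> tm_run M t' C = tm_run M t C"
proof (induction t' rule: nat_induct)
  case (Suc t')
  then show ?case by (cases "t = Suc t'") (auto simp: tm_run_Suc tm_step_def)
qed simp

theorem cook_levin:
  assumes "in_NP L"
  shows "\<exists>m J pos neg. pf False (\<lambda>x y e. m x) \<and> pf False (\<lambda>x y e. J x) \<and> expressible pos \<and> expressible neg \<and>
    (\<forall>x. 0 < m x) \<and>
    (\<forall>x. x \<in> L \<longleftrightarrow> (\<exists>c. \<forall>j<J x. \<exists>i<m x. c i \<and> pos x j i \<or> \<not> c i \<and> neg x j i))"
proof -
  obtain R q where R: "polytime_decidable2 R" and q: "\<And>x. x \<in> L \<longleftrightarrow> (\<exists>y. length y \<le> poly q (length x) \<and> R x y)"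
    using assms unfolding in_NP_def by blast
  obtain M p where wf: "wf_tm M" and M: "\<And>x y. \<exists>t\<le>poly p (length x + length y).
      halted M (tm_run M t (init_config M [x, y])) \<and>
      (fst (tm_run M t (init_config M [x, y])) = tm_accept M \<longleftrightarrow> R x y)"
    using R unfolding polytime_decidable2_def Let_def by blast
  define Y where "Y x = poly q (length x)" for x :: "bool list"
  \<comment> \<open>Polynomials over the naturals are monotone, so one time bound serves all second
    words of length at most \<open>Y x\<close>.\<close>
  define T where "T x = poly p (length x + Y x)" for x
  \<comment> \<open>Room for \<open>T x\<close> moves to either side of cell 0, for the window of
    the second word, and for a margin.\<close>
  define W where "W x = 2 * T x + Y x + 4" for x
  have acc: "R x y \<longleftrightarrow> fst (tm_run M (T x) (init_config M [x, y])) = tm_accept M" if y: "length y \<le> Y x" for x y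
  proof -
    obtain t where t: "t \<le> poly p (length x + length y)" "halted M (tm_run M t (init_config M [x, y]))"
      "fst (tm_run M t (init_config M [x, y])) = tm_accept M \<longleftrightarrow> R x y" using M by blast
    have "t \<le> T x" unfolding T_def using t(1) poly_nat_mono[of "length x + length y" "length x + Y x" p] y by linarith
    from tm_run_halted[OF t(2) this] show ?thesis using t(3) by simp
  qed
  have mem: "x \<in> L \<longleftrightarrow> (\<exists>c. models x (W x) (families M T Y) c)" for x
  proof
    assume "x \<in> L"
    then obtain y where y: "length y \<le> Y x" "R x y" using q unfolding Y_def by blast
    then show "\<exists>c. models x (W x) (families M T Y) c"
      using models_run[of M y Y x T, OF wf y(1)] acc[OF y(1)] by blast
  next
    assume "\<exists>c. models x (W x) (families M T Y) c"
    then obtain y where "length y \<le> Y x" "fst (tm_run M (T x) (init_config M [x, y])) = tm_accept M"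
      using run_of_model[OF wf, of T x Y "W x"] unfolding W_def by blast
    then show "x \<in> L" using acc q unfolding Y_def by blast
  qed
  have Y: "pf False (\<lambda>x y e. Y x)" unfolding Y_def by (intro pf_poly pf_length_fst)
  have T: "pf False (\<lambda>x y e. T x)" unfolding T_def by (intro pf_poly pf.add pf_length_fst Y)
  have W: "pf False (\<lambda>x y e. W x)" unfolding W_def by (intro pf.add pf_mult pf_const T Y)
  have W_less: "T x < W x" and W_pos: "0 < W x" for x by (simp_all add: W_def)
  have time: "t + d < W x" if "(g, ls) \<in> families M T Y" "(s, tg, d, k) \<in> set ls" "t < W x" "g x t z z'"
    for g ls s tg d k x t z z'
    by (rule time_families[where T = T and x = x, OF that(1-3) W_less that(4)])
  from cnf_of_families[where F = "families M T Y", OF finite_families W W_pos guard_ok_families[OF T Y] sel_families time]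
  show ?thesis unfolding mem .
qed

section \<open>Encodings determine instances\<close>

lemma enc_nat_prefix: "enc_nat a @ u = enc_nat b @ v \<longleftrightarrow> a = b \<and> u = v"
proof (induction a arbitrary: b)
  case 0
  then show ?case by (cases b) (auto simp: enc_nat_def)
next
  case (Suc a)
  show ?case
  proof (cases b)
    case (Suc b')
    then show ?thesis using Suc.IH[of b'] by (simp add: enc_nat_def)
  qed (simp add: enc_nat_def)
qed

text \<open>Each component determines where it ends, so equal strings are split at the same places.
  A relation takes the place of equality because components are only determined up to irrelevant
  values.\<close>

lemma concat_prefix:
  assumes "length xs = length ys" "concat (map f xs) @ u = concat (map g ys) @ v"
    and pre: "\<And>x y u v. x \<in> set xs \<Longrightarrow> y \<in> set ys \<Longrightarrow> f x @ u = g y @ v \<Longrightarrow> R x y \<and> u = v"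
  shows "list_all2 R xs ys \<and> u = v"
  using assms
proof (induction xs ys rule: list_induct2)
  case (Cons x xs y ys)
  have "f x @ concat (map f xs) @ u = g y @ concat (map g ys) @ v" using Cons.prems(1) by simp
  then have R: "R x y \<and> concat (map f xs) @ u = concat (map g ys) @ v" by (intro Cons.prems(2)) simp_all
  have "list_all2 R xs ys \<and> u = v"
    by (rule Cons.IH[OF conjunct2[OF R]]) (rule Cons.prems(2), simp, simp, assumption)
  then show ?case using R by simp
qed simp

lemma enc_list_prefix:
  assumes eq: "enc_list f xs @ u = enc_list g ys @ v"
    and pre: "\<And>x y u v. x \<in> set xs \<Longrightarrow> y \<in> set ys \<Longrightarrow> f x @ u = g y @ v \<Longrightarrow> R x y \<and> u = v"
  shows "list_all2 R xs ys \<and> u = v"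
proof -
  have "length xs = length ys" "concat (map f xs) @ u = concat (map g ys) @ v"
    using eq by (simp_all add: enc_list_def enc_nat_prefix)
  then show ?thesis by (rule concat_prefix) (rule pre)
qed

text \<open>This is precisely what the encoding of a state records.\<close>

definition same_row :: "nat \<Rightarrow> cgs \<Rightarrow> cgs \<Rightarrow> nat \<Rightarrow> nat \<Rightarrow> bool" where
  "same_row m C C' q q' \<longleftrightarrow> (q \<in> cgs_init C) = (q' \<in> cgs_init C') \<and>
     (\<forall>p<m. (p \<in> cgs_label C q) = (p \<in> cgs_label C' q')) \<and>
     cgs_actions C q 1 = cgs_actions C' q' 1 \<and> cgs_actions C q 2 = cgs_actions C' q' 2 \<and>
     (\<forall>i<cgs_actions C q 1. \<forall>j<cgs_actions C q 2. cgs_delta C q [Suc i, Suc j] = cgs_delta C' q' [Suc i, Suc j])"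

lemma enc_state_prefix:
  assumes "enc_state 2 m C q @ u = enc_state 2 m C' q' @ v"
  shows "same_row m C C' q q' \<and> u = v"
proof -
  define T where "T D s = concat (map (\<lambda>i. concat (map (\<lambda>j. enc_nat (cgs_delta D s [Suc i, Suc j])) [0..<cgs_actions D s 2]))
       [0..<cgs_actions D s 1])" for D :: cgs and s
  have "map (\<lambda>p. p \<in> cgs_label C q) [0..<m] @ enc_nat (cgs_actions C q 1) @ enc_nat (cgs_actions C q 2) @ T C q @ u =
      map (\<lambda>p. p \<in> cgs_label C' q') [0..<m] @ enc_nat (cgs_actions C' q' 1) @ enc_nat (cgs_actions C' q' 2) @ T C' q' @ v"
    and i: "(q \<in> cgs_init C) = (q' \<in> cgs_init C')"
    using assms unfolding enc_state_two T_def[symmetric] by simp_all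
  then have l: "map (\<lambda>p. p \<in> cgs_label C q) [0..<m] = map (\<lambda>p. p \<in> cgs_label C' q') [0..<m]"
    and "enc_nat (cgs_actions C q 1) @ enc_nat (cgs_actions C q 2) @ T C q @ u =
      enc_nat (cgs_actions C' q' 1) @ enc_nat (cgs_actions C' q' 2) @ T C' q' @ v"
    by simp_all
  then have a: "cgs_actions C q 1 = cgs_actions C' q' 1" "cgs_actions C q 2 = cgs_actions C' q' 2"
    and T: "T C q @ u = T C' q' @ v"
    unfolding enc_nat_prefix by blast+
  define R where "R i i' \<longleftrightarrow> list_all2 (\<lambda>j j'. cgs_delta C q [Suc i, Suc j] = cgs_delta C' q' [Suc i', Suc j'])
    [0..<cgs_actions C q 2] [0..<cgs_actions C q 2]" for i i'
  have "list_all2 R [0..<cgs_actions C q 1] [0..<cgs_actions C q 1] \<and> u = v"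
  proof (rule concat_prefix[OF refl T[unfolded T_def a[symmetric]]])
    fix i i' u v
    assume "concat (map (\<lambda>j. enc_nat (cgs_delta C q [Suc i, Suc j])) [0..<cgs_actions C q 2]) @ u =
       concat (map (\<lambda>j. enc_nat (cgs_delta C' q' [Suc i', Suc j])) [0..<cgs_actions C q 2]) @ v"
    then show "R i i' \<and> u = v"
      unfolding R_def by (rule concat_prefix[OF refl]) (simp add: enc_nat_prefix)
  qed
  then show ?thesis
    using i l a unfolding same_row_def R_def list_all2_conv_all_nth by simp
qed

definition cgs_agree :: "nat \<Rightarrow> cgs \<Rightarrow> cgs \<Rightarrow> bool" where
  "cgs_agree m C C' \<longleftrightarrow> cgs_states C = cgs_states C' \<and> (\<forall>q<cgs_states C. same_row m C C' q q)"

lemma enc_cgs_prefix: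
  assumes "enc_cgs 2 m C @ u = enc_cgs 2 m C' @ v"
  shows "cgs_agree m C C' \<and> u = v"
proof -
  have "list_all2 (same_row m C C') [0..<cgs_states C] [0..<cgs_states C'] \<and> u = v"
    by (rule enc_list_prefix[OF assms[unfolded enc_cgs_def]]) (rule enc_state_prefix)
  then have l: "list_all2 (same_row m C C') [0..<cgs_states C] [0..<cgs_states C']" and "u = v" by blast+
  have len: "cgs_states C = cgs_states C'" using list_all2_lengthD[OF l] by simp
  have "same_row m C C' q q" if "q < cgs_states C" for q
    using list_all2_nthD[OF l, of q] that len by simp
  then show ?thesis using len \<open>u = v\<close> unfolding cgs_agree_def by blast
qed

lemma enc_input_inject:
  assumes "enc_input 2 m Ps Ns B = enc_input 2 m' Ps' Ns' B'"
  shows "m = m' \<and> B = B' \<and> list_all2 (cgs_agree m) Ps Ps' \<and> list_all2 (cgs_agree m) Ns Ns'"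
proof -
  have m: "m = m'" and 1: "enc_list (enc_cgs 2 m) Ps @ enc_list (enc_cgs 2 m) Ns @ enc_nat B =
      enc_list (enc_cgs 2 m') Ps' @ enc_list (enc_cgs 2 m') Ns' @ enc_nat B'"
    using assms unfolding enc_input_def enc_nat_prefix by blast+
  have P: "list_all2 (cgs_agree m) Ps Ps' \<and> enc_list (enc_cgs 2 m) Ns @ enc_nat B = enc_list (enc_cgs 2 m) Ns' @ enc_nat B'"
    by (rule enc_list_prefix[OF 1[folded m]]) (rule enc_cgs_prefix)
  then have N: "list_all2 (cgs_agree m) Ns Ns' \<and> enc_nat B = enc_nat B'"
    by (intro enc_list_prefix[of "enc_cgs 2 m" Ns _ "enc_cgs 2 m"] enc_cgs_prefix) blast+
  then have "B = B'" using enc_nat_prefix[of B "[]" B' "[]"] by simp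
  then show ?thesis using m P N by blast
qed

section \<open>Satisfaction depends on the recorded data only\<close>

lemma agree_sym: "cgs_agree m C C' \<Longrightarrow> cgs_agree m C' C"
  unfolding cgs_agree_def same_row_def by simp

lemma agree_legal: "cgs_agree m C C' \<Longrightarrow> q < cgs_states C \<Longrightarrow> legal_tuples 2 C' q = legal_tuples 2 C q"
  unfolding legal_tuples_two cgs_agree_def same_row_def by simp

lemma agree_delta:
  assumes "cgs_agree m C C'" "q < cgs_states C" "\<alpha> \<in> legal_tuples 2 C q"
  shows "cgs_delta C' q \<alpha> = cgs_delta C q \<alpha>"
proof -
  have "same_row m C C' q q" using assms unfolding cgs_agree_def by blast
  moreover obtain a b where ab: "\<alpha> = [a, b]" "0 < a" "a \<le> cgs_actions C q 1" "0 < b" "b \<le> cgs_actions C q 2"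
    using assms(3) unfolding legal_tuples_two by auto
  then have "\<alpha> = [Suc (a - 1), Suc (b - 1)]" "a - 1 < cgs_actions C q 1" "b - 1 < cgs_actions C q 2" by simp_all
  ultimately show ?thesis unfolding same_row_def by metis
qed

lemma agree_outcomes:
  assumes ag: "cgs_agree m C C'" and wf: "wf_cgs 2 Props C" and q: "q < cgs_states C" and \<rho>: "\<rho> \<in> outcomes 2 C A q s"
  shows "(\<forall>i. \<rho> i < cgs_states C) \<and> \<rho> \<in> outcomes 2 C' A q s"
proof -
  have \<rho>0: "\<rho> 0 = q" and step: "\<And>i. \<exists>\<alpha>\<in>legal_tuples 2 C (\<rho> i).
      (\<forall>a\<in>A. \<alpha> ! (a - 1) = s a (map \<rho> [0..<Suc i])) \<and> \<rho> (Suc i) = cgs_delta C (\<rho> i) \<alpha>"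
    using \<rho> unfolding outcomes_def by blast+
  have less: "\<rho> i < cgs_states C" for i
  proof (induction i)
    case (Suc i)
    then show ?case using step[of i] wf unfolding wf_cgs_def by metis
  qed (simp add: \<rho>0 q)
  have "\<exists>\<alpha>\<in>legal_tuples 2 C' (\<rho> i).
      (\<forall>a\<in>A. \<alpha> ! (a - 1) = s a (map \<rho> [0..<Suc i])) \<and> \<rho> (Suc i) = cgs_delta C' (\<rho> i) \<alpha>" for i
    using step[of i] agree_delta[OF ag less[of i]] unfolding agree_legal[OF ag less[of i]] by metis
  then show ?thesis using less \<rho>0 unfolding outcomes_def by blast
qed

lemma agree_strategy:
  assumes ag: "cgs_agree m C C'" and a: "a \<in> {1..2}" and s: "strategy C a s"
  shows "strategy C' a s"
  unfolding strategy_def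
proof (intro allI impI)
  fix h assume h: "h \<noteq> [] \<and> set h \<subseteq> {..<cgs_states C'}"
  have st: "cgs_states C' = cgs_states C" using ag unfolding cgs_agree_def by simp
  have "last h < cgs_states C" using h last_in_set[of h] unfolding st by blast
  then have "same_row m C C' (last h) (last h)" using ag unfolding cgs_agree_def by blast
  moreover have "a = 1 \<or> a = 2" using a by (simp, linarith)
  ultimately have "cgs_actions C' (last h) a = cgs_actions C (last h) a" unfolding same_row_def by metis
  then show "s h \<in> {1..cgs_actions C' (last h) a}" using s h unfolding strategy_def st by metis
qed

text \<open>Outcomes stay among the states and use legal tuples only, and there the two structures
  agree. So every strategy has the same outcomes in both.\<close>

lemma agree_sat:
  assumes "cgs_agree m C C'" "wf_cgs 2 {..<m} C" "wf_cgs 2 {..<m} C'" "in_fragment 2 {..<m} U Bl \<phi>" "q < cgs_states C"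
    "sat 2 C q \<phi> \<noteq> sat 2 C' q \<phi>"
  shows False
  using assms
proof (induction \<phi> arbitrary: q)
  case (Atom p)
  then show ?case unfolding cgs_agree_def same_row_def by simp
next
  case (Coop A t \<phi>)
  have A: "A \<subseteq> {1..2}" using Coop.prems(4) by simp
  have eq: "sat 2 D q \<phi> = sat 2 D' q \<phi>" if "q < cgs_states C" "{D, D'} = {C, C'}" for D D' q
    using Coop.IH[OF Coop.prems(1-3) _ that(1)] Coop.prems(4) that(2) unfolding doubleton_eq_iff by auto
  \<comment> \<open>\<open>D\<close> and \<open>D'\<close> are the two structures in either order,
    which covers both directions.\<close>
  have imp: "sat 2 D' q (Coop A t \<phi>)"
    if D: "cgs_agree m D D'" "wf_cgs 2 {..<m} D'" "{D, D'} = {C, C'}" and h: "sat 2 D q (Coop A t \<phi>)" for D D'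
  proof -
    have st: "cgs_states D' = cgs_states D" "cgs_states D = cgs_states C"
      using D(1,3) Coop.prems(1) unfolding cgs_agree_def doubleton_eq_iff by auto
    then have q: "q < cgs_states D'" using Coop.prems(5) by simp
    obtain s where s: "\<forall>a\<in>A. strategy D a (s a)"
      "\<forall>\<rho>\<in>outcomes 2 D A q s. tempop_sem t (\<lambda>i. sat 2 D (\<rho> i) \<phi>)" using h unfolding sat.simps by blast
    have "tempop_sem t (\<lambda>i. sat 2 D' (\<rho> i) \<phi>)" if "\<rho> \<in> outcomes 2 D' A q s" for \<rho>
    proof -
      note o = agree_outcomes[OF agree_sym[OF D(1)] D(2) q that]
      have "(\<lambda>i. sat 2 D (\<rho> i) \<phi>) = (\<lambda>i. sat 2 D' (\<rho> i) \<phi>)"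
        by (rule ext, rule eq[OF _ D(3)]) (use o st in simp)
      moreover have "tempop_sem t (\<lambda>i. sat 2 D (\<rho> i) \<phi>)" using s(2) o by blast
      ultimately show ?thesis by simp
    qed
    moreover have "\<forall>a\<in>A. strategy D' a (s a)" using s(1) agree_strategy[OF D(1)] A by blast
    ultimately show ?thesis unfolding sat.simps by blast
  qed
  show ?case
    using imp[OF Coop.prems(1,3) refl] imp[OF agree_sym[OF Coop.prems(1)] Coop.prems(2) insert_commute] Coop.prems(6)
    by blast
next
  case (Bin b \<phi>1 \<phi>2)
  have "in_fragment 2 {..<m} U Bl \<phi>1" "in_fragment 2 {..<m} U Bl \<phi>2" using Bin.prems(4) by simp_all
  from Bin.IH(1)[OF Bin.prems(1-3) this(1) Bin.prems(5)] Bin.IH(2)[OF Bin.prems(1-3) this(2) Bin.prems(5)]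
  have "sat 2 C q \<phi>1 = sat 2 C' q \<phi>1" "sat 2 C q \<phi>2 = sat 2 C' q \<phi>2" by blast+
  then show ?case using Bin.prems(6) by simp
qed simp

lemma agree_cgs_sat:
  assumes ag: "cgs_agree m C C'" and wf: "wf_cgs 2 {..<m} C" "wf_cgs 2 {..<m} C'" and \<phi>: "in_fragment 2 {..<m} U Bl \<phi>"
  shows "cgs_sat 2 C \<phi> = cgs_sat 2 C' \<phi>"
proof -
  have st: "cgs_states C = cgs_states C'" and i: "\<And>q. q < cgs_states C \<Longrightarrow> (q \<in> cgs_init C) = (q \<in> cgs_init C')"
    using ag unfolding cgs_agree_def same_row_def by blast+
  have "cgs_init C \<subseteq> {..<cgs_states C}" "cgs_init C' \<subseteq> {..<cgs_states C}" using wf st unfolding wf_cgs_def by simp_all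
  then have "cgs_init C = cgs_init C'" and "\<And>q. q \<in> cgs_init C \<Longrightarrow> q < cgs_states C" using i by blast+
  then show ?thesis using agree_sat[OF ag wf \<phi>] unfolding cgs_sat_def by blast
qed

text \<open>Membership only provides some instance with this code. By
  \<open>enc_input_inject\<close> its recorded data are the given ones, so the same formula
  separates both instances.\<close>

lemma ATL_Learn_enc_input:
  assumes wf: "\<forall>C \<in> set Ps \<union> set Ns. wf_cgs 2 {..<m} C"
  shows "enc_input 2 m Ps Ns B \<in> ATL_Learn 2 U Bl n \<longleftrightarrow> separable 2 U Bl n {..<m} (set Ps) (set Ns) B"
proof
  assume "separable 2 U Bl n {..<m} (set Ps) (set Ns) B"
  then show "enc_input 2 m Ps Ns B \<in> ATL_Learn 2 U Bl n" unfolding ATL_Learn_def using wf by blast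
next
  assume "enc_input 2 m Ps Ns B \<in> ATL_Learn 2 U Bl n"
  then obtain m' Ps' Ns' B' where e: "enc_input 2 m Ps Ns B = enc_input 2 m' Ps' Ns' B'"
    and wf': "\<forall>C \<in> set Ps' \<union> set Ns'. wf_cgs 2 {..<m'} C" and sep: "separable 2 U Bl n {..<m'} (set Ps') (set Ns') B'"
    unfolding ATL_Learn_def by blast
  note i = enc_input_inject[OF e]
  obtain \<phi> where \<phi>: "in_fragment 2 {..<m} U Bl \<phi>" "atl_size \<phi> \<le> B" "atl_bin_size \<phi> \<le> n"
    and P: "\<And>C. C \<in> set Ps' \<Longrightarrow> cgs_sat 2 C \<phi>" and N: "\<And>C. C \<in> set Ns' \<Longrightarrow> \<not> cgs_sat 2 C \<phi>"
    using sep i unfolding separable_def by blast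
  have wf'': "\<forall>C \<in> set Ps' \<union> set Ns'. wf_cgs 2 {..<m} C" using wf' i by blast
  have "cgs_sat 2 C \<phi>" if h: "C \<in> set Ps" for C
  proof -
    obtain k where k: "k < length Ps" "C = Ps ! k" using h unfolding in_set_conv_nth by blast
    then have k': "cgs_agree m C (Ps' ! k)" "Ps' ! k \<in> set Ps'" using i by (auto simp: list_all2_conv_all_nth)
    have w: "wf_cgs 2 {..<m} C" "wf_cgs 2 {..<m} (Ps' ! k)" using wf wf'' h k'(2) by blast+
    show ?thesis using agree_cgs_sat[OF k'(1) w \<phi>(1)] P[OF k'(2)] by blast
  qed
  moreover have "\<not> cgs_sat 2 C \<phi>" if h: "C \<in> set Ns" for C
  proof -
    obtain k where k: "k < length Ns" "C = Ns ! k" using h unfolding in_set_conv_nth by blast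
    then have k': "cgs_agree m C (Ns' ! k)" "Ns' ! k \<in> set Ns'" using i by (auto simp: list_all2_conv_all_nth)
    have w: "wf_cgs 2 {..<m} C" "wf_cgs 2 {..<m} (Ns' ! k)" using wf wf'' h k'(2) by blast+
    show ?thesis using agree_cgs_sat[OF k'(1) w \<phi>(1)] N[OF k'(2)] by blast
  qed
  ultimately show "separable 2 U Bl n {..<m} (set Ps) (set Ns) B" unfolding separable_def using \<phi> by blast
qed


section \<open>The reduction\<close>

lemma pp_gedge:
  assumes P: "expressible pos" "expressible neg" and j: "pf False j" and q: "pf False q" "pf False q'"
  shows "pp False (\<lambda>x y e. gedge (pos x (j x y e)) (neg x (j x y e)) (q x y e) (q' x y e))"
proof -
  note r = j[THEN pf_rename[of _ _ Suc]] q[THEN pf_rename[of _ _ Suc]]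
  have p: "pp False (\<lambda>x y e. pos x (k x y e) (b x y e))" "pp False (\<lambda>x y e. neg x (k x y e) (b x y e))"
    if "pf False k" "pf False b" for k b
    using P that unfolding expressible_def by blast+
  have below: "pf False (\<lambda>x y e. below (pos x (k x y e)) (neg x (k x y e)) (i x y e) (r x y e) (s x y e))"
    if "pf False k" "pf False i" "pf False r" "pf False s" for k i r s
    unfolding below_def
    by (intro pf_if pp_if pp_disj pp_conj pp_eq p pf_div pf_mod pf_const that)
  have sink: "pf False (\<lambda>x y e. sink (k x y e) (r x y e))" if "pf False k" "pf False r" for k r
    unfolding sink_def by (intro pf_if pp_disj pp_eq pf_const that)
  have lev: "pf False (\<lambda>x y e. lev (s x y e))" "pf False (\<lambda>x y e. rail (s x y e))" "pf False (\<lambda>x y e. side (s x y e))"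
    if "pf False s" for s
    unfolding lev_def rail_def side_def by (intro pf_div pf_mod pf.monus pf_const that)+
  have gst: "pf False (\<lambda>x y e. gst (i x y e) (r x y e) (s x y e))" if "pf False i" "pf False r" "pf False s" for i r s
    unfolding gst_def by (intro pf.add pf_mult pf_const that)
  show ?thesis
    unfolding gedge_def
    by (intro pp_conj pp_disj pp_if pp_ex pp_le pp_less pp_eq sink below lev gst pf_mod pf.monus pf.var pf_const j q r)
qed

lemma even_mod_2: "even i \<longleftrightarrow> i mod 2 = 0" for i :: nat
  by presburger

lemma pf_gown: "pf w q \<Longrightarrow> pf w (\<lambda>x y e. gown (q x y e))"
  unfolding gown_def lown_def lev_def even_mod_2
  by (intro pf_if pp_le pp_eq pf_mod pf_div pf.monus pf_const)

lemma pp_glab: "pf w q \<Longrightarrow> pp w (\<lambda>x y e. glab (q x y e))"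
  unfolding glab_def lab0_def lev_def rail_def
  by (intro pp_disj pp_conj pp_le pp_eq pf_mod pf_div pf.monus pf_const)

text \<open>The case distinctions on the owner are spelled out, so that every entry is visibly a
  definable number.\<close>

lemma enc_gadget:
  "enc_cgs 2 1 (gadget m p n q0) = enc_list (\<lambda>q. [q = q0] @ [glab q] @
     enc_nat (if gown q = 1 then Suc (2 + 48 * m) else 2 + 48 * m) @
     enc_nat (if gown q = 1 then 2 + 48 * m else Suc (2 + 48 * m)) @
     concat (map (\<lambda>i. concat (map (\<lambda>j. enc_nat
       (if gown q = 1 then if i < 2 + 48 * m then if gedge p n q i then i else q else j
        else if j < 2 + 48 * m then if gedge p n q j then j else q else i))
       [0..<if gown q = 1 then 2 + 48 * m else Suc (2 + 48 * m)]))
       [0..<if gown q = 1 then Suc (2 + 48 * m) else 2 + 48 * m])) [0..<2 + 48 * m]"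
proof -
  define S where "S = 2 + 48 * m"
  define C where "C = gadget m p n q0"
  have C: "C = owned_cgs S gown (gedge p n) glab q0" by (simp add: C_def gadget_def S_def)
  have own: "gown q = 1 \<or> gown q = 2" for q by (simp add: gown_def lown_def)
  have act: "cgs_actions C q 1 = (if gown q = 1 then Suc S else S)"
    "cgs_actions C q 2 = (if gown q = 1 then S else Suc S)" for q
    using own[of q] by (auto simp: C owned_cgs_def)
  have delta: "cgs_delta C q [Suc i, Suc j] = (if gown q = 1 then if i < S then if gedge p n q i then i else q else j
        else if j < S then if gedge p n q j then j else q else i)" for q i j
    using own[of q] by (elim disjE) (simp_all add: C owned_cgs_def Suc_le_eq)
  have 1: "map (\<lambda>a. a \<in> cgs_label C q) [0..<1] = [glab q]" for q
    by (simp add: C owned_cgs_def)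
  have i: "(q \<in> cgs_init C) = (q = q0)" for q by (simp add: C owned_cgs_def)
  have s: "cgs_states C = S" by (simp add: C owned_cgs_def)
  show ?thesis
    unfolding C_def[symmetric] S_def[symmetric] enc_cgs_def enc_state_two[abs_def] 1 i s act delta ..
qed

lemma pg_gadget:
  assumes P: "expressible pos" "expressible neg" and m: "pf False (\<lambda>x y e. m x)" and j: "pf False j" and q0: "pf False (\<lambda>x y e. q0 x)"
  shows "pg False (\<lambda>x y e. enc_cgs 2 1 (gadget (m x) (pos x (j x y e)) (neg x (j x y e)) (q0 x)))"
proof -
  note r = j[THEN pf_rename[of _ _ "\<lambda>i. Suc (Suc (Suc i))"]]
  show ?thesis
    unfolding enc_gadget
    by (intro pg_enc_list pg_append pg_single pg_enc_nat pg_concat pp_eq pp_glab pp_less pf_if pf_gown pp_gedge[OF P]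
        pf.add pf_mult pf_const pf_Suc pf.var m q0 r)
qed

text \<open>One reduction serves all \<open>U\<close>, \<open>Bl\<close> and \<open>n\<close>: the
  size bound alone forces chains, and these are available in every fragment considered.\<close>

theorem ATL_Learn_NP_hard:
  assumes U1: "{UTemp Future, UTemp Globally} \<subseteq> U" and U2: "U \<subseteq> {UTemp Future, UTemp Globally, UNeg}"
  shows "NP_hard (ATL_Learn 2 U Bl n)"
  unfolding NP_hard_def
proof (intro allI impI)
  fix L assume "in_NP L"
  then obtain m J pos neg where mJ: "pf False (\<lambda>x y e. m x)" "pf False (\<lambda>x y e. J x)"
    and P: "expressible pos" "expressible neg" and m0: "\<And>x. 0 < m x"
    and L: "\<And>x. x \<in> L \<longleftrightarrow> (\<exists>c. \<forall>j<J x. \<exists>i<m x. c i \<and> pos x j i \<or> \<not> c i \<and> neg x j i)"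
    using cook_levin[of L] by blast
  define f where "f x = enc_input 2 1
    (gadget (m x) no_literal no_literal (top_state (m x) 1) # map (\<lambda>j. gadget (m x) (pos x j) (neg x j) (top_state (m x) 0)) [0..<J x])
    [gadget (m x) no_literal no_literal (top_state (m x) 0)] (12 * m x + 1)" for x
  have "x \<in> L \<longleftrightarrow> f x \<in> ATL_Learn 2 U Bl n" for x
  proof -
    have wf: "wf_cgs 2 {..<1} (gadget (m x) p q (top_state (m x) sd))" if "sd < 2" for p q sd
      unfolding gadget_def by (rule wf_owned_cgs[OF owned_gadget top_state_less[OF m0 that]])
    have "f x \<in> ATL_Learn 2 U Bl n \<longleftrightarrow> separable 2 U Bl n {..<1}
      (insert (gadget (m x) no_literal no_literal (top_state (m x) 1))
        ((\<lambda>j. gadget (m x) (pos x j) (neg x j) (top_state (m x) 0)) ` {..<J x}))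
      {gadget (m x) no_literal no_literal (top_state (m x) 0)} (12 * m x + 1)"
      unfolding f_def by (subst ATL_Learn_enc_input) (use wf[simplified] in \<open>auto simp: lessThan_atLeast0\<close>)
    also have "\<dots> \<longleftrightarrow> x \<in> L"
      unfolding gadget_separable[OF U1 U2 m0] L Ball_def lessThan_iff ..
    finally show ?thesis by blast
  qed
  moreover have "polytime_computable f"
  proof -
    have top_state: "pf False (\<lambda>x y e. top_state (m x) sd)" for sd
      unfolding top_state_def gst_def by (intro pf.add pf_mult pf.monus pf_const mJ)
    have F: "expressible (\<lambda>_ _ _. False)" unfolding expressible_def by (intro allI impI pp_const)
    note G = pg_gadget[OF F F mJ(1) pf.zero top_state]
    have "pg False (\<lambda>x y e. enc_nat 1 @ (enc_nat (Suc (J x)) @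
        enc_cgs 2 1 (gadget (m x) no_literal no_literal (top_state (m x) 1)) @
        concat (map (\<lambda>j. enc_cgs 2 1 (gadget (m x) (pos x j) (neg x j) (top_state (m x) 0))) [0..<J x])) @
        (enc_nat 1 @ enc_cgs 2 1 (gadget (m x) no_literal no_literal (top_state (m x) 0))) @ enc_nat (12 * m x + 1))"
      by (intro pg_append pg_enc_nat pg_concat G pg_gadget[OF P] top_state pf_Suc pf.add pf_mult pf_const pf.var mJ)
    then have "pg False (\<lambda>x y e. f x)"
      by (simp add: f_def enc_input_def enc_list_def comp_def)
    from pg_computable[OF this] show ?thesis .
  qed
  ultimately show "polytime_reducible L (ATL_Learn 2 U Bl n)"
    unfolding polytime_reducible_def by blast
qed


theorem theorem8:
  fixes U :: "unop set" and Bl :: "binop set" and n :: nat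
  assumes "{UTemp Future, UTemp Globally} \<subseteq> U"
    and "U \<subseteq> {UTemp Future, UTemp Globally, UNeg}"
  shows "NP_complete (ATL_Learn 2 U Bl n)"
  unfolding NP_complete_def using ATL_Learn_in_NP[OF assms] ATL_Learn_NP_hard[OF assms] by blast

end
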